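(* Let $s\in(3/4,1)$, $a,b,m>0$, $1<q<2$, $p=4$ and $b>\frac{1}{S_4^2}$, where $$S_4=\inf\Big\{\frac{\|U\|^2_{\mathbb{X}^s_{2\pi}}}{|\mathrm{Tr}(U)|_4^2}:\ U\in\mathbb{X}^s_{2\pi},\ \mathrm{Tr}(U)\neq0\Big\}.$$ Then, for every $\lambda>0$, the problem $$\left\{\begin{array}{ll}(a+b|u|^{2}_{\mathbb{H}^{s}_{2\pi}})(-\Delta+m^{2})^{s}u=\lambda|u|^{q-2}u+|u|^{p-2}u & \text{in } (-\pi,\pi)^{3},\\ u(x+2\pi e_{i})=u(x) & \text{for all } x\in\mathbb{R}^{3},\ i=1,2,3,\end{array}\right.$$ has infinitely many (weak) periodic solutions.
   Context: All functions are real-valued. $\{e_i\}_{i=1,2,3}$ is the canonical basis of $\mathbb{R}^3$; $|\cdot|_r$ is the norm of $L^r((-\pi,\pi)^3)$; $2^*_s=\frac{6}{3-2s}$ (so $2^*_s>4$ when $s>3/4$). For a $2\pi$-periodic (in each variable) function $u=\sum_{k\in\mathbb{Z}^3}c_k\frac{e^{\imath k\cdot x}}{(2\pi)^{3/2}}$ with Fourier coefficients $c_k=(2\pi)^{-3/2}\int_{(-\pi,\pi)^3}u(x)e^{-\imath k\cdot x}dx$, set $(-\Delta+m^2)^su=\sum_k c_k(|k|^2+m^2)^s\frac{e^{\imath k\cdot x}}{(2\pi)^{3/2}}$ and $|u|_{\mathbb{H}^s_{2\pi}}^2=\sum_k(|k|^2+m^2)^s|c_k|^2$. The Hilbert space $\mathbb{H}^s_{2\pi}$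 consists of those $u\in L^2((-\pi,\pi)^3)$ with $|u|_{\mathbb{H}^s_{2\pi}}<\infty$. Let $\mathcal{S}_{2\pi}=(-\pi,\pi)^3\times(0,\infty)$, with points $(x,y)$, and $\kappa_s=2^{1-2s}\Gamma(1-s)/\Gamma(s)$. The Hilbert space $\mathbb{X}^s_{2\pi}$ is the closure of the set of smooth functions on $\mathbb{R}^3\times[0,\infty)$ that are $2\pi$-periodic in each $x_i$ (and of finite norm) with respect to the norm induced by the inner product $$\langle U,V\rangle_{\mathbb{X}^s_{2\pi}}=\frac1{\kappa_s}\iint_{\mathcal{S}_{2\pi}}y^{1-2s}(\nabla U\cdot\nabla V+m^2UV)\,dx\,dy .$$ There is a bounded surjective linear trace operator $\mathrm{Tr}:\mathbb{X}^s_{2\pi}\to\mathbb{H}^s_{2\pi}$ extending $U\mapsto U(\cdot,0)$ from smooth functions; it satisfies $|\mathrm{Tr}(U)|_{\mathbb{H}^s_{2\pi}}\le\|U\|_{\mathbb{X}^s_{2\pi}}$, and $\mathrm{Tr}(\mathbb{X}^s_{2\pi})\subset L^r((-\pi,\pi)^3)$ continuously for $1\le r\le 2^*_s$. Weak solution: $u\in\mathbb{H}^s_{2\pi}$ is a weak (periodic) solution of the problem if $u=\mathrm{Tr}(U)$ for some $U\in\mathbb{X}^s_{2\pi}$ such that, for every $V\in\mathbb{X}^s_{2\pi}$, $$(a+b\|U\|^2_{\mathbb{X}^s_{2\pi}})\langle U,V\rangle_{\mathbb{X}^s_{2\pi}}=\int_{(-\pi,\pi)^3}\big[\lambda|u|^{q-2}u+|u|^{p-2}u\big]\mathrm{Tr}(V)\,dx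 .$$ *)

theory Defs
  imports "HOL-Analysis.Analysis"
begin

definition cube :: "(real^3) set" where
  "cube = box (vec (- pi)) (vec pi)"

definition cell :: "(real^3) measure" where
  "cell = restrict_space lborel cube"

definition periodic :: "(real^3 \<Rightarrow> real) \<Rightarrow> bool" where
  "periodic u \<longleftrightarrow> (\<forall>x i. u (x + (2 * pi) *\<^sub>R axis i 1) = u x)"

(* The function spaces on the cube consist of representatives, identified when related by ae_eq. *)
definition ae_eq :: "((real^3 \<Rightarrow> real) \<times> (real^3 \<Rightarrow> real)) set" where
  "ae_eq = {(u, v). AE x in cell. u x = v x}"

definition Lr_norm :: "real \<Rightarrow> (real^3 \<Rightarrow> real) \<Rightarrow> real" where
  "Lr_norm r u = (LINT x|cell. \<bar>u x\<bar> powr r) powr (1 / r)"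

definition freq :: "int^3 \<Rightarrow> real^3" where
  "freq k = (\<chi> i. of_int (k $ i))"

definition fourier_coeff :: "(real^3 \<Rightarrow> real) \<Rightarrow> int^3 \<Rightarrow> complex" where
  "fourier_coeff u k =
     of_real ((2 * pi) powr (- 3 / 2)) * (LINT x|cell. of_real (u x) * cis (- (freq k \<bullet> x)))"

definition Hs_term :: "real \<Rightarrow> real \<Rightarrow> (real^3 \<Rightarrow> real) \<Rightarrow> int^3 \<Rightarrow> real" where
  "Hs_term s m u k = ((norm (freq k))\<^sup>2 + m\<^sup>2) powr s * (cmod (fourier_coeff u k))\<^sup>2"

definition Hs_space :: "real \<Rightarrow> real \<Rightarrow> (real^3 \<Rightarrow> real) set" where
  "Hs_space s m = {u. periodic u \<and> u \<in> borel_measurable cell \<and>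
     integrable cell (\<lambda>x. (u x)\<^sup>2) \<and> Hs_term s m u summable_on UNIV}"

definition Hs_norm :: "real \<Rightarrow> real \<Rightarrow> (real^3 \<Rightarrow> real) \<Rightarrow> real" where
  "Hs_norm s m u = sqrt (infsum (Hs_term s m u) UNIV)"

definition kappa :: "real \<Rightarrow> real" where
  "kappa s = 2 powr (1 - 2 * s) * Gamma (1 - s) / Gamma s"

definition weighted :: "real \<Rightarrow> ((real^3) \<times> real) measure" where
  "weighted s = density (restrict_space lborel (cube \<times> {0<..}))
     (\<lambda>z. ennreal (snd z powr (1 - 2 * s)))"

(* D bs is the iterated partial derivative of f along the basis vectors in bs;
   at boundary points of S the derivatives are taken within S. *)
definition smooth_on :: "'a::euclidean_space set \<Rightarrow> ('a \<Rightarrow> real) \<Rightarrow> bool" where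
  "smooth_on S f \<longleftrightarrow> (\<exists>D :: 'a list \<Rightarrow> 'a \<Rightarrow> real. D [] = f \<and>
     (\<forall>bs. set bs \<subseteq> Basis \<longrightarrow> (\<forall>z\<in>S.
        (D bs has_derivative (\<lambda>h. \<Sum>b\<in>Basis. (h \<bullet> b) * D (b # bs) z)) (at z within S))))"

definition gradient :: "('a::euclidean_space \<Rightarrow> real) \<Rightarrow> 'a \<Rightarrow> 'a" where
  "gradient f z = (\<Sum>b\<in>Basis. frechet_derivative f (at z) b *\<^sub>R b)"

(* The closure of the smooth functions is realised as the closure of the pairs (U, gradient U) in
   the weighted L^2 space: an element W of Xs_space consists of a function fst W together with its
   (weak) gradient snd W, which is determined by fst W up to null sets. *)
type_synonym jet = "((real^3) \<times> real \<Rightarrow> real) \<times> ((real^3) \<times> real \<Rightarrow> (real^3) \<times> real)"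

definition L2_jets :: "real \<Rightarrow> jet set" where
  "L2_jets s = {W. fst W \<in> borel_measurable (weighted s) \<and> snd W \<in> borel_measurable (weighted s) \<and>
     integrable (weighted s) (\<lambda>z. (fst W z)\<^sup>2) \<and>
     integrable (weighted s) (\<lambda>z. (norm (snd W z))\<^sup>2)}"

definition Xs_inner :: "real \<Rightarrow> real \<Rightarrow> jet \<Rightarrow> jet \<Rightarrow> real" where
  "Xs_inner s m W Z = 1 / kappa s *
     (LINT z|weighted s. snd W z \<bullet> snd Z z + m\<^sup>2 * fst W z * fst Z z)"

definition Xs_norm :: "real \<Rightarrow> real \<Rightarrow> jet \<Rightarrow> real" where
  "Xs_norm s m W = sqrt (Xs_inner s m W W)"

definition smooth_periodic :: "real \<Rightarrow> ((real^3) \<times> real \<Rightarrow> real) set" where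
  "smooth_periodic s = {\<phi>. smooth_on (UNIV \<times> {0..}) \<phi> \<and>
     (\<forall>y\<ge>0. periodic (\<lambda>x. \<phi> (x, y))) \<and> (\<phi>, gradient \<phi>) \<in> L2_jets s}"

definition approximates :: "real \<Rightarrow> real \<Rightarrow> (nat \<Rightarrow> (real^3) \<times> real \<Rightarrow> real) \<Rightarrow> jet \<Rightarrow> bool" where
  "approximates s m \<phi> W \<longleftrightarrow> (\<forall>n. \<phi> n \<in> smooth_periodic s) \<and>
     (\<lambda>n. Xs_norm s m (\<lambda>z. fst W z - \<phi> n z, \<lambda>z. snd W z - gradient (\<phi> n) z)) \<longlonglongrightarrow> 0"

definition Xs_space :: "real \<Rightarrow> real \<Rightarrow> jet set" where
  "Xs_space s m = {W \<in> L2_jets s. \<exists>\<phi>. approximates s m \<phi> W}"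

(* The continuous extension of U |-> U(., 0) to the closure, with values in Hs_space;
   the limit u is determined up to ae_eq. *)
definition has_trace :: "real \<Rightarrow> real \<Rightarrow> jet \<Rightarrow> (real^3 \<Rightarrow> real) \<Rightarrow> bool" where
  "has_trace s m W u \<longleftrightarrow> u \<in> Hs_space s m \<and>
     (\<exists>\<phi>. approximates s m \<phi> W \<and> (\<lambda>n. Hs_norm s m (\<lambda>x. \<phi> n (x, 0) - u x)) \<longlonglongrightarrow> 0)"

definition Tr :: "real \<Rightarrow> real \<Rightarrow> jet \<Rightarrow> real^3 \<Rightarrow> real" where
  "Tr s m W = (SOME u. has_trace s m W u)"

definition S4 :: "real \<Rightarrow> real \<Rightarrow> real" where
  "S4 s m = Inf {(Xs_norm s m U)\<^sup>2 / (Lr_norm 4 (Tr s m U))\<^sup>2 | U.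
     U \<in> Xs_space s m \<and> (Tr s m U, \<lambda>x. 0) \<notin> ae_eq}"

definition weak_solution ::
  "real \<Rightarrow> real \<Rightarrow> real \<Rightarrow> real \<Rightarrow> real \<Rightarrow> real \<Rightarrow> real \<Rightarrow> (real^3 \<Rightarrow> real) \<Rightarrow> bool" where
  "weak_solution s m a b lam q p u \<longleftrightarrow> u \<in> Hs_space s m \<and>
     (\<exists>U\<in>Xs_space s m. (u, Tr s m U) \<in> ae_eq \<and>
       (\<forall>V\<in>Xs_space s m.
          (a + b * (Xs_norm s m U)\<^sup>2) * Xs_inner s m U V =
          (LINT x|cell. (lam * \<bar>u x\<bar> powr (q - 2) * u x + \<bar>u x\<bar> powr (p - 2) * u x) * Tr s m V x)))"

end

theory Submission imports Defs begin

text \<open>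
  The solutions depend on one coordinate only and are odd in it:
  \<open>u x = (\<Sum>j. c j * sin (n * (j + 1) * x\<^sub>1))\<close> for some number \<open>n > 0\<close>.  On the coefficients the
  problem is the Euler-Lagrange equation of the energy
  \<open>A / 2 * N + B / 4 * N\<^sup>2 - \<integral> lam / q * |u|\<^sup>q + |u|\<^sup>4 / 4\<close>, where \<open>N = (\<Sum>j. w j * (c j)\<^sup>2)\<close>,
  the weight \<open>w j\<close> is the symbol of the fractional operator at the frequency \<open>n * (j + 1)\<close>, and \<open>A\<close>
  and \<open>B\<close> are positive multiples of \<open>a\<close> and \<open>b\<close>.  Because \<open>2 * s > 1\<close>, the sum of all \<open>1 / w j\<close>
  is finite, and by the Cauchy-Schwarz inequality its product with \<open>N\<close> bounds \<open>|u|\<^sup>2\<close> everywhere.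
  This sum tends to 0 as \<open>n\<close> grows.  Hence for large \<open>n\<close> the integral of \<open>|u|\<^sup>4 / 4\<close> is at most
  \<open>B / 4 * N\<^sup>2\<close>, and the energy is coercive; the exponent \<open>q < 2\<close> makes it negative at small
  multiples of a sine.  So it has a minimiser and the minimum is negative (\<open>minimiser_exists\<close>).
  Convexity of \<open>lam / q * |u|\<^sup>q + |u|\<^sup>4 / 4\<close> gives the Euler-Lagrange equation (\<open>euler_lagrange\<close>).

  All frequencies of the solution for \<open>n\<close> are multiples of \<open>n\<close>.  As the solution is not 0, some
  frequency \<open>l > 0\<close> occurs in it, and only the finitely many divisors \<open>n\<close> of \<open>l\<close> can lead to the
  same function.  This is why infinitely many \<open>n\<close> produce infinitely many solutions.

  It remains to pass from the equations for the coefficients to the weak equation, in which the test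
  functions range over the whole extension space.  A wave of frequency \<open>k\<close> is extended to the
  half space by the factor \<open>theta (r * y)\<close> with \<open>r\<^sup>2 = |k|\<^sup>2 + m\<^sup>2\<close>, where \<open>theta\<close> is built from
  a modified Bessel function.  Integration by parts shows that the inner product of this extension
  with \<open>V\<close> is \<open>r\<^sup>2\<^sup>s\<close> times the integral of the wave against the trace of \<open>V\<close>
  (\<open>Theta_pairing\<close>, \<open>has_trace_pairing\<close>).  For \<open>k = 0\<close> this computation takes place on single
  vertical lines and writes the trace as an integral over the line; that proves that the trace
  exists in \<open>L\<^sup>2\<close> (\<open>L2_trace_trace_of\<close>).  For all \<open>k\<close> together it yields, by Bessel's inequality,
  the bound on the fractional Sobolev norm (\<open>trace_inequality\<close>).  The trace is unique because the
  pairings with all waves determine it (\<open>fourier_uniqueness\<close>, \<open>Tr_unique\<close>).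

  With \<open>U\<close> the sum of the extended sines, the weak equation against \<open>V\<close> says that the sine series
  of the nonlinear term, which only contains frequencies that are multiples of \<open>n\<close>, may be replaced
  by the nonlinear term itself.  This holds because the nonlinearity is odd: odd powers of sums of
  sines are again sums of sines (\<open>nonlin_fourier_tendsto\<close>, \<open>weak_solution_series\<close>).
\<close>

section \<open>Square integrable functions\<close>

definition square_integrable :: "'a measure \<Rightarrow> ('a \<Rightarrow> 'b::euclidean_space) \<Rightarrow> bool" where
  "square_integrable M f \<longleftrightarrow> f \<in> borel_measurable M \<and> integrable M (\<lambda>x. (norm (f x))\<^sup>2)"

text \<open>The square of the distance rather than the distance: it is additive on orthogonal sums, and
  the triangle inequality with the factor 2 is all that limits need.\<close>
definition sqdist :: "'a measure \<Rightarrow> ('a \<Rightarrow> 'b::euclidean_space) \<Rightarrow> ('a \<Rightarrow> 'b) \<Rightarrow> real" where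
  "sqdist M f g = (LINT x|M. (norm (f x - g x))\<^sup>2)"

lemma square_integrable_measurable: "square_integrable M f \<Longrightarrow> f \<in> borel_measurable M"
  and square_integrable_norm: "square_integrable M f \<Longrightarrow> integrable M (\<lambda>x. (norm (f x))\<^sup>2)"
  by (auto simp: square_integrable_def)

lemma square_integrable_real: "square_integrable M f \<Longrightarrow> integrable M (\<lambda>x. (f x :: real)\<^sup>2)"
  by (auto simp: square_integrable_def)

lemma square_integrable_mono:
  assumes f: "f \<in> borel_measurable M" and g: "integrable M g"
    and le: "AE x in M. (norm (f x))\<^sup>2 \<le> g x"
  shows "square_integrable M f"
  unfolding square_integrable_def
proof
  show "integrable M (\<lambda>x. (norm (f x))\<^sup>2)"
    by (rule Bochner_Integration.integrable_bound[OF g]) (use f le in \<open>auto elim!: eventually_mono\<close>)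
qed (rule f)

lemma integrable_inner_square_integrable:
  assumes "square_integrable M f" "square_integrable M g"
  shows "integrable M (\<lambda>x. f x \<bullet> g x)"
proof (rule Bochner_Integration.integrable_bound)
  show "integrable M (\<lambda>x. (norm (f x))\<^sup>2 + (norm (g x))\<^sup>2)"
    using assms by (auto simp: square_integrable_def)
  show "(\<lambda>x. f x \<bullet> g x) \<in> borel_measurable M"
    using assms by (auto simp: square_integrable_def)
  have "\<bar>u \<bullet> v\<bar> \<le> (norm u)\<^sup>2 + (norm v)\<^sup>2" for u v :: 'b
  proof -
    have "\<bar>u \<bullet> v\<bar> \<le> norm u * norm v" by (rule Cauchy_Schwarz_ineq2)
    also have "\<dots> \<le> (norm u)\<^sup>2 + (norm v)\<^sup>2"
      using sum_squares_bound[of "norm u" "norm v"] mult_nonneg_nonneg[OF norm_ge_zero[of u] norm_ge_zero[of v]]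
      by linarith
    finally show ?thesis .
  qed
  then show "AE x in M. norm (f x \<bullet> g x) \<le> norm ((norm (f x))\<^sup>2 + (norm (g x))\<^sup>2)"
    by auto
qed

lemma square_integrable_scaleR:
  assumes "square_integrable M f"
  shows "square_integrable M (\<lambda>x. c *\<^sub>R f x)"
  using assms by (auto simp: square_integrable_def power_mult_distrib)

lemma square_integrable_add:
  assumes "square_integrable M f" "square_integrable M g"
  shows "square_integrable M (\<lambda>x. f x + g x)"
proof -
  have "(norm (u + v))\<^sup>2 = (norm u)\<^sup>2 + (norm v)\<^sup>2 + 2 * (u \<bullet> v)" for u v :: 'b
    by (simp add: power2_norm_eq_inner inner_add_left inner_add_right inner_commute)
  then have "integrable M (\<lambda>x. (norm (f x + g x))\<^sup>2)"
    using integrable_inner_square_integrable[OF assms]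
      square_integrable_norm[OF assms(1)] square_integrable_norm[OF assms(2)] by simp
  then show ?thesis
    using square_integrable_measurable[OF assms(1)] square_integrable_measurable[OF assms(2)]
    by (simp add: square_integrable_def)
qed

lemma square_integrable_diff:
  assumes "square_integrable M f" "square_integrable M g"
  shows "square_integrable M (\<lambda>x. f x - g x)"
  using square_integrable_add[OF assms(1) square_integrable_scaleR[OF assms(2), of "-1"]] by simp

lemma square_integrable_zero: "square_integrable M (\<lambda>x. 0)"
  by (simp add: square_integrable_def)

lemma square_integrable_sum:
  assumes "\<And>i. i \<in> I \<Longrightarrow> square_integrable M (f i)"
  shows "square_integrable M (\<lambda>x. \<Sum>i\<in>I. f i x)"
  using assms by (induction I rule: infinite_finite_induct)
    (auto intro: square_integrable_add square_integrable_zero)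

lemma (in finite_measure) square_integrable_bounded:
  fixes f :: "'a \<Rightarrow> 'b::euclidean_space"
  assumes "f \<in> borel_measurable M" "\<And>x. norm (f x) \<le> B"
  shows "square_integrable M f"
proof (rule square_integrable_mono)
  show "AE x in M. (norm (f x))\<^sup>2 \<le> B\<^sup>2"
    using assms(2) by (intro AE_I2 power_mono) auto
qed (use assms in auto)

lemma Cauchy_Schwarz_square_integrable:
  assumes f: "square_integrable M f" and g: "square_integrable M g"
  shows "(LINT x|M. f x \<bullet> g x)\<^sup>2 \<le> (LINT x|M. (norm (f x))\<^sup>2) * (LINT x|M. (norm (g x))\<^sup>2)"
proof -
  define A B C where "A = (LINT x|M. (norm (f x))\<^sup>2)" and "B = (LINT x|M. f x \<bullet> g x)"
    and "C = (LINT x|M. (norm (g x))\<^sup>2)"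
  note int = integrable_inner_square_integrable[OF f g] square_integrable_norm[OF f] square_integrable_norm[OF g]
  have expand: "(norm (u - t *\<^sub>R v))\<^sup>2 = (norm u)\<^sup>2 - 2 * t * (u \<bullet> v) + t\<^sup>2 * (norm v)\<^sup>2" for t and u v :: 'b
    unfolding power2_norm_eq_inner power2_eq_square[of t]
    by (simp add: inner_diff_left inner_diff_right inner_commute[of v u] algebra_simps)
  \<comment> \<open>The classical argument: a quadratic polynomial without negative values.\<close>
  have nn: "0 \<le> A - 2 * t * B + t\<^sup>2 * C" for t
  proof -
    have "0 \<le> (LINT x|M. (norm (f x - t *\<^sub>R g x))\<^sup>2)" by simp
    also have "\<dots> = (LINT x|M. (norm (f x))\<^sup>2 - 2 * t * (f x \<bullet> g x) + t\<^sup>2 * (norm (g x))\<^sup>2)"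
      by (simp only: expand)
    also have "\<dots> = A - 2 * t * B + t\<^sup>2 * C"
      using int by (simp add: A_def B_def C_def)
    finally show ?thesis .
  qed
  have "0 \<le> C" "0 \<le> A" by (auto simp: C_def A_def)
  show ?thesis
  proof (cases "C = 0")
    case True
    have "B = 0"
    proof (rule ccontr)
      assume "B \<noteq> 0"
      then show False using nn[of "(A + 1) / (2 * B)"] True by (simp add: field_simps)
    qed
    then show ?thesis using True by (simp add: A_def B_def C_def)
  next
    case False
    with \<open>0 \<le> C\<close> have "0 < C" by simp
    then have "B\<^sup>2 \<le> A * C" using nn[of "B / C"]
      by (simp add: field_simps power2_eq_square)
    then show ?thesis by (simp only: A_def B_def C_def)
  qed
qed

lemma abs_integral_inner_le:
  assumes f: "square_integrable M f" and g: "square_integrable M g"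
  shows "\<bar>LINT x|M. f x \<bullet> g x\<bar> \<le> sqrt (LINT x|M. (norm (f x))\<^sup>2) * sqrt (LINT x|M. (norm (g x))\<^sup>2)"
  using Cauchy_Schwarz_square_integrable[OF assms]
  by (metis real_sqrt_abs real_sqrt_le_mono real_sqrt_mult)

lemma sqdist_commute: "sqdist M f g = sqdist M g f"
  by (simp add: sqdist_def norm_minus_commute)

lemma sqdist_nonneg: "0 \<le> sqdist M f g"
  by (simp add: sqdist_def)

lemma sqdist_triangle:
  assumes f: "square_integrable M f" and g: "square_integrable M g" and h: "square_integrable M h"
  shows "sqdist M f h \<le> 2 * sqdist M f g + 2 * sqdist M g h"
proof -
  have le: "(norm (u - w))\<^sup>2 \<le> 2 * (norm (u - v))\<^sup>2 + 2 * (norm (v - w))\<^sup>2" for u v w :: 'b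
  proof -
    have "norm (u - w) \<le> norm (u - v) + norm (v - w)" by (rule norm_triangle_sub[of "u - w" "u - v", simplified, THEN order_trans]) (simp add: norm_minus_commute)
    then have "(norm (u - w))\<^sup>2 \<le> (norm (u - v) + norm (v - w))\<^sup>2" by (rule power_mono) simp
    also have "\<dots> \<le> 2 * (norm (u - v))\<^sup>2 + 2 * (norm (v - w))\<^sup>2"
      using sum_squares_bound[of "norm (u - v)" "norm (v - w)"] by (simp add: power2_sum)
    finally show ?thesis .
  qed
  have "sqdist M f h \<le> (LINT x|M. 2 * (norm (f x - g x))\<^sup>2 + 2 * (norm (g x - h x))\<^sup>2)"
    unfolding sqdist_def
    by (intro integral_mono) (auto intro!: le square_integrable_norm square_integrable_diff assms)
  also have "\<dots> = 2 * sqdist M f g + 2 * sqdist M g h"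
    unfolding sqdist_def
    by (subst Bochner_Integration.integral_add) (auto intro!: square_integrable_norm square_integrable_diff assms)
  finally show ?thesis .
qed

lemma integral_inner_tendsto:
  assumes f: "\<And>n. square_integrable M (f n)" and l: "square_integrable M l" and g: "square_integrable M g"
    and lim: "(\<lambda>n. sqdist M (f n) l) \<longlonglongrightarrow> 0"
  shows "(\<lambda>n. LINT x|M. g x \<bullet> f n x) \<longlonglongrightarrow> (LINT x|M. g x \<bullet> l x)"
proof -
  have "(\<lambda>n. (LINT x|M. g x \<bullet> f n x) - (LINT x|M. g x \<bullet> l x)) \<longlonglongrightarrow> 0"
  proof (rule tendsto_0_le[where K = "sqrt (LINT x|M. (norm (g x))\<^sup>2)"])
    show "(\<lambda>n. sqrt (sqdist M (f n) l)) \<longlonglongrightarrow> 0"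
      using tendsto_real_sqrt[OF lim] by simp
    show "\<forall>\<^sub>F n in sequentially. norm ((LINT x|M. g x \<bullet> f n x) - (LINT x|M. g x \<bullet> l x))
        \<le> norm (sqrt (sqdist M (f n) l)) * sqrt (LINT x|M. (norm (g x))\<^sup>2)"
    proof (rule always_eventually, rule allI)
      fix n
      have "(LINT x|M. g x \<bullet> f n x) - (LINT x|M. g x \<bullet> l x) = (LINT x|M. g x \<bullet> (f n x - l x))"
        by (subst Bochner_Integration.integral_diff[symmetric])
          (auto intro!: integrable_inner_square_integrable f l g simp: inner_diff_right)
      then show "norm ((LINT x|M. g x \<bullet> f n x) - (LINT x|M. g x \<bullet> l x))
        \<le> norm (sqrt (sqdist M (f n) l)) * sqrt (LINT x|M. (norm (g x))\<^sup>2)"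
        using abs_integral_inner_le[OF g square_integrable_diff[OF f[of n] l]] sqdist_nonneg[of M "f n" l]
        by (simp add: mult.commute sqdist_def)
    qed
  qed
  then show ?thesis by (simp add: LIM_zero_iff)
qed

lemma integral_norm_square_tendsto:
  assumes f: "\<And>n. square_integrable M (f n)" and l: "square_integrable M l"
    and lim: "(\<lambda>n. sqdist M (f n) l) \<longlonglongrightarrow> 0"
  shows "(\<lambda>n. LINT x|M. (norm (f n x))\<^sup>2) \<longlonglongrightarrow> (LINT x|M. (norm (l x))\<^sup>2)"
proof -
  have eq: "(LINT x|M. (norm (f n x))\<^sup>2) = sqdist M (f n) l + 2 * (LINT x|M. l x \<bullet> f n x) - (LINT x|M. (norm (l x))\<^sup>2)" for n
  proof -
    have "sqdist M (f n) l = (LINT x|M. (norm (f n x))\<^sup>2 - 2 * (l x \<bullet> f n x) + (norm (l x))\<^sup>2)"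
      unfolding sqdist_def
      by (rule Bochner_Integration.integral_cong)
        (auto simp: power2_norm_eq_inner inner_diff_left inner_diff_right inner_commute)
    also have "\<dots> = (LINT x|M. (norm (f n x))\<^sup>2) - 2 * (LINT x|M. l x \<bullet> f n x) + (LINT x|M. (norm (l x))\<^sup>2)"
      using integrable_inner_square_integrable[OF l f[of n]] square_integrable_norm[OF f[of n]] square_integrable_norm[OF l]
      by simp
    finally show ?thesis by simp
  qed
  have ll: "(LINT x|M. l x \<bullet> l x) = (LINT x|M. (norm (l x))\<^sup>2)"
    by (simp add: power2_norm_eq_inner)
  have "(\<lambda>n. sqdist M (f n) l + 2 * (LINT x|M. l x \<bullet> f n x) - (LINT x|M. (norm (l x))\<^sup>2))
     \<longlonglongrightarrow> 0 + 2 * (LINT x|M. (norm (l x))\<^sup>2) - (LINT x|M. (norm (l x))\<^sup>2)"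
    by (intro tendsto_intros lim integral_inner_tendsto[OF f l l lim, unfolded ll])
  then show ?thesis unfolding eq by simp
qed

text \<open>Fatou's lemma turns a pointwise limit into a mean-square limit, provided that the
  sequence is Cauchy in mean square with an explicit modulus.\<close>
lemma square_integrable_pointwise_limit:
  fixes f :: "nat \<Rightarrow> 'a \<Rightarrow> 'b::euclidean_space"
  assumes f: "\<And>n. square_integrable M (f n)" and meas: "l \<in> borel_measurable M"
    and ptw: "AE x in M. (\<lambda>n. f n x) \<longlonglongrightarrow> l x"
    and cauchy: "\<And>n k. n \<le> k \<Longrightarrow> sqdist M (f k) (f n) \<le> E n" and E: "E \<longlonglongrightarrow> 0"
  shows "square_integrable M l" "(\<lambda>n. sqdist M (f n) l) \<longlonglongrightarrow> 0"
proof -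
  have E0: "0 \<le> E n" for n using cauchy[of n n] sqdist_nonneg[of M "f n" "f n"] by linarith
  have nnb: "(\<integral>\<^sup>+x. ennreal ((norm (l x - f n x))\<^sup>2) \<partial>M) \<le> ennreal (E n)" for n
  proof -
    have "(\<integral>\<^sup>+x. ennreal ((norm (l x - f n x))\<^sup>2) \<partial>M) = (\<integral>\<^sup>+x. liminf (\<lambda>k. ennreal ((norm (f k x - f n x))\<^sup>2)) \<partial>M)"
    proof (rule nn_integral_cong_AE, use ptw in \<open>rule AE_mp\<close>, rule AE_I2, rule impI)
      fix x assume "(\<lambda>k. f k x) \<longlonglongrightarrow> l x"
      then have "(\<lambda>k. ennreal ((norm (f k x - f n x))\<^sup>2)) \<longlonglongrightarrow> ennreal ((norm (l x - f n x))\<^sup>2)"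
        by (intro tendsto_intros)
      then show "ennreal ((norm (l x - f n x))\<^sup>2) = liminf (\<lambda>k. ennreal ((norm (f k x - f n x))\<^sup>2))"
        by (simp only: lim_imp_Liminf[OF sequentially_bot])
    qed
    also have "\<dots> \<le> liminf (\<lambda>k. \<integral>\<^sup>+x. ennreal ((norm (f k x - f n x))\<^sup>2) \<partial>M)"
      using square_integrable_measurable[OF f] by (intro nn_integral_liminf) measurable
    also have "\<dots> \<le> ennreal (E n)"
    proof (rule Liminf_le)
      show "\<forall>\<^sub>F k in sequentially. (\<integral>\<^sup>+x. ennreal ((norm (f k x - f n x))\<^sup>2) \<partial>M) \<le> ennreal (E n)"
        unfolding eventually_sequentially
      proof (intro exI[of _ n] allI impI)
        fix k assume "n \<le> k"
        have "(\<integral>\<^sup>+x. ennreal ((norm (f k x - f n x))\<^sup>2) \<partial>M) = ennreal (sqdist M (f k) (f n))"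
          unfolding sqdist_def
          by (intro nn_integral_eq_integral square_integrable_norm square_integrable_diff f) auto
        then show "(\<integral>\<^sup>+x. ennreal ((norm (f k x - f n x))\<^sup>2) \<partial>M) \<le> ennreal (E n)"
          using cauchy[OF \<open>n \<le> k\<close>] by (simp add: ennreal_leI)
      qed
    qed simp
    finally show ?thesis .
  qed
  have m: "(\<lambda>x. l x - f n x) \<in> borel_measurable M" for n
    using meas square_integrable_measurable[OF f] by auto
  have si: "square_integrable M (\<lambda>x. l x - f n x)" for n
    unfolding square_integrable_def
  proof (intro conjI m integrableI_nonneg)
    show "(\<integral>\<^sup>+x. ennreal ((norm (l x - f n x))\<^sup>2) \<partial>M) < \<infinity>"
      using nnb[of n] by (simp add: order_le_less_trans)
  qed (use m[of n] in auto)
  show "square_integrable M l"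
    using square_integrable_add[OF si[of 0] f[of 0]] by simp
  have "sqdist M (f n) l \<le> E n" for n
  proof -
    have "ennreal (sqdist M (f n) l) = (\<integral>\<^sup>+x. ennreal ((norm (l x - f n x))\<^sup>2) \<partial>M)"
      unfolding sqdist_def norm_minus_commute[of "f n _"]
      by (intro nn_integral_eq_integral[symmetric] square_integrable_norm si) auto
    then have "ennreal (sqdist M (f n) l) \<le> ennreal (E n)" using nnb[of n] by (simp only:)
    then show ?thesis by (simp only: ennreal_le_iff[OF E0])
  qed
  then have "\<forall>\<^sub>F n in sequentially. sqdist M (f n) l \<le> E n" by (simp add: always_eventually)
  moreover have "\<forall>\<^sub>F n in sequentially. 0 \<le> sqdist M (f n) l" by (simp add: sqdist_nonneg)
  ultimately show "(\<lambda>n. sqdist M (f n) l) \<longlonglongrightarrow> 0"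
    by (rule tendsto_sandwich[OF _ _ tendsto_const E, rotated])
qed

lemma sqdist_tendsto_0_dominated:
  fixes f :: "nat \<Rightarrow> 'a \<Rightarrow> 'b::euclidean_space"
  assumes f: "\<And>n. f n \<in> borel_measurable M" and l: "l \<in> borel_measurable M"
    and g: "square_integrable M (g :: 'a \<Rightarrow> real)"
    and bf: "\<And>n. AE x in M. norm (f n x) \<le> g x" and bl: "AE x in M. norm (l x) \<le> g x"
    and lim: "AE x in M. (\<lambda>n. f n x) \<longlonglongrightarrow> l x"
  shows "(\<lambda>n. sqdist M (f n) l) \<longlonglongrightarrow> 0"
proof -
  have "(\<lambda>n. LINT x|M. (norm (f n x - l x))\<^sup>2) \<longlonglongrightarrow> (LINT x|M. 0)"
  proof (rule integral_dominated_convergence[where w = "\<lambda>x. 4 * (g x)\<^sup>2"])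
    show "AE x in M. (\<lambda>n. (norm (f n x - l x))\<^sup>2) \<longlonglongrightarrow> 0"
      using lim
    proof (rule AE_mp, intro AE_I2 impI)
      fix x assume "(\<lambda>n. f n x) \<longlonglongrightarrow> l x"
      then have "(\<lambda>n. (norm (f n x - l x))\<^sup>2) \<longlonglongrightarrow> (norm (l x - l x))\<^sup>2"
        by (intro tendsto_intros)
      then show "(\<lambda>n. (norm (f n x - l x))\<^sup>2) \<longlonglongrightarrow> 0" by simp
    qed
    show "AE x in M. norm ((norm (f n x - l x))\<^sup>2) \<le> 4 * (g x)\<^sup>2" for n
      using bf[of n] bl
    proof eventually_elim
      case (elim x)
      have "norm (f n x - l x) \<le> 2 * g x" using norm_triangle_ineq4[of "f n x" "l x"] elim by linarith
      then have "(norm (f n x - l x))\<^sup>2 \<le> (2 * g x)\<^sup>2" by (rule power_mono) simp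
      then show ?case by (simp add: power_mult_distrib)
    qed
  qed (use f l g in \<open>auto intro: square_integrable_real\<close>)
  then show ?thesis by (simp add: sqdist_def)
qed

section \<open>The Bessel profile\<close>

lemma integrable_powr_exp:
  fixes p a :: real
  assumes "p > -1" "a > 0"
  shows "(\<lambda>t. t powr p * exp (- (a * t))) absolutely_integrable_on {0<..}"
proof -
  have "(\<lambda>t. complex_of_real t powr (of_real (p + 1) - 1) / of_real (exp (a * t))) absolutely_integrable_on {0<..}"
    using assms by (intro absolutely_integrable_Gamma_integral) auto
  then have "(\<lambda>t. norm (complex_of_real t powr (of_real (p + 1) - 1) / of_real (exp (a * t)))) absolutely_integrable_on {0<..}"
    by (rule absolutely_integrable_norm[unfolded o_def])
  then show ?thesis
    by (rule absolutely_integrable_spike[OF _ negligible_empty])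
      (auto simp: norm_divide norm_powr_real_powr exp_minus field_simps)
qed

text \<open>An integral representation of a modified Bessel function: for \<open>y > 0\<close> the integral \<open>kern \<alpha> y\<close>
  is \<open>2 * (y / 2) powr \<alpha>\<close> times the Bessel function \<open>K\<close> of order \<open>\<alpha>\<close> at \<open>y\<close>.  Unlike \<open>K\<close>
  itself, it has no singularity at \<open>y = 0\<close>.\<close>
definition kern_fun :: "real \<Rightarrow> real \<Rightarrow> real \<Rightarrow> real" where
  "kern_fun \<alpha> y t = t powr (\<alpha> - 1) * exp (- t - y\<^sup>2 / (4 * t))"

definition kern :: "real \<Rightarrow> real \<Rightarrow> real" where
  "kern \<alpha> y = integral {0<..} (kern_fun \<alpha> y)"

lemma kern_fun_nonneg: "0 \<le> kern_fun \<alpha> y t"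
  by (simp add: kern_fun_def)

lemma kern_fun_le: "t > 0 \<Longrightarrow> kern_fun \<alpha> y t \<le> t powr (\<alpha> - 1) * exp (- (1 * t))"
  by (auto simp: kern_fun_def intro!: mult_left_mono)

lemma borel_measurable_lebesgue_on_cont:
  fixes f :: "real \<Rightarrow> real"
  assumes "continuous_on {0<..} f"
  shows "f \<in> borel_measurable (lebesgue_on {0<..})"
  using assms by (intro continuous_imp_measurable_on_sets_lebesgue) auto

lemma kern_fun_integrable:
  assumes "\<alpha> > 0"
  shows "kern_fun \<alpha> y integrable_on {0<..}"
proof -
  have "kern_fun \<alpha> y absolutely_integrable_on {0<..}"
  proof (rule measurable_bounded_by_integrable_imp_absolutely_integrable)
    show "kern_fun \<alpha> y \<in> borel_measurable (lebesgue_on {0<..})"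
      unfolding kern_fun_def by (intro borel_measurable_lebesgue_on_cont continuous_intros) auto
    show "(\<lambda>t. t powr (\<alpha> - 1) * exp (- (1 * t))) integrable_on {0<..}"
      using assms by (intro set_lebesgue_integral_eq_integral integrable_powr_exp) auto
  qed (use kern_fun_le kern_fun_nonneg in auto)
  then show ?thesis by (rule set_lebesgue_integral_eq_integral)
qed

lemma kern_nonneg: "0 \<le> kern \<alpha> y"
  unfolding kern_def
  by (cases "kern_fun \<alpha> y integrable_on {0<..}")
    (auto intro: integral_nonneg simp: kern_fun_nonneg not_integrable_integral)

lemma kern_0:
  assumes "\<alpha> > 0"
  shows "kern \<alpha> 0 = Gamma \<alpha>"
proof -
  have "((\<lambda>t. t powr (\<alpha> - 1) / exp t) has_integral Gamma \<alpha>) {0..}"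
    by (rule Gamma_integral_real[OF assms])
  then have "integral {0..} (\<lambda>t. t powr (\<alpha> - 1) / exp t) = Gamma \<alpha>"
    by (rule integral_unique)
  moreover have "integral {0..} (\<lambda>t. t powr (\<alpha> - 1) / exp t) = integral {0<..} (\<lambda>t. t powr (\<alpha> - 1) / exp t)"
  proof (rule integral_spike_set)
    have "{t \<in> {0..} - {0<..}. t powr (\<alpha> - 1) / exp t \<noteq> 0} \<subseteq> {0}" by auto
    then show "negligible {t \<in> {0..} - {0<..}. t powr (\<alpha> - 1) / exp t \<noteq> 0}"
      by (rule negligible_subset[OF negligible_sing])
    have "{t::real. t \<in> {0<..} - {0..} \<and> t powr (\<alpha> - 1) / exp t \<noteq> 0} = {}" by auto
    then show "negligible {t \<in> {0<..} - {0..}. t powr (\<alpha> - 1) / exp t \<noteq> 0}"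
      by (simp only: negligible_empty)
  qed
  moreover have "kern_fun \<alpha> 0 = (\<lambda>t. t powr (\<alpha> - 1) / exp t)"
    by (rule ext) (simp add: kern_fun_def exp_minus field_simps)
  ultimately show ?thesis
    by (simp add: kern_def)
qed

lemma kern_antimono:
  assumes "\<alpha> > 0" "0 \<le> y" "y \<le> y'"
  shows "kern \<alpha> y' \<le> kern \<alpha> y"
  unfolding kern_def
proof (rule integral_le[OF kern_fun_integrable kern_fun_integrable])
  fix t :: real assume "t \<in> {0<..}"
  have "y\<^sup>2 \<le> y'\<^sup>2" using assms by (intro power_mono) auto
  then show "kern_fun \<alpha> y' t \<le> kern_fun \<alpha> y t"
    unfolding kern_fun_def using \<open>t \<in> _\<close>
    by (intro mult_left_mono) (auto intro!: divide_right_mono)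
qed (use assms in auto)

text \<open>The exponent is split in two: one half of \<open>t\<close> keeps the integral finite, and the rest,
  \<open>t / 2 + y\<^sup>2 / (4 * t)\<close>, is at least \<open>y / 2\<close>.\<close>
lemma kern_exp_bound:
  assumes "\<alpha> > 0"
  obtains C where "C > 0" "\<And>y. y \<ge> 0 \<Longrightarrow> kern \<alpha> y \<le> C * exp (- (y / 2))"
proof -
  define C where "C = integral {0<..} (\<lambda>t. t powr (\<alpha> - 1) * exp (- (1/2 * t)))"
  have int: "(\<lambda>t. t powr (\<alpha> - 1) * exp (- (1/2 * t))) integrable_on {0<..}"
    using assms by (intro set_lebesgue_integral_eq_integral integrable_powr_exp) auto
  have le: "kern \<alpha> y \<le> C * exp (- (y / 2))" for y
  proof -
    have "kern \<alpha> y \<le> integral {0<..} (\<lambda>t. t powr (\<alpha> - 1) * exp (- (1/2 * t)) * exp (- (y / 2)))"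
      unfolding kern_def
    proof (rule integral_le[OF kern_fun_integrable[OF assms]])
      show "(\<lambda>t. t powr (\<alpha> - 1) * exp (- (1/2 * t)) * exp (- (y / 2))) integrable_on {0<..}"
        by (rule integrable_on_mult_left[OF int])
      fix t :: real assume "t \<in> {0<..}"
      then have t: "t > 0" by simp
      have "y / 2 \<le> t / 2 + y\<^sup>2 / (4 * t)"
      proof -
        have "0 \<le> t\<^sup>2 + (t - y)\<^sup>2" by simp
        then have "2 * t * y \<le> 2 * t\<^sup>2 + y\<^sup>2" by (simp add: power2_diff)
        then show ?thesis using t by (simp add: field_simps power2_eq_square)
      qed
      then show "kern_fun \<alpha> y t \<le> t powr (\<alpha> - 1) * exp (- (1/2 * t)) * exp (- (y / 2))"
        unfolding kern_fun_def mult.assoc exp_add[symmetric]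
        by (intro mult_left_mono) auto
    qed
    also have "\<dots> = C * exp (- (y / 2))" by (simp add: C_def)
    finally show ?thesis .
  qed
  have C0: "0 \<le> C"
    unfolding C_def by (rule integral_nonneg[OF int]) auto
  show ?thesis
  proof (rule that[of "C + 1"])
    fix y :: real
    have "C * exp (- (y / 2)) \<le> (C + 1) * exp (- (y / 2))" by (intro mult_right_mono) auto
    then show "kern \<alpha> y \<le> (C + 1) * exp (- (y / 2))" using le[of y] by linarith
  qed (use C0 in simp)
qed

lemma continuous_kern:
  assumes "\<alpha> > 0"
  shows "continuous_on UNIV (kern \<alpha>)"
proof -
  have "(\<lambda>n. kern \<alpha> (X n)) \<longlonglongrightarrow> kern \<alpha> y" if X: "X \<longlonglongrightarrow> y" for X y
    unfolding kern_def
  proof (rule dominated_convergence(2)[OF kern_fun_integrable[OF assms]])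
    show "(\<lambda>t. t powr (\<alpha> - 1) * exp (- (1 * t))) integrable_on {0<..}"
      using assms by (intro set_lebesgue_integral_eq_integral integrable_powr_exp) auto
    show "norm (kern_fun \<alpha> (X k) t) \<le> t powr (\<alpha> - 1) * exp (- (1 * t))" if "t \<in> {0<..}" for k t
      using kern_fun_le kern_fun_nonneg that by auto
    show "(\<lambda>k. kern_fun \<alpha> (X k) t) \<longlonglongrightarrow> kern_fun \<alpha> y t" if "t \<in> {0<..}" for t
      unfolding kern_fun_def using that by (intro tendsto_intros X) auto
  qed
  then show ?thesis by (auto simp: continuous_on_sequentially o_def)
qed

lemma mult_exp_minus_le: "x * exp (- x) \<le> (1::real)"
proof -
  have "x \<le> exp x" using exp_ge_add_one_self[of x] by linarith
  then show ?thesis by (simp add: exp_minus field_simps)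
qed

text \<open>The difference quotients of the integrand at \<open>y\<close> stay below an integrable function as long
  as the increment is at most \<open>y / 2\<close>.\<close>
lemma kern_fun_quotient_bound:
  assumes t: "t > 0" and y: "y > 0" and h: "h \<noteq> 0" "\<bar>h\<bar> \<le> y / 2"
  shows "\<bar>(kern_fun \<alpha> (y + h) t - kern_fun \<alpha> y t) / h\<bar> \<le> 16 / y * (t powr (\<alpha> - 1) * exp (- (1 * t)))"
proof -
  define g where "g = (\<lambda>z. exp (- (z\<^sup>2 / (4 * t))))"
  have der: "(g has_real_derivative - (z / (2 * t)) * g z) (at z)" for z
    unfolding g_def using t by (auto intro!: derivative_eq_intros simp: field_simps)
  have mv: "\<exists>z. y / 2 \<le> z \<and> z \<le> 2 * y \<and> g (y + h) - g y = h * (- (z / (2 * t)) * g z)"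
  proof (cases "h > 0")
    case True
    then have "\<exists>z>y. z < y + h \<and> g (y + h) - g y = (y + h - y) * (- (z / (2 * t)) * g z)"
      by (intro MVT2 der) auto
    then obtain z where "z > y" "z < y + h" "g (y + h) - g y = h * (- (z / (2 * t)) * g z)" by auto
    then show ?thesis using h y by (intro exI[of _ z]) auto
  next
    case False
    then have "\<exists>z>y+h. z < y \<and> g y - g (y + h) = (y - (y + h)) * (- (z / (2 * t)) * g z)"
      using h by (intro MVT2 der) auto
    then obtain z where "z > y+h" "z < y" "g y - g (y + h) = (y - (y + h)) * (- (z / (2 * t)) * g z)" by blast
    then show ?thesis using h y by (intro exI[of _ z]) (auto simp: algebra_simps)
  qed
  then obtain z where z: "y / 2 \<le> z" "z \<le> 2 * y" "g (y + h) - g y = h * (- (z / (2 * t)) * g z)" by blast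
  \<comment> \<open>This choice absorbs the factor \<open>1 / t\<close>, which is not bounded near 0, into \<open>x * exp (- x) \<le> 1\<close>.\<close>
  define x where "x = y\<^sup>2 / (16 * t)"
  have "g z \<le> exp (- x)"
  proof -
    have "(y / 2)\<^sup>2 \<le> z\<^sup>2" using z y by (intro power_mono) auto
    then show ?thesis unfolding g_def x_def using t by (simp add: field_simps)
  qed
  moreover have "z / (2 * t) \<le> y / t" using z t by (simp add: field_simps)
  ultimately have "z / (2 * t) * g z \<le> y / t * exp (- x)"
    using z y t by (intro mult_mono) (auto simp: g_def)
  also have "y / t * exp (- x) = 16 / y * (x * exp (- x))"
    using y t by (simp add: x_def field_simps power2_eq_square)
  also have "\<dots> \<le> 16 / y * 1" using y by (intro mult_left_mono mult_exp_minus_le) auto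
  finally have q: "z / (2 * t) * g z \<le> 16 / y" by simp
  have k: "kern_fun \<alpha> w t = t powr (\<alpha> - 1) * exp (- (1 * t)) * g w" for w
    by (simp add: kern_fun_def g_def exp_add[symmetric])
  have "(kern_fun \<alpha> (y + h) t - kern_fun \<alpha> y t) / h = t powr (\<alpha> - 1) * exp (- (1 * t)) * ((g (y + h) - g y) / h)"
    unfolding k by (simp add: field_simps)
  also have "(g (y + h) - g y) / h = - (z / (2 * t) * g z)"
    using z(3) h by simp
  also have "\<bar>t powr (\<alpha> - 1) * exp (- (1 * t)) * - (z / (2 * t) * g z)\<bar> = t powr (\<alpha> - 1) * exp (- (1 * t)) * (z / (2 * t) * g z)"
    using z y t by (simp add: abs_mult g_def)
  also have "\<dots> \<le> t powr (\<alpha> - 1) * exp (- (1 * t)) * (16 / y)"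
    by (intro mult_left_mono q) auto
  finally show ?thesis by (simp add: mult.commute)
qed

text \<open>Differentiation under the integral sign, by dominated convergence of the difference quotients.\<close>
lemma kern_deriv_integral:
  assumes a: "\<alpha> > 0" and y: "y > 0"
  shows "(kern \<alpha> has_real_derivative integral {0<..} (\<lambda>t. - (y / (2 * t)) * kern_fun \<alpha> y t)) (at y)"
proof -
  let ?D = "integral {0<..} (\<lambda>t. - (y / (2 * t)) * kern_fun \<alpha> y t)"
  have "(\<lambda>n. (kern \<alpha> (y + X n) - kern \<alpha> y) / X n) \<longlonglongrightarrow> ?D" if X: "X \<longlonglongrightarrow> 0" "\<And>n. X n \<noteq> 0" for X
  proof -
    have "\<forall>\<^sub>F n in sequentially. dist (X n) 0 < y / 2" using X(1) y by (intro tendstoD) auto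
    then obtain N where N: "\<And>n. \<bar>X (n + N)\<bar> \<le> y / 2"
      by (auto simp: eventually_sequentially) (metis le_add2 less_imp_le)
    have "(\<lambda>n. integral {0<..} (\<lambda>t. (kern_fun \<alpha> (y + X (n + N)) t - kern_fun \<alpha> y t) / X (n + N))) \<longlonglongrightarrow> ?D"
    proof (rule dominated_convergence(2))
      show "(\<lambda>t. (kern_fun \<alpha> (y + X (n + N)) t - kern_fun \<alpha> y t) / X (n + N)) integrable_on {0<..}" for n
        by (intro integrable_on_divide integrable_diff kern_fun_integrable a)
      show "(\<lambda>t. 16 / y * (t powr (\<alpha> - 1) * exp (- (1 * t)))) integrable_on {0<..}"
        using a by (intro integrable_on_mult_right set_lebesgue_integral_eq_integral integrable_powr_exp) auto
      show "norm ((kern_fun \<alpha> (y + X (n + N)) t - kern_fun \<alpha> y t) / X (n + N)) \<le> 16 / y * (t powr (\<alpha> - 1) * exp (- (1 * t)))"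
        if "t \<in> {0<..}" for n t
        unfolding real_norm_def using that y X(2) N by (intro kern_fun_quotient_bound) auto
      show "(\<lambda>n. (kern_fun \<alpha> (y + X (n + N)) t - kern_fun \<alpha> y t) / X (n + N)) \<longlonglongrightarrow> - (y / (2 * t)) * kern_fun \<alpha> y t"
        if "t \<in> {0<..}" for t
      proof -
        have "((\<lambda>z. kern_fun \<alpha> z t) has_real_derivative - (y / (2 * t)) * kern_fun \<alpha> y t) (at y)"
          unfolding kern_fun_def using that by (auto intro!: derivative_eq_intros simp: field_simps)
        then have "((\<lambda>h. (kern_fun \<alpha> (y + h) t - kern_fun \<alpha> y t) / h) \<longlongrightarrow> - (y / (2 * t)) * kern_fun \<alpha> y t) (at 0)"
          by (simp add: DERIV_def)
        from this[unfolded tendsto_at_iff_sequentially, rule_format, of "\<lambda>n. X (n + N)"]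
        show ?thesis using X(2) LIMSEQ_ignore_initial_segment[OF X(1), of N] by (simp add: o_def)
      qed
    qed
    moreover have "integral {0<..} (\<lambda>t. (kern_fun \<alpha> (y + h) t - kern_fun \<alpha> y t) / h) = (kern \<alpha> (y + h) - kern \<alpha> y) / h" for h
      unfolding kern_def by (simp add: Henstock_Kurzweil_Integration.integral_diff kern_fun_integrable a)
    ultimately have "(\<lambda>n. (kern \<alpha> (y + X (n + N)) - kern \<alpha> y) / X (n + N)) \<longlonglongrightarrow> ?D" by (simp only:)
    then show ?thesis by (rule LIMSEQ_offset)
  qed
  then have "((\<lambda>h. (kern \<alpha> (y + h) - kern \<alpha> y) / h) \<longlongrightarrow> ?D) (at 0)"
    unfolding tendsto_at_iff_sequentially by (auto simp: o_def)
  then show "(kern \<alpha> has_real_derivative ?D) (at y)" by (simp add: DERIV_def)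
qed

text \<open>The substitution \<open>t \<mapsto> y\<^sup>2 / (4 t)\<close> exchanges the parameters \<open>\<alpha>\<close> and \<open>1 - \<alpha>\<close>.\<close>
lemma kern_reflect:
  assumes a: "\<alpha> < 1" and y: "y > 0"
  shows "integral {0<..} (\<lambda>t. - (y / (2 * t)) * kern_fun \<alpha> y t) = - ((y / 2) powr (2 * \<alpha> - 1) * kern (1 - \<alpha>) y)"
proof -
  let ?g = "\<lambda>t. y\<^sup>2 / (4 * t)" and ?g' = "\<lambda>t. - (y\<^sup>2 / (4 * t\<^sup>2))"
  let ?f = "kern_fun (1 - \<alpha>) y"
  have im: "?g ` {0<..} = {0<..}"
  proof safe
    fix u :: real assume "u > 0"
    then show "u \<in> ?g ` {0<..}" using y by (intro image_eqI[of _ _ "y\<^sup>2 / (4 * u)"]) (auto simp: field_simps)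
  qed (use y in auto)
  have "?f absolutely_integrable_on ?g ` {0<..}"
    unfolding im using kern_fun_integrable[of "1 - \<alpha>" y] a kern_fun_nonneg
    by (intro nonnegative_absolutely_integrable_1) auto
  moreover have "(\<lambda>x. \<bar>?g' x\<bar> * ?f (?g x)) absolutely_integrable_on {0<..} \<and>
     integral {0<..} (\<lambda>x. \<bar>?g' x\<bar> * ?f (?g x)) = kern (1 - \<alpha>) y
     \<longleftrightarrow> ?f absolutely_integrable_on (?g ` {0<..}) \<and> integral (?g ` {0<..}) ?f = kern (1 - \<alpha>) y"
    by (rule has_absolute_integral_change_of_variables_1')
      (use y in \<open>auto intro!: derivative_eq_intros simp: inj_on_def field_simps power2_eq_square\<close>)
  ultimately have eq: "integral {0<..} (\<lambda>x. \<bar>?g' x\<bar> * ?f (?g x)) = kern (1 - \<alpha>) y"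
    unfolding im by (simp add: kern_def)
  have pt: "- (y / (2 * t)) * kern_fun \<alpha> y t = - ((y / 2) powr (2 * \<alpha> - 1)) * (\<bar>?g' t\<bar> * ?f (?g t))" if t: "t \<in> {0<..}" for t
  proof -
    have t: "t > 0" using that by simp
    have e: "exp (- ?g t - y\<^sup>2 / (4 * ?g t)) = exp (- t - y\<^sup>2 / (4 * t))"
      using t y by (simp add: field_simps)
    have p: "(?g t) powr (1 - \<alpha> - 1) = (y / 2) powr (- (2 * \<alpha>)) * t powr \<alpha>"
    proof -
      have "?g t = (y / 2) powr 2 * t powr (-1)" using t y by (simp add: powr_minus field_simps power2_eq_square powr_numeral)
      then have "(?g t) powr (1 - \<alpha> - 1) = ((y / 2) powr 2 * t powr (-1)) powr (- \<alpha>)" by (simp only:) simp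
      also have "\<dots> = (y / 2) powr (- (2 * \<alpha>)) * t powr \<alpha>"
        by (simp only: powr_mult powr_powr) simp
      finally show ?thesis .
    qed
    have q: "y / (2 * t) * t powr (\<alpha> - 1) = (y / 2) powr (2 * \<alpha> - 1) * ((y\<^sup>2 / (4 * t\<^sup>2)) * ((y / 2) powr (- (2 * \<alpha>)) * t powr \<alpha>))"
    proof -
      have "(y / 2) powr (2 * \<alpha> - 1) * (y / 2) powr (- (2 * \<alpha>)) = (y / 2) powr (-1)"
        by (simp add: powr_add[symmetric])
      then have "(y / 2) powr (2 * \<alpha> - 1) * ((y\<^sup>2 / (4 * t\<^sup>2)) * ((y / 2) powr (- (2 * \<alpha>)) * t powr \<alpha>))
        = (y / 2) powr (-1) * (y\<^sup>2 / (4 * t\<^sup>2)) * t powr \<alpha>" by (simp add: mult_ac)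
      also have "\<dots> = y / (2 * t) * (t powr \<alpha> / t)" using t y by (simp add: powr_minus field_simps power2_eq_square)
      also have "t powr \<alpha> / t = t powr (\<alpha> - 1)" using t by (simp add: powr_diff)
      finally show ?thesis by simp
    qed
    have "- (y / (2 * t)) * kern_fun \<alpha> y t = - (y / (2 * t) * t powr (\<alpha> - 1) * exp (- t - y\<^sup>2 / (4 * t)))"
      by (simp add: kern_fun_def)
    also have "\<dots> = - ((y / 2) powr (2 * \<alpha> - 1)) * (\<bar>?g' t\<bar> * ?f (?g t))"
      unfolding kern_fun_def p e q by simp
    finally show ?thesis .
  qed
  have "integral {0<..} (\<lambda>t. - (y / (2 * t)) * kern_fun \<alpha> y t)
    = integral {0<..} (\<lambda>t. - ((y / 2) powr (2 * \<alpha> - 1)) * (\<bar>?g' t\<bar> * ?f (?g t)))"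
    by (rule integral_cong) (rule pt)
  also have "\<dots> = - ((y / 2) powr (2 * \<alpha> - 1)) * kern (1 - \<alpha>) y"
    by (simp only: Henstock_Kurzweil_Integration.integral_mult_right eq)
  finally show ?thesis by simp
qed

lemma kern_deriv:
  assumes "0 < \<alpha>" "\<alpha> < 1" "y > 0"
  shows "(kern \<alpha> has_real_derivative - ((y / 2) powr (2 * \<alpha> - 1) * kern (1 - \<alpha>) y)) (at y)"
  using kern_deriv_integral[OF assms(1,3)] kern_reflect[OF assms(2,3)] by simp

text \<open>The solution of \<open>(y\<^sup>1\<^sup>-\<^sup>2\<^sup>s theta')' = y\<^sup>1\<^sup>-\<^sup>2\<^sup>s theta\<close> with the value 1 at 0 that decays at infinity;
  \<open>flux\<close> is its conormal derivative \<open>- y\<^sup>1\<^sup>-\<^sup>2\<^sup>s theta'\<close>.  By the symmetry of the kernel under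
  \<open>\<alpha> \<mapsto> 1 - \<alpha>\<close> both are kernels up to constants, and the second-order equation becomes a first-order
  system.\<close>
definition theta :: "real \<Rightarrow> real \<Rightarrow> real" where
  "theta s y = kern s y / Gamma s"

definition flux :: "real \<Rightarrow> real \<Rightarrow> real" where
  "flux s y = 2 powr (1 - 2 * s) * kern (1 - s) y / Gamma s"

lemma theta_deriv:
  assumes "0 < s" "s < 1" "y > 0"
  shows "(theta s has_real_derivative - (y powr (2 * s - 1) * flux s y)) (at y)"
proof -
  have "(y / 2) powr (2 * s - 1) = y powr (2 * s - 1) * 2 powr (1 - 2 * s)"
    using assms by (simp add: powr_divide powr_diff divide_simps)
  then show ?thesis
    unfolding theta_def[abs_def]
    using DERIV_cdivide[OF kern_deriv[OF assms], of "Gamma s"] by (simp add: flux_def mult_ac)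
qed

lemma flux_deriv:
  assumes "0 < s" "s < 1" "y > 0"
  shows "(flux s has_real_derivative - (y powr (1 - 2 * s) * theta s y)) (at y)"
proof -
  have "(y / 2) powr (1 - 2 * s) = y powr (1 - 2 * s) / 2 powr (1 - 2 * s)"
    using assms by (simp add: powr_divide)
  then have "- ((y / 2) powr (2 * (1 - s) - 1) * kern (1 - (1 - s)) y) * (2 powr (1 - 2 * s)) / Gamma s = - (y powr (1 - 2 * s) * theta s y)"
    by (simp add: theta_def)
  moreover have "(flux s has_real_derivative - ((y / 2) powr (2 * (1 - s) - 1) * kern (1 - (1 - s)) y) * (2 powr (1 - 2 * s)) / Gamma s) (at y)"
    unfolding flux_def[abs_def] mult.commute[of "2 powr (1 - 2 * s)"]
    using kern_deriv[of "1 - s" y] assms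
    by (intro DERIV_cdivide DERIV_cmult_right) simp_all
  ultimately show ?thesis by simp
qed

lemma theta_0: "0 < s \<Longrightarrow> theta s 0 = 1"
  using Gamma_real_pos[of s] by (simp add: theta_def kern_0 less_imp_neq[symmetric])

lemma flux_0: "s < 1 \<Longrightarrow> flux s 0 = kappa s"
  by (simp add: flux_def kern_0 kappa_def)

lemma continuous_theta: "0 < s \<Longrightarrow> continuous_on UNIV (theta s)"
  unfolding theta_def[abs_def] using Gamma_real_pos[of s] by (intro continuous_intros continuous_kern) (simp_all add: less_imp_neq[symmetric])

lemma continuous_flux: "0 < s \<Longrightarrow> s < 1 \<Longrightarrow> continuous_on UNIV (flux s)"
  unfolding flux_def[abs_def] using Gamma_real_pos[of s] by (intro continuous_intros continuous_kern) (simp_all add: less_imp_neq[symmetric])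

lemma theta_exp_bound:
  assumes "0 < s"
  obtains C where "C > 0" "\<And>y. y \<ge> 0 \<Longrightarrow> \<bar>theta s y\<bar> \<le> C * exp (- (y / 2))"
proof -
  from kern_exp_bound[OF assms] obtain C where C: "C > 0" "\<And>y. y \<ge> 0 \<Longrightarrow> kern s y \<le> C * exp (- (y / 2))" by blast
  show ?thesis using Gamma_real_pos[OF assms] C kern_nonneg[of s]
    by (intro that[of "C / Gamma s"]) (auto simp: theta_def field_simps)
qed

lemma flux_exp_bound:
  assumes "0 < s" "s < 1"
  obtains C where "C > 0" "\<And>y. y \<ge> 0 \<Longrightarrow> \<bar>flux s y\<bar> \<le> C * exp (- (y / 2))"
proof -
  have "1 - s > 0" using assms by simp
  from kern_exp_bound[OF this] obtain C where C: "C > 0" "\<And>y. y \<ge> 0 \<Longrightarrow> kern (1 - s) y \<le> C * exp (- (y / 2))" by blast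
  show ?thesis using Gamma_real_pos[OF assms(1)] C kern_nonneg[of "1 - s"]
    by (intro that[of "2 powr (1 - 2 * s) * C / Gamma s"])
      (auto simp: flux_def field_simps abs_mult intro!: mult_left_mono)
qed

lemma theta_le_1:
  assumes "0 < s" "y \<ge> 0"
  shows "\<bar>theta s y\<bar> \<le> 1"
  using kern_antimono[OF assms(1) order_refl assms(2)] kern_nonneg[of s y] Gamma_real_pos[OF assms(1)]
  by (simp add: theta_def kern_0 assms(1))

lemma kappa_pos: "0 < s \<Longrightarrow> s < 1 \<Longrightarrow> 0 < kappa s"
  using Gamma_real_pos[of s] Gamma_real_pos[of "1 - s"] by (simp add: kappa_def)

text \<open>Since \<open>theta' = - y\<^sup>2\<^sup>s\<^sup>-\<^sup>1 flux\<close> and \<open>flux' = - y\<^sup>1\<^sup>-\<^sup>2\<^sup>s theta\<close>, differentiation maps the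
  linear span of the functions \<open>y\<^sup>p theta\<close> and \<open>y\<^sup>p flux\<close> into itself.
  A list of triples \<open>(c, p, b)\<close> encodes an element of this span.\<close>
fun term_deriv :: "real \<Rightarrow> real \<times> real \<times> bool \<Rightarrow> (real \<times> real \<times> bool) list" where
  "term_deriv s (c, p, True) = [(c * p, p - 1, True), (- c, p + (2 * s - 1), False)]"
| "term_deriv s (c, p, False) = [(c * p, p - 1, False), (- c, p + (1 - 2 * s), True)]"

definition term_val :: "real \<Rightarrow> real \<Rightarrow> real \<times> real \<times> bool \<Rightarrow> real" where
  "term_val s y = (\<lambda>(c, p, b). c * (y powr p * (if b then theta s y else flux s y)))"

lemma term_val_deriv:
  assumes "0 < s" "s < 1" "y > 0"
  shows "((\<lambda>y. term_val s y m) has_real_derivative (\<Sum>m'\<leftarrow>term_deriv s m. term_val s y m')) (at y)"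
proof -
  obtain c p b where m: "m = (c, p, b)" by (cases m)
  have pw: "((\<lambda>y. y powr p) has_real_derivative p * y powr (p - 1)) (at y)"
    using assms by (intro has_real_derivative_powr)
  show ?thesis
  proof (cases b)
    case True
    show ?thesis
      unfolding m term_val_def using True assms
      by (auto intro!: derivative_eq_intros pw theta_deriv simp: powr_add[symmetric] algebra_simps)

  next
    case False
    show ?thesis
      unfolding m term_val_def using False assms
      by (auto intro!: derivative_eq_intros pw flux_deriv simp: powr_add[symmetric] algebra_simps)
  qed
qed

lemma terms_val_deriv:
  assumes "0 < s" "s < 1" "y > 0"
  shows "((\<lambda>y. \<Sum>m\<leftarrow>ms. term_val s y m) has_real_derivative
    (\<Sum>m\<leftarrow>concat (map (term_deriv s) ms). term_val s y m)) (at y)"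
  by (induction ms) (auto intro!: derivative_eq_intros term_val_deriv assms)

lemma theta_smooth:
  assumes "0 < s" "s < 1"
  obtains vd :: "nat \<Rightarrow> real \<Rightarrow> real" where "\<And>y. y > 0 \<Longrightarrow> vd 0 y = theta s y"
    "\<And>l y. y > 0 \<Longrightarrow> (vd l has_real_derivative vd (Suc l) y) (at y)"
proof
  let ?L = "\<lambda>l. ((\<lambda>ms. concat (map (term_deriv s) ms)) ^^ l) [(1, 0, True)]"
  show "(\<lambda>l y. \<Sum>m\<leftarrow>?L l. term_val s y m) 0 y = theta s y" if "y > 0" for y
    using that by (simp add: term_val_def)
  show "((\<lambda>l y. \<Sum>m\<leftarrow>?L l. term_val s y m) l has_real_derivative (\<lambda>l y. \<Sum>m\<leftarrow>?L l. term_val s y m) (Suc l) y) (at y)" if "y > 0" for l y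
    using terms_val_deriv[OF assms that, of "?L l"] by simp
qed

section \<open>The weighted half line\<close>

text \<open>The vertical factor of the measure \<open>weighted s\<close>.\<close>
definition nu :: "real \<Rightarrow> real measure" where
  "nu s = density (restrict_space lborel {0<..}) (\<lambda>y. ennreal (y powr (1 - 2 * s)))"

lemma space_nu: "space (nu s) = {0<..}"
  by (simp add: nu_def space_restrict_space)

lemma measurable_nu: "f \<in> borel_measurable borel \<Longrightarrow> f \<in> borel_measurable (nu s)"
  by (auto simp: nu_def intro: measurable_restrict_space1)

lemma AE_nu: "(\<And>y. y > 0 \<Longrightarrow> P y) \<Longrightarrow> AE y in nu s. P y"
  by (rule AE_I2) (auto simp: space_nu)

lemma
  fixes f :: "real \<Rightarrow> real"
  assumes f: "f \<in> borel_measurable borel"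
  shows integrable_nu_iff: "integrable (nu s) f \<longleftrightarrow> set_integrable lborel {0<..} (\<lambda>y. y powr (1 - 2 * s) * f y)"
    and integral_nu: "integral\<^sup>L (nu s) f = (LINT y:{0<..}|lborel. y powr (1 - 2 * s) * f y)"
proof -
  have m: "f \<in> borel_measurable (restrict_space lborel {0<..})" "(\<lambda>y. y powr (1 - 2 * s)) \<in> borel_measurable (restrict_space lborel {0<..})"
    using f by (auto intro: measurable_restrict_space1)
  show "integrable (nu s) f \<longleftrightarrow> set_integrable lborel {0<..} (\<lambda>y. y powr (1 - 2 * s) * f y)"
    unfolding nu_def set_integrable_def
    by (subst integrable_density) (auto simp: integrable_restrict_space m)
  show "integral\<^sup>L (nu s) f = (LINT y:{0<..}|lborel. y powr (1 - 2 * s) * f y)"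
    unfolding nu_def set_lebesgue_integral_def
    by (subst integral_density) (auto simp: integral_restrict_space m)
qed

lemma integrable_nu_powr_exp:
  assumes p: "p + (1 - 2 * s) > -1" and a: "a > 0"
  shows "integrable (nu s) (\<lambda>y. y powr p * exp (- (a * y)))"
proof -
  have "(\<lambda>t. t powr (p + (1 - 2 * s)) * exp (- (a * t))) absolutely_integrable_on {0<..}"
    by (rule integrable_powr_exp) (use assms in auto)
  then have "set_integrable lborel {0<..} (\<lambda>t. t powr (p + (1 - 2 * s)) * exp (- (a * t)))"
    unfolding set_integrable_def by (subst (asm) integrable_completion) auto
  then have "set_integrable lborel {0<..} (\<lambda>y. y powr (1 - 2 * s) * (y powr p * exp (- (a * y))))"
    by (rule set_integrable_cong[THEN iffD1, rotated 3]) (auto simp: powr_add)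
  then show ?thesis by (subst integrable_nu_iff) auto
qed

lemma borel_measurable_theta [measurable]: "0 < s \<Longrightarrow> theta s \<in> borel_measurable borel"
  by (intro borel_measurable_continuous_onI continuous_theta)

lemma borel_measurable_flux [measurable]: "0 < s \<Longrightarrow> s < 1 \<Longrightarrow> flux s \<in> borel_measurable borel"
  by (intro borel_measurable_continuous_onI continuous_flux)

text \<open>The profile that extends a wave of frequency \<open>k\<close>, for \<open>r\<^sup>2 = |k|\<^sup>2 + m\<^sup>2\<close>; \<open>prof'\<close> is its derivative.\<close>
definition prof :: "real \<Rightarrow> real \<Rightarrow> real \<Rightarrow> real" where
  "prof s r y = theta s (r * y)"

definition prof' :: "real \<Rightarrow> real \<Rightarrow> real \<Rightarrow> real" where
  "prof' s r y = - r * ((r * y) powr (2 * s - 1) * flux s (r * y))"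

lemma borel_measurable_prof [measurable]: "0 < s \<Longrightarrow> prof s r \<in> borel_measurable borel"
  and borel_measurable_prof' [measurable]: "0 < s \<Longrightarrow> s < 1 \<Longrightarrow> prof' s r \<in> borel_measurable borel"
  unfolding prof_def[abs_def] prof'_def[abs_def] by measurable

lemma prof_deriv:
  assumes "0 < s" "s < 1" "r > 0" "y > 0"
  shows "(prof s r has_real_derivative prof' s r y) (at y)"
proof -
  have "(theta s has_real_derivative - ((r * y) powr (2 * s - 1) * flux s (r * y))) (at (r * y))"
    by (rule theta_deriv) (use assms in auto)
  then have "((\<lambda>y. theta s (r * y)) has_real_derivative - ((r * y) powr (2 * s - 1) * flux s (r * y)) * r) (at y)"
    by (intro DERIV_chain2) (auto intro!: derivative_eq_intros)
  then show ?thesis by (simp add: prof_def[abs_def] prof'_def mult.commute)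
qed

lemma isCont_compose_mult:
  fixes f :: "real \<Rightarrow> real"
  assumes "continuous_on UNIV f"
  shows "isCont (\<lambda>y. f (r * y)) y"
proof -
  have "isCont (\<lambda>y. r * y) y" by (intro continuous_intros)
  moreover have "isCont f (r * y)" using assms by (simp add: continuous_on_eq_continuous_at)
  ultimately show ?thesis by (rule isCont_o2)
qed

lemma isCont_prof': "0 < s \<Longrightarrow> s < 1 \<Longrightarrow> r > 0 \<Longrightarrow> y > 0 \<Longrightarrow> isCont (prof' s r) y"
  unfolding prof'_def[abs_def]
  by (intro continuous_intros isCont_compose_mult continuous_flux) auto

lemma isCont_prof: "0 < s \<Longrightarrow> isCont (prof s r) y"
  unfolding prof_def[abs_def] by (intro isCont_compose_mult continuous_theta)

text \<open>Serves dominated convergence when the translation of the profile tends to 0.\<close>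
lemma prof_majorant:
  assumes s: "1 / 2 < s" "s < 1" and r: "r > 0"
  obtains g :: "real \<Rightarrow> real" where "square_integrable (nu s) g"
    "\<And>y e. 0 \<le> e \<Longrightarrow> e \<le> 1 \<Longrightarrow> 0 < y \<Longrightarrow> \<bar>prof s r (y + e)\<bar> \<le> g y \<and> \<bar>prof' s r (y + e)\<bar> \<le> g y"
proof -
  obtain C where C: "C > 0" "\<And>y. y \<ge> 0 \<Longrightarrow> \<bar>theta s y\<bar> \<le> C * exp (- (y / 2))"
    using theta_exp_bound[of s] s by auto
  obtain D where D: "D > 0" "\<And>y. y \<ge> 0 \<Longrightarrow> \<bar>flux s y\<bar> \<le> D * exp (- (y / 2))"
    using flux_exp_bound[of s] s by auto
  define g where "g = (\<lambda>y. (C + r * D) * ((1 + r + r * y) * exp (- (r * y / 2))))"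
  have "integrable (nu s) (\<lambda>y. (C + r * D)\<^sup>2 * ((1 + r)\<^sup>2 * (y powr 0 * exp (- (r * y))) + 2 * (1 + r) * r * (y powr 1 * exp (- (r * y)))
     + r\<^sup>2 * (y powr 2 * exp (- (r * y)))))"
    by (intro Bochner_Integration.integrable_add integrable_mult_right integrable_nu_powr_exp) (use s r in auto)
  then have "integrable (nu s) (\<lambda>y. (g y)\<^sup>2)"
  proof (rule Bochner_Integration.integrable_cong[THEN iffD1, rotated 2])
    fix y assume "y \<in> space (nu s)"
    then have y: "y > 0" by (simp add: space_nu)
    have e: "exp (- (r * y / 2)) * exp (- (r * y / 2)) = exp (- (r * y))" by (simp add: exp_add[symmetric])
    have "(g y)\<^sup>2 = (C + r * D)\<^sup>2 * ((1 + r + r * y)\<^sup>2 * (exp (- (r * y / 2)) * exp (- (r * y / 2))))"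
      by (simp add: g_def power2_eq_square mult_ac)
    also have "\<dots> = (C + r * D)\<^sup>2 * ((1 + r)\<^sup>2 * (y powr 0 * exp (- (r * y))) + 2 * (1 + r) * r * (y powr 1 * exp (- (r * y)))
     + r\<^sup>2 * (y powr 2 * exp (- (r * y))))"
      unfolding e using y by (simp add: powr_numeral) (simp add: algebra_simps power2_eq_square)
    finally show "(C + r * D)\<^sup>2 * ((1 + r)\<^sup>2 * (y powr 0 * exp (- (r * y))) + 2 * (1 + r) * r * (y powr 1 * exp (- (r * y)))
     + r\<^sup>2 * (y powr 2 * exp (- (r * y)))) = (g y)\<^sup>2" by simp
  qed simp
  then have gs: "square_integrable (nu s) g"
    unfolding square_integrable_def by (auto simp: g_def intro!: measurable_nu)
  show ?thesis
  proof (rule that[OF gs])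
    fix y e :: real assume e: "0 \<le> e" "e \<le> 1" "0 < y"
    have mon: "exp (- (r * (y + e) / 2)) \<le> exp (- (r * y / 2))" using e r by simp
    have one: "1 \<le> 1 + r + r * y" using e r by simp
    have "\<bar>prof s r (y + e)\<bar> \<le> C * exp (- (r * (y + e) / 2))"
      unfolding prof_def using C(2)[of "r * (y + e)"] e r by simp
    also have "\<dots> \<le> C * exp (- (r * y / 2))" using mon C by simp
    also have "\<dots> \<le> (C + r * D) * ((1 + r + r * y) * exp (- (r * y / 2)))"
      using C D r one by (intro mult_mono) auto
    finally have 1: "\<bar>prof s r (y + e)\<bar> \<le> g y" by (simp add: g_def)
    let ?z = "r * (y + e)"
    have z: "?z > 0" using e r by simp
    have "?z powr (2 * s - 1) \<le> 1 + ?z"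
    proof (cases "?z \<le> 1")
      case True
      then have "?z powr (2 * s - 1) \<le> 1" using z s by (intro powr_le1) auto
      then show ?thesis using z by linarith
    next
      case False
      then have "?z powr (2 * s - 1) \<le> ?z powr 1" using s by (intro powr_mono) auto
      then show ?thesis using z by simp
    qed
    also have "\<dots> \<le> 1 + r + r * y" using e r by (simp add: algebra_simps)
    finally have p: "?z powr (2 * s - 1) \<le> 1 + r + r * y" .
    have "\<bar>flux s ?z\<bar> \<le> D * exp (- (r * y / 2))"
      using D(2)[of ?z] z mult_left_mono[OF mon, of D] D(1) by linarith
    then have "?z powr (2 * s - 1) * \<bar>flux s ?z\<bar> \<le> (1 + r + r * y) * (D * exp (- (r * y / 2)))"
      using p one by (intro mult_mono) auto
    then have "r * (?z powr (2 * s - 1) * \<bar>flux s ?z\<bar>) \<le> r * ((1 + r + r * y) * (D * exp (- (r * y / 2))))"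
      using r by (intro mult_left_mono) auto
    also have "\<dots> = (r * D) * ((1 + r + r * y) * exp (- (r * y / 2)))" by simp
    also have "\<dots> \<le> g y" unfolding g_def using C one by (intro mult_right_mono) auto
    finally have 2: "\<bar>prof' s r (y + e)\<bar> \<le> g y" using r by (simp add: prof'_def abs_mult)
    show "\<bar>prof s r (y + e)\<bar> \<le> g y \<and> \<bar>prof' s r (y + e)\<bar> \<le> g y" using 1 2 by simp
  qed
qed

lemma square_integrable_prof_shift:
  assumes s: "1 / 2 < s" "s < 1" and r: "r > 0" and e: "0 \<le> e" "e \<le> 1"
  shows "square_integrable (nu s) (\<lambda>y. prof s r (y + e))" "square_integrable (nu s) (\<lambda>y. prof' s r (y + e))"
proof -
  obtain g where g: "square_integrable (nu s) g"
    "\<And>y e. 0 \<le> e \<Longrightarrow> e \<le> 1 \<Longrightarrow> 0 < y \<Longrightarrow> \<bar>prof s r (y + e)\<bar> \<le> g y \<and> \<bar>prof' s r (y + e)\<bar> \<le> g y"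
    using prof_majorant[OF s r] by blast
  have gi: "integrable (nu s) (\<lambda>y. (g y)\<^sup>2)" using g(1) by (rule square_integrable_real)
  have "(norm (prof s r (y + e)))\<^sup>2 \<le> (g y)\<^sup>2 \<and> (norm (prof' s r (y + e)))\<^sup>2 \<le> (g y)\<^sup>2" if "y > 0" for y
    using g(2)[OF e that] by (intro conjI power_mono) simp_all
  then have "AE y in nu s. (norm (prof s r (y + e)))\<^sup>2 \<le> (g y)\<^sup>2" "AE y in nu s. (norm (prof' s r (y + e)))\<^sup>2 \<le> (g y)\<^sup>2"
    by (auto intro!: AE_nu)
  then show "square_integrable (nu s) (\<lambda>y. prof s r (y + e))" "square_integrable (nu s) (\<lambda>y. prof' s r (y + e))"
    using s by (auto intro!: square_integrable_mono[OF _ gi] measurable_nu)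
qed

lemma square_integrable_prof:
  assumes "1 / 2 < s" "s < 1" "r > 0"
  shows "square_integrable (nu s) (prof s r)" "square_integrable (nu s) (prof' s r)"
  using square_integrable_prof_shift[OF assms, of 0] by simp_all

lemma prof_shift_tendsto:
  assumes s: "1 / 2 < s" "s < 1" and r: "r > 0"
  shows "(\<lambda>n. sqdist (nu s) (\<lambda>y. prof s r (y + 1 / Suc n)) (prof s r)) \<longlonglongrightarrow> 0"
    and "(\<lambda>n. sqdist (nu s) (\<lambda>y. prof' s r (y + 1 / Suc n)) (prof' s r)) \<longlonglongrightarrow> 0"
proof -
  obtain g where g: "square_integrable (nu s) g"
    "\<And>y e. 0 \<le> e \<Longrightarrow> e \<le> 1 \<Longrightarrow> 0 < y \<Longrightarrow> \<bar>prof s r (y + e)\<bar> \<le> g y \<and> \<bar>prof' s r (y + e)\<bar> \<le> g y"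
    using prof_majorant[OF s r] by blast
  have seq: "(\<lambda>n. y + 1 / Suc n) \<longlonglongrightarrow> y" for y :: real
    using tendsto_add[OF tendsto_const[of y] LIMSEQ_inverse_real_of_nat] by (simp add: inverse_eq_divide)
  show "(\<lambda>n. sqdist (nu s) (\<lambda>y. prof s r (y + 1 / Suc n)) (prof s r)) \<longlonglongrightarrow> 0"
  proof (rule sqdist_tendsto_0_dominated[OF _ _ g(1)])
    show "AE y in nu s. (\<lambda>n. prof s r (y + 1 / Suc n)) \<longlonglongrightarrow> prof s r y"
      using s by (intro AE_nu isCont_tendsto_compose[OF isCont_prof seq]) auto
    show "AE y in nu s. norm (prof s r (y + 1 / real (Suc n))) \<le> g y" for n
      using g(2)[of "1 / real (Suc n)"] by (intro AE_nu) simp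
    show "AE y in nu s. norm (prof s r y) \<le> g y"
      using g(2)[of 0] by (intro AE_nu) simp
  qed (use s in \<open>auto intro!: measurable_nu\<close>)
  show "(\<lambda>n. sqdist (nu s) (\<lambda>y. prof' s r (y + 1 / Suc n)) (prof' s r)) \<longlonglongrightarrow> 0"
  proof (rule sqdist_tendsto_0_dominated[OF _ _ g(1)])
    show "AE y in nu s. (\<lambda>n. prof' s r (y + 1 / Suc n)) \<longlonglongrightarrow> prof' s r y"
      using s r by (intro AE_nu isCont_tendsto_compose[OF isCont_prof' seq]) auto
    show "AE y in nu s. norm (prof' s r (y + 1 / real (Suc n))) \<le> g y" for n
      using g(2)[of "1 / real (Suc n)"] by (intro AE_nu) simp
    show "AE y in nu s. norm (prof' s r y) \<le> g y"
      using g(2)[of 0] by (intro AE_nu) simp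
  qed (use s in \<open>auto intro!: measurable_nu\<close>)
qed

text \<open>Integrability of the derivative yields a limit at infinity; a limit other than 0 would contradict
  integrability of the function.\<close>
lemma tendsto_0_at_top_if_integrable:
  fixes F f :: "real \<Rightarrow> real"
  assumes F: "\<And>y. y > 0 \<Longrightarrow> (F has_real_derivative f y) (at y)" and f: "\<And>y. y > 0 \<Longrightarrow> isCont f y"
    and fi: "set_integrable lborel {0<..} f" and Fi: "set_integrable lborel {0<..} F"
  shows "(F \<longlongrightarrow> 0) at_top"
proof -
  have fi1: "set_integrable lborel {1..} f" by (rule set_integrable_subset[OF fi]) auto
  define L where "L = F 1 + (LINT x|lborel. indicator {1..} x *\<^sub>R f x)"
  have "((\<lambda>y. LINT x|lborel. indicator {..y} x *\<^sub>R (indicator {1..} x *\<^sub>R f x)) \<longlongrightarrow> (LINT x|lborel. indicator {1..} x *\<^sub>R f x)) at_top"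
    by (rule tendsto_integral_at_top) (use fi1 in \<open>auto simp: set_integrable_def\<close>)
  then have "((\<lambda>y. F 1 + (LINT x|lborel. indicator {..y} x *\<^sub>R (indicator {1..} x *\<^sub>R f x))) \<longlongrightarrow> L) at_top"
    unfolding L_def by (intro tendsto_intros)
  moreover have "\<forall>\<^sub>F y in at_top. F 1 + (LINT x|lborel. indicator {..y} x *\<^sub>R (indicator {1..} x *\<^sub>R f x)) = F y"
    using eventually_ge_at_top[of 1]
  proof eventually_elim
    case (elim y)
    have "(LINT x|lborel. indicator {..y} x *\<^sub>R (indicator {1..} x *\<^sub>R f x)) = (LINT x|lborel. f x * indicator {1..y} x)"
      by (rule Bochner_Integration.integral_cong) (auto simp: indicator_def)
    also have "\<dots> = F y - F 1"
      by (rule integral_FTC_Icc_real) (use elim in \<open>auto intro!: F f\<close>)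
    finally show ?case by simp
  qed
  ultimately have lim: "(F \<longlongrightarrow> L) at_top" by (rule Lim_transform_eventually)
  have "L = 0"
  proof (rule ccontr)
    assume L: "L \<noteq> 0"
    have "((\<lambda>y. \<bar>F y\<bar>) \<longlongrightarrow> \<bar>L\<bar>) at_top" by (intro tendsto_intros lim)
    then have "\<forall>\<^sub>F y in at_top. \<bar>L\<bar> / 2 < \<bar>F y\<bar>" using L by (intro order_tendstoD) auto
    then obtain Y0 where Y0: "\<And>y. y \<ge> Y0 \<Longrightarrow> \<bar>L\<bar> / 2 < \<bar>F y\<bar>" by (auto simp: eventually_at_top_linorder)
    define Y where "Y = max Y0 1"
    have Fa: "integrable lborel (\<lambda>y. \<bar>indicator {0<..} y *\<^sub>R F y\<bar>)"
      using Fi by (auto simp: set_integrable_def)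
    have le: "real n * (\<bar>L\<bar> / 2) \<le> (LINT y|lborel. \<bar>indicator {0<..} y *\<^sub>R F y\<bar>)" for n :: nat
    proof -
      have "real n * (\<bar>L\<bar> / 2) = (LINT y|lborel. indicator {Y..Y + real n} y * (\<bar>L\<bar> / 2))" by simp
      also have "\<dots> \<le> (LINT y|lborel. \<bar>indicator {0<..} y *\<^sub>R F y\<bar>)"
      proof (rule integral_mono[OF _ Fa])
        show "integrable lborel (\<lambda>y. indicat_real {Y..Y + real n} y * (\<bar>L\<bar> / 2))" by simp
        fix y show "indicat_real {Y..Y + real n} y * (\<bar>L\<bar> / 2) \<le> \<bar>indicator {0<..} y *\<^sub>R F y\<bar>"
          using Y0[of y] by (auto simp: indicator_def Y_def)
      qed
      finally show ?thesis .
    qed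
    obtain n :: nat where "(LINT y|lborel. \<bar>indicator {0<..} y *\<^sub>R F y\<bar>) / (\<bar>L\<bar> / 2) < real n"
      using reals_Archimedean2 by blast
    then show False using le[of n] L by (simp add: field_simps)
  qed
  with lim show ?thesis by simp
qed

text \<open>The weak form of the equation for the profile.  The function \<open>- r\<^sup>2\<^sup>s flux(r y) v(y)\<close> has the
  weighted integrand as its derivative; at infinity it tends to 0, and its value at 0 is the
  right-hand side up to the sign.\<close>
lemma profile_identity:
  assumes s: "1 / 2 < s" "s < 1" and r: "r > 0"
    and v: "\<And>y. y > 0 \<Longrightarrow> (v has_real_derivative v' y) (at y)" "\<And>y. y > 0 \<Longrightarrow> isCont v' y"
    and v0: "(v \<longlongrightarrow> v0) (at_right 0)"
    and vm: "v \<in> borel_measurable borel" "v' \<in> borel_measurable borel"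
    and vi: "square_integrable (nu s) v" "square_integrable (nu s) v'"
  shows "integrable (nu s) (\<lambda>y. prof' s r y * v' y + r\<^sup>2 * prof s r y * v y)"
    "(LINT y|nu s. prof' s r y * v' y + r\<^sup>2 * prof s r y * v y) = r powr (2 * s) * kappa s * v0"
proof -
  let ?w = "\<lambda>y. y powr (1 - 2 * s)"
  let ?h = "\<lambda>y. prof' s r y * v' y + r\<^sup>2 * prof s r y * v y"
  let ?f = "\<lambda>y. ?w y * ?h y"
  let ?F = "\<lambda>y. - (r powr (2 * s)) * flux s (r * y) * v y"
  have s': "0 < s" using s by simp
  note sq = square_integrable_prof[OF s r]
  have wp: "?w y * prof' s r y = - (r powr (2 * s)) * flux s (r * y)" if "y > 0" for y
  proof -
    have "?w y * (r * (r * y) powr (2 * s - 1)) = r powr (2 * s)"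
      using r that by (simp add: powr_mult powr_diff field_simps)
    then show ?thesis by (simp add: prof'_def)
  qed
  have hi: "integrable (nu s) ?h"
    using integrable_inner_square_integrable[OF sq(2) vi(2)]
      integrable_mult_right[OF integrable_inner_square_integrable[OF sq(1) vi(1)], of "r\<^sup>2"]
    by (simp add: mult.assoc)
  have hm: "?h \<in> borel_measurable borel" using vm s by auto
  have fi: "set_integrable lborel {0<..} ?f"
    using hi hm by (simp add: integrable_nu_iff)
  have Fi: "set_integrable lborel {0<..} ?F"
  proof -
    have "integrable (nu s) (\<lambda>y. prof' s r y * v y)"
      using integrable_inner_square_integrable[OF sq(2) vi(1)] by simp
    then have "set_integrable lborel {0<..} (\<lambda>y. ?w y * (prof' s r y * v y))"
      using vm s by (subst (asm) integrable_nu_iff) auto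
    then show ?thesis
      by (rule set_integrable_cong[THEN iffD1, rotated 3]) (auto simp: wp mult.assoc[symmetric])
  qed
  have der: "(?F has_real_derivative ?f y) (at y)" if y: "y > 0" for y
  proof -
    have "(flux s has_real_derivative - ((r * y) powr (1 - 2 * s) * theta s (r * y))) (at (r * y))"
      by (rule flux_deriv) (use s r y in auto)
    then have fl: "((\<lambda>y. flux s (r * y)) has_real_derivative - ((r * y) powr (1 - 2 * s) * theta s (r * y)) * r) (at y)"
      by (intro DERIV_chain2) (auto intro!: derivative_eq_intros)
    have rr: "r powr (2 * s) * ((r * y) powr (1 - 2 * s) * r) = r\<^sup>2 * ?w y"
      using r y by (simp add: powr_mult powr_diff field_simps power2_eq_square)
    have "(?F has_real_derivative - (r powr (2 * s)) * (- ((r * y) powr (1 - 2 * s) * theta s (r * y)) * r) * v y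
       + - (r powr (2 * s)) * flux s (r * y) * v' y) (at y)"
      by (rule derivative_eq_intros fl v(1)[OF y] refl)+ simp
    moreover have "- (r powr (2 * s)) * (- ((r * y) powr (1 - 2 * s) * theta s (r * y)) * r) * v y
       + - (r powr (2 * s)) * flux s (r * y) * v' y = ?f y"
    proof -
      have "- (r powr (2 * s)) * (- ((r * y) powr (1 - 2 * s) * theta s (r * y)) * r) * v y
        = r powr (2 * s) * ((r * y) powr (1 - 2 * s) * r) * theta s (r * y) * v y" by simp
      then show ?thesis unfolding rr using wp[OF y] by (simp add: prof_def distrib_left mult.assoc[symmetric] mult.commute[of "r\<^sup>2"])
    qed
    ultimately show ?thesis by simp
  qed
  have cont: "isCont ?f y" if y: "y > 0" for y
    using v(1)[OF y, THEN DERIV_isCont] v(2)[OF y] isCont_prof'[OF s' s(2) r y] isCont_prof[OF s', where r = r and y = y] y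
    by (intro continuous_intros) auto
  have B: "(?F \<longlongrightarrow> 0) at_top" by (rule tendsto_0_at_top_if_integrable[OF der cont fi Fi])
  have A: "(?F \<longlongrightarrow> - (r powr (2 * s)) * kappa s * v0) (at_right 0)"
  proof -
    have "isCont (flux s) 0" using continuous_flux[OF s' s(2)] by (simp add: continuous_on_eq_continuous_at)
    then have "(flux s \<longlongrightarrow> kappa s) (at 0)" using flux_0[OF s(2)] by (simp add: isCont_def)
    moreover have "filterlim (\<lambda>y. r * y) (at 0) (at_right 0)"
      using r by (auto simp: filterlim_at eventually_at_filter intro!: tendsto_eq_intros)
    ultimately have "((\<lambda>y. flux s (r * y)) \<longlongrightarrow> kappa s) (at_right 0)" by (rule filterlim_compose)
    then show ?thesis by (intro tendsto_intros v0)
  qed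
  have "(LBINT y=0..\<infinity>. ?f y) = 0 - (- (r powr (2 * s)) * kappa s * v0)"
  proof (rule interval_integral_FTC_integrable)
    show "(?F has_vector_derivative ?f y) (at y)" if "0 < ereal y" for y
      using der[of y] that by (simp add: has_real_derivative_iff_has_vector_derivative)
    show "isCont ?f y" if "0 < ereal y" for y using cont[of y] that by simp
    show "set_integrable lborel (einterval 0 \<infinity>) ?f" using fi by (simp add: einterval_def greaterThan_def)
    show "((?F \<circ> real_of_ereal) \<longlongrightarrow> - (r powr (2 * s)) * kappa s * v0) (at_right 0)"
      using A by (simp add: zero_ereal_def ereal_tendsto_simps)
    show "((?F \<circ> real_of_ereal) \<longlongrightarrow> 0) (at_left \<infinity>)"
      using B by (simp add: ereal_tendsto_simps)
  qed auto
  moreover have "(LBINT y=0..\<infinity>. ?f y) = (LINT y:{0<..}|lborel. ?f y)"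
    by (simp add: interval_lebesgue_integral_def einterval_def greaterThan_def)
  ultimately show "(LINT y|nu s. ?h y) = r powr (2 * s) * kappa s * v0"
    using integral_nu[OF hm, of s] by simp
  show "integrable (nu s) ?h" by (rule hi)
qed

section \<open>Integrals over the periodic cell\<close>

lemma mem_cube: "x \<in> cube \<longleftrightarrow> (\<forall>i. - pi < x $ i \<and> x $ i < pi)"
  by (auto simp: cube_def mem_box_cart)

lemma sets_cube [measurable]: "cube \<in> sets borel"
  by (simp add: cube_def)

lemma space_cell: "space cell = cube"
  by (simp add: cell_def space_restrict_space)

lemma measurable_cell: "f \<in> borel_measurable borel \<Longrightarrow> f \<in> borel_measurable cell"
  by (auto simp: cell_def intro: measurable_restrict_space1)

lemma measure_cell: "measure cell (space cell) = (2 * pi) ^ 3"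
proof -
  have "measure cell (space cell) = measure lborel cube"
    by (simp add: space_cell cell_def measure_restrict_space)
  also have "\<dots> = (\<Prod>b\<in>(Basis :: (real^3) set). (vec pi - vec (- pi)) \<bullet> b)"
    unfolding cube_def measure_lborel_box_eq
    by (simp add: Basis_vec_def inner_axis)
  also have "\<dots> = (\<Prod>b\<in>(Basis :: (real^3) set). 2 * pi)"
    by (rule prod.cong) (auto simp: Basis_vec_def inner_axis)
  finally show ?thesis by simp
qed

lemma finite_measure_cell: "finite_measure cell"
proof
  have "emeasure cell (space cell) = emeasure lborel cube"
    by (simp add: space_cell cell_def emeasure_restrict_space)
  then show "emeasure cell (space cell) \<noteq> \<infinity>" using emeasure_lborel_box_finite[of "vec (- pi) :: real^3" "vec pi"]
    by (simp add: cube_def less_top)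
qed

interpretation cell: finite_measure cell by (rule finite_measure_cell)

lemma integral_cell: "integral\<^sup>L cell f = (LINT x:cube|lborel. f x)" for f :: "_ \<Rightarrow> 'b::{banach, second_countable_topology}"
  unfolding cell_def set_lebesgue_integral_def by (subst integral_restrict_space) auto

lemma integrable_cell_iff: "integrable cell f \<longleftrightarrow> set_integrable lborel cube f" for f :: "_ \<Rightarrow> 'b::{banach, second_countable_topology}"
  unfolding cell_def set_integrable_def by (subst integrable_restrict_space) auto

lemma cell_integrable_bounded:
  fixes f :: "real^3 \<Rightarrow> real"
  assumes "f \<in> borel_measurable cell" "\<And>x. x \<in> cube \<Longrightarrow> \<bar>f x\<bar> \<le> B"
  shows "integrable cell f"
  by (rule cell.integrable_const_bound[where B = B]) (use assms in \<open>auto intro!: AE_I2 simp: space_cell\<close>)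

lemma AE_lborel_hyperplane: "AE x in lborel. (x :: real^3) $ i \<noteq> c"
proof -
  have "{x :: real^3. x $ i = c} \<in> null_sets (completion lborel)"
    using negligible_standard_hyperplane[of "axis i (1::real)" c]
    by (simp add: negligible_iff_null_sets inner_axis Basis_vec_def) blast
  moreover have "{x :: real^3. x $ i = c} \<in> sets lborel" by simp
  ultimately have "{x :: real^3. x $ i = c} \<in> null_sets lborel" by (simp add: null_sets_completion_iff)
  from AE_not_in[OF this] show ?thesis by simp
qed

lemma lborel_integral_translate:
  fixes f :: "real^3 \<Rightarrow> real"
  assumes [measurable]: "f \<in> borel_measurable borel"
  shows "(LINT x|lborel. f (c + x)) = (LINT x|lborel. f x)"
  using integral_distr[where g = "(+) c" and M = lborel and N = borel and f = f] by (simp add: lborel_distr_plus)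

lemma set_integrable_continuous_bounded:
  fixes F :: "real^3 \<Rightarrow> real"
  assumes F: "continuous_on UNIV F" and S: "S \<in> sets borel" "bounded S"
  shows "set_integrable lborel S F"
proof -
  obtain a where "S \<subseteq> cbox (- a) a" using bounded_subset_cbox_symmetric[OF S(2)] by blast
  moreover have "set_integrable lborel (cbox (- a) a) F"
    using F by (intro borel_integrable_compact[of "cbox (- a) a" F, folded set_integrable_def]) (auto intro: continuous_on_subset simp: set_integrable_def)
  ultimately show ?thesis using S by (intro set_integrable_subset[of lborel "cbox (- a) a" F S]) auto
qed

text \<open>Translating the cube in a coordinate direction moves a slab out on one side, and
  periodicity moves that slab back in on the other side.\<close>
lemma integral_cell_shift:
  fixes F :: "real^3 \<Rightarrow> real"
  assumes F: "continuous_on UNIV F" and per: "\<And>x. F (x + (2 * pi) *\<^sub>R axis i 1) = F x"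
    and h: "0 \<le> h" "h \<le> 2 * pi"
  shows "(LINT x|cell. F (x + h *\<^sub>R axis i 1)) = (LINT x|cell. F x)"
proof -
  let ?e = "axis i 1 :: real^3"
  have [measurable]: "F \<in> borel_measurable borel" using F by (rule borel_measurable_continuous_onI)
  define A where "A = {x \<in> cube. x $ i > - pi + h}"
  define B' where "B' = {x \<in> cube. x $ i < - pi + h}"
  have [measurable]: "A \<in> sets borel" "B' \<in> sets borel" by (auto simp: A_def B'_def)
  have bd: "bounded A" "bounded B'" by (auto simp: A_def B'_def cube_def intro: bounded_subset[OF bounded_box])
  have iA: "integrable lborel (\<lambda>x. indicat_real A x * F x)" and iB: "integrable lborel (\<lambda>x. indicat_real B' x * F x)"
    using set_integrable_continuous_bounded[OF F _ bd(1)] set_integrable_continuous_bounded[OF F _ bd(2)]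
    by (auto simp: set_integrable_def)
  have iB2: "integrable lborel (\<lambda>x. indicat_real B' (x - (2 * pi) *\<^sub>R ?e) * F x)"
  proof -
    have "integrable (distr lborel borel ((+) (- ((2 * pi) *\<^sub>R ?e)))) (\<lambda>x. indicat_real B' x * F x)"
      using iB by (simp add: lborel_distr_plus)
    then have "integrable lborel (\<lambda>x. indicat_real B' (x - (2 * pi) *\<^sub>R ?e) * F (x - (2 * pi) *\<^sub>R ?e))"
      by (subst (asm) integrable_distr_eq) auto
    moreover have "F (x - (2 * pi) *\<^sub>R ?e) = F x" for x using per[of "x - (2 * pi) *\<^sub>R ?e"] by simp
    ultimately show ?thesis by simp
  qed
  have "(LINT x|cell. F (x + h *\<^sub>R ?e)) = (LINT x|lborel. indicat_real cube x * F (x + h *\<^sub>R ?e))"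
    by (simp add: integral_cell set_lebesgue_integral_def)
  also have "\<dots> = (LINT x|lborel. indicat_real cube (x - h *\<^sub>R ?e) * F x)"
    using lborel_integral_translate[of "\<lambda>x. indicat_real cube (x - h *\<^sub>R ?e) * F x" "h *\<^sub>R ?e"]
    by (simp add: add.commute)
  also have "\<dots> = (LINT x|lborel. indicat_real A x * F x + indicat_real B' (x - (2 * pi) *\<^sub>R ?e) * F x)"
  proof (rule integral_cong_AE)
    show "AE x in lborel. indicat_real cube (x - h *\<^sub>R ?e) * F x = indicat_real A x * F x + indicat_real B' (x - (2 * pi) *\<^sub>R ?e) * F x"
      using AE_lborel_hyperplane[of i pi]
    proof eventually_elim
      case (elim x)
      have e: "?e $ j = (if j = i then 1 else 0)" for j by (simp add: axis_def)
      have "x - h *\<^sub>R ?e \<in> cube \<longleftrightarrow> (x \<in> A \<and> x - (2 * pi) *\<^sub>R ?e \<notin> B') \<or> (x \<notin> A \<and> x - (2 * pi) *\<^sub>R ?e \<in> B')"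
      proof -
        have sp: "(\<forall>j. P j) \<longleftrightarrow> (\<forall>j. j \<noteq> i \<longrightarrow> P j) \<and> P i" for P :: "3 \<Rightarrow> bool" by metis
        have 1: "x - h *\<^sub>R ?e \<in> cube \<longleftrightarrow> (\<forall>j. j \<noteq> i \<longrightarrow> - pi < x $ j \<and> x $ j < pi) \<and> - pi < x $ i - h \<and> x $ i - h < pi"
          unfolding mem_cube sp[of "\<lambda>j. - pi < (x - h *\<^sub>R ?e) $ j \<and> (x - h *\<^sub>R ?e) $ j < pi"] by (auto simp: e)
        have 2: "x \<in> A \<longleftrightarrow> (\<forall>j. j \<noteq> i \<longrightarrow> - pi < x $ j \<and> x $ j < pi) \<and> - pi + h < x $ i \<and> x $ i < pi"
          unfolding A_def mem_cube mem_Collect_eq sp[of "\<lambda>j. - pi < x $ j \<and> x $ j < pi"] using h by auto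
        have 3: "x - (2 * pi) *\<^sub>R ?e \<in> B' \<longleftrightarrow> (\<forall>j. j \<noteq> i \<longrightarrow> - pi < x $ j \<and> x $ j < pi) \<and> pi < x $ i \<and> x $ i < pi + h"
          unfolding B'_def mem_cube mem_Collect_eq
            sp[of "\<lambda>j. - pi < (x - (2 * pi) *\<^sub>R ?e) $ j \<and> (x - (2 * pi) *\<^sub>R ?e) $ j < pi"]
          using h by (auto simp: e)
        show ?thesis unfolding 1 2 3 using elim h by auto
      qed
      moreover have "\<not> (x \<in> A \<and> x - (2 * pi) *\<^sub>R ?e \<in> B')"
      proof
        assume "x \<in> A \<and> x - (2 * pi) *\<^sub>R ?e \<in> B'"
        then have "x \<in> cube" "x - (2 * pi) *\<^sub>R ?e \<in> cube" by (auto simp: A_def B'_def)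
        then have "x $ i < pi" "- pi < (x - (2 * pi) *\<^sub>R ?e) $ i" unfolding mem_cube by blast+
        then show False by (simp add: e)
      qed
      ultimately show ?case by (auto simp: indicator_def)
    qed
  qed auto
  also have "\<dots> = (LINT x|lborel. indicat_real A x * F x) + (LINT x|lborel. indicat_real B' (x - (2 * pi) *\<^sub>R ?e) * F x)"
    by (rule Bochner_Integration.integral_add[OF iA iB2])
  also have "(LINT x|lborel. indicat_real B' (x - (2 * pi) *\<^sub>R ?e) * F x) = (LINT x|lborel. indicat_real B' x * F x)"
    using lborel_integral_translate[of "\<lambda>x. indicat_real B' (x - (2 * pi) *\<^sub>R ?e) * F x" "(2 * pi) *\<^sub>R ?e"] per
    by (simp add: add.commute)
  also have "(LINT x|lborel. indicat_real A x * F x) + (LINT x|lborel. indicat_real B' x * F x)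
    = (LINT x|lborel. indicat_real A x * F x + indicat_real B' x * F x)"
    by (rule Bochner_Integration.integral_add[OF iA iB, symmetric])
  also have "\<dots> = (LINT x|lborel. indicat_real cube x * F x)"
  proof (rule integral_cong_AE)
    show "AE x in lborel. indicat_real A x * F x + indicat_real B' x * F x = indicat_real cube x * F x"
      using AE_lborel_hyperplane[of i "- pi + h"]
      by eventually_elim (auto simp: A_def B'_def indicator_def)
  qed auto
  also have "\<dots> = (LINT x|cell. F x)" by (simp add: integral_cell set_lebesgue_integral_def)
  finally show ?thesis .
qed

text \<open>The integral of a difference quotient vanishes because the integral over the cell is invariant
  under translations; then the increment tends to 0.\<close>
lemma integral_cell_partial_derivative:
  fixes F D :: "real^3 \<Rightarrow> real"
  assumes F: "continuous_on UNIV F" and per: "\<And>x. F (x + (2 * pi) *\<^sub>R axis i 1) = F x"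
    and D: "continuous_on UNIV D"
    and der: "\<And>x t. ((\<lambda>t. F (x + t *\<^sub>R axis i 1)) has_real_derivative D (x + t *\<^sub>R axis i 1)) (at t)"
  shows "(LINT x|cell. D x) = 0"
proof -
  let ?e = "axis i 1 :: real^3"
  let ?K = "cbox (vec (- pi)) (vec pi) :: (real^3) set"
  let ?g = "\<lambda>(x, t). D (x + t *\<^sub>R ?e)"
  have [measurable]: "F \<in> borel_measurable borel" "D \<in> borel_measurable borel"
    using F D by (auto intro: borel_measurable_continuous_onI)
  have "compact (?g ` (?K \<times> {0..1}))"
    by (intro compact_continuous_image compact_Times compact_cbox compact_Icc)
      (auto simp: case_prod_beta intro!: continuous_intros continuous_on_compose2[OF D])
  then obtain B where B: "\<And>z. z \<in> ?g ` (?K \<times> {0..1}) \<Longrightarrow> \<bar>z\<bar> \<le> B"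
    using compact_imp_bounded bounded_real by metis
  define q where "q = (\<lambda>n x. (F (x + (1 / real (Suc n)) *\<^sub>R ?e) - F x) / (1 / real (Suc n)))"
  have qb: "\<bar>q n x\<bar> \<le> B" if "x \<in> cube" for n x
  proof -
    let ?h = "1 / real (Suc n)"
    have "\<exists>t>0. t < ?h \<and> F (x + ?h *\<^sub>R ?e) - F (x + 0 *\<^sub>R ?e) = (?h - 0) * D (x + t *\<^sub>R ?e)"
      by (rule MVT2) (use der in auto)
    then obtain t where t: "t > 0" "t < ?h" "F (x + ?h *\<^sub>R ?e) - F x = ?h * D (x + t *\<^sub>R ?e)" by auto
    have "?h \<le> 1" by simp
    then have "t \<le> 1" using t by linarith
    moreover have "x \<in> ?K" using that box_subset_cbox unfolding cube_def by blast
    ultimately have "\<bar>D (x + t *\<^sub>R ?e)\<bar> \<le> B" using t by (intro B) force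
    then show ?thesis unfolding q_def t(3) by simp
  qed
  have qlim: "(\<lambda>n. q n x) \<longlonglongrightarrow> D x" for x
  proof -
    have "((\<lambda>h. (F (x + h *\<^sub>R ?e) - F x) / h) \<longlongrightarrow> D x) (at 0)"
      using der[of x 0] by (simp add: DERIV_def)
    moreover have "filterlim (\<lambda>n. 1 / real (Suc n)) (at 0) sequentially"
      using LIMSEQ_inverse_real_of_nat by (simp add: filterlim_at inverse_eq_divide)
    ultimately show ?thesis unfolding q_def by (rule filterlim_compose)
  qed
  have "(\<lambda>n. LINT x|cell. q n x) \<longlonglongrightarrow> (LINT x|cell. D x)"
  proof (rule integral_dominated_convergence[where w = "\<lambda>_. B"])
    show "AE x in cell. norm (q n x) \<le> B" for n using qb by (intro AE_I2) (auto simp: space_cell)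
  qed (use qlim in \<open>auto simp: q_def intro!: measurable_cell\<close>)
  moreover have "(LINT x|cell. q n x) = 0" for n
  proof -
    have c: "continuous_on UNIV (\<lambda>x. F (x + (1 / real (Suc n)) *\<^sub>R ?e))"
      by (intro continuous_on_compose2[OF F] continuous_intros) auto
    have int: "integrable cell F" "integrable cell (\<lambda>x. F (x + (1 / real (Suc n)) *\<^sub>R ?e))"
      using F c by (auto simp: integrable_cell_iff cube_def intro!: set_integrable_continuous_bounded)
    have "1 / real (Suc n) \<le> 2 * pi"
    proof -
      have "1 / real (Suc n) \<le> 1" by simp
      then show ?thesis using pi_gt3 by linarith
    qed
    then have "(LINT x|cell. F (x + (1 / real (Suc n)) *\<^sub>R ?e)) = (LINT x|cell. F x)"
      by (intro integral_cell_shift[OF F per]) auto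
    then show ?thesis unfolding q_def using int by simp
  qed
  ultimately show ?thesis using LIMSEQ_unique[OF tendsto_const] by fastforce
qed

section \<open>Plane waves on the periodic cell\<close>

text \<open>A free phase covers cosines (\<open>d = 0\<close>) and sines (\<open>d = - pi / 2\<close>) at once, and partial
  derivatives merely shift it by \<open>pi / 2\<close>.\<close>
definition wave :: "int^3 \<Rightarrow> real \<Rightarrow> real^3 \<Rightarrow> real" where
  "wave k d x = cos (freq k \<bullet> x + d)"

lemma abs_wave_le: "\<bar>wave k d x\<bar> \<le> 1"
  by (simp add: wave_def)

lemma continuous_wave: "continuous_on A (wave k d)"
  unfolding wave_def[abs_def] by (intro continuous_intros)

lemma borel_measurable_wave [measurable]: "wave k d \<in> borel_measurable borel"
  by (intro borel_measurable_continuous_onI continuous_wave)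

lemma freq_inner_axis: "freq k \<bullet> axis i c = of_int (k $ i) * c"
  by (simp add: freq_def inner_axis)

lemma wave_shift: "wave k d (x + t *\<^sub>R axis i 1) = wave k (d + t * of_int (k $ i)) x"
  by (simp add: wave_def inner_add_right freq_inner_axis algebra_simps)

lemma wave_add_2pi_int: "wave k (d + (2 * pi) * of_int n) x = wave k d x"
  by (simp add: wave_def cos_add[of "_ + d"] add.assoc[symmetric])

lemma periodic_wave: "wave k d (x + (2 * pi) *\<^sub>R axis i 1) = wave k d x"
  by (simp add: wave_shift wave_add_2pi_int)

lemma wave_deriv:
  "((\<lambda>t. wave k d (x + t *\<^sub>R axis i 1)) has_real_derivative of_int (k $ i) * wave k (d + pi / 2) (x + t *\<^sub>R axis i 1)) (at t)"
proof -
  have "cos (freq k \<bullet> x + (d + pi / 2 + t * of_int (k $ i))) = - sin (freq k \<bullet> x + (d + t * of_int (k $ i)))"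
    using cos_add[of "freq k \<bullet> x + (d + t * of_int (k $ i))" "pi / 2"] by (simp add: algebra_simps)
  then show ?thesis
    unfolding wave_shift unfolding wave_def by (auto intro!: derivative_eq_intros)
qed

lemma integral_wave: "(LINT x|cell. wave k d x) = (if k = 0 then (2 * pi) ^ 3 * cos d else 0)"
proof (cases "k = 0")
  case True
  then have "wave k d x = cos d" for x by (simp add: wave_def freq_def zero_vec_def[symmetric] flip: zero_vec_def)
  then show ?thesis using True measure_cell by simp
next
  case False
  then obtain i where i: "k $ i \<noteq> 0" by (auto simp: vec_eq_iff)
  have "(LINT x|cell. of_int (k $ i) * wave k d x) = 0"
  proof (rule integral_cell_partial_derivative[where F = "wave k (d - pi / 2)" and i = i])
    show "((\<lambda>t. wave k (d - pi / 2) (x + t *\<^sub>R axis i 1)) has_real_derivative of_int (k $ i) * wave k d (x + t *\<^sub>R axis i 1)) (at t)" for x t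
      using wave_deriv[of k "d - pi / 2" x i t] by simp
  qed (auto intro!: continuous_intros continuous_wave periodic_wave)
  then show ?thesis using i False by simp
qed

lemma freq_add: "freq (k + l) = freq k + freq l" and freq_diff: "freq (k - l) = freq k - freq l"
  by (auto simp: freq_def vec_eq_iff)

lemma wave_mult: "wave k d x * wave l e x = (wave (k + l) (d + e) x + wave (k - l) (d - e) x) / 2"
  by (simp add: wave_def freq_add freq_diff inner_add_left inner_diff_left cos_times_cos algebra_simps)

lemma integrable_wave: "integrable cell (wave k d)"
  by (rule cell_integrable_bounded[of _ 1]) (auto intro!: measurable_cell simp: abs_wave_le)

lemma integral_wave_mult:
  "(LINT x|cell. wave k d x * wave l e x) =
    ((if k = - l then (2 * pi) ^ 3 * cos (d + e) else 0) + (if k = l then (2 * pi) ^ 3 * cos (d - e) else 0)) / 2"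
  unfolding wave_mult using integrable_wave
  by (simp add: integral_wave eq_neg_iff_add_eq_0)

section \<open>Minimising a Kirchhoff energy over coefficient sequences\<close>

definition nonlin :: "real \<Rightarrow> real \<Rightarrow> real \<Rightarrow> real" where
  "nonlin lam q t = lam * \<bar>t\<bar> powr (q - 2) * t + \<bar>t\<bar> powr 2 * t"

definition potential :: "real \<Rightarrow> real \<Rightarrow> real \<Rightarrow> real" where
  "potential lam q t = lam / q * \<bar>t\<bar> powr q + \<bar>t\<bar> powr 4 / 4"

text \<open>Convexity of \<open>|t| powr p / p\<close>, in the form of Young's inequality for \<open>|t|\<close> and
  \<open>|s| powr (p - 1)\<close>.\<close>
lemma powr_tangent:
  fixes p s t :: real
  assumes p: "p > 1"
  shows "\<bar>s\<bar> powr p / p + \<bar>s\<bar> powr (p - 2) * s * (t - s) \<le> \<bar>t\<bar> powr p / p"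
proof (cases "s = 0")
  case False
  define p' where "p' = p / (p - 1)"
  have p': "p' > 1" "1 / p + 1 / p' = 1" using p by (auto simp: p'_def field_simps)
  have "\<bar>t\<bar> * (\<bar>s\<bar> powr (p - 1)) \<le> \<bar>t\<bar> powr p / p + (\<bar>s\<bar> powr (p - 1)) powr p' / p'"
    by (rule Youngs_inequality) (use p p' in auto)
  also have "(\<bar>s\<bar> powr (p - 1)) powr p' = \<bar>s\<bar> powr p" using p by (simp add: powr_powr p'_def)
  also have "\<bar>s\<bar> powr p / p' = \<bar>s\<bar> powr p - \<bar>s\<bar> powr p / p"
    using p by (simp add: p'_def field_simps)
  finally have y: "\<bar>t\<bar> * \<bar>s\<bar> powr (p - 1) \<le> \<bar>t\<bar> powr p / p + \<bar>s\<bar> powr p - \<bar>s\<bar> powr p / p" by simp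
  have s1: "\<bar>s\<bar> powr (p - 2) * \<bar>s\<bar> = \<bar>s\<bar> powr (p - 1)"
    using False powr_add[of "\<bar>s\<bar>" "p - 2" 1] by simp
  have s2: "\<bar>s\<bar> powr (p - 2) * s * s = \<bar>s\<bar> powr p"
    using False powr_add[of "\<bar>s\<bar>" "p - 2" 2] by (simp add: powr_numeral power2_eq_square mult.assoc)
  have "\<bar>s\<bar> powr (p - 2) * s * t \<le> \<bar>s\<bar> powr (p - 2) * (\<bar>s\<bar> * \<bar>t\<bar>)"
    using abs_ge_self[of "s * t"] by (simp add: mult.assoc abs_mult mult_left_mono)
  also have "\<dots> = \<bar>t\<bar> * \<bar>s\<bar> powr (p - 1)" by (simp add: s1[symmetric] mult_ac)
  finally show ?thesis using y s2 by (simp add: right_diff_distrib)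
qed (use p in auto)

lemma potential_tangent:
  assumes "lam > 0" "q > 1"
  shows "potential lam q s + nonlin lam q s * (t - s) \<le> potential lam q t"
proof -
  have "lam * (\<bar>s\<bar> powr q / q + \<bar>s\<bar> powr (q - 2) * s * (t - s)) \<le> lam * (\<bar>t\<bar> powr q / q)"
    using powr_tangent[OF assms(2)] assms(1) by (intro mult_left_mono) auto
  moreover have "\<bar>s\<bar> powr 4 / 4 + \<bar>s\<bar> powr 2 * s * (t - s) \<le> \<bar>t\<bar> powr 4 / 4"
    using powr_tangent[of 4 s t] by simp
  ultimately show ?thesis unfolding potential_def nonlin_def by (simp add: algebra_simps)
qed

lemma potential_mono:
  assumes "lam > 0" "q > 1" "\<bar>t\<bar> \<le> u"
  shows "potential lam q t \<le> potential lam q u"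
  unfolding potential_def using assms
  by (intro add_mono mult_left_mono divide_right_mono powr_mono2) auto

lemma potential_nonneg: "lam > 0 \<Longrightarrow> q > 1 \<Longrightarrow> 0 \<le> potential lam q t"
  by (simp add: potential_def)

lemma continuous_potential: "q > 1 \<Longrightarrow> continuous_on UNIV (potential lam q)"
  unfolding potential_def[abs_def] by (intro continuous_intros continuous_on_powr') auto

lemma abs_signed_powr: "q > 1 \<Longrightarrow> \<bar>\<bar>t\<bar> powr (q - 2) * t\<bar> = \<bar>t :: real\<bar> powr (q - 1)"
  using powr_add[of "\<bar>t\<bar>" "q - 2" 1] by (cases "t = 0") (auto simp: abs_mult)

lemma isCont_signed_powr:
  assumes "q > 1"
  shows "isCont (\<lambda>t :: real. \<bar>t\<bar> powr (q - 2) * t) t"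
proof (cases "t = 0")
  case True
  have lim: "((\<lambda>t :: real. \<bar>t\<bar> powr (q - 1)) \<longlongrightarrow> 0) (at 0)"
    using assms tendsto_zero_powrI[of "\<lambda>t::real. \<bar>t\<bar>" "at 0" "\<lambda>_. q - 1" "q - 1"]
    by (auto intro!: tendsto_eq_intros)
  have "((\<lambda>t :: real. \<bar>t\<bar> powr (q - 2) * t) \<longlongrightarrow> 0) (at 0)"
  proof (rule Lim_null_comparison[OF _ lim])
    show "\<forall>\<^sub>F t in at (0::real). norm (\<bar>t\<bar> powr (q - 2) * t) \<le> \<bar>t\<bar> powr (q - 1)"
      using abs_signed_powr[OF assms] by (intro always_eventually allI) (simp only: real_norm_def order_refl)
  qed
  then show ?thesis using True by (simp add: isCont_def)
next
  case False
  then show ?thesis unfolding isCont_def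
    by (intro tendsto_mult tendsto_powr tendsto_rabs tendsto_const tendsto_ident_at) auto
qed

lemma continuous_nonlin:
  assumes "q > 1"
  shows "continuous_on UNIV (nonlin lam q)"
proof -
  have eq: "nonlin lam q = (\<lambda>t. lam * (\<bar>t\<bar> powr (q - 2) * t) + \<bar>t\<bar> powr (4 - 2) * t)"
    by (rule ext) (simp add: nonlin_def)
  have c: "continuous_on UNIV (\<lambda>t :: real. \<bar>t\<bar> powr (r - 2) * t)" if "r > 1" for r
    using isCont_signed_powr[OF that] by (simp add: continuous_on_eq_continuous_at)
  show ?thesis
    unfolding eq using assms by (intro continuous_on_add continuous_on_mult_left c) auto
qed

lemma nonlin_minus: "nonlin lam q (- t) = - nonlin lam q t"
  by (simp add: nonlin_def)

lemma compact_bounded_sequences: "compact {a :: nat \<Rightarrow> real. \<forall>j. a j \<in> {- c j..c j}}"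
proof -
  have "compactin (product_topology (\<lambda>i. euclidean) UNIV) (PiE UNIV (\<lambda>j. {- c j..c j :: real}))"
    by (subst compactin_PiE) (auto simp: compactin_euclidean_iff)
  moreover have "PiE UNIV (\<lambda>j. {- c j..c j}) = {a. \<forall>j. a j \<in> {- c j..c j}}" by (auto simp: PiE_def)
  ultimately show ?thesis by (simp add: euclidean_product_topology compactin_euclidean_iff)
qed

text \<open>The first-order condition at a minimum without a derivative: a linear function below a parabola
  that touches it at 0 has slope 0.\<close>
lemma quadratic_touching_linear:
  fixes c E :: real
  assumes "\<And>t. \<bar>t\<bar> \<le> 1 \<Longrightarrow> t * c \<le> t\<^sup>2 * E"
  shows "c = 0"
proof (rule ccontr)
  assume c: "c \<noteq> 0"
  define \<tau> where "\<tau> = min 1 (\<bar>c\<bar> / (2 * (\<bar>E\<bar> + 1)))"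
  have tau: "0 < \<tau>" "\<tau> \<le> 1" "\<tau> \<le> \<bar>c\<bar> / (2 * (\<bar>E\<bar> + 1))" using c by (auto simp: \<tau>_def)
  have "\<tau> * \<bar>c\<bar> = (\<tau> * sgn c) * c" by (simp add: sgn_if)
  also have "\<dots> \<le> (\<tau> * sgn c)\<^sup>2 * E" using tau by (intro assms) (auto simp: abs_mult sgn_if)
  also have "\<dots> = \<tau> * (\<tau> * E)" using c by (simp add: power_mult_distrib power2_eq_square sgn_if)
  finally have "\<bar>c\<bar> \<le> \<tau> * E" using tau by simp
  also have "\<dots> \<le> \<tau> * (\<bar>E\<bar> + 1)" using tau by (intro mult_left_mono) auto
  also have "\<dots> \<le> \<bar>c\<bar> / 2" using tau(3) by (simp add: field_simps)
  finally show False using c by simp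
qed

text \<open>A coefficient sequence \<open>a\<close> stands for the function \<open>\<Sum>j. a j * e j x\<close>.  The assumption \<open>small\<close>
  is what makes the quartic part of the potential harmless: the square of the function is at most
  \<open>(\<Sum>j. 1 / w j)\<close> times the squared norm \<open>size2 a\<close>, so the integral of a quarter of its fourth
  power does not exceed the term of the energy with the factor \<open>B / 4\<close>.\<close>
locale kirchhoff_energy = finite_measure M for M :: "'a measure" +
  fixes e :: "nat \<Rightarrow> 'a \<Rightarrow> real" and w :: "nat \<Rightarrow> real" and A B lam q :: real
  assumes e_meas [measurable]: "\<And>j. e j \<in> borel_measurable M"
    and e_le: "\<And>j x. \<bar>e j x\<bar> \<le> 1"
    and w_pos: "\<And>j. w j > 0" and w_sum: "summable (\<lambda>j. 1 / w j)"
    and A_pos: "A > 0" and B_pos: "B > 0" and lam_pos: "lam > 0" and q: "1 < q" "q < 2"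
    and small: "measure M (space M) * (\<Sum>j. 1 / w j)\<^sup>2 \<le> B"
    and nontrivial: "(LINT x|M. \<bar>e 0 x\<bar> powr q) > 0"
begin

definition admissible :: "(nat \<Rightarrow> real) \<Rightarrow> bool" where
  "admissible a \<longleftrightarrow> summable (\<lambda>j. w j * (a j)\<^sup>2)"

definition size2 :: "(nat \<Rightarrow> real) \<Rightarrow> real" where
  "size2 a = (\<Sum>j. w j * (a j)\<^sup>2)"

definition series :: "(nat \<Rightarrow> real) \<Rightarrow> 'a \<Rightarrow> real" where
  "series a x = (\<Sum>j. a j * e j x)"

definition energy :: "(nat \<Rightarrow> real) \<Rightarrow> real" where
  "energy a = A / 2 * size2 a + B / 4 * (size2 a)\<^sup>2 - (LINT x|M. potential lam q (series a x))"

abbreviation "S0 \<equiv> (\<Sum>j. 1 / w j)"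

lemma S0_pos: "0 < S0"
  using w_sum w_pos by (intro suminf_pos) auto

lemma size2_nonneg: "admissible a \<Longrightarrow> 0 \<le> size2 a"
  unfolding size2_def admissible_def using w_pos by (intro suminf_nonneg) (auto simp: less_imp_le)

lemma admissible_abs_summable:
  assumes "admissible a"
  shows "summable (\<lambda>j. \<bar>a j\<bar>)"
proof (rule summable_comparison_test'[where N = 0])
  show "summable (\<lambda>j. w j * (a j)\<^sup>2 + 1 / w j)"
    using assms w_sum unfolding admissible_def by (rule summable_add)
  fix j
  have "0 \<le> (w j * \<bar>a j\<bar> - 1)\<^sup>2" by simp
  then have "2 * (w j * \<bar>a j\<bar>) \<le> w j * (w j * (a j)\<^sup>2) + 1" by (simp add: power2_eq_square algebra_simps)
  then have "2 * \<bar>a j\<bar> \<le> w j * (a j)\<^sup>2 + 1 / w j" using w_pos[of j] by (simp add: field_simps)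
  then show "norm \<bar>a j\<bar> \<le> w j * (a j)\<^sup>2 + 1 / w j" by simp
qed

text \<open>Cauchy-Schwarz for \<open>(1 / sqrt (w j)) * (sqrt (w j) * |a j|)\<close>.  The bound is uniform on sets of
  bounded \<open>size2\<close>, which is the source of all compactness below.\<close>
lemma tail_bound:
  assumes "admissible a"
  shows "(\<Sum>j. \<bar>a (j + K)\<bar>) \<le> sqrt ((\<Sum>j. 1 / w (j + K)) * size2 a)"
proof (rule suminf_le_const)
  show "summable (\<lambda>j. \<bar>a (j + K)\<bar>)" using admissible_abs_summable[OF assms] by (simp add: summable_iff_shift[of "\<lambda>j. \<bar>a j\<bar>"])
  fix n
  have "(\<Sum>j<n. \<bar>a (j + K)\<bar>)\<^sup>2 = (\<Sum>j<n. (1 / sqrt (w (j + K))) * (sqrt (w (j + K)) * \<bar>a (j + K)\<bar>))\<^sup>2"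
    using w_pos by (intro arg_cong[where f = "\<lambda>x. x\<^sup>2"] sum.cong) (auto simp: less_imp_neq[symmetric])
  also have "\<dots> \<le> (\<Sum>j<n. (1 / sqrt (w (j + K)))\<^sup>2) * (\<Sum>j<n. (sqrt (w (j + K)) * \<bar>a (j + K)\<bar>)\<^sup>2)"
    by (rule Cauchy_Schwarz_ineq_sum)
  also have "\<dots> = (\<Sum>j<n. 1 / w (j + K)) * (\<Sum>j<n. w (j + K) * (a (j + K))\<^sup>2)"
    using w_pos by (simp add: power_mult_distrib power_divide less_imp_le)
  also have "\<dots> \<le> (\<Sum>j. 1 / w (j + K)) * size2 a"
  proof (rule mult_mono)
    show "(\<Sum>j<n. 1 / w (j + K)) \<le> (\<Sum>j. 1 / w (j + K))"
      using w_sum w_pos by (intro sum_le_suminf) (auto simp: less_imp_le summable_iff_shift[of "\<lambda>j. 1 / w j"])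
    have "(\<Sum>j<n. w (j + K) * (a (j + K))\<^sup>2) = (\<Sum>j\<in>{K..<n + K}. w j * (a j)\<^sup>2)"
      using sum.shift_bounds_nat_ivl[of "\<lambda>j. w j * (a j)\<^sup>2" 0 K n] by (simp add: lessThan_atLeast0)
    also have "\<dots> \<le> size2 a"
      unfolding size2_def using assms w_pos unfolding admissible_def
      by (intro sum_le_suminf) (auto simp: less_imp_le)
    finally show "(\<Sum>j<n. w (j + K) * (a (j + K))\<^sup>2) \<le> size2 a" .
    show "0 \<le> (\<Sum>j. 1 / w (j + K))"
      using w_sum w_pos by (intro suminf_nonneg) (auto simp: less_imp_le summable_iff_shift[of "\<lambda>j. 1 / w j"])
    show "0 \<le> (\<Sum>j<n. w (j + K) * (a (j + K))\<^sup>2)" using w_pos by (intro sum_nonneg) (auto simp: less_imp_le)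
  qed
  finally show "(\<Sum>j<n. \<bar>a (j + K)\<bar>) \<le> sqrt ((\<Sum>j. 1 / w (j + K)) * size2 a)"
    by (rule real_le_rsqrt)
qed

lemma series_summable:
  assumes "admissible a"
  shows "summable (\<lambda>j. \<bar>a j * e j x\<bar>)" "summable (\<lambda>j. a j * e j x)"
proof -
  show "summable (\<lambda>j. \<bar>a j * e j x\<bar>)"
    using e_le by (intro summable_comparison_test'[OF admissible_abs_summable[OF assms], of 0])
      (auto simp: abs_mult intro: mult_left_le)
  then show "summable (\<lambda>j. a j * e j x)" by (rule summable_rabs_cancel)
qed

lemma series_tail:
  assumes "admissible a"
  shows "\<bar>series a x - (\<Sum>j<K. a j * e j x)\<bar> \<le> sqrt ((\<Sum>j. 1 / w (j + K)) * size2 a)"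
proof -
  have "series a x - (\<Sum>j<K. a j * e j x) = (\<Sum>j. a (j + K) * e (j + K) x)"
    unfolding series_def using suminf_minus_initial_segment[OF series_summable(2)[OF assms]] by simp
  also have "\<bar>\<dots>\<bar> \<le> (\<Sum>j. \<bar>a (j + K) * e (j + K) x\<bar>)"
    using series_summable(1)[OF assms, of x] by (intro summable_rabs) (simp add: summable_iff_shift[of "\<lambda>j. \<bar>a j * e j x\<bar>"])
  also have "\<dots> \<le> (\<Sum>j. \<bar>a (j + K)\<bar>)"
  proof (rule suminf_le)
    show "\<bar>a (j + K) * e (j + K) x\<bar> \<le> \<bar>a (j + K)\<bar>" for j
      using e_le by (auto simp: abs_mult intro: mult_left_le)
  qed (intro summable_ignore_initial_segment[of "\<lambda>j. \<bar>a j * e j x\<bar>"]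
      summable_ignore_initial_segment[of "\<lambda>j. \<bar>a j\<bar>"] series_summable admissible_abs_summable assms)+
  also note tail_bound[OF assms]
  finally show ?thesis .
qed

lemma series_bound:
  assumes "admissible a"
  shows "\<bar>series a x\<bar> \<le> sqrt (S0 * size2 a)"
  using series_tail[OF assms, of x 0] by simp

lemma series_measurable [measurable]: "series a \<in> borel_measurable M"
  unfolding series_def[abs_def]
  by (intro borel_measurable_suminf borel_measurable_times borel_measurable_const e_meas)

lemma potential_measurable [measurable]: "potential lam q \<in> borel_measurable borel"
  by (intro borel_measurable_continuous_onI continuous_potential q)

lemma nonlin_measurable [measurable]: "nonlin lam q \<in> borel_measurable borel"
  by (intro borel_measurable_continuous_onI continuous_nonlin q)

lemma integrable_potential:
  assumes [measurable]: "f \<in> borel_measurable M" and f: "\<And>x. \<bar>f x\<bar> \<le> u"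
  shows "integrable M (\<lambda>x. potential lam q (f x))"
proof (rule integrable_const_bound[where B = "potential lam q u"])
  show "AE x in M. norm (potential lam q (f x)) \<le> potential lam q u"
    using potential_mono[OF lam_pos q(1) f]
    by (intro AE_I2) (simp add: abs_of_nonneg[OF potential_nonneg[OF lam_pos q(1)]])
qed measurable

lemma integral_potential_le:
  assumes [measurable]: "f \<in> borel_measurable M" and f: "\<And>x. \<bar>f x\<bar> \<le> u"
  shows "(LINT x|M. potential lam q (f x)) \<le> measure M (space M) * potential lam q u"
proof -
  have "(LINT x|M. potential lam q (f x)) \<le> (LINT x|M. potential lam q u)"
    using potential_mono[OF lam_pos q(1) f] by (intro integral_mono integrable_potential[OF assms(1) f]) auto
  then show ?thesis by simp
qed

text \<open>The constant in front of \<open>size2 a powr (q / 2)\<close> that results from inserting the uniform bound on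
  the function into the part of the potential with the exponent \<open>q\<close>.\<close>
definition "Cq = lam / q * measure M (space M) * S0 powr (q / 2)"

lemma Cq_nonneg: "0 \<le> Cq"
  unfolding Cq_def using lam_pos q by simp

lemma energy_lower_bound:
  assumes "admissible a"
  shows "A / 2 * size2 a - Cq * size2 a powr (q / 2) \<le> energy a"
proof -
  let ?N = "size2 a"
  have N: "0 \<le> ?N" by (rule size2_nonneg[OF assms])
  have SN: "0 \<le> S0 * ?N" using N S0_pos by simp
  have "(LINT x|M. potential lam q (series a x)) \<le> measure M (space M) * potential lam q (sqrt (S0 * ?N))"
    by (rule integral_potential_le[OF series_measurable series_bound[OF assms]])
  also have "potential lam q (sqrt (S0 * ?N)) = lam / q * (S0 powr (q / 2) * ?N powr (q / 2)) + (S0 * ?N)\<^sup>2 / 4"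
  proof -
    have "sqrt (S0 * ?N) powr r = (S0 * ?N) powr (r / 2)" for r
      using SN by (simp add: powr_half_sqrt[symmetric] powr_powr)
    moreover have "(S0 * ?N) powr 2 = (S0 * ?N)\<^sup>2"
      using SN by (cases "S0 * ?N = 0") (auto simp: powr_numeral)
    moreover have "(S0 * ?N) powr (q / 2) = S0 powr (q / 2) * ?N powr (q / 2)" using N S0_pos by (simp add: powr_mult)
    ultimately show ?thesis using SN by (simp add: potential_def)
  qed
  also have "measure M (space M) * (lam / q * (S0 powr (q / 2) * ?N powr (q / 2)) + (S0 * ?N)\<^sup>2 / 4)
    = Cq * ?N powr (q / 2) + (measure M (space M) * S0\<^sup>2) * ?N\<^sup>2 / 4"
    by (simp add: Cq_def algebra_simps)
  also have "\<dots> \<le> Cq * ?N powr (q / 2) + B * ?N\<^sup>2 / 4"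
    using mult_right_mono[OF small, of "?N\<^sup>2"] by simp
  finally show ?thesis unfolding energy_def by simp
qed

text \<open>The lower bound of the energy is positive as soon as \<open>size2 a\<close> exceeds this number.\<close>
definition "Rmax = (2 * Cq / A) powr (2 / (2 - q))"

lemma size2_le_if_energy_neg:
  assumes a: "admissible a" and neg: "energy a \<le> 0"
  shows "size2 a \<le> Rmax"
proof (rule ccontr)
  let ?N = "size2 a"
  assume "\<not> ?thesis"
  then have N: "Rmax < ?N" by simp
  have N0: "0 < ?N" using N powr_ge_zero[of "2 * Cq / A" "2 / (2 - q)"] unfolding Rmax_def by linarith
  have "2 * Cq / A = Rmax powr (1 - q / 2)"
  proof -
    have "2 / (2 - q) * (1 - q / 2) = 1" using q by (simp add: field_simps)
    then show ?thesis unfolding Rmax_def using Cq_nonneg A_pos by (simp add: powr_powr)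
  qed
  also have "\<dots> < ?N powr (1 - q / 2)"
    using N q by (intro powr_less_mono2) (auto simp: Rmax_def)
  finally have "Cq < A / 2 * ?N powr (1 - q / 2)" using A_pos by (simp add: field_simps)
  then have "Cq * ?N powr (q / 2) < A / 2 * ?N powr (1 - q / 2) * ?N powr (q / 2)"
    using N0 by (intro mult_strict_right_mono) auto
  also have "\<dots> = A / 2 * ?N" using N0 by (simp add: mult.assoc powr_add[symmetric])
  finally show False using energy_lower_bound[OF a] neg by simp
qed

lemma energy_bounded_below:
  assumes a: "admissible a"
  shows "- (Cq * Rmax powr (q / 2)) \<le> energy a"
proof (cases "energy a \<le> 0")
  case True
  have "size2 a powr (q / 2) \<le> Rmax powr (q / 2)"
    using size2_le_if_energy_neg[OF a True] size2_nonneg[OF a] q by (intro powr_mono2) auto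
  then have "Cq * size2 a powr (q / 2) \<le> Cq * Rmax powr (q / 2)" using Cq_nonneg by (rule mult_left_mono)
  moreover have "0 \<le> A / 2 * size2 a" using A_pos size2_nonneg[OF a] by simp
  ultimately show ?thesis using energy_lower_bound[OF a] by linarith
next
  case False
  have "0 \<le> Cq * Rmax powr (q / 2)" using Cq_nonneg by simp
  then show ?thesis using False by linarith
qed

lemma perturb:
  fixes j :: nat
  assumes a: "admissible a"
  defines "a' \<equiv> \<lambda>t i. a i + (if i = j then t else 0)"
  shows "admissible (a' t)" "size2 (a' t) = size2 a + 2 * t * (w j * a j) + t\<^sup>2 * w j"
    "series (a' t) x = series a x + t * e j x"
proof -
  have s1: "(\<lambda>i. w i * (a' t i)\<^sup>2) sums (size2 a + (2 * t * (w j * a j) + t\<^sup>2 * w j))"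
  proof -
    have "(\<lambda>i. w i * (a i)\<^sup>2 + (if i = j then 2 * t * (w j * a j) + t\<^sup>2 * w j else 0)) sums (size2 a + (2 * t * (w j * a j) + t\<^sup>2 * w j))"
      using a unfolding size2_def admissible_def
      by (intro sums_add summable_sums sums_single) auto
    moreover have "w i * (a' t i)\<^sup>2 = w i * (a i)\<^sup>2 + (if i = j then 2 * t * (w j * a j) + t\<^sup>2 * w j else 0)" for i
      by (auto simp: a'_def power2_eq_square algebra_simps)
    ultimately show ?thesis by simp
  qed
  then show "admissible (a' t)" by (auto simp: admissible_def sums_iff)
  show "size2 (a' t) = size2 a + 2 * t * (w j * a j) + t\<^sup>2 * w j"
    using s1 by (simp add: size2_def sums_iff)
  have "(\<lambda>i. a i * e i x + (if i = j then t * e j x else 0)) sums (series a x + t * e j x)"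
    using series_summable(2)[OF a] unfolding series_def by (intro sums_add summable_sums sums_single) auto
  moreover have "a' t i * e i x = a i * e i x + (if i = j then t * e j x else 0)" for i
    by (auto simp: a'_def algebra_simps)
  ultimately show "series (a' t) x = series a x + t * e j x" by (simp add: series_def sums_iff)
qed

text \<open>At \<open>t\<close> times the first basis function the energy is at most a multiple of \<open>t\<^sup>2\<close> minus a multiple
  of \<open>t powr q\<close>, and \<open>q < 2\<close>.\<close>
lemma energy_negative_somewhere: "\<exists>a. admissible a \<and> energy a < 0"
proof -
  define c where "c = (LINT x|M. \<bar>e 0 x\<bar> powr q)"
  define D where "D = A / 2 * w 0 + B / 4 * (w 0)\<^sup>2"
  have D: "D > 0" using A_pos B_pos w_pos[of 0] by (auto simp: D_def intro!: add_pos_pos)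
  have c: "c > 0" using nontrivial by (simp add: c_def)
  define d where "d = lam / q * c / D"
  have d: "d > 0" using lam_pos q c D by (simp add: d_def)
  \<comment> \<open>The bound 1 allows \<open>t\<^sup>4 \<le> t\<^sup>2\<close>; the other bound gives \<open>t powr (2 - q) \<le> d / 2 < d\<close>.\<close>
  define t where "t = min 1 ((d / 2) powr (1 / (2 - q)))"
  have t: "0 < t" "t \<le> 1" "t \<le> (d / 2) powr (1 / (2 - q))" using d by (auto simp: t_def)
  have "t powr (2 - q) \<le> ((d / 2) powr (1 / (2 - q))) powr (2 - q)" using t q by (intro powr_mono2) auto
  also have "\<dots> = d / 2" using q d by (simp add: powr_powr)
  finally have td: "t powr (2 - q) < d" using d by simp
  have a0: "admissible (\<lambda>_. 0)" by (simp add: admissible_def)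
  let ?a = "\<lambda>i. 0 + (if i = 0 then t else 0)"
  have s0: "size2 (\<lambda>_. 0) = 0" "series (\<lambda>_. 0) = (\<lambda>x. 0)" by (auto simp: size2_def series_def)
  note p = perturb[OF a0, where t = t and j = 0, unfolded s0]
  have ad: "admissible ?a" using p(1) by simp
  have N: "size2 ?a = t\<^sup>2 * w 0" using p(2) by simp
  have f: "series ?a x = t * e 0 x" for x using p(3) by simp
  have ei: "integrable M (\<lambda>x. \<bar>e 0 x\<bar> powr q)"
    by (rule integrable_const_bound[where B = 1]) (use e_le q in \<open>auto intro!: powr_le1\<close>)
  have "lam / q * t powr q * c = (LINT x|M. lam / q * t powr q * \<bar>e 0 x\<bar> powr q)" by (simp add: c_def)
  also have "\<dots> \<le> (LINT x|M. potential lam q (series ?a x))"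
  proof (rule integral_mono)
    show "integrable M (\<lambda>x. potential lam q (series ?a x))"
      by (rule integrable_potential[OF series_measurable series_bound[OF ad]])
    show "lam / q * t powr q * \<bar>e 0 x\<bar> powr q \<le> potential lam q (series ?a x)" for x
      unfolding f potential_def using t by (simp add: abs_mult powr_mult mult.assoc)
  qed (use ei in simp)
  finally have G: "lam / q * t powr q * c \<le> (LINT x|M. potential lam q (series ?a x))" .
  have "energy ?a \<le> A / 2 * (t\<^sup>2 * w 0) + B / 4 * (t\<^sup>2 * w 0)\<^sup>2 - lam / q * t powr q * c"
    unfolding energy_def N using G by simp
  also have "\<dots> \<le> t\<^sup>2 * D - lam / q * t powr q * c"
  proof -
    have "t^4 \<le> t\<^sup>2" using t by (intro power_decreasing) auto
    then have "B / 4 * (w 0)\<^sup>2 * t^4 \<le> B / 4 * (w 0)\<^sup>2 * t\<^sup>2" using B_pos by (intro mult_left_mono) auto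
    then show ?thesis by (simp add: D_def power_mult_distrib algebra_simps)
  qed
  also have "\<dots> = D * t powr q * (t powr (2 - q) - d)"
  proof -
    have "t powr q * t powr (2 - q) = t\<^sup>2" using t by (simp add: powr_add[symmetric] powr_numeral)
    then have "D * t powr q * (t powr (2 - q) - d) = D * t\<^sup>2 - t powr q * (D * d)" by (simp add: algebra_simps)
    also have "D * d = lam / q * c" using D by (simp add: d_def)
    finally show ?thesis by (simp add: mult_ac)
  qed
  also have "\<dots> < 0" using D t td by (simp add: mult_pos_neg)
  finally show ?thesis using ad by blast
qed

text \<open>Convergence of each coefficient suffices because the tails of the series are uniformly small.\<close>
lemma series_tendsto:
  assumes an: "\<And>n. admissible (an n)" "\<And>n. size2 (an n) \<le> R" and a: "admissible a" "size2 a \<le> R"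
    and lim: "\<And>j. (\<lambda>n. an n j) \<longlonglongrightarrow> a j"
  shows "(\<lambda>n. series (an n) x) \<longlonglongrightarrow> series a x"
proof (rule LIMSEQ_I)
  fix \<epsilon> :: real assume eps: "\<epsilon> > 0"
  have "(\<lambda>K. sqrt ((\<Sum>j. 1 / w (j + K)) * R)) \<longlonglongrightarrow> sqrt (0 * R)"
    using suminf_exist_split2[OF w_sum] by (intro tendsto_intros)
  then have "\<forall>\<^sub>F K in sequentially. sqrt ((\<Sum>j. 1 / w (j + K)) * R) < \<epsilon> / 3"
    using eps by (intro order_tendstoD) auto
  then obtain K where K: "sqrt ((\<Sum>j. 1 / w (j + K)) * R) < \<epsilon> / 3"
    using eventually_happens by fastforce
  have tail: "\<bar>series b x - (\<Sum>j<K. b j * e j x)\<bar> < \<epsilon> / 3" if "admissible b" "size2 b \<le> R" for b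
  proof -
    have "0 \<le> (\<Sum>j. 1 / w (j + K))"
      using w_sum w_pos by (intro suminf_nonneg) (auto simp: less_imp_le summable_iff_shift[of "\<lambda>j. 1 / w j"])
    then have "sqrt ((\<Sum>j. 1 / w (j + K)) * size2 b) \<le> sqrt ((\<Sum>j. 1 / w (j + K)) * R)"
      using that by (intro real_sqrt_le_mono mult_left_mono)
    then show ?thesis using series_tail[OF that(1), of x K] K by linarith
  qed
  have "(\<lambda>n. \<Sum>j<K. an n j * e j x) \<longlonglongrightarrow> (\<Sum>j<K. a j * e j x)"
    by (intro tendsto_intros lim)
  then obtain n0 where n0: "\<And>n. n \<ge> n0 \<Longrightarrow> \<bar>(\<Sum>j<K. an n j * e j x) - (\<Sum>j<K. a j * e j x)\<bar> < \<epsilon> / 3"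
    using LIMSEQ_D[of _ _ "\<epsilon> / 3"] eps by fastforce
  show "\<exists>n0. \<forall>n\<ge>n0. norm (series (an n) x - series a x) < \<epsilon>"
  proof (intro exI allI impI)
    fix n assume "n \<ge> n0"
    then show "norm (series (an n) x - series a x) < \<epsilon>"
      using n0[of n] tail[OF an(1) an(2), of n] tail[OF a] unfolding real_norm_def by linarith
  qed
qed

text \<open>The direct method for the convergence of each coefficient.  A minimising sequence stays in a
  product of compact intervals.  Along it the potential part of the energy is continuous, by
  dominated convergence, whereas \<open>size2\<close> is only lower semicontinuous: its partial sums converge,
  and they are below the full sums.\<close>
theorem minimiser_exists:
  obtains a where "admissible a" "energy a < 0" "\<And>b. admissible b \<Longrightarrow> energy a \<le> energy b"
proof -
  define m where "m = Inf {energy a | a. admissible a}"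
  have bdd: "bdd_below {energy a | a. admissible a}"
    using energy_bounded_below by (intro bdd_belowI) auto
  obtain a0 where a0: "admissible a0" "energy a0 < 0" using energy_negative_somewhere by blast
  have m_le: "m \<le> energy a" if "admissible a" for a
    unfolding m_def using bdd that by (intro cInf_lower) auto
  have m_neg: "m < 0" using m_le[OF a0(1)] a0(2) by simp
  have "\<exists>a. admissible a \<and> energy a < min (m + 1 / Suc n) 0" for n
  proof -
    have "m < min (m + 1 / Suc n) 0" using m_neg by simp
    then obtain z where "z \<in> {energy a | a. admissible a}" "z < min (m + 1 / Suc n) 0"
      unfolding m_def using cInf_lessD[of "{energy a | a. admissible a}"] a0 by blast
    then show ?thesis by blast
  qed
  then obtain an where an: "\<And>n. admissible (an n)" "\<And>n. energy (an n) < min (m + 1 / Suc n) 0" by metis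
  have R: "size2 (an n) \<le> Rmax" for n
    using an by (intro size2_le_if_energy_neg) (auto simp: less_imp_le)
  have "an n j \<in> {- sqrt (Rmax / w j)..sqrt (Rmax / w j)}" for n j
  proof -
    have "w j * (an n j)\<^sup>2 \<le> size2 (an n)"
      unfolding size2_def using sum_le_suminf[of "\<lambda>j. w j * (an n j)\<^sup>2" "{j}"] an(1)[of n] w_pos
      by (auto simp: admissible_def less_imp_le)
    then have "(an n j)\<^sup>2 \<le> Rmax / w j" using R[of n] w_pos[of j] by (simp add: field_simps)
    then have "\<bar>an n j\<bar> \<le> sqrt (Rmax / w j)" by (rule real_le_rsqrt[of "\<bar>an n j\<bar>", simplified])
    then show ?thesis by auto
  qed
  then obtain a r where r: "strict_mono r" and lim0: "(an \<circ> r) \<longlonglongrightarrow> a"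
    using compact_bounded_sequences[of "\<lambda>j. sqrt (Rmax / w j)"] unfolding compact_def by blast
  define bn where "bn = an \<circ> r"
  have lim: "(\<lambda>n. bn n j) \<longlonglongrightarrow> a j" for j
  proof -
    have "continuous_on UNIV (\<lambda>x::nat \<Rightarrow> real. x j)" by (rule continuous_on_product_coordinates)
    then show ?thesis using lim0 unfolding bn_def continuous_on_sequentially by (auto simp: o_def)
  qed
  have bn: "admissible (bn n)" "size2 (bn n) \<le> Rmax" for n using an R by (auto simp: bn_def)
  have en: "energy (bn n) \<le> m + 1 / Suc n" for n
  proof -
    have "1 / real (Suc (r n)) \<le> 1 / real (Suc n)" using seq_suble[OF r, of n] by (simp add: field_simps)
    then show ?thesis using an(2)[of "r n"] by (simp add: bn_def)
  qed
  have partial: "(\<Sum>j<K. w j * (a j)\<^sup>2) \<le> Rmax" for K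
  proof (rule LIMSEQ_le_const2)
    show "(\<lambda>n. \<Sum>j<K. w j * (bn n j)\<^sup>2) \<longlonglongrightarrow> (\<Sum>j<K. w j * (a j)\<^sup>2)" by (intro tendsto_intros lim)
    have "(\<Sum>j<K. w j * (bn n j)\<^sup>2) \<le> size2 (bn n)" for n
      unfolding size2_def using bn(1)[of n] w_pos by (intro sum_le_suminf) (auto simp: admissible_def less_imp_le)
    then show "\<exists>N. \<forall>n\<ge>N. (\<Sum>j<K. w j * (bn n j)\<^sup>2) \<le> Rmax" using bn(2) order_trans by blast
  qed
  have a: "admissible a"
    unfolding admissible_def
  proof (rule summableI_nonneg_bounded)
    show "0 \<le> w j * (a j)\<^sup>2" for j using w_pos[of j] by simp
  qed (rule partial)
  have aR: "size2 a \<le> Rmax"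
    unfolding size2_def using a partial by (intro suminf_le_const) (auto simp: admissible_def)
  have Glim: "(\<lambda>n. LINT x|M. potential lam q (series (bn n) x)) \<longlonglongrightarrow> (LINT x|M. potential lam q (series a x))"
  proof (rule integral_dominated_convergence[where w = "\<lambda>_. potential lam q (sqrt (S0 * Rmax))"])
    show "AE x in M. (\<lambda>n. potential lam q (series (bn n) x)) \<longlonglongrightarrow> potential lam q (series a x)"
      using continuous_potential[OF q(1), of lam] series_tendsto[OF bn a aR lim]
      by (intro AE_I2 isCont_tendsto_compose[of _ "potential lam q"]) (auto simp: continuous_on_eq_continuous_at)
    show "AE x in M. norm (potential lam q (series (bn n) x)) \<le> potential lam q (sqrt (S0 * Rmax))" for n
    proof (rule AE_I2)
      fix x
      have "\<bar>series (bn n) x\<bar> \<le> sqrt (S0 * size2 (bn n))" by (rule series_bound[OF bn(1)])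
      also have "\<dots> \<le> sqrt (S0 * Rmax)" using bn(2)[of n] S0_pos by simp
      finally show "norm (potential lam q (series (bn n) x)) \<le> potential lam q (sqrt (S0 * Rmax))"
        using potential_mono[OF lam_pos q(1)] potential_nonneg[OF lam_pos q(1)] by simp
    qed
  qed (use series_measurable series_measurable in auto)
  \<comment> \<open>In the limit \<open>n \<rightarrow> \<infinity>\<close> only finitely many coefficients can be kept, so the quadratic part is cut
    off at \<open>K\<close>; then \<open>K \<rightarrow> \<infinity>\<close>.\<close>
  have partial_energy: "A / 2 * (\<Sum>j<K. w j * (a j)\<^sup>2) + B / 4 * (\<Sum>j<K. w j * (a j)\<^sup>2)\<^sup>2 - (LINT x|M. potential lam q (series a x)) \<le> m" for K
  proof (rule LIMSEQ_le)
    show "(\<lambda>n. A / 2 * (\<Sum>j<K. w j * (bn n j)\<^sup>2) + B / 4 * (\<Sum>j<K. w j * (bn n j)\<^sup>2)\<^sup>2 - (LINT x|M. potential lam q (series (bn n) x)))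
       \<longlonglongrightarrow> A / 2 * (\<Sum>j<K. w j * (a j)\<^sup>2) + B / 4 * (\<Sum>j<K. w j * (a j)\<^sup>2)\<^sup>2 - (LINT x|M. potential lam q (series a x))"
      by (intro tendsto_intros lim Glim)
    show "(\<lambda>n. m + 1 / Suc n) \<longlonglongrightarrow> m"
      using tendsto_add[OF tendsto_const[of m] LIMSEQ_inverse_real_of_nat] by (simp add: inverse_eq_divide)
    show "\<exists>N. \<forall>n\<ge>N. A / 2 * (\<Sum>j<K. w j * (bn n j)\<^sup>2) + B / 4 * (\<Sum>j<K. w j * (bn n j)\<^sup>2)\<^sup>2 - (LINT x|M. potential lam q (series (bn n) x)) \<le> m + 1 / Suc n"
    proof (intro exI allI impI)
      fix n
      let ?p = "\<Sum>j<K. w j * (bn n j)\<^sup>2"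
      have "?p \<le> size2 (bn n)"
        unfolding size2_def using bn(1)[of n] w_pos by (intro sum_le_suminf) (auto simp: admissible_def less_imp_le)
      moreover have "0 \<le> ?p" using w_pos by (intro sum_nonneg) (auto simp: less_imp_le)
      ultimately have "A / 2 * ?p \<le> A / 2 * size2 (bn n)" "B / 4 * ?p\<^sup>2 \<le> B / 4 * (size2 (bn n))\<^sup>2"
        using A_pos B_pos by (auto intro!: mult_left_mono power_mono)
      then show "A / 2 * ?p + B / 4 * ?p\<^sup>2 - (LINT x|M. potential lam q (series (bn n) x)) \<le> m + 1 / Suc n"
        using en[of n] unfolding energy_def by linarith
    qed
  qed
  have "energy a \<le> m"
  proof (rule LIMSEQ_le_const2)
    have "(\<lambda>K. \<Sum>j<K. w j * (a j)\<^sup>2) \<longlonglongrightarrow> size2 a"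
      unfolding size2_def using a by (intro summable_LIMSEQ) (simp add: admissible_def)
    then show "(\<lambda>K. A / 2 * (\<Sum>j<K. w j * (a j)\<^sup>2) + B / 4 * (\<Sum>j<K. w j * (a j)\<^sup>2)\<^sup>2 - (LINT x|M. potential lam q (series a x))) \<longlonglongrightarrow> energy a"
      unfolding energy_def by (intro tendsto_intros)
  qed (use partial_energy in blast)
  then show ?thesis using a m_neg m_le by (intro that[of a]) (auto intro: order_trans)
qed

text \<open>The minimiser is compared with its perturbations in the direction \<open>e j\<close>.  The tangent inequality
  of the convex potential bounds the change of the integral from below by a linear term, so the
  integral need not be differentiated.\<close>
theorem euler_lagrange:
  assumes a: "admissible a" and min: "\<And>b. admissible b \<Longrightarrow> energy a \<le> energy b"
  shows "(A + B * size2 a) * (w j * a j) = (LINT x|M. nonlin lam q (series a x) * e j x)"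
proof -
  define P Q where "P = w j * a j" and "Q = (LINT x|M. nonlin lam q (series a x) * e j x)"
  define N where "N = size2 a"
  define u where "u = sqrt (S0 * N)"
  have fb: "\<bar>series a x\<bar> \<le> u" for x unfolding u_def N_def by (rule series_bound[OF a])
  have "compact (nonlin lam q ` {- u..u})"
    using continuous_nonlin[OF q(1)] by (intro compact_continuous_image) (auto intro: continuous_on_subset)
  then obtain L where L: "\<And>z. z \<in> nonlin lam q ` {- u..u} \<Longrightarrow> \<bar>z\<bar> \<le> L"
    using compact_imp_bounded bounded_real by metis
  have gi: "integrable M (\<lambda>x. nonlin lam q (series a x) * e j x)"
  proof (rule integrable_const_bound[where B = L])
    show "AE x in M. norm (nonlin lam q (series a x) * e j x) \<le> L"
    proof (rule AE_I2)
      fix x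
      have "\<bar>nonlin lam q (series a x)\<bar> \<le> L" using fb[of x] by (intro L imageI) (auto simp: abs_le_iff)
      then have "\<bar>nonlin lam q (series a x)\<bar> * \<bar>e j x\<bar> \<le> L * 1" using e_le[of j x] by (intro mult_mono) auto
      then show "norm (nonlin lam q (series a x) * e j x) \<le> L" by (simp add: abs_mult)
    qed
  qed measurable
  have key: "t * (Q - (A + B * N) * P) \<le> t\<^sup>2 * (A / 2 * w j + B / 4 * (2 * \<bar>N\<bar> * w j + 4 * P\<^sup>2 + 4 * \<bar>P\<bar> * w j + (w j)\<^sup>2))"
    if t: "\<bar>t\<bar> \<le> 1" for t
  proof -
    let ?b = "\<lambda>i. a i + (if i = j then t else 0)"
    note p = perturb[OF a, where t = t and j = j]
    have ub: "\<bar>series a x + t * e j x\<bar> \<le> u + 1" for x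
    proof -
      have "\<bar>t * e j x\<bar> \<le> 1 * 1" unfolding abs_mult using t e_le[of j x] by (intro mult_mono) auto
      then show ?thesis using fb[of x] abs_triangle_ineq[of "series a x" "t * e j x"] by linarith
    qed
    have "t * Q + (LINT x|M. potential lam q (series a x)) = (LINT x|M. potential lam q (series a x) + t * (nonlin lam q (series a x) * e j x))"
      unfolding Q_def using gi integrable_potential[OF series_measurable fb] by simp
    also have "\<dots> \<le> (LINT x|M. potential lam q (series a x + t * e j x))"
    proof (rule integral_mono)
      show "integrable M (\<lambda>x. potential lam q (series a x) + t * (nonlin lam q (series a x) * e j x))"
        using gi integrable_potential[OF series_measurable fb] by simp
      show "integrable M (\<lambda>x. potential lam q (series a x + t * e j x))"
        by (rule integrable_potential[OF _ ub]) measurable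
      show "potential lam q (series a x) + t * (nonlin lam q (series a x) * e j x) \<le> potential lam q (series a x + t * e j x)" for x
        using potential_tangent[OF lam_pos q(1), of "series a x" "series a x + t * e j x"] by (simp add: mult_ac)
    qed
    finally have G: "t * Q + (LINT x|M. potential lam q (series a x)) \<le> (LINT x|M. potential lam q (series a x + t * e j x))" .
    have "energy a \<le> energy ?b" by (rule min[OF p(1)])
    then have "A / 2 * N + B / 4 * N\<^sup>2 - (LINT x|M. potential lam q (series a x))
       \<le> A / 2 * (N + 2 * t * P + t\<^sup>2 * w j) + B / 4 * (N + 2 * t * P + t\<^sup>2 * w j)\<^sup>2 - (LINT x|M. potential lam q (series a x + t * e j x))"
      unfolding energy_def p(2,3) N_def[symmetric] P_def[symmetric] .
    then have "t * Q \<le> A / 2 * (2 * t * P + t\<^sup>2 * w j) + B / 4 * ((N + 2 * t * P + t\<^sup>2 * w j)\<^sup>2 - N\<^sup>2)"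
      using G by (simp add: algebra_simps)
    also have "(N + 2 * t * P + t\<^sup>2 * w j)\<^sup>2 - N\<^sup>2 = 4 * t * N * P + t\<^sup>2 * (2 * N * w j + 4 * P\<^sup>2 + 4 * t * P * w j + t\<^sup>2 * (w j)\<^sup>2)"
      by (simp add: power2_eq_square algebra_simps)
    finally have "t * (Q - (A + B * N) * P) \<le> t\<^sup>2 * (A / 2 * w j + B / 4 * (2 * N * w j + 4 * P\<^sup>2 + 4 * t * P * w j + t\<^sup>2 * (w j)\<^sup>2))"
      by (simp add: algebra_simps)
    also have "\<dots> \<le> t\<^sup>2 * (A / 2 * w j + B / 4 * (2 * \<bar>N\<bar> * w j + 4 * P\<^sup>2 + 4 * \<bar>P\<bar> * w j + (w j)\<^sup>2))"
    proof -
      have "N * w j \<le> \<bar>N\<bar> * w j" using w_pos[of j] by (intro mult_right_mono) auto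
      moreover have "t * P * w j \<le> \<bar>P\<bar> * w j"
      proof -
        have "t * P \<le> \<bar>t\<bar> * \<bar>P\<bar>" by (metis abs_ge_self abs_mult)
        also have "\<dots> \<le> 1 * \<bar>P\<bar>" using t by (intro mult_right_mono) auto
        finally show ?thesis using w_pos[of j] by (intro mult_right_mono) auto
      qed
      moreover have "t\<^sup>2 * (w j)\<^sup>2 \<le> 1 * (w j)\<^sup>2" using t by (intro mult_right_mono) (auto simp: abs_square_le_1)
      ultimately show ?thesis using B_pos A_pos by (intro mult_left_mono add_mono) auto
    qed
    finally show ?thesis .
  qed
  have "Q - (A + B * N) * P = 0" by (rule quadratic_touching_linear) (rule key)
  then show ?thesis by (simp add: P_def Q_def N_def)
qed

end

section \<open>Uniqueness of Fourier coefficients\<close>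

text \<open>The trigonometric polynomials on the torus form an algebra, since a product of waves is a sum of
  two waves.\<close>
inductive trig_poly :: "(real^3 \<Rightarrow> real) \<Rightarrow> bool" where
  wave: "trig_poly (wave k d)"
| add: "trig_poly f \<Longrightarrow> trig_poly g \<Longrightarrow> trig_poly (\<lambda>x. f x + g x)"
| scale: "trig_poly f \<Longrightarrow> trig_poly (\<lambda>x. c * f x)"

lemma trig_poly_const: "trig_poly (\<lambda>x. c)"
proof -
  have "wave 0 0 = (\<lambda>x. 1)" by (simp add: wave_def[abs_def] freq_def zero_vec_def[symmetric] flip: zero_vec_def)
  then show ?thesis using trig_poly.scale[OF trig_poly.wave[of 0 0], of c] by simp
qed

lemma trig_poly_sum: "(\<And>i. i \<in> I \<Longrightarrow> trig_poly (f i)) \<Longrightarrow> trig_poly (\<lambda>x. \<Sum>i\<in>I. f i x)"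
  by (induction I rule: infinite_finite_induct) (auto intro: trig_poly_const trig_poly.add)

lemma trig_poly_wave_mult: "trig_poly f \<Longrightarrow> trig_poly (\<lambda>x. wave k d x * f x)"
proof (induction rule: trig_poly.induct)
  case (wave l e)
  have "trig_poly (\<lambda>x. (1 / 2) * (wave (k + l) (d + e) x + wave (k - l) (d - e) x))"
    by (intro trig_poly.intros)
  then show ?case by (simp add: wave_mult)
next
  case (add f g)
  then show ?case using trig_poly.add[OF add.IH] by (simp add: distrib_left)
next
  case (scale f c)
  then show ?case using trig_poly.scale[OF scale.IH, of c] by (simp add: mult.left_commute)
qed

lemma trig_poly_mult: "trig_poly f \<Longrightarrow> trig_poly g \<Longrightarrow> trig_poly (\<lambda>x. f x * g x)"
proof (induction rule: trig_poly.induct)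
  case (wave k d)
  then show ?case by (rule trig_poly_wave_mult)
next
  case (add f f')
  then show ?case using trig_poly.add[OF add.IH] by (simp add: distrib_right)
next
  case (scale f c)
  then show ?case using trig_poly.scale[OF scale.IH, of c] by (simp add: mult.assoc)
qed

text \<open>The torus as a product of three circles: trigonometric polynomials in \<open>x\<close> include all ordinary
  polynomials in these coordinates, to which the theorem of Stone and Weierstrass applies.\<close>
definition circle_coords :: "real^3 \<Rightarrow> (real^3) \<times> (real^3)" where
  "circle_coords x = ((\<chi> i. cos (x $ i)), (\<chi> i. sin (x $ i)))"

text \<open>The inverse of \<open>circle_coords\<close> on the cube, by the half-angle formula \<open>tan (x / 2) = sin x / (cos x + 1)\<close>.\<close>
definition angle_coords :: "(real^3) \<times> (real^3) \<Rightarrow> real^3" where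
  "angle_coords z = (\<chi> i. 2 * arctan (snd z $ i / (fst z $ i + 1)))"

lemma angle_circle_coords:
  assumes "x \<in> cube"
  shows "angle_coords (circle_coords x) = x"
proof -
  have "2 * arctan (sin (x $ i) / (cos (x $ i) + 1)) = x $ i" for i
  proof -
    have "- pi < x $ i \<and> x $ i < pi" using assms unfolding mem_cube by blast
    then have "arctan (tan (x $ i / 2)) = x $ i / 2" by (intro arctan_tan) auto
    then show ?thesis using tan_half[of "x $ i / 2"] by simp
  qed
  then show ?thesis by (simp add: angle_coords_def circle_coords_def vec_eq_iff)
qed

lemma borel_measurable_vec3:
  fixes f :: "'a \<Rightarrow> real^3"
  assumes "\<And>i. (\<lambda>x. f x $ i) \<in> borel_measurable M"
  shows "f \<in> borel_measurable M"
  unfolding borel_measurable_euclidean_space[of f]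
  using assms by (auto simp: Basis_vec_def inner_axis)

lemma borel_measurable_angle_coords: "angle_coords \<in> borel_measurable borel"
proof (rule borel_measurable_vec3)
  fix i
  have "(\<lambda>z :: (real^3) \<times> (real^3). snd z $ i) \<in> borel_measurable borel"
    "(\<lambda>z :: (real^3) \<times> (real^3). fst z $ i) \<in> borel_measurable borel"
    by (intro borel_measurable_continuous_onI continuous_intros)+
  then show "(\<lambda>z. angle_coords z $ i) \<in> borel_measurable borel"
    unfolding angle_coords_def by simp
qed

lemma continuous_circle_coords: "continuous_on UNIV circle_coords"
  unfolding circle_coords_def[abs_def] by (intro continuous_intros)

lemma borel_measurable_circle_coords [measurable]: "circle_coords \<in> borel_measurable borel"
  by (intro borel_measurable_continuous_onI continuous_circle_coords)

lemma trig_poly_coordinate: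
  assumes "b \<in> Basis"
  shows "trig_poly (\<lambda>x. circle_coords x \<bullet> b)"
proof -
  have fr: "freq (axis i 1) \<bullet> x = x $ i" for i x
  proof -
    have "freq (axis i 1) = axis i 1" by (auto simp: freq_def vec_eq_iff axis_def)
    then show ?thesis by (simp add: inner_axis')
  qed
  from assms consider i where "b = (axis i 1, 0)" | i where "b = (0, axis i 1)"
    by (auto simp: Basis_prod_def Basis_vec_def)
  then show ?thesis
  proof cases
    case 1
    have "(\<lambda>x. circle_coords x \<bullet> b) = wave (axis i 1) 0"
      by (simp add: 1 circle_coords_def wave_def fr inner_axis fun_eq_iff)
    then show ?thesis using trig_poly.wave by simp
  next
    case 2
    have "(\<lambda>x. circle_coords x \<bullet> b) = wave (axis i 1) (- (pi / 2))"
      by (simp add: 2 circle_coords_def wave_def fr inner_axis fun_eq_iff cos_diff)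
    then show ?thesis using trig_poly.wave by simp
  qed
qed

lemma trig_poly_compose_polynomial:
  assumes "real_polynomial_function p"
  shows "trig_poly (\<lambda>x. p (circle_coords x))"
  using assms
proof (induction rule: real_polynomial_function.induct)
  case (linear f)
  have "f (circle_coords x) = (\<Sum>b\<in>Basis. f b * (circle_coords x \<bullet> b))" for x
  proof -
    let ?z = "circle_coords x"
    have "f ?z = f (\<Sum>b\<in>Basis. (?z \<bullet> b) *\<^sub>R b)" by (simp only: euclidean_representation)
    also have "\<dots> = (\<Sum>b\<in>Basis. (?z \<bullet> b) * f b)"
      using bounded_linear.linear[OF linear] by (simp add: linear_sum linear_cmul)
    finally show ?thesis by (simp add: mult.commute)
  qed
  moreover have "trig_poly (\<lambda>x. \<Sum>b\<in>Basis. f b * (circle_coords x \<bullet> b))"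
    by (intro trig_poly_sum trig_poly.scale trig_poly_coordinate)
  ultimately show ?case by (simp only:)
qed (auto intro: trig_poly_const trig_poly.add trig_poly_mult)

lemma integrable_mult_bounded:
  fixes u f :: "'a \<Rightarrow> real"
  assumes u: "integrable M u" and f: "f \<in> borel_measurable M" and b: "\<And>x. x \<in> space M \<Longrightarrow> \<bar>f x\<bar> \<le> B"
  shows "integrable M (\<lambda>x. u x * f x)"
proof (rule Bochner_Integration.integrable_bound)
  show "integrable M (\<lambda>x. B * u x)" using u by simp
  show "AE x in M. norm (u x * f x) \<le> norm (B * u x)"
  proof (rule AE_I2)
    fix x assume "x \<in> space M"
    then have "\<bar>f x\<bar> \<le> \<bar>B\<bar>" using b[of x] by linarith
    then show "norm (u x * f x) \<le> norm (B * u x)"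
      by (simp add: abs_mult mult.commute[of "\<bar>u x\<bar>"] mult_right_mono)
  qed
qed (use u f in auto)

lemma trig_poly_bounded: "trig_poly f \<Longrightarrow> \<exists>B. \<forall>x. \<bar>f x\<bar> \<le> B"
proof (induction rule: trig_poly.induct)
  case (wave k d)
  then show ?case using abs_wave_le by blast
next
  case (add f g)
  then obtain B C where "\<And>x. \<bar>f x\<bar> \<le> B" "\<And>x. \<bar>g x\<bar> \<le> C" by blast
  then have "\<bar>f x + g x\<bar> \<le> B + C" for x using abs_triangle_ineq[of "f x" "g x"] by (smt (verit))
  then show ?case by blast
next
  case (scale f c)
  then obtain B where "\<And>x. \<bar>f x\<bar> \<le> B" by blast
  then have "\<bar>c * f x\<bar> \<le> \<bar>c\<bar> * B" for x by (simp add: abs_mult mult_left_mono)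
  then show ?case by blast
qed

lemma trig_poly_measurable: "trig_poly f \<Longrightarrow> f \<in> borel_measurable cell"
  by (induction rule: trig_poly.induct) (auto intro: measurable_cell)

text \<open>An integrable function whose integrals against all waves vanish is 0.  Its integrals against
  functions of the circle coordinates vanish successively for polynomials, continuous functions,
  indicators of closed sets and indicators of Borel sets.\<close>
context
  fixes u :: "real^3 \<Rightarrow> real"
  assumes u: "integrable cell u" and orth: "\<And>k d. (LINT x|cell. u x * wave k d x) = 0"
begin

lemma orth_trig_poly: "trig_poly f \<Longrightarrow> (LINT x|cell. u x * f x) = 0"
proof (induction rule: trig_poly.induct)
  case (add f g)
  have "integrable cell (\<lambda>x. u x * h x)" if "trig_poly h" for h
    using trig_poly_bounded[OF that] trig_poly_measurable[OF that] integrable_mult_bounded[OF u] by blast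
  then show ?case using add by (simp add: distrib_left)
next
  case (scale f c)
  have "(LINT x|cell. u x * (c * f x)) = (LINT x|cell. c * (u x * f x))" by (simp add: mult.left_commute)
  then show ?case using scale by simp
qed (simp add: orth)

lemma orth_continuous:
  fixes F :: "(real^3) \<times> (real^3) \<Rightarrow> real"
  assumes F: "continuous_on UNIV F"
  shows "(LINT x|cell. u x * F (circle_coords x)) = 0"
proof (rule ccontr)
  let ?I = "LINT x|cell. u x * F (circle_coords x)"
  let ?N = "LINT x|cell. \<bar>u x\<bar>"
  assume "?I \<noteq> 0"
  define K where "K = cbox (- One) (One :: (real^3) \<times> (real^3))"
  have K: "circle_coords x \<in> K" for x
  proof -
    have "circle_coords x \<bullet> b \<in> {-1..1}" if b: "b \<in> Basis" for b
    proof -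
      from b consider i where "b = (axis i 1, 0)" | i where "b = (0, axis i 1)"
        by (auto simp: Basis_prod_def Basis_vec_def)
      then show ?thesis by cases (auto simp: circle_coords_def inner_axis)
    qed
    then show ?thesis unfolding K_def mem_box by auto
  qed
  define \<epsilon> where "\<epsilon> = \<bar>?I\<bar> / (2 * (?N + 1))"
  have N: "?N \<ge> 0" by simp
  have N1: "?N + 1 > 0" using N by linarith
  have eps: "\<epsilon> > 0" unfolding \<epsilon>_def using \<open>?I \<noteq> 0\<close> N1 by (intro divide_pos_pos) auto
  have "compact K" "continuous_on K F" using F by (auto simp: K_def intro: continuous_on_subset)
  from Stone_Weierstrass_real_polynomial_function[OF this eps]
  obtain p where p: "real_polynomial_function p" "\<And>z. z \<in> K \<Longrightarrow> \<bar>F z - p z\<bar> < \<epsilon>" by blast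
  have tp: "trig_poly (\<lambda>x. p (circle_coords x))" by (rule trig_poly_compose_polynomial[OF p(1)])
  have Fm: "F \<in> borel_measurable borel" by (rule borel_measurable_continuous_onI[OF F])
  have d: "(\<lambda>x. F (circle_coords x) - p (circle_coords x)) \<in> borel_measurable cell"
    by (intro borel_measurable_diff trig_poly_measurable[OF tp]
        measurable_cell[OF measurable_compose[OF borel_measurable_circle_coords Fm]])
  have int: "integrable cell (\<lambda>x. u x * (F (circle_coords x) - p (circle_coords x)))"
    using p(2)[OF K] by (intro integrable_mult_bounded[OF u d, of \<epsilon>]) (auto intro: less_imp_le)
  have ip: "integrable cell (\<lambda>x. u x * p (circle_coords x))"
    using trig_poly_bounded[OF tp] trig_poly_measurable[OF tp] integrable_mult_bounded[OF u] by blast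
  have "?I = (LINT x|cell. u x * (F (circle_coords x) - p (circle_coords x)) + u x * p (circle_coords x))"
    by (simp add: right_diff_distrib)
  also have "\<dots> = (LINT x|cell. u x * (F (circle_coords x) - p (circle_coords x)))"
    using int ip orth_trig_poly[OF tp] by simp
  finally have "\<bar>?I\<bar> \<le> (LINT x|cell. \<bar>u x * (F (circle_coords x) - p (circle_coords x))\<bar>)"
    using integral_abs_bound[of cell "\<lambda>x. u x * (F (circle_coords x) - p (circle_coords x))"] by simp
  also have "\<dots> \<le> (LINT x|cell. \<epsilon> * \<bar>u x\<bar>)"
  proof (rule integral_mono)
    show "\<bar>u x * (F (circle_coords x) - p (circle_coords x))\<bar> \<le> \<epsilon> * \<bar>u x\<bar>" for x
      using p(2)[OF K[of x]] by (simp add: abs_mult mult.commute[of "\<bar>u x\<bar>"] mult_right_mono)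
  qed (use int u in auto)
  also have "\<dots> = \<epsilon> * ?N" by simp
  also have "\<dots> \<le> \<bar>?I\<bar> / 2 * (?N / (?N + 1))" by (simp add: \<epsilon>_def)
  also have "\<dots> \<le> \<bar>?I\<bar> / 2 * 1"
  proof (rule mult_left_mono)
    show "?N / (?N + 1) \<le> 1" unfolding divide_le_eq_1_pos[OF N1] by linarith
  qed linarith
  finally show False using \<open>?I \<noteq> 0\<close> by simp
qed

lemma orth_closed:
  assumes C: "closed C"
  shows "(LINT x|cell. u x * indicator C (circle_coords x)) = 0"
proof (cases "C = {}")
  case False
  \<comment> \<open>Continuous functions that decrease to the indicator of \<open>C\<close>.\<close>
  define F where "F = (\<lambda>n z. max 0 (1 - real n * infdist z C))"
  have cont: "continuous_on UNIV (F n)" for n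
    unfolding F_def by (intro continuous_intros)
  have [measurable]: "F n \<in> borel_measurable borel" for n by (rule borel_measurable_continuous_onI[OF cont])
  have [measurable]: "C \<in> sets borel" using C by simp
  have "(\<lambda>n. LINT x|cell. u x * F n (circle_coords x)) \<longlonglongrightarrow> (LINT x|cell. u x * indicator C (circle_coords x))"
  proof (rule integral_dominated_convergence[where w = "\<lambda>x. \<bar>u x\<bar>"])
    show "(\<lambda>x. u x * indicat_real C (circle_coords x)) \<in> borel_measurable cell"
      by (intro borel_measurable_times borel_measurable_integrable[OF u] measurable_cell) measurable
    show "(\<lambda>x. u x * F n (circle_coords x)) \<in> borel_measurable cell" for n
      by (intro borel_measurable_times borel_measurable_integrable[OF u] measurable_cell) measurable
    show "AE x in cell. (\<lambda>n. u x * F n (circle_coords x)) \<longlonglongrightarrow> u x * indicat_real C (circle_coords x)"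
    proof (rule AE_I2, rule tendsto_mult[OF tendsto_const])
      fix x
      let ?z = "circle_coords x"
      show "(\<lambda>n. F n ?z) \<longlonglongrightarrow> indicat_real C ?z"
      proof (cases "?z \<in> C")
        case True
        then show ?thesis by (simp add: F_def)
      next
        case False
        then have pos: "infdist ?z C > 0" using C \<open>C \<noteq> {}\<close> infdist_pos_not_in_closed by blast
        obtain N :: nat where N: "1 / infdist ?z C < real N" using reals_Archimedean2 by blast
        have "F n ?z = 0" if "n \<ge> N" for n
        proof -
          have "1 / infdist ?z C < real n" using N that by linarith
          then have "1 < real n * infdist ?z C" using pos by (simp add: field_simps)
          then show ?thesis by (simp add: F_def)
        qed
        then have "\<forall>\<^sub>F n in sequentially. F n ?z = 0" by (auto simp: eventually_sequentially)
        then show ?thesis using False by (simp add: tendsto_eventually)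
      qed
    qed
    show "AE x in cell. norm (u x * F n (circle_coords x)) \<le> \<bar>u x\<bar>" for n
    proof (rule AE_I2)
      fix x
      have "\<bar>F n (circle_coords x)\<bar> \<le> 1" using infdist_nonneg[of "circle_coords x" C] by (auto simp: F_def)
      then show "norm (u x * F n (circle_coords x)) \<le> \<bar>u x\<bar>" by (simp add: abs_mult mult_left_le)
    qed
  qed (use u in simp)
  then show ?thesis using orth_continuous[OF cont] LIMSEQ_unique[OF tendsto_const] by fastforce
qed simp

lemma orth_borel:
  assumes "C \<in> sets borel"
  shows "(LINT x|cell. u x * indicator C (circle_coords x)) = 0"
proof -
  \<comment> \<open>Closed sets are stable under intersections and generate the Borel sets.\<close>
  have "Int_stable (Collect closed :: ((real^3) \<times> (real^3)) set set)" by (auto simp: Int_stable_def)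
  moreover have "Collect closed \<subseteq> Pow (UNIV :: ((real^3) \<times> (real^3)) set)" by simp
  moreover have "C \<in> sigma_sets UNIV (Collect closed)" using assms by (simp add: borel_eq_closed)
  ultimately show ?thesis
  proof (induction rule: sigma_sets_induct_disjoint[where \<Omega> = UNIV])
    case (compl A)
    have [measurable]: "A \<in> sets borel" using compl(1) by (simp add: borel_eq_closed)
    have iA: "integrable cell (\<lambda>x. u x * indicat_real A (circle_coords x))"
      by (rule integrable_mult_bounded[OF u, of _ 1]) (auto intro!: measurable_cell simp: indicator_def)
    have "(LINT x|cell. u x * indicat_real (UNIV - A) (circle_coords x)) = (LINT x|cell. u x - u x * indicat_real A (circle_coords x))"
      by (rule Bochner_Integration.integral_cong) (auto simp: indicator_def)
    also have "\<dots> = (LINT x|cell. u x) - 0" using u iA compl(2) by simp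
    also have "(LINT x|cell. u x) = 0" using orth_closed[of UNIV] by simp
    finally show ?case by simp
  next
    case (union A)
    have A: "A i \<in> sets borel" for i using union(2) by (auto simp: borel_eq_closed)
    let ?B = "\<lambda>i. circle_coords -` A i \<inter> space cell"
    have m: "?B i \<in> sets cell" for i
      by (rule measurable_sets[OF measurable_cell[OF borel_measurable_circle_coords] A])
    have "(LINT x|cell. u x * indicat_real (\<Union>i. A i) (circle_coords x)) = (LINT x:(\<Union>i. ?B i)|cell. u x)"
      unfolding set_lebesgue_integral_def by (rule Bochner_Integration.integral_cong) (auto simp: indicator_def)
    also have "\<dots> = (\<Sum>i. (LINT x:?B i|cell. u x))"
    proof (rule lebesgue_integral_countable_add[OF m])
      show "?B i \<inter> ?B j = {}" if "i \<noteq> j" for i j using disjoint_family_onD[OF union(1), of i j] that by auto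
      show "set_integrable cell (\<Union>i. ?B i) u"
        unfolding set_integrable_def
      proof (rule integrable_mult_indicator[OF _ u])
        show "(\<Union>i. ?B i) \<in> sets cell" using m by blast
      qed
    qed
    also have "\<dots> = 0"
    proof -
      have "(LINT x:?B i|cell. u x) = 0" for i
      proof -
      have "(LINT x:?B i|cell. u x) = (LINT x|cell. u x * indicat_real (A i) (circle_coords x))"
        unfolding set_lebesgue_integral_def by (rule Bochner_Integration.integral_cong) (auto simp: indicator_def)
      then show ?thesis using union(3) by simp
      qed
      then show ?thesis by simp
    qed
    finally show ?case .
  qed (auto intro: orth_closed)
qed

theorem fourier_uniqueness: "AE x in cell. u x = 0"
proof (rule density_unique_real[OF u, of "\<lambda>x. 0"])
  fix A assume A: "A \<in> sets cell"
  then have Ab: "A \<in> sets borel" "A \<subseteq> cube"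
    using sets_restrict_space_iff[of cube lborel A] by (auto simp: cell_def sets_restrict_space)
  have C: "angle_coords -` A \<in> sets borel"
    using measurable_sets[OF borel_measurable_angle_coords Ab(1)] by simp
  have "(LINT x:A|cell. u x) = (LINT x|cell. u x * indicat_real (angle_coords -` A) (circle_coords x))"
    unfolding set_lebesgue_integral_def
    by (rule Bochner_Integration.integral_cong) (auto simp: indicator_def space_cell angle_circle_coords)
  then show "(LINT x:A|cell. u x) = (LINT x:A|cell. 0)" using orth_borel[OF C] by simp
qed simp

end

section \<open>Sums of sines\<close>

text \<open>Sums of sines are closed under odd powers because the square of a sum of sines is a sum of
  cosines.\<close>
inductive sin_poly :: "(real \<Rightarrow> real) \<Rightarrow> bool" where
  sin: "sin_poly (\<lambda>t. sin (real j * t))"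
| add: "sin_poly f \<Longrightarrow> sin_poly g \<Longrightarrow> sin_poly (\<lambda>t. f t + g t)"
| scale: "sin_poly f \<Longrightarrow> sin_poly (\<lambda>t. c * f t)"

inductive cos_poly :: "(real \<Rightarrow> real) \<Rightarrow> bool" where
  cos: "cos_poly (\<lambda>t. cos (real j * t))"
| add: "cos_poly f \<Longrightarrow> cos_poly g \<Longrightarrow> cos_poly (\<lambda>t. f t + g t)"
| scale: "cos_poly f \<Longrightarrow> cos_poly (\<lambda>t. c * f t)"

lemma cos_poly_cos_diff: "cos_poly (\<lambda>t. cos (real i * t - real j * t))"
proof (cases "j \<le> i")
  case True
  then show ?thesis using cos_poly.cos[of "i - j"] by (simp add: of_nat_diff left_diff_distrib)
next
  case False
  have "cos (real i * t - real j * t) = cos (real (j - i) * t)" for t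
    using False cos_minus[of "real i * t - real j * t"] by (simp add: of_nat_diff left_diff_distrib)
  then show ?thesis using cos_poly.cos[of "j - i"] by simp
qed

lemma sin_poly_sin_diff: "sin_poly (\<lambda>t. sin (real i * t - real j * t))"
proof (cases "j \<le> i")
  case True
  then show ?thesis using sin_poly.sin[of "i - j"] by (simp add: of_nat_diff left_diff_distrib)
next
  case False
  have "sin (real i * t - real j * t) = - 1 * sin (real (j - i) * t)" for t
    using False sin_minus[of "real i * t - real j * t"] by (simp add: of_nat_diff left_diff_distrib)
  then show ?thesis using sin_poly.scale[OF sin_poly.sin[of "j - i"], of "-1"] by simp
qed

lemma sin_poly_mult_sin: "sin_poly g \<Longrightarrow> cos_poly (\<lambda>t. sin (real i * t) * g t)"
proof (induction rule: sin_poly.induct)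
  case (sin j)
  have "sin (real i * t) * sin (real j * t) = (1 / 2) * (cos (real i * t - real j * t) + (-1) * cos (real (i + j) * t))" for t
    by (simp add: sin_times_sin distrib_right)
  then show ?case by (simp only:) (intro cos_poly.scale cos_poly.add cos_poly_cos_diff cos_poly.cos)
next
  case (add f g)
  then show ?case using cos_poly.add[OF add.IH] by (simp add: distrib_left)
next
  case (scale f c)
  then show ?case using cos_poly.scale[OF scale.IH, of c] by (simp add: mult.left_commute)
qed

lemma sin_poly_mult: "sin_poly f \<Longrightarrow> sin_poly g \<Longrightarrow> cos_poly (\<lambda>t. f t * g t)"
proof (induction rule: sin_poly.induct)
  case (sin j)
  then show ?case by (rule sin_poly_mult_sin)
next
  case (add f f')
  then show ?case using cos_poly.add[OF add.IH] by (simp add: distrib_right)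
next
  case (scale f c)
  then show ?case using cos_poly.scale[OF scale.IH, of c] by (simp add: mult.assoc)
qed

lemma cos_mult_sin_poly: "sin_poly g \<Longrightarrow> sin_poly (\<lambda>t. cos (real i * t) * g t)"
proof (induction rule: sin_poly.induct)
  case (sin j)
  have "cos (real i * t) * sin (real j * t) = (1 / 2) * (sin (real (i + j) * t) + (-1) * sin (real i * t - real j * t))" for t
    by (simp add: cos_times_sin distrib_right)
  then show ?case by (simp only:) (intro sin_poly.scale sin_poly.add sin_poly_sin_diff sin_poly.sin)
next
  case (add f g)
  then show ?case using sin_poly.add[OF add.IH] by (simp add: distrib_left)
next
  case (scale f c)
  then show ?case using sin_poly.scale[OF scale.IH, of c] by (simp add: mult.left_commute)
qed

lemma cos_poly_mult_sin_poly: "cos_poly f \<Longrightarrow> sin_poly g \<Longrightarrow> sin_poly (\<lambda>t. f t * g t)"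
proof (induction rule: cos_poly.induct)
  case (cos j)
  then show ?case by (intro cos_mult_sin_poly)
next
  case (add f f')
  then show ?case using sin_poly.add[OF add.IH] by (simp add: distrib_right)
next
  case (scale f c)
  then show ?case using sin_poly.scale[OF scale.IH, of c] by (simp add: mult.assoc)
qed

lemma sin_poly_odd_power: "sin_poly f \<Longrightarrow> sin_poly (\<lambda>t. f t ^ (2 * i + 1))"
proof (induction i)
  case (Suc i)
  have "sin_poly (\<lambda>t. (f t * f t) * f t ^ (2 * i + 1))"
    by (intro cos_poly_mult_sin_poly sin_poly_mult Suc)
  then show ?case by (simp add: mult.assoc)
qed simp

lemma sin_poly_0: "sin_poly (\<lambda>t. 0)"
  using sin_poly.sin[of 0] by simp

lemma sin_poly_sum: "(\<And>i. i \<in> I \<Longrightarrow> sin_poly (f i)) \<Longrightarrow> sin_poly (\<lambda>t. \<Sum>i\<in>I. f i t)"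
  by (induction I rule: infinite_finite_induct) (auto intro: sin_poly_0 sin_poly.add)

text \<open>The cut-off at \<open>J\<close> lets all longer sums represent the same function, so that one choice of
  coefficients can be compared with every later partial sum of a series.\<close>
lemma sin_poly_coefficients:
  "sin_poly f \<Longrightarrow> \<exists>J c. \<forall>K\<ge>J. \<forall>t. f t = (\<Sum>j<K. (if j < J then c j else 0) * sin (real (Suc j) * t))"
proof (induction rule: sin_poly.induct)
  case (sin i)
  show ?case
  proof (cases i)
    case 0
    then show ?thesis by (intro exI[of _ 0]) simp
  next
    case (Suc i')
    have "sin (real i * t) = (\<Sum>j<K. (if j < i then (if j = i' then 1 else 0) else 0) * sin (real (Suc j) * t))" if "K \<ge> i" for K t
    proof -
      have "(\<Sum>j<K. (if j < i then (if j = i' then 1 else 0) else 0) * sin (real (Suc j) * t))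
        = (\<Sum>j<K. if j = i' then sin (real i * t) else 0)"
        by (rule sum.cong) (auto simp: Suc)
      then show ?thesis using that by (simp add: Suc)
    qed
    then show ?thesis by (intro exI[of _ i] exI[of _ "\<lambda>j. if j = i' then 1 else 0"] allI impI)
  qed
next
  case (add f g)
  then obtain J c J' c' where f: "\<And>K t. K \<ge> J \<Longrightarrow> f t = (\<Sum>j<K. (if j < J then c j else 0) * sin (real (Suc j) * t))"
    and g: "\<And>K t. K \<ge> J' \<Longrightarrow> g t = (\<Sum>j<K. (if j < J' then c' j else 0) * sin (real (Suc j) * t))" by blast
  have "f t + g t = (\<Sum>j<K. (if j < max J J' then (if j < J then c j else 0) + (if j < J' then c' j else 0) else 0) * sin (real (Suc j) * t))"
    if "K \<ge> max J J'" for K t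
  proof -
    have "f t + g t = (\<Sum>j<K. (if j < J then c j else 0) * sin (real (Suc j) * t) + (if j < J' then c' j else 0) * sin (real (Suc j) * t))"
      using f[of K t] g[of K t] that by (simp add: sum.distrib)
    also have "\<dots> = (\<Sum>j<K. (if j < max J J' then (if j < J then c j else 0) + (if j < J' then c' j else 0) else 0) * sin (real (Suc j) * t))"
      by (rule sum.cong) (auto simp: distrib_right)
    finally show ?thesis .
  qed
  then show ?case
    by (intro exI[of _ "max J J'"] exI[of _ "\<lambda>j. (if j < J then c j else 0) + (if j < J' then c' j else 0)"] allI impI)
next
  case (scale f a)
  then obtain J c where f: "\<And>K t. K \<ge> J \<Longrightarrow> f t = (\<Sum>j<K. (if j < J then c j else 0) * sin (real (Suc j) * t))" by blast
  have "a * f t = (\<Sum>j<K. (if j < J then a * c j else 0) * sin (real (Suc j) * t))" if "K \<ge> J" for K t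
    using f[OF that, of t] by (simp add: sum_distrib_left) (intro sum.cong, auto)
  then show ?case by (intro exI[of _ J] exI[of _ "\<lambda>j. a * c j"] allI impI)
qed

lemma half_of_sum_less: "T = X / 2 \<Longrightarrow> a < e / 2 \<Longrightarrow> b < e / 2 \<Longrightarrow> X \<le> a + b \<Longrightarrow> T < e / (2::real)"
  by linarith

text \<open>The function \<open>g\<close> is approximated by a polynomial on an interval around the values of \<open>f\<close>.  Since
  \<open>g\<close> is odd, the odd part of the polynomial is as close to it, and odd polynomials map sums of sines
  to sums of sines.\<close>
lemma odd_continuous_approx:
  fixes g f :: "real \<Rightarrow> real"
  assumes g: "continuous_on UNIV g" and odd: "\<And>t. g (- t) = - g t"
    and M: "\<And>t. \<bar>f t\<bar> \<le> M" and fJ: "\<And>J. sin_poly (fJ J)"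
    and lim: "uniform_limit UNIV fJ f sequentially" and eps: "\<epsilon> > 0"
  shows "\<exists>p. sin_poly p \<and> (\<forall>t. \<bar>g (f t) - p t\<bar> < \<epsilon>)"
proof -
  let ?K = "{- (M + 1)..M + 1}"
  have "uniformly_continuous_on ?K g"
    using g by (intro compact_uniformly_continuous) (auto intro: continuous_on_subset)
  then obtain \<delta> where d: "\<delta> > 0" "\<And>x y. x \<in> ?K \<Longrightarrow> y \<in> ?K \<Longrightarrow> dist y x < \<delta> \<Longrightarrow> dist (g y) (g x) < \<epsilon> / 2"
    using eps unfolding uniformly_continuous_on_def by (metis half_gt_zero)
  have "\<forall>\<^sub>F J in sequentially. \<forall>t\<in>UNIV. dist (fJ J t) (f t) < min \<delta> 1"
    using lim d(1) by (intro uniform_limitD) auto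
  then obtain J where J: "\<And>t. dist (fJ J t) (f t) < min \<delta> 1" using eventually_happens by fastforce
  obtain P where P: "real_polynomial_function P" "\<And>t. t \<in> ?K \<Longrightarrow> \<bar>g t - P t\<bar> < \<epsilon> / 2"
    using Stone_Weierstrass_real_polynomial_function[of ?K g "\<epsilon> / 2"] g eps continuous_on_subset
    by (metis compact_Icc half_gt_zero subset_UNIV)
  obtain a n where a: "P = (\<lambda>x. \<Sum>i\<le>n. a i * x ^ i)" using P(1) real_polynomial_function_iff_sum by blast
  \<comment> \<open>The odd part of the polynomial.\<close>
  define Po where "Po = (\<lambda>x. (P x - P (- x)) / 2)"
  have Po: "Po x = (\<Sum>i\<le>n. if odd i then a i * x ^ i else 0)" for x
    unfolding Po_def a sum_subtractf[symmetric] sum_divide_distrib by (rule sum.cong) auto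
  define p where "p = (\<lambda>t. Po (fJ J t))"
  have "sin_poly (\<lambda>t. \<Sum>i\<le>n. if odd i then a i * fJ J t ^ i else 0)"
  proof (rule sin_poly_sum)
    fix i
    show "sin_poly (\<lambda>t. if odd i then a i * fJ J t ^ i else 0)"
    proof (cases "odd i")
      case True
      then obtain l where "i = 2 * l + 1" by (elim oddE)
      then show ?thesis using sin_poly.scale[OF sin_poly_odd_power[OF fJ]] by simp
    qed (simp add: sin_poly_0)
  qed
  then have "sin_poly p" by (simp add: p_def Po)
  moreover have "\<bar>g (f t) - p t\<bar> < \<epsilon>" for t
  proof -
    have fd: "\<bar>fJ J t - f t\<bar> < \<delta>" "\<bar>fJ J t - f t\<bar> < 1" using J[of t] by (auto simp: dist_real_def)
    have k: "f t \<in> ?K" "fJ J t \<in> ?K" "- fJ J t \<in> ?K" using M[of t] fd(2) by auto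
    have 1: "\<bar>g (fJ J t) - g (f t)\<bar> < \<epsilon> / 2" using d(2)[OF k(1,2)] fd(1) by (simp add: dist_real_def)
    have 2: "\<bar>g (fJ J t) - P (fJ J t)\<bar> < \<epsilon> / 2" "\<bar>g (- fJ J t) - P (- fJ J t)\<bar> < \<epsilon> / 2" using P(2) k by auto
    have "g (fJ J t) - Po (fJ J t) = ((g (fJ J t) - P (fJ J t)) - (g (- fJ J t) - P (- fJ J t))) / 2"
      unfolding odd Po_def by (simp add: field_simps)
    then have "\<bar>g (fJ J t) - Po (fJ J t)\<bar> = \<bar>(g (fJ J t) - P (fJ J t)) - (g (- fJ J t) - P (- fJ J t))\<bar> / 2"
      by (simp only: abs_divide abs_numeral)
    then have "\<bar>g (fJ J t) - Po (fJ J t)\<bar> < \<epsilon> / 2"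
      using 2 abs_triangle_ineq4 half_of_sum_less by blast
    then show ?thesis using 1 unfolding p_def by linarith
  qed
  ultimately show ?thesis by blast
qed

section \<open>The weighted cylinder\<close>

lemma sigma_finite_nu: "sigma_finite_measure (nu s)"
proof -
  interpret R: sigma_finite_measure "restrict_space lborel {0<..} :: real measure"
    by (rule sigma_finite_measure_restrict_space[OF sigma_finite_lborel]) simp
  show ?thesis
    unfolding nu_def
    by (subst R.sigma_finite_iff_density_finite) (auto intro!: measurable_restrict_space1)
qed

lemma sigma_finite_cell: "sigma_finite_measure cell"
  by (rule finite_measure.axioms(1)[OF finite_measure_cell])

interpretation cn: pair_sigma_finite cell "nu s"
  by (intro pair_sigma_finite.intro sigma_finite_cell sigma_finite_nu)

lemma sets_nu: "sets (nu s) = sets (restrict_space borel {0<..})"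
  by (simp add: nu_def) (intro sets_restrict_space_cong, simp)

lemma sets_cell: "sets cell = sets (restrict_space borel cube)"
  unfolding cell_def by (intro sets_restrict_space_cong) simp

lemma sets_cell_nu: "sets (cell \<Otimes>\<^sub>M nu s) = sets (restrict_space borel (cube \<times> {0<..}))"
proof (intro equalityI subsetI)
  let ?R = "restrict_space borel (cube \<times> {0<..}) :: ((real^3) \<times> real) measure"
  have sp: "space (cell \<Otimes>\<^sub>M nu s) = cube \<times> {0<..}" by (simp add: space_pair_measure space_cell space_nu)
  fix X assume X: "X \<in> sets (cell \<Otimes>\<^sub>M nu s)"
  have "(\<lambda>z. (fst z, snd z)) \<in> measurable ?R (cell \<Otimes>\<^sub>M nu s)"
  proof (rule measurable_Pair)
    have "fst \<in> measurable ?R (restrict_space borel cube)"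
      by (rule measurable_restrict_space2) (auto simp: space_restrict_space intro!: measurable_restrict_space1 borel_measurable_continuous_onI continuous_intros)
    then show "fst \<in> measurable ?R cell" using measurable_cong_sets[OF refl sets_cell] by blast
    have "snd \<in> measurable ?R (restrict_space borel {0<..})"
      by (rule measurable_restrict_space2) (auto simp: space_restrict_space intro!: measurable_restrict_space1 borel_measurable_continuous_onI continuous_intros)
    then show "snd \<in> measurable ?R (nu s)" using measurable_cong_sets[OF refl sets_nu] by blast
  qed
  then have "(\<lambda>z. (fst z, snd z)) -` X \<inter> space ?R \<in> sets ?R" using X by (rule measurable_sets)
  moreover have "(\<lambda>z. (fst z, snd z)) -` X \<inter> space ?R = X"
    using sets.sets_into_space[OF X] by (auto simp: sp space_restrict_space)
  ultimately show "X \<in> sets ?R" by simp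
next
  let ?R = "restrict_space borel (cube \<times> {0<..}) :: ((real^3) \<times> real) measure"
  have sp: "space (cell \<Otimes>\<^sub>M nu s) = cube \<times> {0<..}" by (simp add: space_pair_measure space_cell space_nu)
  fix X assume "X \<in> sets ?R"
  then obtain Y where Y: "Y \<in> sets (borel :: ((real^3) \<times> real) measure)" "X = (cube \<times> {0<..}) \<inter> Y"
    by (auto simp: sets_restrict_space)
  have "(\<lambda>z. (fst z, snd z)) \<in> measurable (cell \<Otimes>\<^sub>M nu s) (borel \<Otimes>\<^sub>M borel)"
    by (intro measurable_Pair measurable_compose[OF measurable_fst measurable_cell] measurable_compose[OF measurable_snd measurable_nu])
      (auto intro: measurable_ident_sets)
  then have "(\<lambda>z. (fst z, snd z)) -` Y \<inter> space (cell \<Otimes>\<^sub>M nu s) \<in> sets (cell \<Otimes>\<^sub>M nu s)"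
    using Y(1) by (intro measurable_sets) (auto simp: borel_prod)
  moreover have "(\<lambda>z. (fst z, snd z)) -` Y \<inter> space (cell \<Otimes>\<^sub>M nu s) = X" by (auto simp: sp Y(2))
  ultimately show "X \<in> sets (cell \<Otimes>\<^sub>M nu s)" by simp
qed

text \<open>Both measures agree on rectangles; this makes Fubini's theorem available on the weighted cylinder.\<close>
lemma weighted_eq: "weighted s = cell \<Otimes>\<^sub>M nu s"
proof (rule sym, rule pair_measure_eqI[OF sigma_finite_cell sigma_finite_nu])
  have "sets (weighted s) = sets (restrict_space lborel (cube \<times> {0<..}) :: ((real^3) \<times> real) measure)"
    by (simp add: weighted_def)
  also have "\<dots> = sets (restrict_space borel (cube \<times> {0<..}))" by (intro sets_restrict_space_cong) simp
  finally show "sets (cell \<Otimes>\<^sub>M nu s) = sets (weighted s)" by (simp add: sets_cell_nu)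
  fix A B assume A: "A \<in> sets cell" and B: "B \<in> sets (nu s)"
  let ?w = "\<lambda>y :: real. ennreal (y powr (1 - 2 * s))"
  have A': "A \<subseteq> cube" "A \<in> sets borel"
    using A sets_restrict_space_iff[of cube borel A] by (auto simp: sets_cell)
  have B': "B \<subseteq> {0<..}" "B \<in> sets borel"
    using B sets_restrict_space_iff[of "{0<..}" borel B] by (auto simp: sets_nu)
  have "emeasure (weighted s) (A \<times> B) = (\<integral>\<^sup>+z. ?w (snd z) * indicator (A \<times> B) z \<partial>restrict_space lborel (cube \<times> {0<..}))"
    unfolding weighted_def
  proof (rule emeasure_density)
    show "(\<lambda>z. ennreal (snd z powr (1 - 2 * s))) \<in> borel_measurable (restrict_space lborel (cube \<times> {0<..}) :: ((real^3) \<times> real) measure)"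
    proof (rule measurable_restrict_space1)
      have "(\<lambda>y. ennreal (y powr (1 - 2 * s))) \<in> borel_measurable borel" by measurable
      moreover have "(snd :: (real^3) \<times> real \<Rightarrow> real) \<in> borel_measurable lborel"
        by (simp add: borel_measurable_continuous_onI continuous_intros)
      ultimately show "(\<lambda>z. ennreal (snd z powr (1 - 2 * s))) \<in> borel_measurable (lborel :: ((real^3) \<times> real) measure)"
        using measurable_compose by blast
    qed
    have "A \<times> B \<in> sets (cell \<Otimes>\<^sub>M nu s)" using A B by simp
    then show "A \<times> B \<in> sets (restrict_space lborel (cube \<times> {0<..}))"
      using sets_cell_nu[of s] sets_restrict_space_cong[of lborel borel "cube \<times> {0<..}"] by simp
  qed
  also have "\<dots> = (\<integral>\<^sup>+z. ?w (snd z) * indicator (A \<times> B) z * indicator (cube \<times> {0<..}) z \<partial>lborel)"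
    by (subst nn_integral_restrict_space) (auto intro!: borel_Times)
  also have "\<dots> = (\<integral>\<^sup>+z. indicator A (fst z) * (?w (snd z) * indicator B (snd z)) \<partial>lborel)"
    using A' B' by (intro nn_integral_cong) (auto simp: indicator_def)
  also have "\<dots> = (\<integral>\<^sup>+z. indicator A (fst z) * (?w (snd z) * indicator B (snd z)) \<partial>(lborel \<Otimes>\<^sub>M lborel))"
    by (simp add: lborel_prod)
  also have "\<dots> = (\<integral>\<^sup>+x. \<integral>\<^sup>+y. indicator A x * (?w y * indicator B y) \<partial>lborel \<partial>lborel)"
    using A' B' by (subst lborel.nn_integral_fst[symmetric]) auto
  also have "\<dots> = (\<integral>\<^sup>+x. indicator A x * (\<integral>\<^sup>+y. ?w y * indicator B y \<partial>lborel) \<partial>lborel)"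
    using B' by (subst nn_integral_cmult) auto
  also have "\<dots> = emeasure lborel A * (\<integral>\<^sup>+y. ?w y * indicator B y \<partial>lborel)"
    using A' by (subst nn_integral_multc) auto
  also have "emeasure lborel A = emeasure cell A"
    using A' unfolding cell_def by (subst emeasure_restrict_space) auto
  also have "(\<integral>\<^sup>+y. ?w y * indicator B y \<partial>lborel) = emeasure (nu s) B"
  proof -
    have "emeasure (nu s) B = (\<integral>\<^sup>+y. ?w y * indicator B y \<partial>restrict_space lborel {0<..})"
      unfolding nu_def using B by (intro emeasure_density) (auto intro!: measurable_restrict_space1 simp: nu_def)
    also have "\<dots> = (\<integral>\<^sup>+y. ?w y * indicator B y * indicator {0<..} y \<partial>lborel)"
      by (subst nn_integral_restrict_space) auto
    also have "\<dots> = (\<integral>\<^sup>+y. ?w y * indicator B y \<partial>lborel)"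
      using B' by (intro nn_integral_cong) (auto simp: indicator_def)
    finally show ?thesis by simp
  qed
  finally show "emeasure cell A * emeasure (nu s) B = emeasure (weighted s) (A \<times> B)" by simp
qed

lemma space_weighted: "space (weighted s) = cube \<times> {0<..}"
  by (simp add: weighted_eq space_pair_measure space_cell space_nu)

lemma integral_weighted:
  fixes f :: "(real^3) \<times> real \<Rightarrow> real"
  assumes "integrable (weighted s) f"
  shows "(LINT z|weighted s. f z) = (LINT x|cell. LINT y|nu s. f (x, y))"
    "(LINT z|weighted s. f z) = (LINT y|nu s. LINT x|cell. f (x, y))"
    "AE x in cell. integrable (nu s) (\<lambda>y. f (x, y))"
    "integrable cell (\<lambda>x. LINT y|nu s. f (x, y))"
proof -
  have f: "integrable (cell \<Otimes>\<^sub>M nu s) f" using assms by (simp add: weighted_eq)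
  then have f': "integrable (cell \<Otimes>\<^sub>M nu s) (case_prod (\<lambda>x y. f (x, y)))" by simp
  show "(LINT z|weighted s. f z) = (LINT x|cell. LINT y|nu s. f (x, y))"
    using cn.integral_fst[OF f'] by (simp add: weighted_eq)
  show "(LINT z|weighted s. f z) = (LINT y|nu s. LINT x|cell. f (x, y))"
    using cn.integral_snd[OF f'] by (simp add: weighted_eq)
  show "AE x in cell. integrable (nu s) (\<lambda>y. f (x, y))"
    using cn.AE_integrable_fst[OF f'] by simp
  show "integrable cell (\<lambda>x. LINT y|nu s. f (x, y))"
    using cn.integrable_fst[OF f'] by simp
qed

lemma square_integrable_tensor:
  fixes a :: "real^3 \<Rightarrow> real" and b :: "real \<Rightarrow> real"
  assumes a: "square_integrable cell a" and b: "square_integrable (nu s) b"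
  shows "square_integrable (weighted s) (\<lambda>z. a (fst z) * b (snd z))"
    "(LINT z|weighted s. (a (fst z) * b (snd z))\<^sup>2) = (LINT x|cell. (a x)\<^sup>2) * (LINT y|nu s. (b y)\<^sup>2)"
proof -
  have m: "(\<lambda>z. a (fst z) * b (snd z)) \<in> borel_measurable (cell \<Otimes>\<^sub>M nu s)"
    using square_integrable_measurable[OF a] square_integrable_measurable[OF b]
    by (intro borel_measurable_times measurable_compose[OF measurable_fst] measurable_compose[OF measurable_snd])
  have ia: "integrable cell (\<lambda>x. (a x)\<^sup>2)" and ib: "integrable (nu s) (\<lambda>y. (b y)\<^sup>2)"
    using a b by (auto intro: square_integrable_real)
  have "integrable (cell \<Otimes>\<^sub>M nu s) (\<lambda>(x, y). (a x)\<^sup>2 * (b y)\<^sup>2)"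
  proof (rule cn.Fubini_integrable)
    show "(\<lambda>(x, y). (a x)\<^sup>2 * (b y)\<^sup>2) \<in> borel_measurable (cell \<Otimes>\<^sub>M nu s)"
      using square_integrable_measurable[OF a] square_integrable_measurable[OF b]
      unfolding split_beta
      by (intro borel_measurable_times borel_measurable_power measurable_compose[OF measurable_fst] measurable_compose[OF measurable_snd])
    show "integrable cell (\<lambda>x. LINT y|nu s. norm (case (x, y) of (x, y) \<Rightarrow> (a x)\<^sup>2 * (b y)\<^sup>2))"
      using ia by (simp add: abs_mult)
    show "AE x in cell. integrable (nu s) (\<lambda>y. case (x, y) of (x, y) \<Rightarrow> (a x)\<^sup>2 * (b y)\<^sup>2)"
      using ib by simp
  qed
  then have int: "integrable (weighted s) (\<lambda>z. (a (fst z) * b (snd z))\<^sup>2)"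
    by (simp add: weighted_eq case_prod_unfold power_mult_distrib)
  show "square_integrable (weighted s) (\<lambda>z. a (fst z) * b (snd z))"
    using m int by (simp add: square_integrable_def weighted_eq)
  show "(LINT z|weighted s. (a (fst z) * b (snd z))\<^sup>2) = (LINT x|cell. (a x)\<^sup>2) * (LINT y|nu s. (b y)\<^sup>2)"
    using integral_weighted(1)[OF int] by (simp add: power_mult_distrib)
qed

section \<open>Smooth periodic functions on the half space\<close>

abbreviation half_space :: "((real^3) \<times> real) set" where
  "half_space \<equiv> UNIV \<times> {0..}"

lemma half_space_at: "snd z > 0 \<Longrightarrow> at z within half_space = at z"
proof -
  assume z: "snd z > 0"
  have "open (UNIV \<times> {0<..} :: ((real^3) \<times> real) set)" by (intro open_Times) auto
  moreover have "z \<in> UNIV \<times> {0<..}" using z by (cases z) auto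
  moreover have "(UNIV \<times> {0<..} :: ((real^3) \<times> real) set) \<subseteq> half_space" by auto
  ultimately show ?thesis by (meson at_within_open_subset)
qed

lemma gradient_eq:
  fixes f :: "(real^3) \<times> real \<Rightarrow> real"
  assumes "(f has_derivative (\<lambda>h. \<Sum>b\<in>Basis. (h \<bullet> b) * D b)) (at z)"
  shows "gradient f z = (\<Sum>b\<in>Basis. D b *\<^sub>R b)"
proof -
  have "frechet_derivative f (at z) = (\<lambda>h. \<Sum>b\<in>Basis. (h \<bullet> b) * D b)"
    using frechet_derivative_at[OF assms] by simp
  moreover have "(\<Sum>b'\<in>Basis. (b \<bullet> b') * D b') = D b" if "b \<in> Basis" for b
    using that by (simp add: inner_Basis if_distrib[of "\<lambda>x. x * _"] cong: if_cong)
  ultimately show ?thesis unfolding gradient_def by (simp cong: sum.cong)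
qed

text \<open>What is used of a smooth periodic function: a field \<open>G\<close>, continuous up to the boundary, that is
  its gradient in the interior.\<close>
lemma smooth_periodic_classical:
  assumes "\<phi> \<in> smooth_periodic s"
  obtains G where "continuous_on half_space \<phi>" "continuous_on half_space G"
    "\<And>z. snd z > 0 \<Longrightarrow> gradient \<phi> z = G z"
    "\<And>x y i t. y > 0 \<Longrightarrow> ((\<lambda>t. \<phi> (x + t *\<^sub>R axis i 1, y)) has_real_derivative fst (G (x + t *\<^sub>R axis i 1, y)) $ i) (at t)"
    "\<And>x y. y > 0 \<Longrightarrow> ((\<lambda>y. \<phi> (x, y)) has_real_derivative snd (G (x, y))) (at y)"
    "\<And>x y i. y \<ge> 0 \<Longrightarrow> \<phi> (x + (2 * pi) *\<^sub>R axis i 1, y) = \<phi> (x, y)"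
proof -
  from assms obtain D where D0: "D [] = \<phi>"
    and D: "\<And>bs z. set bs \<subseteq> Basis \<Longrightarrow> z \<in> half_space \<Longrightarrow>
      (D bs has_derivative (\<lambda>h. \<Sum>b\<in>Basis. (h \<bullet> b) * D (b # bs) z)) (at z within half_space)"
    and per: "\<And>y. y \<ge> 0 \<Longrightarrow> periodic (\<lambda>x. \<phi> (x, y))"
    unfolding smooth_periodic_def smooth_on_def by blast
  define G where "G = (\<lambda>z. \<Sum>b\<in>Basis. D [b] z *\<^sub>R b)"
  have cont: "continuous_on half_space (D bs)" if "set bs \<subseteq> Basis" for bs
    using D[OF that] has_derivative_continuous unfolding continuous_on_eq_continuous_within by blast
  have der: "(\<phi> has_derivative (\<lambda>h. \<Sum>b\<in>Basis. (h \<bullet> b) * D [b] z)) (at z)" if "snd z > 0" for z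
    using D[of "[]" z] that half_space_at[OF that] by (simp add: D0 mem_Times_iff)
  have G: "gradient \<phi> z = G z" if "snd z > 0" for z
    unfolding G_def by (rule gradient_eq[OF der[OF that]])
  have Gb: "G z \<bullet> b = D [b] z" if "b \<in> Basis" for z b
    unfolding G_def using that by (simp add: inner_sum_left inner_Basis if_distrib[of "\<lambda>x. _ * x"] cong: if_cong)
  have dir: "((\<lambda>t. \<phi> (z0 + t *\<^sub>R b)) has_real_derivative G (z0 + t *\<^sub>R b) \<bullet> b) (at t)"
    if "snd (z0 + t *\<^sub>R b) > 0" "b \<in> Basis" for z0 t b
  proof -
    have "((\<lambda>t. z0 + t *\<^sub>R b) has_derivative (\<lambda>h. h *\<^sub>R b)) (at t)"
      by (auto intro!: derivative_eq_intros)
    from has_derivative_compose[OF this der[OF that(1)]]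
    have "((\<lambda>t. \<phi> (z0 + t *\<^sub>R b)) has_derivative (\<lambda>h. \<Sum>b'\<in>Basis. ((h *\<^sub>R b) \<bullet> b') * D [b'] (z0 + t *\<^sub>R b))) (at t)" .
    moreover have "(\<Sum>b'\<in>Basis. ((h *\<^sub>R b) \<bullet> b') * D [b'] (z0 + t *\<^sub>R b)) = G (z0 + t *\<^sub>R b) \<bullet> b * h" for h
      using that(2) by (simp add: Gb inner_Basis if_distrib[of "\<lambda>x. x * _"] if_distrib[of "\<lambda>x. _ * x"] cong: if_cong)
    ultimately show ?thesis by (simp add: has_field_derivative_def)
  qed
  have bx: "(axis i 1, 0) \<in> (Basis :: ((real^3) \<times> real) set)" for i by (auto simp: Basis_prod_def Basis_vec_def)
  have bz: "(0, 1) \<in> (Basis :: ((real^3) \<times> real) set)" by (auto simp: Basis_prod_def)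
  show ?thesis
  proof (rule that[of G])
    show "continuous_on half_space \<phi>" using cont[of "[]"] by (simp add: D0)
    show "continuous_on half_space G" unfolding G_def by (intro continuous_intros cont) auto
    show "gradient \<phi> z = G z" if "snd z > 0" for z by (rule G[OF that])
    show "((\<lambda>t. \<phi> (x + t *\<^sub>R axis i 1, y)) has_real_derivative fst (G (x + t *\<^sub>R axis i 1, y)) $ i) (at t)" if "y > 0" for x y i t
      using dir[of "(x, y)" t "(axis i 1, 0)"] that bx by (simp add: inner_prod_def inner_axis)
    show "((\<lambda>y. \<phi> (x, y)) has_real_derivative snd (G (x, y))) (at y)" if "y > 0" for x y
      using dir[of "(x, 0)" y "(0, 1)"] that bz by (simp add: inner_prod_def)
    show "\<phi> (x + (2 * pi) *\<^sub>R axis i 1, y) = \<phi> (x, y)" if "y \<ge> 0" for x y i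
      using per[OF that] by (auto simp: periodic_def)
  qed
qed

lemma smooth_on_lincomb:
  assumes "smooth_on S f" "smooth_on S g"
  shows "smooth_on S (\<lambda>z. a * f z + b * g z)"
proof -
  from assms obtain D E where D: "D [] = f" "\<And>bs z. set bs \<subseteq> Basis \<Longrightarrow> z \<in> S \<Longrightarrow>
      (D bs has_derivative (\<lambda>h. \<Sum>b\<in>Basis. (h \<bullet> b) * D (b # bs) z)) (at z within S)"
    and E: "E [] = g" "\<And>bs z. set bs \<subseteq> Basis \<Longrightarrow> z \<in> S \<Longrightarrow>
      (E bs has_derivative (\<lambda>h. \<Sum>b\<in>Basis. (h \<bullet> b) * E (b # bs) z)) (at z within S)"
    unfolding smooth_on_def by blast
  show ?thesis
    unfolding smooth_on_def
  proof (intro exI[of _ "\<lambda>bs z. a * D bs z + b * E bs z"] conjI allI impI ballI)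
    fix bs :: "'a list" and z assume "set bs \<subseteq> Basis" "z \<in> S"
    then have "((\<lambda>z. a * D bs z + b * E bs z) has_derivative
      (\<lambda>h. a * (\<Sum>b\<in>Basis. (h \<bullet> b) * D (b # bs) z) + b * (\<Sum>b\<in>Basis. (h \<bullet> b) * E (b # bs) z))) (at z within S)"
      by (intro has_derivative_add has_derivative_mult_right D(2) E(2))
    then show "((\<lambda>z. a * D bs z + b * E bs z) has_derivative
      (\<lambda>h. \<Sum>c\<in>Basis. (h \<bullet> c) * (a * D (c # bs) z + b * E (c # bs) z))) (at z within S)"
      by (rule has_derivative_eq_rhs) (auto simp: sum_distrib_left sum.distrib[symmetric] algebra_simps intro!: ext sum.cong)
  qed (simp add: D(1) E(1))
qed

lemma smooth_on_differentiable:
  assumes "smooth_on half_space f" "snd z > 0"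
  shows "f differentiable (at z)"
proof -
  from assms(1) obtain D where D0: "D [] = f"
    and D: "\<And>bs z. set bs \<subseteq> Basis \<Longrightarrow> z \<in> half_space \<Longrightarrow>
      (D bs has_derivative (\<lambda>h. \<Sum>b\<in>Basis. (h \<bullet> b) * D (b # bs) z)) (at z within half_space)"
    unfolding smooth_on_def by blast
  show ?thesis using D[of "[]" z] assms(2) half_space_at[OF assms(2)]
    by (auto simp: D0 mem_Times_iff differentiable_def)
qed

lemma gradient_lincomb:
  fixes f g :: "(real^3) \<times> real \<Rightarrow> real"
  assumes "f differentiable (at z)" "g differentiable (at z)"
  shows "gradient (\<lambda>z. a * f z + b * g z) z = a *\<^sub>R gradient f z + b *\<^sub>R gradient g z"
proof -
  have "((\<lambda>z. a * f z + b * g z) has_derivative (\<lambda>h. a * frechet_derivative f (at z) h + b * frechet_derivative g (at z) h)) (at z)"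
    using assms by (intro has_derivative_add has_derivative_mult_right) (auto simp: frechet_derivative_works)
  then have "frechet_derivative (\<lambda>z. a * f z + b * g z) (at z) = (\<lambda>h. a * frechet_derivative f (at z) h + b * frechet_derivative g (at z) h)"
    by (rule frechet_derivative_at[symmetric])
  then show ?thesis
    by (simp add: gradient_def scaleR_add_left sum.distrib scaleR_sum_right)
qed

text \<open>The triple \<open>(c, i, l)\<close> encodes the iterated derivative of \<open>wave k d x * v y\<close> as \<open>c\<close> times the wave
  with its phase shifted by \<open>i * pi / 2\<close> times the \<open>l\<close>-th derivative of \<open>v\<close>.\<close>
primrec wave_iter :: "int^3 \<Rightarrow> ((real^3) \<times> real) list \<Rightarrow> real \<times> nat \<times> nat" where
  "wave_iter k [] = (1, 0, 0)"
| "wave_iter k (b # bs) = (case wave_iter k bs of (c, i, l) \<Rightarrow>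
     if snd b = 0 then (c * (freq k \<bullet> fst b), Suc i, l) else (c, i, Suc l))"

lemma wave_has_derivative:
  "(wave k d has_derivative (\<lambda>h. (freq k \<bullet> h) * wave k (d + pi / 2) x)) (at x)"
proof -
  have "cos (freq k \<bullet> x + (d + pi / 2)) = - sin (freq k \<bullet> x + d)"
    using cos_add[of "freq k \<bullet> x + d" "pi / 2"] by (simp add: algebra_simps)
  then show ?thesis
    unfolding wave_def[abs_def] by (auto intro!: derivative_eq_intros)
qed

lemma sum_Basis_prod:
  fixes f :: "'a::euclidean_space \<times> 'b::euclidean_space \<Rightarrow> real"
  shows "(\<Sum>b\<in>Basis. f b) = (\<Sum>b\<in>Basis. f (b, 0)) + (\<Sum>b\<in>Basis. f (0, b))"
  unfolding Basis_prod_def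
  by (subst sum.union_disjoint) (auto simp: sum.reindex inj_on_def)

lemma smooth_on_wave_times:
  fixes vd :: "nat \<Rightarrow> real \<Rightarrow> real"
  assumes vd: "\<And>l y. y \<ge> 0 \<Longrightarrow> (vd l has_real_derivative vd (Suc l) y) (at y)"
  shows "smooth_on half_space (\<lambda>z. wave k d (fst z) * vd 0 (snd z))"
proof -
  define D where "D = (\<lambda>bs (z :: (real^3) \<times> real). case wave_iter k bs of (c, i, l) \<Rightarrow>
     c * (wave k (d + real i * (pi / 2)) (fst z) * vd l (snd z)))"
  have "(D bs has_derivative (\<lambda>h. \<Sum>b\<in>Basis. (h \<bullet> b) * D (b # bs) z)) (at z within half_space)"
    if z: "z \<in> half_space" for bs z
  proof -
    obtain c i l where w: "wave_iter k bs = (c, i, l)" by (cases "wave_iter k bs") auto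
    let ?d = "d + real i * (pi / 2)"
    have y: "snd z \<ge> 0" using z by auto
    have 1: "((\<lambda>z :: (real^3) \<times> real. wave k ?d (fst z)) has_derivative (\<lambda>h. (freq k \<bullet> fst h) * wave k (?d + pi / 2) (fst z))) (at z within half_space)"
      by (rule has_derivative_compose[OF has_derivative_fst[OF has_derivative_ident] wave_has_derivative])
    have 2: "((\<lambda>z :: (real^3) \<times> real. vd l (snd z)) has_derivative (\<lambda>h. vd (Suc l) (snd z) * snd h)) (at z within half_space)"
      using has_derivative_compose[OF has_derivative_snd[OF has_derivative_ident] vd[OF y, of l, unfolded has_field_derivative_def]] .
    have "(D bs has_derivative (\<lambda>h. c * (wave k ?d (fst z) * (vd (Suc l) (snd z) * snd h) + (freq k \<bullet> fst h) * wave k (?d + pi / 2) (fst z) * vd l (snd z)))) (at z within half_space)"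
      unfolding D_def w prod.case by (intro has_derivative_mult_right has_derivative_mult 1 2)
    moreover have "c * (wave k ?d (fst z) * (vd (Suc l) (snd z) * snd h) + (freq k \<bullet> fst h) * wave k (?d + pi / 2) (fst z) * vd l (snd z))
      = (\<Sum>b\<in>Basis. (h \<bullet> b) * D (b # bs) z)" for h :: "(real^3) \<times> real"
    proof -
      have "(\<Sum>b\<in>(Basis :: ((real^3) \<times> real) set). (h \<bullet> b) * D (b # bs) z)
        = (\<Sum>b\<in>Basis. (h \<bullet> (b, 0)) * D ((b, 0) # bs) z) + (\<Sum>b\<in>Basis. (h \<bullet> (0, b)) * D ((0, b) # bs) z)"
        by (rule sum_Basis_prod)
      also have "(\<Sum>b\<in>Basis. (h \<bullet> (b, 0)) * D ((b, 0) # bs) z)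
        = (\<Sum>b\<in>Basis. (fst h \<bullet> b) * (freq k \<bullet> b)) * (c * (wave k (?d + pi / 2) (fst z) * vd l (snd z)))"
      proof -
        have e: "d + real (Suc i) * (pi / 2) = ?d + pi / 2" by (simp add: algebra_simps)
        have "(h \<bullet> (b, 0)) * D ((b, 0) # bs) z = (fst h \<bullet> b) * (freq k \<bullet> b) * (c * (wave k (?d + pi / 2) (fst z) * vd l (snd z)))" for b
          unfolding e[symmetric] by (simp add: D_def w inner_prod_def del: of_nat_Suc)
        then show ?thesis by (simp only: sum_distrib_right)
      qed
      also have "(\<Sum>b\<in>Basis. (fst h \<bullet> b) * (freq k \<bullet> b)) = freq k \<bullet> fst h"
        by (simp add: euclidean_inner[of "freq k" "fst h"] mult.commute)
      also have "(\<Sum>b\<in>Basis. (h \<bullet> (0, b)) * D ((0, b) # bs) z) = snd h * (c * (wave k ?d (fst z) * vd (Suc l) (snd z)))"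
        by (simp add: D_def w inner_prod_def)
      finally show ?thesis by (simp add: algebra_simps)
    qed
    ultimately show ?thesis by simp
  qed
  moreover have "D [] = (\<lambda>z. wave k d (fst z) * vd 0 (snd z))" by (simp add: D_def)
  ultimately show ?thesis unfolding smooth_on_def by blast
qed

lemma gradient_wave_times:
  assumes v: "(v has_real_derivative v') (at (snd z))"
  shows "gradient (\<lambda>z. wave k d (fst z) * v (snd z)) z =
    ((wave k (d + pi / 2) (fst z) * v (snd z)) *\<^sub>R freq k, wave k d (fst z) * v')"
proof -
  let ?f = "\<lambda>z. wave k d (fst z) * v (snd z)"
  let ?f' = "\<lambda>h. wave k d (fst z) * (v' * snd h) + (freq k \<bullet> fst h) * wave k (d + pi / 2) (fst z) * v (snd z)"
  have 1: "((\<lambda>z :: (real^3) \<times> real. wave k d (fst z)) has_derivative (\<lambda>h. (freq k \<bullet> fst h) * wave k (d + pi / 2) (fst z))) (at z)"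
    by (rule has_derivative_compose[OF has_derivative_fst[OF has_derivative_ident] wave_has_derivative])
  have 2: "((\<lambda>z :: (real^3) \<times> real. v (snd z)) has_derivative (\<lambda>h. v' * snd h)) (at z)"
    using has_derivative_compose[OF has_derivative_snd[OF has_derivative_ident] v[unfolded has_field_derivative_def]] .
  have "(?f has_derivative ?f') (at z)" by (intro has_derivative_mult 1 2)
  then have f: "frechet_derivative ?f (at z) = ?f'" by (rule frechet_derivative_at[symmetric])
  have L: "gradient ?f z \<bullet> b = ?f' b" if "b \<in> Basis" for b
    unfolding gradient_def f using that
    by (simp add: inner_sum_left inner_Basis if_distrib[of "\<lambda>x. _ * x"] cong: if_cong)
  have R: "((wave k (d + pi / 2) (fst z) * v (snd z)) *\<^sub>R freq k, wave k d (fst z) * v') \<bullet> b = ?f' b" for b :: "(real^3) \<times> real"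
    by (simp add: inner_prod_def algebra_simps)
  show ?thesis by (rule euclidean_eqI) (simp only: L R)
qed

section \<open>Jets\<close>

lemma square_integrable_cong:
  assumes "\<And>x. x \<in> space M \<Longrightarrow> f x = g x"
  shows "square_integrable M f \<longleftrightarrow> square_integrable M g"
proof -
  have "f \<in> borel_measurable M \<longleftrightarrow> g \<in> borel_measurable M" using assms by (rule measurable_cong)
  moreover have "integrable M (\<lambda>x. (norm (f x))\<^sup>2) \<longleftrightarrow> integrable M (\<lambda>x. (norm (g x))\<^sup>2)"
    using assms by (intro Bochner_Integration.integrable_cong) auto
  ultimately show ?thesis by (simp add: square_integrable_def)
qed

lemma sqdist_cong:
  assumes "\<And>x. x \<in> space M \<Longrightarrow> f x = f' x" "\<And>x. x \<in> space M \<Longrightarrow> g x = g' x"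
  shows "sqdist M f g = sqdist M f' g'"
  unfolding sqdist_def using assms by (intro Bochner_Integration.integral_cong) auto

lemma square_integrable_Pair:
  assumes "square_integrable M f" "square_integrable M g"
  shows "square_integrable M (\<lambda>x. (f x, g x))"
  unfolding square_integrable_def
proof
  show "(\<lambda>x. (f x, g x)) \<in> borel_measurable M"
    using assms[THEN square_integrable_measurable] by (rule borel_measurable_Pair)
  show "integrable M (\<lambda>x. (norm (f x, g x))\<^sup>2)"
    using assms[THEN square_integrable_norm] by (simp add: norm_Pair)
qed

lemma square_integrable_dominated:
  assumes "square_integrable M f" "g \<in> borel_measurable M" "\<And>x. norm (g x) \<le> C * norm (f x)"
  shows "square_integrable M g"
proof (rule square_integrable_mono[OF assms(2)])
  show "integrable M (\<lambda>x. C\<^sup>2 * (norm (f x))\<^sup>2)" using assms(1) by (simp add: square_integrable_norm)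
  show "AE x in M. (norm (g x))\<^sup>2 \<le> C\<^sup>2 * (norm (f x))\<^sup>2"
    using power_mono[OF assms(3) norm_ge_zero, of _ 2] by (auto simp: power_mult_distrib)
qed

lemma norm_snd_le_norm: "norm (snd z) \<le> norm z" and norm_fst_le_norm: "norm (fst z) \<le> norm z"
  using norm_snd_le[where x = "fst z" and y = "snd z"] norm_fst_le[where x = "fst z" and y = "snd z"] by simp_all

lemma square_integrable_snd:
  "square_integrable M f \<Longrightarrow> square_integrable M (\<lambda>x. snd (f x :: 'b::euclidean_space \<times> 'c::euclidean_space))"
  by (rule square_integrable_dominated[where C = 1])
    (auto intro: norm_snd_le_norm borel_measurable_continuous_on[OF continuous_on_snd[OF continuous_on_id]] dest: square_integrable_measurable)

lemma square_integrable_inner_fst: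
  "square_integrable M f \<Longrightarrow> square_integrable M (\<lambda>x. v \<bullet> fst (f x :: 'b::euclidean_space \<times> 'c::euclidean_space))"
proof (rule square_integrable_dominated[where C = "norm v"])
  assume f: "square_integrable M f"
  have c: "continuous_on UNIV (\<lambda>z :: 'b \<times> 'c. v \<bullet> fst z)" by (intro continuous_intros)
  show "(\<lambda>x. v \<bullet> fst (f x)) \<in> borel_measurable M"
    using borel_measurable_continuous_on[OF c square_integrable_measurable[OF f]] by simp
  show "norm (v \<bullet> fst (f x)) \<le> norm v * norm (f x)" for x
    using Cauchy_Schwarz_ineq2[of v "fst (f x)"] mult_left_mono[OF norm_fst_le_norm[of "f x"] norm_ge_zero[of v]]
    by simp
qed

lemma square_integrable_scaleR_const:
  "square_integrable M f \<Longrightarrow> square_integrable M (\<lambda>x. f x *\<^sub>R v)" for f :: "_ \<Rightarrow> real"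
  by (rule square_integrable_dominated[where C = "norm v"])
    (auto dest: square_integrable_measurable simp: mult.commute)

text \<open>With the function part scaled by \<open>m\<close>, the inner product \<open>Xs_inner s m\<close> becomes, up to the factor
  \<open>1 / kappa s\<close>, the plain \<open>L\<^sup>2\<close> product of vector-valued functions.\<close>
definition join :: "real \<Rightarrow> jet \<Rightarrow> (real^3) \<times> real \<Rightarrow> real \<times> ((real^3) \<times> real)" where
  "join m W z = (m * fst W z, snd W z)"

abbreviation grad_jet :: "((real^3) \<times> real \<Rightarrow> real) \<Rightarrow> jet" where
  "grad_jet \<phi> \<equiv> (\<phi>, gradient \<phi>)"

definition jdiff :: "jet \<Rightarrow> jet \<Rightarrow> jet" where
  "jdiff W Z = (\<lambda>z. fst W z - fst Z z, \<lambda>z. snd W z - snd Z z)"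

definition jsum :: "'i set \<Rightarrow> ('i \<Rightarrow> real) \<Rightarrow> ('i \<Rightarrow> jet) \<Rightarrow> jet" where
  "jsum I c W = (\<lambda>z. \<Sum>i\<in>I. c i * fst (W i) z, \<lambda>z. \<Sum>i\<in>I. c i *\<^sub>R snd (W i) z)"

lemma join_jdiff: "join m (jdiff W Z) z = join m W z - join m Z z"
  by (simp add: join_def jdiff_def right_diff_distrib)

lemma join_jsum: "join m (jsum I c W) z = (\<Sum>i\<in>I. c i *\<^sub>R join m (W i) z)"
  by (simp add: prod_eq_iff fst_sum snd_sum join_def jsum_def sum_distrib_left mult.left_commute)

lemma L2_jets_iff: "W \<in> L2_jets s \<longleftrightarrow> square_integrable (weighted s) (fst W) \<and> square_integrable (weighted s) (snd W)"
  by (auto simp: L2_jets_def square_integrable_def)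

lemma L2_jets_jdiff: "W \<in> L2_jets s \<Longrightarrow> Z \<in> L2_jets s \<Longrightarrow> jdiff W Z \<in> L2_jets s"
  by (auto simp: L2_jets_iff jdiff_def intro: square_integrable_diff)

lemma L2_jets_jsum: "(\<And>i. i \<in> I \<Longrightarrow> W i \<in> L2_jets s) \<Longrightarrow> jsum I c W \<in> L2_jets s"
  using square_integrable_scaleR[of "weighted s" "fst (W _)"]
  by (auto simp: L2_jets_iff jsum_def intro!: square_integrable_sum intro: square_integrable_scaleR)

lemma square_integrable_join: "W \<in> L2_jets s \<Longrightarrow> square_integrable (weighted s) (join m W)"
  using square_integrable_scaleR[of "weighted s" "fst W" m]
  by (auto simp: L2_jets_iff join_def[abs_def] intro: square_integrable_Pair)

lemma Xs_inner_join: "Xs_inner s m W Z = 1 / kappa s * (LINT z|weighted s. join m W z \<bullet> join m Z z)"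
  unfolding Xs_inner_def by (simp add: join_def power2_eq_square algebra_simps)

lemma Xs_inner_commute: "Xs_inner s m W Z = Xs_inner s m Z W"
  by (simp add: Xs_inner_join inner_commute)

lemma Xs_inner_self: "Xs_inner s m W W = 1 / kappa s * (LINT z|weighted s. (norm (join m W z))\<^sup>2)"
  by (simp add: Xs_inner_join power2_norm_eq_inner)

lemma Xs_inner_jsum_left:
  assumes W: "\<And>i. i \<in> I \<Longrightarrow> W i \<in> L2_jets s" and Z: "Z \<in> L2_jets s"
  shows "Xs_inner s m (jsum I c W) Z = (\<Sum>i\<in>I. c i * Xs_inner s m (W i) Z)"
proof -
  have "(LINT z|weighted s. join m (jsum I c W) z \<bullet> join m Z z) = (LINT z|weighted s. (\<Sum>i\<in>I. c i * (join m (W i) z \<bullet> join m Z z)))"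
    by (simp add: join_jsum inner_sum_left)
  also have "\<dots> = (\<Sum>i\<in>I. c i * (LINT z|weighted s. join m (W i) z \<bullet> join m Z z))"
    using W Z by (subst Bochner_Integration.integral_sum)
      (auto intro!: integrable_inner_square_integrable square_integrable_join)
  finally show ?thesis unfolding Xs_inner_join by (simp add: sum_distrib_left mult.left_commute)
qed

text \<open>A wave times a vertical profile \<open>p\<close> with derivative \<open>p'\<close>; the tangential part of the gradient
  shifts the phase of the wave by \<open>pi / 2\<close>.\<close>
definition wave_jet :: "int^3 \<Rightarrow> real \<Rightarrow> (real \<Rightarrow> real) \<Rightarrow> (real \<Rightarrow> real) \<Rightarrow> jet" where
  "wave_jet k d p p' = (\<lambda>z. wave k d (fst z) * p (snd z),
     \<lambda>z. ((wave k (d + pi / 2) (fst z) * p (snd z)) *\<^sub>R freq k, wave k d (fst z) * p' (snd z)))"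

lemma square_integrable_wave: "square_integrable cell (wave k d)"
  by (rule cell.square_integrable_bounded[where B = 1]) (auto intro!: measurable_cell simp: abs_wave_le)

lemma wave_jet_L2:
  assumes "square_integrable (nu s) p" "square_integrable (nu s) p'"
  shows "wave_jet k d p p' \<in> L2_jets s"
  unfolding L2_jets_iff wave_jet_def fst_conv snd_conv
  by (intro conjI square_integrable_Pair square_integrable_scaleR_const square_integrable_tensor
      square_integrable_wave assms)

lemma wave_jet_sqdist:
  assumes p: "square_integrable (nu s) p" "square_integrable (nu s) p'"
    and q: "square_integrable (nu s) q" "square_integrable (nu s) q'"
  shows "sqdist (weighted s) (join m (wave_jet k d p p')) (join m (wave_jet k d q q'))
    \<le> (2 * pi) ^ 3 * (((norm (freq k))\<^sup>2 + m\<^sup>2) * sqdist (nu s) p q + sqdist (nu s) p' q')"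
proof -
  let ?r = "(norm (freq k))\<^sup>2 + m\<^sup>2"
  have one: "square_integrable cell (\<lambda>x. 1 :: real)" by (rule cell.square_integrable_bounded[where B = 1]) auto
  have c: "(LINT x|cell. (1 :: real)\<^sup>2) = (2 * pi) ^ 3" using measure_cell by simp
  note t = square_integrable_tensor[OF one square_integrable_diff[OF p(1) q(1)]]
  note t' = square_integrable_tensor[OF one square_integrable_diff[OF p(2) q(2)]]
  have i: "integrable (weighted s) (\<lambda>z. (p (snd z) - q (snd z))\<^sup>2)" "integrable (weighted s) (\<lambda>z. (p' (snd z) - q' (snd z))\<^sup>2)"
    using square_integrable_real[OF t(1)] square_integrable_real[OF t'(1)] by simp_all
  have "sqdist (weighted s) (join m (wave_jet k d p p')) (join m (wave_jet k d q q'))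
    \<le> (LINT z|weighted s. ?r * (p (snd z) - q (snd z))\<^sup>2 + (p' (snd z) - q' (snd z))\<^sup>2)"
    unfolding sqdist_def
  proof (rule integral_mono)
    show "integrable (weighted s) (\<lambda>z. (norm (join m (wave_jet k d p p') z - join m (wave_jet k d q q') z))\<^sup>2)"
      by (intro square_integrable_norm square_integrable_diff square_integrable_join wave_jet_L2 p q)
    show "integrable (weighted s) (\<lambda>z. ?r * (p (snd z) - q (snd z))\<^sup>2 + (p' (snd z) - q' (snd z))\<^sup>2)"
      using i by simp
    fix z :: "(real^3) \<times> real"
    let ?w = "wave k d (fst z)" and ?w' = "wave k (d + pi / 2) (fst z)"
    let ?a = "p (snd z) - q (snd z)" and ?b = "p' (snd z) - q' (snd z)"
    have w: "?w\<^sup>2 \<le> 1" "?w'\<^sup>2 \<le> 1" by (simp_all add: abs_square_le_1 abs_wave_le)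
    have "join m (wave_jet k d p p') z - join m (wave_jet k d q q') z = (m * (?w * ?a), (?w' * ?a) *\<^sub>R freq k, ?w * ?b)"
      by (simp add: join_def wave_jet_def algebra_simps)
    then have "(norm (join m (wave_jet k d p p') z - join m (wave_jet k d q q') z))\<^sup>2 = (m * (?w * ?a))\<^sup>2 + (norm ((?w' * ?a) *\<^sub>R freq k))\<^sup>2 + (?w * ?b)\<^sup>2"
      by (simp add: norm_Pair)
    also have "\<dots> = ?w\<^sup>2 * (m\<^sup>2 * ?a\<^sup>2) + ?w'\<^sup>2 * ((norm (freq k))\<^sup>2 * ?a\<^sup>2) + ?w\<^sup>2 * ?b\<^sup>2"
      by (simp add: power_mult_distrib)
    also have "\<dots> \<le> 1 * (m\<^sup>2 * ?a\<^sup>2) + 1 * ((norm (freq k))\<^sup>2 * ?a\<^sup>2) + 1 * ?b\<^sup>2"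
      using w by (intro add_mono mult_right_mono) auto
    also have "\<dots> = ?r * ?a\<^sup>2 + ?b\<^sup>2" by (simp add: algebra_simps)
    finally show "(norm (join m (wave_jet k d p p') z - join m (wave_jet k d q q') z))\<^sup>2 \<le> ?r * ?a\<^sup>2 + ?b\<^sup>2" .
  qed
  also have "\<dots> = (2 * pi) ^ 3 * (?r * sqdist (nu s) p q + sqdist (nu s) p' q')"
    using i t(2) t'(2) c by (simp add: sqdist_def algebra_simps)
  finally show ?thesis .
qed

lemma smooth_periodic_L2: "\<phi> \<in> smooth_periodic s \<Longrightarrow> grad_jet \<phi> \<in> L2_jets s"
  by (simp add: smooth_periodic_def)

text \<open>By Fubini's theorem almost all vertical lines carry square integrable data, and on those the
  identity for the profile applies with every \<open>r\<close>; the exceptional set does not depend on \<open>r\<close>.\<close>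
lemma smooth_periodic_slices:
  assumes s: "1 / 2 < s" "s < 1" and phi: "\<phi> \<in> smooth_periodic s"
  shows "AE x in cell. \<forall>r>0. (LINT y|nu s. prof' s r y * snd (gradient \<phi> (x, y)) + r\<^sup>2 * prof s r y * \<phi> (x, y))
    = r powr (2 * s) * kappa s * \<phi> (x, 0)"
proof -
  obtain G where G: "continuous_on half_space \<phi>" "continuous_on half_space G"
    "\<And>z. snd z > 0 \<Longrightarrow> gradient \<phi> z = G z"
    "\<And>x y. y > 0 \<Longrightarrow> ((\<lambda>y. \<phi> (x, y)) has_real_derivative snd (G (x, y))) (at y)"
    using smooth_periodic_classical[OF phi] by metis
  have L: "square_integrable (weighted s) \<phi>" "square_integrable (weighted s) (gradient \<phi>)"
    using smooth_periodic_L2[OF phi] by (auto simp: L2_jets_iff)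
  have "AE x in cell. integrable (nu s) (\<lambda>y. (\<phi> (x, y))\<^sup>2)" "AE x in cell. integrable (nu s) (\<lambda>y. (norm (gradient \<phi> (x, y)))\<^sup>2)"
    using integral_weighted(3)[OF square_integrable_real[OF L(1)]] integral_weighted(3)[OF square_integrable_norm[OF L(2)]] by auto
  then show ?thesis
  proof eventually_elim
    case (elim x)
    \<comment> \<open>Replacing \<open>y\<close> by \<open>max y 0\<close> extends the slice to a continuous function on the whole line.\<close>
    define v where "v = (\<lambda>y. \<phi> (x, max y 0))"
    define v' where "v' = (\<lambda>y. snd (G (x, max y 0)))"
    have cv: "continuous_on UNIV v"
      unfolding v_def by (intro continuous_on_compose2[OF G(1)] continuous_intros) auto
    have cv': "continuous_on UNIV v'"
      unfolding v'_def by (intro continuous_on_snd continuous_on_compose2[OF G(2)] continuous_intros) auto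
    have m: "v \<in> borel_measurable borel" "v' \<in> borel_measurable borel" using cv cv' by (auto intro: borel_measurable_continuous_onI)
    have sv: "square_integrable (nu s) v"
    proof (rule square_integrable_mono[OF measurable_nu[OF m(1)] elim(1)])
      show "AE y in nu s. (norm (v y))\<^sup>2 \<le> (\<phi> (x, y))\<^sup>2" by (rule AE_nu) (simp add: v_def)
    qed
    have sv': "square_integrable (nu s) v'"
    proof (rule square_integrable_mono[OF measurable_nu[OF m(2)] elim(2)])
      show "AE y in nu s. (norm (v' y))\<^sup>2 \<le> (norm (gradient \<phi> (x, y)))\<^sup>2"
      proof (rule AE_nu)
        fix y :: real assume y: "y > 0"
        then have "norm (v' y) \<le> norm (gradient \<phi> (x, y))"
          using norm_snd_le_norm[of "G (x, y)"] by (simp add: v'_def G(3))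
        then show "(norm (v' y))\<^sup>2 \<le> (norm (gradient \<phi> (x, y)))\<^sup>2" by (rule power_mono) simp
      qed
    qed
    have der: "(v has_real_derivative v' y) (at y)" if "y > 0" for y
    proof (rule has_field_derivative_transform_within_open)
      show "((\<lambda>y. \<phi> (x, y)) has_real_derivative v' y) (at y)" using G(4)[OF that] that by (simp add: v'_def)
      show "open {0 :: real<..}" "y \<in> {0<..}" using that by auto
    qed (auto simp: v_def)
    have cont': "isCont v' y" for y using cv' by (simp add: continuous_on_eq_continuous_at)
    have lim: "(v \<longlongrightarrow> \<phi> (x, 0)) (at_right 0)"
    proof -
      have "isCont v 0" using cv by (simp add: continuous_on_eq_continuous_at)
      then have "(v \<longlongrightarrow> v 0) (at 0)" by (simp add: isCont_def)
      then have "(v \<longlongrightarrow> v 0) (at_right 0)" by (rule tendsto_within_subset[of v _ 0 UNIV]) auto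
      then show ?thesis by (simp add: v_def)
    qed
    show ?case
    proof (intro allI impI)
      fix r :: real assume r: "r > 0"
      have "(LINT y|nu s. prof' s r y * snd (gradient \<phi> (x, y)) + r\<^sup>2 * prof s r y * \<phi> (x, y))
        = (LINT y|nu s. prof' s r y * v' y + r\<^sup>2 * prof s r y * v y)"
        by (rule Bochner_Integration.integral_cong) (auto simp: space_nu v_def v'_def G(3))
      also have "\<dots> = r powr (2 * s) * kappa s * \<phi> (x, 0)"
        by (rule profile_identity(2)[OF s r der cont' lim m sv sv'])
      finally show "(LINT y|nu s. prof' s r y * snd (gradient \<phi> (x, y)) + r\<^sup>2 * prof s r y * \<phi> (x, y))
        = r powr (2 * s) * kappa s * \<phi> (x, 0)" .
    qed
  qed
qed

lemma continuous_integrable_cell: "continuous_on UNIV f \<Longrightarrow> integrable cell f" for f :: "real^3 \<Rightarrow> real"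
  by (auto simp: integrable_cell_iff cube_def intro!: set_integrable_continuous_bounded)

text \<open>Integration by parts on the torus: the tangential Dirichlet form against a wave is
  \<open>|k|\<^sup>2\<close> times the mass form.\<close>
lemma wave_integration_by_parts:
  fixes f :: "real^3 \<Rightarrow> real" and g :: "real^3 \<Rightarrow> real^3"
  assumes f: "continuous_on UNIV f" and g: "continuous_on UNIV g"
    and der: "\<And>x i t. ((\<lambda>t. f (x + t *\<^sub>R axis i 1)) has_real_derivative g (x + t *\<^sub>R axis i 1) $ i) (at t)"
    and per: "\<And>x i. f (x + (2 * pi) *\<^sub>R axis i 1) = f x"
  shows "(LINT x|cell. wave k (d + pi / 2) x * (freq k \<bullet> g x)) = (norm (freq k))\<^sup>2 * (LINT x|cell. wave k d x * f x)"
proof -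
  have wpi: "wave k (d + pi / 2 + pi / 2) x = - wave k d x" for x
    using cos_periodic_pi[of "freq k \<bullet> x + d"] by (simp add: wave_def add.assoc)
  have ci: "integrable cell (\<lambda>x. wave k d x * f x)" "integrable cell (\<lambda>x. wave k (d + pi / 2) x * g x $ i)" for i
    by (intro continuous_integrable_cell continuous_intros continuous_wave f g)+
  have one: "(LINT x|cell. wave k (d + pi / 2) x * g x $ i) = of_int (k $ i) * (LINT x|cell. wave k d x * f x)" for i
  proof -
    have "(LINT x|cell. of_int (k $ i) * wave k (d + pi / 2 + pi / 2) x * f x + wave k (d + pi / 2) x * g x $ i) = 0"
    proof (rule integral_cell_partial_derivative[where F = "\<lambda>x. wave k (d + pi / 2) x * f x" and i = i])
      show "((\<lambda>t. wave k (d + pi / 2) (x + t *\<^sub>R axis i 1) * f (x + t *\<^sub>R axis i 1)) has_real_derivative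
        of_int (k $ i) * wave k (d + pi / 2 + pi / 2) (x + t *\<^sub>R axis i 1) * f (x + t *\<^sub>R axis i 1)
        + wave k (d + pi / 2) (x + t *\<^sub>R axis i 1) * g (x + t *\<^sub>R axis i 1) $ i) (at t)" for x t
        using DERIV_mult[OF wave_deriv[of k "d + pi / 2" x i t] der[of x i t]] by (simp add: mult_ac)
    qed (auto intro!: continuous_intros continuous_wave f g simp: periodic_wave per)
    then have "(LINT x|cell. - (of_int (k $ i) * (wave k d x * f x)) + wave k (d + pi / 2) x * g x $ i) = 0"
      unfolding wpi by (simp add: mult.assoc)
    then show ?thesis using ci by simp
  qed
  have "(LINT x|cell. wave k (d + pi / 2) x * (freq k \<bullet> g x)) = (LINT x|cell. (\<Sum>i\<in>UNIV. of_int (k $ i) * (wave k (d + pi / 2) x * g x $ i)))"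
    by (simp add: inner_vec_def freq_def sum_distrib_left mult_ac)
  also have "\<dots> = (\<Sum>i\<in>UNIV. of_int (k $ i) * (of_int (k $ i) * (LINT x|cell. wave k d x * f x)))"
    using ci(2) by (simp add: one)
  also have "\<dots> = (\<Sum>i\<in>UNIV. of_int (k $ i) * of_int (k $ i)) * (LINT x|cell. wave k d x * f x)"
    by (simp add: sum_distrib_right mult.assoc)
  also have "(\<Sum>i\<in>UNIV. of_int (k $ i) * of_int (k $ i)) = (norm (freq k))\<^sup>2"
    by (simp add: power2_norm_eq_inner inner_vec_def freq_def)
  finally show ?thesis .
qed

section \<open>Extending a wave into the half space\<close>

locale extension =
  fixes s m :: real
  assumes s: "1 / 2 < s" "s < 1" and m: "0 < m"
begin

lemma s0: "0 < s" using s by simp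

lemma kap: "0 < kappa s" by (rule kappa_pos[OF s0 s(2)])

definition rad :: "int^3 \<Rightarrow> real" where
  "rad k = sqrt ((norm (freq k))\<^sup>2 + m\<^sup>2)"

lemma rad_pos: "0 < rad k"
  unfolding rad_def using m by (auto intro: add_nonneg_pos)

lemma rad_power2: "(rad k)\<^sup>2 = (norm (freq k))\<^sup>2 + m\<^sup>2"
  by (simp add: rad_def)

lemma rad_powr: "rad k powr (2 * s) = ((norm (freq k))\<^sup>2 + m\<^sup>2) powr s"
  by (simp add: rad_power2[symmetric] powr_powr[symmetric] powr_numeral less_imp_le[OF rad_pos])

text \<open>The extension of a wave that satisfies the degenerate elliptic equation of the half space.\<close>
definition Theta :: "int^3 \<Rightarrow> real \<Rightarrow> jet" where
  "Theta k d = wave_jet k d (prof s (rad k)) (prof' s (rad k))"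

lemma Theta_L2: "Theta k d \<in> L2_jets s"
  unfolding Theta_def by (intro wave_jet_L2 square_integrable_prof s rad_pos)

text \<open>Two integrations by parts.  On horizontal slices the tangential part of the inner product turns into
  \<open>|k|\<^sup>2\<close> times the mass part, so that the mass part has the factor \<open>|k|\<^sup>2 + m\<^sup>2\<close> in total; on
  vertical lines the rest is then given by the identity for the profile with \<open>r = rad k\<close>.\<close>
lemma Theta_pairing_smooth:
  assumes phi: "\<phi> \<in> smooth_periodic s"
  shows "Xs_inner s m (Theta k d) (grad_jet \<phi>) = rad k powr (2 * s) * (LINT x|cell. wave k d x * \<phi> (x, 0))"
proof -
  let ?r = "rad k"
  let ?P = "prof s ?r" and ?P' = "prof' s ?r"
  obtain G where G: "continuous_on half_space \<phi>" "continuous_on half_space G"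
    "\<And>z. snd z > 0 \<Longrightarrow> gradient \<phi> z = G z"
    "\<And>x y i t. y > 0 \<Longrightarrow> ((\<lambda>t. \<phi> (x + t *\<^sub>R axis i 1, y)) has_real_derivative fst (G (x + t *\<^sub>R axis i 1, y)) $ i) (at t)"
    "\<And>x y. y > 0 \<Longrightarrow> ((\<lambda>y. \<phi> (x, y)) has_real_derivative snd (G (x, y))) (at y)"
    "\<And>x y i. y \<ge> 0 \<Longrightarrow> \<phi> (x + (2 * pi) *\<^sub>R axis i 1, y) = \<phi> (x, y)"
    by (rule smooth_periodic_classical[OF phi]) (rule that; assumption)
  have L: "square_integrable (weighted s) \<phi>" "square_integrable (weighted s) (gradient \<phi>)"
    using smooth_periodic_L2[OF phi] by (auto simp: L2_jets_iff)
  note sp = square_integrable_prof[OF s rad_pos[of k]]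
  note T0 = square_integrable_tensor(1)[OF square_integrable_wave[of k d] sp(1)]
  note T0' = square_integrable_tensor(1)[OF square_integrable_wave[of k d] sp(2)]
  note T1 = square_integrable_tensor(1)[OF square_integrable_wave[of k "d + pi / 2"] sp(1)]
  define f1 where "f1 = (\<lambda>z. wave k (d + pi / 2) (fst z) * ?P (snd z) * (freq k \<bullet> fst (gradient \<phi> z)))"
  define f2 where "f2 = (\<lambda>z. wave k d (fst z) * ?P' (snd z) * snd (gradient \<phi> z))"
  define f3 where "f3 = (\<lambda>z. wave k d (fst z) * ?P (snd z) * \<phi> z)"
  have i1: "integrable (weighted s) f1"
    using integrable_inner_square_integrable[OF T1 square_integrable_inner_fst[OF L(2)]] by (simp add: f1_def)
  have i2: "integrable (weighted s) f2"
    using integrable_inner_square_integrable[OF T0' square_integrable_snd[OF L(2)]] by (simp add: f2_def)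
  have i3: "integrable (weighted s) f3"
    using integrable_inner_square_integrable[OF T0 L(1)] by (simp add: f3_def)
  have I1: "(LINT z|weighted s. f1 z) = (norm (freq k))\<^sup>2 * (LINT z|weighted s. f3 z)"
  proof -
    have "(LINT x|cell. f1 (x, y)) = (norm (freq k))\<^sup>2 * (LINT x|cell. f3 (x, y))" if y: "y > 0" for y
    proof -
      have "(LINT x|cell. f1 (x, y)) = (LINT x|cell. ?P y * (wave k (d + pi / 2) x * (freq k \<bullet> fst (G (x, y)))))"
        using y by (simp add: f1_def G(3) mult_ac)
      also have "\<dots> = ?P y * (LINT x|cell. wave k (d + pi / 2) x * (freq k \<bullet> fst (G (x, y))))" by simp
      also have "(LINT x|cell. wave k (d + pi / 2) x * (freq k \<bullet> fst (G (x, y)))) = (norm (freq k))\<^sup>2 * (LINT x|cell. wave k d x * \<phi> (x, y))"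
      proof (rule wave_integration_by_parts)
        show "continuous_on UNIV (\<lambda>x. \<phi> (x, y))" using y by (intro continuous_on_compose2[OF G(1)] continuous_intros) auto
        show "continuous_on UNIV (\<lambda>x. fst (G (x, y)))" using y by (intro continuous_on_fst continuous_on_compose2[OF G(2)] continuous_intros) auto
      qed (use y G(4,6) in auto)
      also have "?P y * ((norm (freq k))\<^sup>2 * (LINT x|cell. wave k d x * \<phi> (x, y))) = (norm (freq k))\<^sup>2 * (LINT x|cell. ?P y * (wave k d x * \<phi> (x, y)))" by simp
      finally show ?thesis by (simp add: f3_def mult_ac)
    qed
    then have "(LINT y|nu s. LINT x|cell. f1 (x, y)) = (LINT y|nu s. (norm (freq k))\<^sup>2 * (LINT x|cell. f3 (x, y)))"
      by (intro Bochner_Integration.integral_cong) (auto simp: space_nu)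
    then show ?thesis using integral_weighted(2)[OF i1] integral_weighted(2)[OF i3] by simp
  qed
  define h where "h = (\<lambda>z. f2 z + ?r\<^sup>2 * f3 z)"
  have ih: "integrable (weighted s) h" unfolding h_def using i2 i3 by simp
  have "kappa s * Xs_inner s m (Theta k d) (grad_jet \<phi>) = (LINT z|weighted s. f1 z + f2 z + m\<^sup>2 * f3 z)"
    unfolding Xs_inner_def using kap
    by (simp add: Theta_def wave_jet_def f1_def f2_def f3_def inner_prod_def algebra_simps)
  also have "\<dots> = (LINT z|weighted s. h z)"
    using i1 i2 i3 I1 by (simp add: h_def rad_power2 algebra_simps)
  also have "\<dots> = (LINT x|cell. LINT y|nu s. h (x, y))" by (rule integral_weighted(1)[OF ih])
  also have "\<dots> = (LINT x|cell. ?r powr (2 * s) * kappa s * (wave k d x * \<phi> (x, 0)))"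
  proof (rule integral_cong_AE)
    show "(\<lambda>x. LINT y|nu s. h (x, y)) \<in> borel_measurable cell" using integral_weighted(4)[OF ih] by simp
    have "continuous_on UNIV (\<lambda>x. \<phi> (x, 0))" by (intro continuous_on_compose2[OF G(1)] continuous_intros) auto
    then show "(\<lambda>x. ?r powr (2 * s) * kappa s * (wave k d x * \<phi> (x, 0))) \<in> borel_measurable cell"
      by (intro measurable_cell borel_measurable_continuous_onI continuous_intros continuous_wave)
    show "AE x in cell. (LINT y|nu s. h (x, y)) = ?r powr (2 * s) * kappa s * (wave k d x * \<phi> (x, 0))"
      using smooth_periodic_slices[OF s phi]
    proof eventually_elim
      case (elim x)
      have "(LINT y|nu s. h (x, y)) = (LINT y|nu s. wave k d x * (?P' y * snd (gradient \<phi> (x, y)) + ?r\<^sup>2 * ?P y * \<phi> (x, y)))"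
        by (simp add: h_def f2_def f3_def algebra_simps)
      also have "\<dots> = wave k d x * (?r powr (2 * s) * kappa s * \<phi> (x, 0))" using elim rad_pos[of k] by simp
      finally show ?case by (simp add: mult_ac)
    qed
  qed
  also have "\<dots> = ?r powr (2 * s) * kappa s * (LINT x|cell. wave k d x * \<phi> (x, 0))" by simp
  finally show ?thesis using kap by simp
qed

lemma Xs_inner_nonneg: "0 \<le> Xs_inner s m W W"
  unfolding Xs_inner_self using kap by simp

lemma Xs_norm_power2: "(Xs_norm s m W)\<^sup>2 = Xs_inner s m W W"
  unfolding Xs_norm_def using Xs_inner_nonneg by simp

lemma Xs_inner_jdiff: "Xs_inner s m (jdiff W Z) (jdiff W Z) = 1 / kappa s * sqdist (weighted s) (join m W) (join m Z)"
  by (simp add: Xs_inner_self join_jdiff sqdist_def)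

lemma Xs_norm_tendsto_iff:
  "((\<lambda>n. Xs_norm s m (jdiff (W n) (Z n))) \<longlonglongrightarrow> 0) \<longleftrightarrow> ((\<lambda>n. sqdist (weighted s) (join m (W n)) (join m (Z n))) \<longlonglongrightarrow> 0)"
proof
  assume "(\<lambda>n. Xs_norm s m (jdiff (W n) (Z n))) \<longlonglongrightarrow> 0"
  then have "(\<lambda>n. kappa s * (Xs_norm s m (jdiff (W n) (Z n)))\<^sup>2) \<longlonglongrightarrow> kappa s * 0\<^sup>2" by (intro tendsto_intros)
  then show "(\<lambda>n. sqdist (weighted s) (join m (W n)) (join m (Z n))) \<longlonglongrightarrow> 0"
    using kap by (simp add: Xs_norm_power2 Xs_inner_jdiff)
next
  assume "(\<lambda>n. sqdist (weighted s) (join m (W n)) (join m (Z n))) \<longlonglongrightarrow> 0"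
  then have "(\<lambda>n. sqrt (1 / kappa s * sqdist (weighted s) (join m (W n)) (join m (Z n)))) \<longlonglongrightarrow> sqrt (1 / kappa s * 0)"
    by (intro tendsto_intros)
  then show "(\<lambda>n. Xs_norm s m (jdiff (W n) (Z n))) \<longlonglongrightarrow> 0"
    by (simp add: Xs_norm_def Xs_inner_jdiff)
qed

lemma approximates_iff:
  "approximates s m \<phi> W \<longleftrightarrow> (\<forall>n. \<phi> n \<in> smooth_periodic s) \<and>
    (\<lambda>n. sqdist (weighted s) (join m W) (join m (grad_jet (\<phi> n)))) \<longlonglongrightarrow> 0"
  unfolding approximates_def Xs_norm_tendsto_iff[of "\<lambda>_. W" "\<lambda>n. grad_jet (\<phi> n)", symmetric] by (simp add: jdiff_def)

lemma Xs_inner_tendsto: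
  assumes W: "\<And>n. W n \<in> L2_jets s" and L: "L \<in> L2_jets s" and Z: "Z \<in> L2_jets s"
    and lim: "(\<lambda>n. sqdist (weighted s) (join m L) (join m (W n))) \<longlonglongrightarrow> 0"
  shows "(\<lambda>n. Xs_inner s m Z (W n)) \<longlonglongrightarrow> Xs_inner s m Z L" "(\<lambda>n. Xs_inner s m (W n) (W n)) \<longlonglongrightarrow> Xs_inner s m L L"
proof -
  have lim': "(\<lambda>n. sqdist (weighted s) (join m (W n)) (join m L)) \<longlonglongrightarrow> 0"
    using lim by (simp add: sqdist_commute[of _ "join m L"])
  show "(\<lambda>n. Xs_inner s m Z (W n)) \<longlonglongrightarrow> Xs_inner s m Z L"
    unfolding Xs_inner_join
    by (intro tendsto_intros integral_inner_tendsto[where f = "\<lambda>n. join m (W n)"] square_integrable_join W L Z lim')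
  show "(\<lambda>n. Xs_inner s m (W n) (W n)) \<longlonglongrightarrow> Xs_inner s m L L"
    unfolding Xs_inner_self
    by (intro tendsto_intros integral_norm_square_tendsto[where f = "\<lambda>n. join m (W n)"] square_integrable_join W L lim')
qed

text \<open>Translating the profile away from the boundary makes it smooth up to \<open>y = 0\<close>.\<close>
lemma Theta_approximable:
  obtains \<phi> where "approximates s m \<phi> (Theta k d)"
    "\<And>n x. \<phi> n (x, 0) = wave k d x * prof s (rad k) (1 / Suc n)"
proof -
  let ?r = "rad k"
  obtain vd :: "nat \<Rightarrow> real \<Rightarrow> real" where vd: "\<And>y. y > 0 \<Longrightarrow> vd 0 y = theta s y"
    "\<And>l y. y > 0 \<Longrightarrow> (vd l has_real_derivative vd (Suc l) y) (at y)"
    using theta_smooth[OF s0 s(2)] by blast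
  \<comment> \<open>By the chain rule \<open>vn n l\<close> is the \<open>l\<close>-th derivative of the profile translated by \<open>1 / Suc n\<close>.\<close>
  define vn where "vn = (\<lambda>n l y. ?r ^ l * vd l (?r * (y + 1 / Suc n)))"
  define \<phi> where "\<phi> = (\<lambda>n z. wave k d (fst z) * vn n 0 (snd z))"
  have pos: "?r * (y + 1 / Suc n) > 0" if "y \<ge> 0" for y and n :: nat
    using that rad_pos[of k] by (auto intro!: mult_pos_pos add_nonneg_pos)
  have vnd: "(vn n l has_real_derivative vn n (Suc l) y) (at y)" if "y \<ge> 0" for n l y
  proof -
    have "((\<lambda>y. vd l (?r * (y + 1 / Suc n))) has_real_derivative vd (Suc l) (?r * (y + 1 / Suc n)) * ?r) (at y)"
    proof (rule DERIV_chain2[where f = "vd l" and g = "\<lambda>y. ?r * (y + 1 / Suc n)"])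
      show "(vd l has_real_derivative vd (Suc l) (?r * (y + 1 / Suc n))) (at (?r * (y + 1 / Suc n)))"
        by (rule vd(2)[OF pos[OF that]])
    qed (auto intro!: derivative_eq_intros)
    then show ?thesis unfolding vn_def by (auto intro!: derivative_eq_intros simp: mult_ac)
  qed
  have vn0: "vn n 0 y = prof s ?r (y + 1 / Suc n)" if "y \<ge> 0" for n y
    using vd(1)[OF pos[OF that, of n]] by (simp add: vn_def prof_def)
  have vn1: "(vn n 0 has_real_derivative prof' s ?r (y + 1 / Suc n)) (at y)" if "y > 0" for n y
  proof (rule has_field_derivative_transform_within_open)
    have "y + 1 / real (Suc n) > 0" using that by (simp add: add_pos_pos)
    then have "(prof s ?r has_real_derivative prof' s ?r (y + 1 / Suc n)) (at (y + 1 / Suc n))"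
      by (intro prof_deriv s0 s rad_pos)
    then show "((\<lambda>y. prof s ?r (y + 1 / Suc n)) has_real_derivative prof' s ?r (y + 1 / Suc n)) (at y)"
      by (simp add: DERIV_shift)
    show "open {0 :: real<..}" "y \<in> {0<..}" using that by auto
  qed (use vn0 in auto)
  have e: "0 \<le> 1 / real (Suc n)" "1 / real (Suc n) \<le> 1" for n by auto
  note sq = square_integrable_prof_shift[OF s rad_pos[of k] e]
  define J where "J = (\<lambda>n. wave_jet k d (\<lambda>y. prof s ?r (y + 1 / Suc n)) (\<lambda>y. prof' s ?r (y + 1 / Suc n)))"
  have J: "fst (J n) z = \<phi> n z" "snd (J n) z = gradient (\<phi> n) z" if "z \<in> space (weighted s)" for n z
  proof -
    have z: "snd z > 0" using that by (auto simp: space_weighted)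
    show "fst (J n) z = \<phi> n z" using z by (simp add: J_def wave_jet_def \<phi>_def vn0)
    show "snd (J n) z = gradient (\<phi> n) z"
      unfolding \<phi>_def gradient_wave_times[OF vn1[OF z]] using z by (simp add: J_def wave_jet_def vn0)
  qed
  have JL: "J n \<in> L2_jets s" for n unfolding J_def by (rule wave_jet_L2[OF sq[of n]])
  have L: "grad_jet (\<phi> n) \<in> L2_jets s" for n
    using JL[of n] square_integrable_cong[of "weighted s" "fst (J n)" "\<phi> n", OF J(1)]
      square_integrable_cong[of "weighted s" "snd (J n)" "gradient (\<phi> n)", OF J(2)] by (simp add: L2_jets_iff)
  have sp: "\<phi> n \<in> smooth_periodic s" for n
    unfolding smooth_periodic_def mem_Collect_eq
  proof (intro conjI L allI impI)
    show "smooth_on half_space (\<phi> n)" unfolding \<phi>_def by (rule smooth_on_wave_times[where vd = "vn n", OF vnd])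
    show "periodic (\<lambda>x. \<phi> n (x, y))" if "y \<ge> 0" for y
      unfolding periodic_def \<phi>_def by (simp add: periodic_wave)
  qed
  have "(\<lambda>n. sqdist (weighted s) (join m (Theta k d)) (join m (grad_jet (\<phi> n)))) \<longlonglongrightarrow> 0"
  proof (rule tendsto_sandwich[OF _ _ tendsto_const])
    show "\<forall>\<^sub>F n in sequentially. 0 \<le> sqdist (weighted s) (join m (Theta k d)) (join m (grad_jet (\<phi> n)))"
      by (simp add: sqdist_nonneg)
    let ?E = "\<lambda>n. (2 * pi) ^ 3 * (((norm (freq k))\<^sup>2 + m\<^sup>2) * sqdist (nu s) (\<lambda>y. prof s ?r (y + 1 / Suc n)) (prof s ?r)
        + sqdist (nu s) (\<lambda>y. prof' s ?r (y + 1 / Suc n)) (prof' s ?r))"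
    show "\<forall>\<^sub>F n in sequentially. sqdist (weighted s) (join m (Theta k d)) (join m (grad_jet (\<phi> n))) \<le> ?E n"
    proof (rule always_eventually, rule allI)
      fix n
      have "sqdist (weighted s) (join m (Theta k d)) (join m (grad_jet (\<phi> n))) = sqdist (weighted s) (join m (J n)) (join m (Theta k d))"
        unfolding sqdist_commute[of _ "join m (J n)"] using J[of _ n] by (intro sqdist_cong) (auto simp: join_def)
      then show "sqdist (weighted s) (join m (Theta k d)) (join m (grad_jet (\<phi> n))) \<le> ?E n"
        using wave_jet_sqdist[OF sq[of n] square_integrable_prof[OF s rad_pos[of k]], where k = k and d = d and m = m] unfolding J_def Theta_def by simp
    qed
    have "?E \<longlonglongrightarrow> (2 * pi) ^ 3 * (((norm (freq k))\<^sup>2 + m\<^sup>2) * 0 + 0)"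
      by (intro tendsto_intros prof_shift_tendsto s rad_pos)
    then show "?E \<longlonglongrightarrow> 0" by simp
  qed
  then have "approximates s m \<phi> (Theta k d)" using sp by (simp add: approximates_iff)
  moreover have "\<phi> n (x, 0) = wave k d x * prof s ?r (1 / Suc n)" for n x by (simp add: \<phi>_def vn0)
  ultimately show ?thesis by (rule that)
qed

lemma Theta_in_Xs: "Theta k d \<in> Xs_space s m"
proof -
  obtain \<phi> where "approximates s m \<phi> (Theta k d)"
    by (rule Theta_approximable[of k d]) (rule that)
  then show ?thesis using Theta_L2 unfolding Xs_space_def by auto
qed

end

section \<open>The trace in the mean\<close>

text \<open>Translates each coordinate into the period \<open>[- pi, pi)\<close>; composing with it turns a function that
  matters on the cube only into a periodic one.\<close>
definition fold_to_cube :: "real^3 \<Rightarrow> real^3" where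
  "fold_to_cube x = (\<chi> i. x $ i - 2 * pi * of_int \<lfloor>(x $ i + pi) / (2 * pi)\<rfloor>)"

lemma fold_to_cube_id: "x \<in> cube \<Longrightarrow> fold_to_cube x = x"
proof -
  assume x: "x \<in> cube"
  have "\<lfloor>(x $ i + pi) / (2 * pi)\<rfloor> = 0" for i
  proof -
    have "- pi < x $ i \<and> x $ i < pi" using x unfolding mem_cube by blast
    then show ?thesis by (intro floor_unique) (auto simp: field_simps)
  qed
  then show ?thesis by (simp add: fold_to_cube_def vec_eq_iff)
qed

lemma fold_to_cube_periodic: "fold_to_cube (x + (2 * pi) *\<^sub>R axis j 1) = fold_to_cube x"
proof -
  have "((x $ i + 2 * pi + pi) / (2 * pi)) = (x $ i + pi) / (2 * pi) + 1" for i by (simp add: field_simps)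
  then show ?thesis by (auto simp: fold_to_cube_def vec_eq_iff axis_def algebra_simps)
qed

lemma two_pi_powr: "((2 * pi) powr (- 3 / 2))\<^sup>2 = 1 / (2 * pi) ^ 3"
proof -
  have "((2 * pi) powr (- 3 / 2))\<^sup>2 = (2 * pi) powr (- 3 / 2 + - 3 / 2)"
    by (simp only: power2_eq_square powr_add)
  also have "(- 3 / 2 + - 3 / 2 :: real) = - real 3" by simp
  also have "(2 * pi) powr (- real 3) = inverse ((2 * pi) powr real 3)" by (rule powr_minus)
  also have "(2 * pi) powr real 3 = (2 * pi) ^ 3" by (rule powr_realpow) simp
  finally show ?thesis by (simp only: inverse_eq_divide)
qed

lemma Fourier_coeff_square:
  assumes "integrable cell u"
  shows "(cmod (fourier_coeff u k))\<^sup>2 = ((LINT x|cell. wave k 0 x * u x)\<^sup>2 + (LINT x|cell. wave k (- (pi / 2)) x * u x)\<^sup>2) / (2 * pi) ^ 3"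
proof -
  let ?f = "\<lambda>x. of_real (u x) * cis (- (freq k \<bullet> x))"
  have mw: "wave k d \<in> borel_measurable cell" for d by (intro measurable_cell) simp
  have i: "integrable cell (\<lambda>x. u x * wave k d x)" for d
    by (rule integrable_mult_bounded[OF assms mw, where B = 1]) (simp add: abs_wave_le)
  have re: "Re (?f x) = u x * wave k 0 x" and im: "Im (?f x) = - (u x * wave k (- (pi / 2)) x)" for x
    by (auto simp: wave_def cos_diff)
  have "?f = (\<lambda>x. Complex (u x * wave k 0 x) (- (u x * wave k (- (pi / 2)) x)))"
    using re im by (auto simp: complex_eq_iff fun_eq_iff)
  then have "?f = (\<lambda>x. of_real (u x * wave k 0 x) + \<i> * of_real (- (u x * wave k (- (pi / 2)) x)))"
    by (simp add: Complex_eq)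
  then have fi: "integrable cell ?f"
    using i[of 0] i[of "- (pi / 2)"] by (simp only:) (intro Bochner_Integration.integrable_add integrable_mult_right, auto simp del: of_real_mult of_real_minus intro!: integrable_of_real)
  have "Re (LINT x|cell. ?f x) = (LINT x|cell. wave k 0 x * u x)"
    by (simp only: integral_Re[OF fi, symmetric] re mult.commute)
  moreover have "Im (LINT x|cell. ?f x) = - (LINT x|cell. wave k (- (pi / 2)) x * u x)"
    by (simp only: integral_Im[OF fi, symmetric] im mult.commute) simp
  ultimately have "(cmod (LINT x|cell. ?f x))\<^sup>2 = (LINT x|cell. wave k 0 x * u x)\<^sup>2 + (LINT x|cell. wave k (- (pi / 2)) x * u x)\<^sup>2"
    by (simp add: cmod_power2)
  moreover have "((2 * pi) powr (- 3 / 2))\<^sup>2 = 1 / (2 * pi) ^ 3"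
    by (rule two_pi_powr)
  ultimately show ?thesis
    unfolding fourier_coeff_def norm_mult power_mult_distrib by simp
qed

lemma wave_phase: "wave k d x = cos d * wave k 0 x - sin d * wave k (- (pi / 2)) x"
  by (simp add: wave_def cos_add cos_diff)

lemma integrable_wave_mult: "integrable cell u \<Longrightarrow> integrable cell (\<lambda>x. wave k d x * u x)"
  using integrable_mult_bounded[of cell u "wave k d" 1]
  by (simp add: measurable_cell abs_wave_le mult.commute)

lemma integral_wave_phase:
  assumes "integrable cell u"
  shows "(LINT x|cell. wave k d x * u x) = cos d * (LINT x|cell. wave k 0 x * u x) - sin d * (LINT x|cell. wave k (- (pi / 2)) x * u x)"
proof -
  have "(LINT x|cell. wave k d x * u x) = (LINT x|cell. cos d * (wave k 0 x * u x) - sin d * (wave k (- (pi / 2)) x * u x))"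
    by (subst wave_phase) (simp add: left_diff_distrib mult.assoc)
  then show ?thesis using integrable_wave_mult[OF assms] by simp
qed

lemma integrable_square_integrable_cell: "square_integrable cell u \<Longrightarrow> integrable cell u" for u :: "real^3 \<Rightarrow> real"
  using integrable_inner_square_integrable[of cell u "\<lambda>x. 1 :: real"]
    cell.square_integrable_bounded[of "\<lambda>x. 1 :: real" 1] by simp

text \<open>With the right phase one wave picks up the whole modulus of a Fourier coefficient.\<close>
lemma optimal_phase:
  assumes "square_integrable cell u"
  obtains d where "(LINT x|cell. wave k d x * u x) \<ge> 0"
    "(LINT x|cell. wave k d x * u x)\<^sup>2 = (2 * pi) ^ 3 * (cmod (fourier_coeff u k))\<^sup>2"
proof -
  define a b where "a = (LINT x|cell. wave k 0 x * u x)" and "b = (LINT x|cell. wave k (- (pi / 2)) x * u x)"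
  have ui: "integrable cell u" by (rule integrable_square_integrable_cell[OF assms])
  note phase = integral_wave_phase[OF ui, of k, folded a_def b_def]
  define \<rho> where "\<rho> = sqrt (a\<^sup>2 + b\<^sup>2)"
  have rho2: "\<rho>\<^sup>2 = a\<^sup>2 + b\<^sup>2" by (simp add: \<rho>_def)
  have four: "\<rho>\<^sup>2 = (2 * pi) ^ 3 * (cmod (fourier_coeff u k))\<^sup>2"
    unfolding rho2 Fourier_coeff_square[OF ui] a_def b_def by simp
  show ?thesis
  proof (cases "\<rho> = 0")
    case True
    then have "a = 0" "b = 0" using rho2 by (auto simp: sum_power2_eq_zero_iff)
    then show ?thesis using four True phase[of 0] by (intro that[of 0]) auto
  next
    case False
    have "(a / \<rho>)\<^sup>2 + (- b / \<rho>)\<^sup>2 = (a\<^sup>2 + b\<^sup>2) / \<rho>\<^sup>2" by (simp add: power_divide add_divide_distrib)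
    also have "\<dots> = 1" using False by (simp add: rho2[symmetric])
    finally obtain d where d: "a / \<rho> = cos d" "- b / \<rho> = sin d" using sincos_total_2pi by blast
    have "(LINT x|cell. wave k d x * u x) = \<rho>"
    proof -
      have "cos d * a - sin d * b = (a\<^sup>2 + b\<^sup>2) / \<rho>"
        unfolding d[symmetric] by (simp add: power2_eq_square add_divide_distrib)
      also have "\<dots> = \<rho>" unfolding rho2[symmetric] using False by (simp add: power2_eq_square)
      finally show ?thesis by (simp only: phase)
    qed
    then show ?thesis using four by (intro that[of d]) (auto simp: \<rho>_def)
  qed
qed

lemma abs_integral_wave_le:
  assumes "square_integrable cell u"
  shows "(LINT x|cell. wave k d x * u x)\<^sup>2 \<le> (2 * pi) ^ 3 * (cmod (fourier_coeff u k))\<^sup>2"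
proof -
  define a b where "a = (LINT x|cell. wave k 0 x * u x)" and "b = (LINT x|cell. wave k (- (pi / 2)) x * u x)"
  have ui: "integrable cell u" by (rule integrable_square_integrable_cell[OF assms])
  have "(cos d * a - sin d * b)\<^sup>2 + (sin d * a + cos d * b)\<^sup>2 = ((cos d)\<^sup>2 + (sin d)\<^sup>2) * (a\<^sup>2 + b\<^sup>2)"
    by algebra
  also have "\<dots> = a\<^sup>2 + b\<^sup>2" by (simp only: sin_cos_squared_add2 mult_1)
  finally have "(cos d * a - sin d * b)\<^sup>2 \<le> a\<^sup>2 + b\<^sup>2"
    using zero_le_power2[of "sin d * a + cos d * b"] by linarith
  then show ?thesis unfolding integral_wave_phase[OF ui, of k d] Fourier_coeff_square[OF ui] a_def b_def by simp
qed

context extension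
begin

text \<open>The identity for the profile with \<open>r = m\<close>, which is the profile of frequency 0, recovers the
  boundary value of a smooth function on almost every vertical line.  The formula makes sense for
  every square integrable jet, and so defines the trace without a limit.\<close>
definition trace_of :: "jet \<Rightarrow> real^3 \<Rightarrow> real" where
  "trace_of W x = (LINT y|nu s. prof' s m y * snd (snd W (x, y)) + m\<^sup>2 * prof s m y * fst W (x, y)) / (m powr (2 * s) * kappa s)"

lemma trace_of_smooth: "\<phi> \<in> smooth_periodic s \<Longrightarrow> AE x in cell. trace_of (grad_jet \<phi>) x = \<phi> (x, 0)"
  using smooth_periodic_slices[OF s, of \<phi>] m kap by (auto simp: trace_of_def elim!: eventually_mono)

definition "prof_norm = (LINT y|nu s. (norm (prof' s m y, m * prof s m y))\<^sup>2)"

definition "trace_const = prof_norm * kappa s / (m powr (2 * s) * kappa s)\<^sup>2"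

lemma prof_norm_nonneg: "0 \<le> prof_norm" by (simp add: prof_norm_def)

lemma trace_integrand:
  assumes W: "W \<in> L2_jets s"
  shows "integrable (weighted s) (\<lambda>z. prof' s m (snd z) * snd (snd W z) + m\<^sup>2 * prof s m (snd z) * fst W z)"
proof -
  have one: "square_integrable cell (\<lambda>x. 1 :: real)" by (rule cell.square_integrable_bounded[where B = 1]) auto
  note sp = square_integrable_prof[OF s m]
  note t = square_integrable_tensor(1)[OF one sp(1)] and t' = square_integrable_tensor(1)[OF one sp(2)]
  have "square_integrable (weighted s) (fst W)" "square_integrable (weighted s) (\<lambda>z. snd (snd W z))"
    using W by (auto simp: L2_jets_iff intro: square_integrable_snd)
  then have "integrable (weighted s) (\<lambda>z. prof s m (snd z) * fst W z)" "integrable (weighted s) (\<lambda>z. prof' s m (snd z) * snd (snd W z))"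
    using integrable_inner_square_integrable[OF t] integrable_inner_square_integrable[OF t'] by auto
  then show ?thesis by (simp add: mult.assoc)
qed

text \<open>Cauchy-Schwarz on each vertical line, with the profile as the second factor.\<close>
lemma trace_of_bound:
  assumes W: "W \<in> L2_jets s"
  shows "square_integrable cell (trace_of W)" "(LINT x|cell. (trace_of W x)\<^sup>2) \<le> trace_const * Xs_inner s m W W"
proof -
  let ?c = "m powr (2 * s) * kappa s"
  let ?b = "\<lambda>z. (snd (snd W z), m * fst W z)"
  let ?a = "\<lambda>y. (prof' s m y, m * prof s m y)"
  have c: "?c > 0" using m kap by simp
  have sb: "square_integrable (weighted s) ?b"
    using W square_integrable_scaleR[of "weighted s" "fst W" m]
    by (auto simp: L2_jets_iff intro!: square_integrable_Pair square_integrable_snd)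
  have sa: "square_integrable (nu s) ?a"
    using square_integrable_prof[OF s m] square_integrable_scaleR[of "nu s" "prof s m" m]
    by (auto intro!: square_integrable_Pair)
  have eq: "trace_of W x = (LINT y|nu s. ?a y \<bullet> ?b (x, y)) / ?c" for x
    by (simp add: trace_of_def power2_eq_square mult_ac)
  have meas: "trace_of W \<in> borel_measurable cell"
    using integral_weighted(4)[OF trace_integrand[OF W]] unfolding trace_of_def[abs_def] by simp
  have ib: "integrable (weighted s) (\<lambda>z. (norm (?b z))\<^sup>2)" by (rule square_integrable_norm[OF sb])
  have bm: "(\<lambda>y. ?b (x, y)) \<in> borel_measurable (nu s)" if "x \<in> space cell" for x
  proof -
    have "?b \<in> borel_measurable (cell \<Otimes>\<^sub>M nu s)" using square_integrable_measurable[OF sb] by (simp add: weighted_eq)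
    then show ?thesis using measurable_compose[OF measurable_Pair1'[OF that]] by blast
  qed
  have le: "AE x in cell. (trace_of W x)\<^sup>2 \<le> prof_norm / ?c\<^sup>2 * (LINT y|nu s. (norm (?b (x, y)))\<^sup>2)"
    using integral_weighted(3)[OF ib] AE_space
  proof eventually_elim
    case (elim x)
    have "square_integrable (nu s) (\<lambda>y. ?b (x, y))"
      unfolding square_integrable_def using elim bm by blast
    from Cauchy_Schwarz_square_integrable[OF sa this]
    have "(LINT y|nu s. ?a y \<bullet> ?b (x, y))\<^sup>2 \<le> prof_norm * (LINT y|nu s. (norm (?b (x, y)))\<^sup>2)"
      by (simp only: prof_norm_def)
    from divide_right_mono[OF this zero_le_power2[of ?c]]
    show ?case unfolding eq power_divide by (simp only: times_divide_eq_left)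
  qed
  have int: "integrable cell (\<lambda>x. prof_norm / ?c\<^sup>2 * (LINT y|nu s. (norm (?b (x, y)))\<^sup>2))"
    using integral_weighted(4)[OF ib] by simp
  show sq: "square_integrable cell (trace_of W)"
    by (rule square_integrable_mono[OF meas int]) (use le in simp)
  have "(LINT x|cell. (trace_of W x)\<^sup>2) \<le> (LINT x|cell. prof_norm / ?c\<^sup>2 * (LINT y|nu s. (norm (?b (x, y)))\<^sup>2))"
    by (rule integral_mono_AE[OF square_integrable_real[OF sq] int le])
  also have "\<dots> = prof_norm / ?c\<^sup>2 * (LINT z|weighted s. (norm (?b z))\<^sup>2)"
    using integral_weighted(1)[OF ib] by simp
  also have "\<dots> \<le> prof_norm / ?c\<^sup>2 * (LINT z|weighted s. (norm (join m W z))\<^sup>2)"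
  proof (intro mult_left_mono integral_mono ib square_integrable_norm square_integrable_join W)
    show "(norm (?b z))\<^sup>2 \<le> (norm (join m W z))\<^sup>2" for z
      using power_mono[OF norm_snd_le_norm[of "snd W z"] norm_ge_zero, of 2]
      by (simp add: join_def norm_Pair)
  qed (use prof_norm_nonneg in auto)
  also have "\<dots> = trace_const * Xs_inner s m W W"
    using kap by (simp add: trace_const_def Xs_inner_self)
  finally show "(LINT x|cell. (trace_of W x)\<^sup>2) \<le> trace_const * Xs_inner s m W W" .
qed

lemma trace_of_jdiff:
  assumes "W \<in> L2_jets s" "Z \<in> L2_jets s"
  shows "AE x in cell. trace_of (jdiff W Z) x = trace_of W x - trace_of Z x"
  using integral_weighted(3)[OF trace_integrand[OF assms(1)]] integral_weighted(3)[OF trace_integrand[OF assms(2)]]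
proof eventually_elim
  case (elim x)
  let ?i = "\<lambda>W y. prof' s m y * snd (snd W (x, y)) + m\<^sup>2 * prof s m y * fst W (x, y)"
  have "(LINT y|nu s. ?i (jdiff W Z) y) = (LINT y|nu s. ?i W y - ?i Z y)"
    by (simp add: jdiff_def algebra_simps)
  also have "\<dots> = (LINT y|nu s. ?i W y) - (LINT y|nu s. ?i Z y)" using elim by simp
  finally show ?case unfolding trace_of_def by (simp add: diff_divide_distrib)
qed

lemma Xs_space_L2: "V \<in> Xs_space s m \<Longrightarrow> V \<in> L2_jets s"
  by (simp add: Xs_space_def)

lemma approximates_smooth: "approximates s m \<phi> V \<Longrightarrow> \<phi> n \<in> smooth_periodic s"
  by (simp add: approximates_def)

lemma approximates_L2: "approximates s m \<phi> V \<Longrightarrow> grad_jet (\<phi> n) \<in> L2_jets s"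
  by (intro smooth_periodic_L2 approximates_smooth)

lemma smooth_trace_square_integrable:
  assumes "\<phi> \<in> smooth_periodic s"
  shows "square_integrable cell (\<lambda>x. \<phi> (x, 0))"
proof -
  have c0: "continuous_on half_space \<phi>" by (rule smooth_periodic_classical[OF assms])
  have c: "continuous_on UNIV (\<lambda>x. \<phi> (x, 0))" by (intro continuous_on_compose2[OF c0] continuous_intros) auto
  then have "integrable cell (\<lambda>x. (\<phi> (x, 0))\<^sup>2)" by (intro continuous_integrable_cell continuous_intros)
  then show ?thesis using c by (simp add: square_integrable_def measurable_cell borel_measurable_continuous_onI)
qed

text \<open>All approximating sequences are required to have the same limit; \<open>L2_traceI\<close> shows that one
  sequence suffices.\<close>
definition L2_trace :: "jet \<Rightarrow> (real^3 \<Rightarrow> real) \<Rightarrow> bool" where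
  "L2_trace V u \<longleftrightarrow> square_integrable cell u \<and>
    (\<forall>\<phi>. approximates s m \<phi> V \<longrightarrow> (\<lambda>n. sqdist cell (\<lambda>x. \<phi> n (x, 0)) u) \<longlonglongrightarrow> 0)"

text \<open>Both sides of the convergence are values of \<open>trace_of\<close>, which is linear and bounded.\<close>
lemma L2_trace_trace_of:
  assumes V: "V \<in> L2_jets s"
  shows "L2_trace V (trace_of V)"
  unfolding L2_trace_def
proof (intro conjI allI impI)
  show "square_integrable cell (trace_of V)" by (rule trace_of_bound(1)[OF V])
  fix \<phi> assume a: "approximates s m \<phi> V"
  have le: "sqdist cell (\<lambda>x. \<phi> n (x, 0)) (trace_of V) \<le> trace_const * (1 / kappa s * sqdist (weighted s) (join m V) (join m (grad_jet (\<phi> n))))" for n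
  proof -
    note D = L2_jets_jdiff[OF V approximates_L2[OF a]]
    have "sqdist cell (\<lambda>x. \<phi> n (x, 0)) (trace_of V) = (LINT x|cell. (trace_of (jdiff V (grad_jet (\<phi> n))) x)\<^sup>2)"
      unfolding sqdist_def
    proof (rule integral_cong_AE)
      show "(\<lambda>x. (norm (\<phi> n (x, 0) - trace_of V x))\<^sup>2) \<in> borel_measurable cell"
        using square_integrable_measurable[OF smooth_trace_square_integrable[OF approximates_smooth[OF a, of n]]]
          square_integrable_measurable[OF trace_of_bound(1)[OF V]] by simp
      show "(\<lambda>x. (trace_of (jdiff V (grad_jet (\<phi> n))) x)\<^sup>2) \<in> borel_measurable cell"
        using square_integrable_measurable[OF trace_of_bound(1)[OF D]] by simp
      show "AE x in cell. (norm (\<phi> n (x, 0) - trace_of V x))\<^sup>2 = (trace_of (jdiff V (grad_jet (\<phi> n))) x)\<^sup>2"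
        using trace_of_jdiff[OF V approximates_L2[OF a, of n]] trace_of_smooth[OF approximates_smooth[OF a, of n]]
        by eventually_elim (simp add: power2_commute)
    qed
    also have "\<dots> \<le> trace_const * Xs_inner s m (jdiff V (grad_jet (\<phi> n))) (jdiff V (grad_jet (\<phi> n)))"
      by (rule trace_of_bound(2)[OF D])
    finally show ?thesis by (simp add: Xs_inner_jdiff)
  qed
  have "(\<lambda>n. trace_const * (1 / kappa s * sqdist (weighted s) (join m V) (join m (grad_jet (\<phi> n))))) \<longlonglongrightarrow> trace_const * (1 / kappa s * 0)"
    using a by (intro tendsto_intros) (simp add: approximates_iff)
  then have lim: "(\<lambda>n. trace_const * (1 / kappa s * sqdist (weighted s) (join m V) (join m (grad_jet (\<phi> n))))) \<longlonglongrightarrow> 0"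
    by simp
  show "(\<lambda>n. sqdist cell (\<lambda>x. \<phi> n (x, 0)) (trace_of V)) \<longlonglongrightarrow> 0"
    by (rule tendsto_sandwich[OF _ _ tendsto_const lim]) (intro always_eventually allI sqdist_nonneg le)+
qed

lemma L2_trace_cong:
  assumes "L2_trace V u" "\<And>x. x \<in> cube \<Longrightarrow> u' x = u x"
  shows "L2_trace V u'"
  using assms(1) square_integrable_cong[of cell u' u] sqdist_cong[of cell _ _ u' u]
  unfolding L2_trace_def using assms(2) by (simp add: space_cell)

lemma L2_trace_exists:
  assumes "V \<in> Xs_space s m"
  obtains u where "periodic u" "L2_trace V u"
proof
  show "periodic (trace_of V \<circ> fold_to_cube)" by (simp add: periodic_def fold_to_cube_periodic)
  show "L2_trace V (trace_of V \<circ> fold_to_cube)"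
    by (rule L2_trace_cong[OF L2_trace_trace_of[OF Xs_space_L2[OF assms]]]) (simp add: fold_to_cube_id)
qed

lemma L2_traceI:
  assumes V: "V \<in> Xs_space s m" and a: "approximates s m \<phi> V"
    and w: "square_integrable cell w" and lim: "(\<lambda>n. sqdist cell (\<lambda>x. \<phi> n (x, 0)) w) \<longlonglongrightarrow> 0"
  shows "L2_trace V w"
proof -
  obtain u where u: "L2_trace V u" using L2_trace_exists[OF V] by blast
  have us: "square_integrable cell u" using u by (simp add: L2_trace_def)
  have ps: "square_integrable cell (\<lambda>x. \<psi> n (x, 0))" if "approximates s m \<psi> V" for \<psi> n
    by (intro smooth_trace_square_integrable approximates_smooth[OF that])
  have "sqdist cell u w \<le> 0"
  proof (rule LIMSEQ_le[OF tendsto_const])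
    have "(\<lambda>n. 2 * sqdist cell (\<lambda>x. \<phi> n (x, 0)) u + 2 * sqdist cell (\<lambda>x. \<phi> n (x, 0)) w) \<longlonglongrightarrow> 2 * 0 + 2 * 0"
      using u a lim unfolding L2_trace_def by (intro tendsto_intros) auto
    then show "(\<lambda>n. 2 * sqdist cell (\<lambda>x. \<phi> n (x, 0)) u + 2 * sqdist cell (\<lambda>x. \<phi> n (x, 0)) w) \<longlonglongrightarrow> 0" by simp
    show "\<exists>N. \<forall>n\<ge>N. sqdist cell u w \<le> 2 * sqdist cell (\<lambda>x. \<phi> n (x, 0)) u + 2 * sqdist cell (\<lambda>x. \<phi> n (x, 0)) w"
      using sqdist_triangle[OF us ps[OF a] w] by (auto simp: sqdist_commute[of cell u])
  qed
  then have z: "sqdist cell u w = 0" using sqdist_nonneg[of cell u w] by simp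
  show ?thesis
    unfolding L2_trace_def
  proof (intro conjI w allI impI)
    fix \<psi> assume b: "approximates s m \<psi> V"
    have "\<forall>\<^sub>F n in sequentially. sqdist cell (\<lambda>x. \<psi> n (x, 0)) w \<le> 2 * sqdist cell (\<lambda>x. \<psi> n (x, 0)) u"
      using sqdist_triangle[OF ps[OF b] us w] z by simp
    moreover have "\<forall>\<^sub>F n in sequentially. 0 \<le> sqdist cell (\<lambda>x. \<psi> n (x, 0)) w" by (simp add: sqdist_nonneg)
    moreover have "(\<lambda>n. 2 * sqdist cell (\<lambda>x. \<psi> n (x, 0)) u) \<longlonglongrightarrow> 2 * 0"
      using u b unfolding L2_trace_def by (intro tendsto_intros) auto
    ultimately show "(\<lambda>n. sqdist cell (\<lambda>x. \<psi> n (x, 0)) w) \<longlonglongrightarrow> 0"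
      using tendsto_sandwich[OF _ _ tendsto_const] by fastforce
  qed
qed

lemma Theta_pairing:
  assumes V: "V \<in> Xs_space s m" and u: "L2_trace V u"
  shows "Xs_inner s m (Theta k d) V = rad k powr (2 * s) * (LINT x|cell. wave k d x * u x)"
proof -
  obtain \<phi> where a: "approximates s m \<phi> V" using V by (auto simp: Xs_space_def)
  have us: "square_integrable cell u" using u by (simp add: L2_trace_def)
  have "(\<lambda>n. Xs_inner s m (Theta k d) (grad_jet (\<phi> n))) \<longlonglongrightarrow> Xs_inner s m (Theta k d) V"
    using a by (intro Xs_inner_tendsto approximates_L2[OF a] Xs_space_L2[OF V] Theta_L2) (simp add: approximates_iff)
  then have "(\<lambda>n. rad k powr (2 * s) * (LINT x|cell. wave k d x * \<phi> n (x, 0))) \<longlonglongrightarrow> Xs_inner s m (Theta k d) V"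
    by (simp add: Theta_pairing_smooth approximates_smooth[OF a])
  moreover have "(\<lambda>n. rad k powr (2 * s) * (LINT x|cell. wave k d x * \<phi> n (x, 0))) \<longlonglongrightarrow> rad k powr (2 * s) * (LINT x|cell. wave k d x * u x)"
  proof (intro tendsto_intros)
    have "(\<lambda>n. LINT x|cell. wave k d x \<bullet> \<phi> n (x, 0)) \<longlonglongrightarrow> (LINT x|cell. wave k d x \<bullet> u x)"
      using u a unfolding L2_trace_def
      by (intro integral_inner_tendsto smooth_trace_square_integrable approximates_smooth[OF a] square_integrable_wave) auto
    then show "(\<lambda>n. LINT x|cell. wave k d x * \<phi> n (x, 0)) \<longlonglongrightarrow> (LINT x|cell. wave k d x * u x)" by simp
  qed
  ultimately show ?thesis by (rule LIMSEQ_unique)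
qed

lemma Theta_trace: "L2_trace (Theta k d) (wave k d)"
proof -
  obtain \<phi> where a: "approximates s m \<phi> (Theta k d)"
    and v: "\<And>n x. \<phi> n (x, 0) = wave k d x * prof s (rad k) (1 / Suc n)"
    by (rule Theta_approximable[of k d]) (rule that)
  show ?thesis
  proof (rule L2_traceI[OF Theta_in_Xs a square_integrable_wave])
    have eq: "sqdist cell (\<lambda>x. \<phi> n (x, 0)) (wave k d) = (prof s (rad k) (1 / Suc n) - 1)\<^sup>2 * (LINT x|cell. (wave k d x)\<^sup>2)" for n
    proof -
      have "sqdist cell (\<lambda>x. \<phi> n (x, 0)) (wave k d) = (LINT x|cell. (prof s (rad k) (1 / Suc n) - 1)\<^sup>2 * (wave k d x)\<^sup>2)"
        unfolding sqdist_def v by (rule Bochner_Integration.integral_cong) (auto simp: power_mult_distrib[symmetric] algebra_simps)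
      then show ?thesis by simp
    qed
    have "(\<lambda>n. prof s (rad k) (1 / Suc n)) \<longlonglongrightarrow> prof s (rad k) 0"
      using LIMSEQ_inverse_real_of_nat by (intro isCont_tendsto_compose[OF isCont_prof[OF s0]]) (simp add: inverse_eq_divide)
    then have "(\<lambda>n. prof s (rad k) (1 / Suc n)) \<longlonglongrightarrow> 1" by (simp add: prof_def theta_0 s0)
    then have "(\<lambda>n. (prof s (rad k) (1 / Suc n) - 1)\<^sup>2 * (LINT x|cell. (wave k d x)\<^sup>2)) \<longlonglongrightarrow> (1 - 1)\<^sup>2 * (LINT x|cell. (wave k d x)\<^sup>2)"
      by (intro tendsto_intros)
    then show "(\<lambda>n. sqdist cell (\<lambda>x. \<phi> n (x, 0)) (wave k d)) \<longlonglongrightarrow> 0" by (simp add: eq)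
  qed
qed

lemma Theta_gram: "Xs_inner s m (Theta k d) (Theta l e) = rad k powr (2 * s) * (LINT x|cell. wave k d x * wave l e x)"
  by (rule Theta_pairing[OF Theta_in_Xs Theta_trace])

end

section \<open>The trace inequality\<close>

context extension
begin

lemma Xs_inner_Cauchy_Schwarz:
  assumes "W \<in> L2_jets s" "Z \<in> L2_jets s"
  shows "(Xs_inner s m W Z)\<^sup>2 \<le> Xs_inner s m W W * Xs_inner s m Z Z"
proof -
  have "(1 / kappa s)\<^sup>2 * (LINT z|weighted s. join m W z \<bullet> join m Z z)\<^sup>2
    \<le> (1 / kappa s)\<^sup>2 * ((LINT z|weighted s. (norm (join m W z))\<^sup>2) * (LINT z|weighted s. (norm (join m Z z))\<^sup>2))"
    by (intro mult_left_mono Cauchy_Schwarz_square_integrable square_integrable_join assms) simp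
  then show ?thesis
    unfolding Xs_inner_self unfolding Xs_inner_join by (simp add: power_mult_distrib power2_eq_square)
qed

lemma Hs_term_eq: "Hs_term s m u k = rad k powr (2 * s) * (cmod (fourier_coeff u k))\<^sup>2"
  by (simp add: Hs_term_def rad_powr)

lemma Hs_term_nonneg: "0 \<le> Hs_term s m u k"
  by (simp add: Hs_term_def)

lemma rad_minus: "rad (- k) = rad k"
proof -
  have "freq (- k) = - freq k" by (simp add: freq_def vec_eq_iff)
  then show ?thesis by (simp add: rad_def)
qed

lemma abs_Theta_gram_le:
  "\<bar>Xs_inner s m (Theta k d) (Theta l e)\<bar> \<le> (2 * pi) ^ 3 / 2 * rad k powr (2 * s) * ((if k = - l then 1 else 0) + (if k = l then 1 else 0))"
proof -
  have c: "\<bar>(2 * pi) ^ 3 * cos x\<bar> \<le> (2 * pi) ^ 3" for x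
    using abs_cos_le_one[of x] by (simp add: abs_mult mult_left_le)
  have "\<bar>LINT x|cell. wave k d x * wave l e x\<bar> \<le> (2 * pi) ^ 3 / 2 * ((if k = - l then 1 else 0) + (if k = l then 1 else 0))"
    unfolding integral_wave_mult using c[of "d + e"] c[of "d - e"]
      abs_triangle_ineq[of "(2 * pi) ^ 3 * cos (d + e)" "(2 * pi) ^ 3 * cos (d - e)"] by auto
  then have "rad k powr (2 * s) * \<bar>LINT x|cell. wave k d x * wave l e x\<bar>
    \<le> rad k powr (2 * s) * ((2 * pi) ^ 3 / 2 * ((if k = - l then 1 else 0) + (if k = l then 1 else 0)))"
    by (rule mult_left_mono) simp
  then show ?thesis unfolding Theta_gram by (simp add: abs_mult mult_ac)
qed

text \<open>Bessel's inequality in the extension space for the family \<open>Theta\<close>.  The waves of \<open>k\<close> and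
  \<open>- k\<close> are not orthogonal to each other; the corresponding cross terms are absorbed by
  \<open>2 a b \<le> a\<^sup>2 + b\<^sup>2\<close>.\<close>
lemma trace_inequality:
  assumes V: "V \<in> Xs_space s m" and u: "L2_trace V u" and F: "finite F"
  shows "(\<Sum>k\<in>F. Hs_term s m u k) \<le> Xs_inner s m V V"
proof -
  have us: "square_integrable cell u" using u by (simp add: L2_trace_def)
  have "\<forall>k. \<exists>d. (LINT x|cell. wave k d x * u x) \<ge> 0 \<and>
    (LINT x|cell. wave k d x * u x)\<^sup>2 = (2 * pi) ^ 3 * (cmod (fourier_coeff u k))\<^sup>2"
  proof
    fix k
    show "\<exists>d. (LINT x|cell. wave k d x * u x) \<ge> 0 \<and>
      (LINT x|cell. wave k d x * u x)\<^sup>2 = (2 * pi) ^ 3 * (cmod (fourier_coeff u k))\<^sup>2"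
      by (rule optimal_phase[OF us, of k]) blast
  qed
  from choice[OF this] obtain d where d: "\<And>k. (LINT x|cell. wave k (d k) x * u x) \<ge> 0"
    "\<And>k. (LINT x|cell. wave k (d k) x * u x)\<^sup>2 = (2 * pi) ^ 3 * (cmod (fourier_coeff u k))\<^sup>2" by blast
  define \<rho> where "\<rho> = (\<lambda>k. LINT x|cell. wave k (d k) x * u x)"
  define R where "R = (\<lambda>k. rad k powr (2 * s))"
  define T where "T = (\<Sum>k\<in>F. R k * (\<rho> k)\<^sup>2)"
  \<comment> \<open>The combination whose inner product with \<open>V\<close> is the weighted square sum \<open>T\<close>; Cauchy-Schwarz then
    compares \<open>T\<^sup>2\<close> with a multiple of \<open>T\<close>.\<close>
  define Z where "Z = jsum F \<rho> (\<lambda>k. Theta k (d k))"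
  have rho0: "0 \<le> \<rho> k" for k using d(1) by (simp add: \<rho>_def)
  have R0: "0 \<le> R k" for k by (simp add: R_def)
  have Rm: "R (- k) = R k" for k by (simp add: R_def rad_minus)
  have T0: "0 \<le> T" unfolding T_def by (intro sum_nonneg mult_nonneg_nonneg R0) simp
  have ZL: "Z \<in> L2_jets s" unfolding Z_def by (intro L2_jets_jsum Theta_L2)
  have ZV: "Xs_inner s m Z V = T"
    unfolding Z_def T_def R_def
    by (subst Xs_inner_jsum_left[OF Theta_L2 Xs_space_L2[OF V]])
      (simp add: Theta_pairing[OF V u] \<rho>_def power2_eq_square mult_ac)
  have "Xs_inner s m Z Z = (\<Sum>k\<in>F. \<rho> k * Xs_inner s m (Theta k (d k)) Z)"
    unfolding Z_def by (rule Xs_inner_jsum_left[OF Theta_L2]) (intro L2_jets_jsum Theta_L2)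
  also have "\<dots> = (\<Sum>k\<in>F. \<rho> k * (\<Sum>l\<in>F. \<rho> l * Xs_inner s m (Theta l (d l)) (Theta k (d k))))"
  proof (intro sum.cong refl arg_cong2[where f = "(*)"])
    fix k
    show "Xs_inner s m (Theta k (d k)) Z = (\<Sum>l\<in>F. \<rho> l * Xs_inner s m (Theta l (d l)) (Theta k (d k)))"
      by (subst Xs_inner_commute, unfold Z_def) (intro Xs_inner_jsum_left Theta_L2)
  qed
  also have "\<dots> \<le> (\<Sum>k\<in>F. \<Sum>l\<in>F. (2 * pi) ^ 3 / 2 * (R l * ((if l = - k then 1 else 0) + (if l = k then 1 else 0)) * ((\<rho> k)\<^sup>2 + (\<rho> l)\<^sup>2) / 2))"
    unfolding sum_distrib_left
  proof (intro sum_mono)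
    fix k l :: "int^3"
    let ?\<delta> = "(if l = - k then 1 else 0) + (if l = k then 1 else 0) :: real"
    have "\<rho> k * (\<rho> l * Xs_inner s m (Theta l (d l)) (Theta k (d k))) \<le> \<rho> k * (\<rho> l * ((2 * pi) ^ 3 / 2 * R l * ?\<delta>))"
      using abs_Theta_gram_le[of l "d l" k "d k"] rho0 unfolding R_def
      by (intro mult_left_mono) auto
    also have "\<dots> = ((2 * pi) ^ 3 / 2 * R l * ?\<delta>) * (\<rho> k * \<rho> l)" by simp
    also have "\<dots> \<le> ((2 * pi) ^ 3 / 2 * R l * ?\<delta>) * (((\<rho> k)\<^sup>2 + (\<rho> l)\<^sup>2) / 2)"
    proof (rule mult_left_mono)
      show "\<rho> k * \<rho> l \<le> ((\<rho> k)\<^sup>2 + (\<rho> l)\<^sup>2) / 2" using sum_squares_bound[of "\<rho> k" "\<rho> l"] by simp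
      show "0 \<le> (2 * pi) ^ 3 / 2 * R l * ?\<delta>" using R0 by (intro mult_nonneg_nonneg) auto
    qed
    finally show "\<rho> k * (\<rho> l * Xs_inner s m (Theta l (d l)) (Theta k (d k)))
      \<le> (2 * pi) ^ 3 / 2 * (R l * ?\<delta> * ((\<rho> k)\<^sup>2 + (\<rho> l)\<^sup>2) / 2)" by (simp add: mult_ac)
  qed
  also have "\<dots> \<le> (2 * pi) ^ 3 * T"
  proof -
    have one: "(\<Sum>l\<in>F. R l * ((if l = - k then 1 else 0) + (if l = k then 1 else 0))) \<le> 2 * R k" if "k \<in> F" for k
    proof -
      have "(\<Sum>l\<in>F. R l * ((if l = - k then 1 else 0) + (if l = k then 1 else 0)))
        = (\<Sum>l\<in>F. if l = - k then R l else 0) + (\<Sum>l\<in>F. if l = k then R l else 0)"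
        unfolding sum.distrib[symmetric] by (rule sum.cong) (simp_all add: distrib_left Rm)
      also have "\<dots> = (if - k \<in> F then R (- k) else 0) + R k" using F that by simp
      also have "\<dots> \<le> 2 * R k" using R0 by (simp add: Rm)
      finally show ?thesis .
    qed
    have sym: "(\<Sum>k\<in>F. \<Sum>l\<in>F. R l * ((if l = - k then 1 else 0) + (if l = k then 1 else 0)) * (\<rho> l)\<^sup>2)
      = (\<Sum>k\<in>F. \<Sum>l\<in>F. R l * ((if l = - k then 1 else 0) + (if l = k then 1 else 0)) * (\<rho> k)\<^sup>2)"
    proof (subst sum.swap, intro sum.cong refl)
      fix k l :: "int^3"
      let ?A = "(if l = - k then 1 else 0) + (if l = k then 1 else 0) :: real"
      have "(if k = - l then 1 else 0) + (if k = l then 1 else 0) = ?A" by auto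
      moreover have "R k * ?A = R l * ?A" by (cases "l = - k"; cases "l = k") (simp_all add: Rm)
      ultimately show "R k * ((if k = - l then 1 else 0) + (if k = l then 1 else 0)) * (\<rho> k)\<^sup>2 = R l * ?A * (\<rho> k)\<^sup>2"
        by (simp only:)
    qed
    have "(\<Sum>k\<in>F. \<Sum>l\<in>F. (2 * pi) ^ 3 / 2 * (R l * ((if l = - k then 1 else 0) + (if l = k then 1 else 0)) * ((\<rho> k)\<^sup>2 + (\<rho> l)\<^sup>2) / 2))
      = (2 * pi) ^ 3 / 4 * ((\<Sum>k\<in>F. \<Sum>l\<in>F. R l * ((if l = - k then 1 else 0) + (if l = k then 1 else 0)) * (\<rho> k)\<^sup>2)
        + (\<Sum>k\<in>F. \<Sum>l\<in>F. R l * ((if l = - k then 1 else 0) + (if l = k then 1 else 0)) * (\<rho> l)\<^sup>2))"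
      unfolding sum.distrib[symmetric] sum_distrib_left by (intro sum.cong refl) (simp add: algebra_simps)
    also have "\<dots> = (2 * pi) ^ 3 / 2 * (\<Sum>k\<in>F. (\<rho> k)\<^sup>2 * (\<Sum>l\<in>F. R l * ((if l = - k then 1 else 0) + (if l = k then 1 else 0))))"
      unfolding sym by (simp add: sum_distrib_left mult_ac)
    also have "\<dots> \<le> (2 * pi) ^ 3 / 2 * (\<Sum>k\<in>F. (\<rho> k)\<^sup>2 * (2 * R k))"
      by (intro mult_left_mono sum_mono one) auto
    also have "\<dots> = (2 * pi) ^ 3 * T" by (simp add: T_def sum_distrib_left mult_ac)
    finally show ?thesis .
  qed
  finally have ZZ: "Xs_inner s m Z Z \<le> (2 * pi) ^ 3 * T" .
  have "T\<^sup>2 \<le> Xs_inner s m Z Z * Xs_inner s m V V"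
    using Xs_inner_Cauchy_Schwarz[OF ZL Xs_space_L2[OF V]] by (simp add: ZV)
  also have "\<dots> \<le> (2 * pi) ^ 3 * T * Xs_inner s m V V" using ZZ Xs_inner_nonneg by (rule mult_right_mono)
  finally have TT: "T * T \<le> T * ((2 * pi) ^ 3 * Xs_inner s m V V)" by (simp add: power2_eq_square mult_ac)
  have "T \<le> (2 * pi) ^ 3 * Xs_inner s m V V"
  proof (cases "T = 0")
    case True
    then show ?thesis using Xs_inner_nonneg by simp
  next
    case False
    then show ?thesis using TT T0 by (auto simp: mult_le_cancel_left)
  qed
  moreover have "T = (2 * pi) ^ 3 * (\<Sum>k\<in>F. Hs_term s m u k)"
    unfolding T_def sum_distrib_left
    by (intro sum.cong refl) (simp add: Hs_term_eq R_def \<rho>_def d(2))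
  ultimately show ?thesis by simp
qed

lemma
  assumes V: "V \<in> Xs_space s m" and u: "L2_trace V u"
  shows Hs_term_summable: "Hs_term s m u summable_on UNIV"
    and Hs_infsum_le: "infsum (Hs_term s m u) UNIV \<le> Xs_inner s m V V"
proof -
  show s: "Hs_term s m u summable_on UNIV"
  proof (rule nonneg_bdd_above_summable_on)
    show "bdd_above (sum (Hs_term s m u) ` {F. F \<subseteq> UNIV \<and> finite F})"
      using trace_inequality[OF V u] by (intro bdd_aboveI[of _ "Xs_inner s m V V"]) auto
  qed (rule Hs_term_nonneg)
  show "infsum (Hs_term s m u) UNIV \<le> Xs_inner s m V V"
    by (rule infsum_le_finite_sums[OF s trace_inequality[OF V u]])
qed

section \<open>The trace operator\<close>

lemma smooth_periodic_lincomb: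
  assumes f: "f \<in> smooth_periodic s" and g: "g \<in> smooth_periodic s"
  shows "(\<lambda>z. a * f z + b * g z) \<in> smooth_periodic s"
    "snd z > 0 \<Longrightarrow> gradient (\<lambda>z. a * f z + b * g z) z = a *\<^sub>R gradient f z + b *\<^sub>R gradient g z"
proof -
  have so: "smooth_on half_space f" "smooth_on half_space g" using f g by (auto simp: smooth_periodic_def)
  show gr: "gradient (\<lambda>z. a * f z + b * g z) z = a *\<^sub>R gradient f z + b *\<^sub>R gradient g z" if "snd z > 0" for z
    by (intro gradient_lincomb smooth_on_differentiable so that)
  have L: "square_integrable (weighted s) f" "square_integrable (weighted s) (gradient f)"
    "square_integrable (weighted s) g" "square_integrable (weighted s) (gradient g)"
    using f g by (auto simp: smooth_periodic_def L2_jets_iff)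
  have "square_integrable (weighted s) (\<lambda>z. a * f z + b * g z)"
    using square_integrable_add[OF square_integrable_scaleR[OF L(1), of a] square_integrable_scaleR[OF L(3), of b]] by simp
  moreover have "square_integrable (weighted s) (gradient (\<lambda>z. a * f z + b * g z))"
    using square_integrable_cong[of "weighted s" "gradient (\<lambda>z. a * f z + b * g z)" "\<lambda>z. a *\<^sub>R gradient f z + b *\<^sub>R gradient g z"]
      square_integrable_add[OF square_integrable_scaleR[OF L(2), of a] square_integrable_scaleR[OF L(4), of b]] gr
    by (auto simp: space_weighted)
  ultimately show "(\<lambda>z. a * f z + b * g z) \<in> smooth_periodic s"
    using f g smooth_on_lincomb[OF so, of a b] unfolding smooth_periodic_def L2_jets_iff
    by (auto simp: periodic_def)
qed

definition jlin :: "real \<Rightarrow> jet \<Rightarrow> real \<Rightarrow> jet \<Rightarrow> jet" where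
  "jlin a W b Z = (\<lambda>z. a * fst W z + b * fst Z z, \<lambda>z. a *\<^sub>R snd W z + b *\<^sub>R snd Z z)"

lemma join_jlin: "join m (jlin a W b Z) z = a *\<^sub>R join m W z + b *\<^sub>R join m Z z"
  by (simp add: join_def jlin_def algebra_simps)

lemma jlin_L2: "W \<in> L2_jets s \<Longrightarrow> Z \<in> L2_jets s \<Longrightarrow> jlin a W b Z \<in> L2_jets s"
  using square_integrable_scaleR[of "weighted s" "fst W" a] square_integrable_scaleR[of "weighted s" "fst Z" b]
  by (auto simp: L2_jets_iff jlin_def intro: square_integrable_add square_integrable_scaleR)

lemma sqdist_jlin:
  assumes "W \<in> L2_jets s" "Z \<in> L2_jets s" "W' \<in> L2_jets s" "Z' \<in> L2_jets s"
  shows "sqdist (weighted s) (join m (jlin a W b Z)) (join m (jlin a W' b Z'))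
    \<le> 2 * (a\<^sup>2 * sqdist (weighted s) (join m W) (join m W')) + 2 * (b\<^sup>2 * sqdist (weighted s) (join m Z) (join m Z'))"
proof -
  have "sqdist (weighted s) (join m (jlin a W b Z)) (join m (jlin a W' b Z'))
    \<le> 2 * sqdist (weighted s) (join m (jlin a W b Z)) (join m (jlin a W' b Z)) + 2 * sqdist (weighted s) (join m (jlin a W' b Z)) (join m (jlin a W' b Z'))"
    by (intro sqdist_triangle square_integrable_join jlin_L2 assms)
  moreover have "sqdist (weighted s) (join m (jlin a W b Z)) (join m (jlin a W' b Z)) = a\<^sup>2 * sqdist (weighted s) (join m W) (join m W')"
    unfolding sqdist_def join_jlin by (simp add: scaleR_diff_right[symmetric] power_mult_distrib)
  moreover have "sqdist (weighted s) (join m (jlin a W' b Z)) (join m (jlin a W' b Z')) = b\<^sup>2 * sqdist (weighted s) (join m Z) (join m Z')"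
    unfolding sqdist_def join_jlin by (simp add: scaleR_diff_right[symmetric] power_mult_distrib)
  ultimately show ?thesis by simp
qed

lemma approximates_jlin:
  assumes W: "W \<in> L2_jets s" "approximates s m \<phi> W" and Z: "Z \<in> L2_jets s" "approximates s m \<psi> Z"
  shows "approximates s m (\<lambda>n z. a * \<phi> n z + b * \<psi> n z) (jlin a W b Z)"
  unfolding approximates_iff
proof (intro conjI allI)
  note sm = approximates_smooth[OF W(2)] approximates_smooth[OF Z(2)]
  show "(\<lambda>z. a * \<phi> n z + b * \<psi> n z) \<in> smooth_periodic s" for n by (rule smooth_periodic_lincomb[OF sm])
  let ?d = "\<lambda>n. sqdist (weighted s) (join m (jlin a W b Z)) (join m (grad_jet (\<lambda>z. a * \<phi> n z + b * \<psi> n z)))"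
  let ?E = "\<lambda>n. 2 * (a\<^sup>2 * sqdist (weighted s) (join m W) (join m (grad_jet (\<phi> n)))) + 2 * (b\<^sup>2 * sqdist (weighted s) (join m Z) (join m (grad_jet (\<psi> n))))"
  have le: "?d n \<le> ?E n" for n
  proof -
    have "?d n = sqdist (weighted s) (join m (jlin a W b Z)) (join m (jlin a (grad_jet (\<phi> n)) b (grad_jet (\<psi> n))))"
      by (rule sqdist_cong) (auto simp: join_def jlin_def space_weighted smooth_periodic_lincomb(2)[OF sm])
    also have "\<dots> \<le> ?E n" by (intro sqdist_jlin W Z approximates_L2[OF W(2)] approximates_L2[OF Z(2)])
    finally show ?thesis .
  qed
  have "?E \<longlonglongrightarrow> 2 * (a\<^sup>2 * 0) + 2 * (b\<^sup>2 * 0)"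
    using W(2) Z(2) by (intro tendsto_intros) (auto simp: approximates_iff)
  then have lim: "?E \<longlonglongrightarrow> 0" by simp
  show "?d \<longlonglongrightarrow> 0"
    by (rule tendsto_sandwich[OF _ _ tendsto_const lim]) (intro always_eventually allI sqdist_nonneg le)+
qed

lemma Xs_jlin: "W \<in> Xs_space s m \<Longrightarrow> Z \<in> Xs_space s m \<Longrightarrow> jlin a W b Z \<in> Xs_space s m"
  using approximates_jlin jlin_L2 unfolding Xs_space_def by blast

lemma Xs_jsum:
  assumes "finite I" "\<And>i. i \<in> I \<Longrightarrow> W i \<in> Xs_space s m"
  shows "jsum I c W \<in> Xs_space s m"
  using assms
proof (induction I rule: finite_induct)
  case empty
  have "jsum {} c W = jlin 0 (Theta 0 0) 0 (Theta 0 0)" by (simp add: jsum_def jlin_def)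
  then show ?case using Xs_jlin[OF Theta_in_Xs Theta_in_Xs] by simp
next
  case (insert i F)
  have "jsum (insert i F) c W = jlin (c i) (W i) 1 (jsum F c W)"
    using insert(1,2) by (simp add: jsum_def jlin_def)
  then show ?case using Xs_jlin[of "W i" "jsum F c W" "c i" 1] insert by simp
qed

lemma grad_jet_in_Xs:
  assumes "\<phi> \<in> smooth_periodic s"
  shows "approximates s m (\<lambda>n. \<phi>) (grad_jet \<phi>)" "grad_jet \<phi> \<in> Xs_space s m"
proof -
  show a: "approximates s m (\<lambda>n. \<phi>) (grad_jet \<phi>)"
    using assms by (simp add: approximates_iff sqdist_def)
  then show "grad_jet \<phi> \<in> Xs_space s m"
    using smooth_periodic_L2[OF assms] unfolding Xs_space_def by blast
qed

lemma L2_trace_grad_jet: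
  assumes "\<phi> \<in> smooth_periodic s"
  shows "L2_trace (grad_jet \<phi>) (\<lambda>x. \<phi> (x, 0))"
  by (rule L2_traceI[OF grad_jet_in_Xs(2)[OF assms] grad_jet_in_Xs(1)[OF assms] smooth_trace_square_integrable[OF assms]])
    (simp add: sqdist_def)

text \<open>A diagonal sequence of smooth functions.\<close>
lemma Xs_closed:
  assumes W: "\<And>n. W n \<in> Xs_space s m" and L: "L \<in> L2_jets s"
    and lim: "(\<lambda>n. sqdist (weighted s) (join m L) (join m (W n))) \<longlonglongrightarrow> 0"
  shows "L \<in> Xs_space s m"
proof -
  have "\<exists>\<phi>. \<phi> \<in> smooth_periodic s \<and> sqdist (weighted s) (join m (W n)) (join m (grad_jet \<phi>)) < 1 / Suc n" for n
  proof -
    obtain \<phi> where a: "approximates s m \<phi> (W n)" using W[of n] by (auto simp: Xs_space_def)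
    then have "(\<lambda>j. sqdist (weighted s) (join m (W n)) (join m (grad_jet (\<phi> j)))) \<longlonglongrightarrow> 0" by (simp add: approximates_iff)
    then have "\<forall>\<^sub>F j in sequentially. sqdist (weighted s) (join m (W n)) (join m (grad_jet (\<phi> j))) < 1 / Suc n"
      by (rule order_tendstoD(2)) simp
    then obtain j where "sqdist (weighted s) (join m (W n)) (join m (grad_jet (\<phi> j))) < 1 / Suc n"
      using eventually_happens by fastforce
    then show ?thesis using approximates_smooth[OF a] by blast
  qed
  then obtain \<phi> where phi: "\<And>n. \<phi> n \<in> smooth_periodic s" "\<And>n. sqdist (weighted s) (join m (W n)) (join m (grad_jet (\<phi> n))) < 1 / Suc n" by metis
  let ?E = "\<lambda>n. 2 * sqdist (weighted s) (join m L) (join m (W n)) + 2 * (1 / real (Suc n))"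
  have le: "sqdist (weighted s) (join m L) (join m (grad_jet (\<phi> n))) \<le> ?E n" for n
    using sqdist_triangle[OF square_integrable_join[OF L] square_integrable_join[OF Xs_space_L2[OF W[of n]]] square_integrable_join[OF smooth_periodic_L2[OF phi(1)[of n]]]] phi(2)[of n]
    by (smt (verit))
  have "?E \<longlonglongrightarrow> 2 * 0 + 2 * 0"
    using LIMSEQ_inverse_real_of_nat by (intro tendsto_intros lim) (simp add: inverse_eq_divide)
  then have lim0: "?E \<longlonglongrightarrow> 0" by simp
  have "(\<lambda>n. sqdist (weighted s) (join m L) (join m (grad_jet (\<phi> n)))) \<longlonglongrightarrow> 0"
    by (rule tendsto_sandwich[OF _ _ tendsto_const lim0]) (intro always_eventually allI sqdist_nonneg le)+
  then have "approximates s m \<phi> L" using phi(1) by (simp add: approximates_iff)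
  then show ?thesis using L unfolding Xs_space_def by blast
qed

text \<open>The error \<open>\<phi> n - V\<close> is itself an element of the extension space, and its trace is \<open>\<phi> n - u\<close>.
  The trace inequality therefore upgrades the convergence of traces in \<open>L\<^sup>2\<close> to convergence in the
  norm of \<open>Hs_space\<close>.\<close>
lemma has_traceI:
  assumes V: "V \<in> Xs_space s m" and per: "periodic u" and u: "L2_trace V u"
  shows "has_trace s m V u"
  unfolding has_trace_def
proof
  have us: "square_integrable cell u" using u by (simp add: L2_trace_def)
  show "u \<in> Hs_space s m"
    using per us Hs_term_summable[OF V u]
    by (auto simp: Hs_space_def square_integrable_real square_integrable_measurable)
  obtain \<phi> where a: "approximates s m \<phi> V" using V by (auto simp: Xs_space_def)
  let ?D = "\<lambda>n. jlin 1 (grad_jet (\<phi> n)) (-1) V"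
  have sq: "Xs_inner s m (?D n) (?D n) = 1 / kappa s * sqdist (weighted s) (join m V) (join m (grad_jet (\<phi> n)))" for n
    unfolding Xs_inner_self sqdist_def join_jlin by (simp add: norm_minus_commute)
  have le: "Hs_norm s m (\<lambda>x. \<phi> n (x, 0) - u x) \<le> sqrt (1 / kappa s * sqdist (weighted s) (join m V) (join m (grad_jet (\<phi> n))))" for n
  proof -
    note sm = approximates_smooth[OF a, of n]
    have DX: "?D n \<in> Xs_space s m" by (intro Xs_jlin grad_jet_in_Xs sm V)
    have app: "approximates s m (\<lambda>j z. 1 * \<phi> n z + (-1) * \<phi> j z) (?D n)"
      by (intro approximates_jlin grad_jet_in_Xs sm smooth_periodic_L2 Xs_space_L2[OF V] a)
    have "L2_trace (?D n) (\<lambda>x. \<phi> n (x, 0) - u x)"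
    proof (rule L2_traceI[OF DX app])
      show "square_integrable cell (\<lambda>x. \<phi> n (x, 0) - u x)"
        by (intro square_integrable_diff smooth_trace_square_integrable sm us)
      have "sqdist cell (\<lambda>x. 1 * \<phi> n (x, 0) + (-1) * \<phi> j (x, 0)) (\<lambda>x. \<phi> n (x, 0) - u x) = sqdist cell (\<lambda>x. \<phi> j (x, 0)) u" for j
        unfolding sqdist_def by (rule Bochner_Integration.integral_cong) (auto simp: abs_minus_commute power2_commute)
      then show "(\<lambda>j. sqdist cell (\<lambda>x. 1 * \<phi> n (x, 0) + (-1) * \<phi> j (x, 0)) (\<lambda>x. \<phi> n (x, 0) - u x)) \<longlonglongrightarrow> 0"
        using u a by (simp add: L2_trace_def)
    qed
    from Hs_infsum_le[OF DX this] show ?thesis unfolding Hs_norm_def sq by (rule real_sqrt_le_mono)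
  qed
  have "(\<lambda>n. sqrt (1 / kappa s * sqdist (weighted s) (join m V) (join m (grad_jet (\<phi> n))))) \<longlonglongrightarrow> sqrt (1 / kappa s * 0)"
    using a by (intro tendsto_intros) (simp add: approximates_iff)
  then have lim: "(\<lambda>n. sqrt (1 / kappa s * sqdist (weighted s) (join m V) (join m (grad_jet (\<phi> n))))) \<longlonglongrightarrow> 0" by simp
  have "0 \<le> Hs_norm s m f" for f unfolding Hs_norm_def by (simp add: infsum_nonneg Hs_term_nonneg)
  then have "(\<lambda>n. Hs_norm s m (\<lambda>x. \<phi> n (x, 0) - u x)) \<longlonglongrightarrow> 0"
    by (intro tendsto_sandwich[OF _ _ tendsto_const lim] always_eventually allI le)
  then show "\<exists>\<phi>. approximates s m \<phi> V \<and> (\<lambda>n. Hs_norm s m (\<lambda>x. \<phi> n (x, 0) - u x)) \<longlonglongrightarrow> 0" using a by blast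
qed

lemma has_trace_Tr: "V \<in> Xs_space s m \<Longrightarrow> has_trace s m V (Tr s m V)"
proof -
  assume V: "V \<in> Xs_space s m"
  obtain u where "periodic u" "L2_trace V u" by (rule L2_trace_exists[OF V])
  then have "has_trace s m V u" by (rule has_traceI[OF V])
  then show ?thesis unfolding Tr_def by (rule someI[of "has_trace s m V"])
qed

lemma Hs_space_square_integrable: "u \<in> Hs_space s m \<Longrightarrow> square_integrable cell u"
  by (auto simp: Hs_space_def square_integrable_def)

lemma Hs_term_diff_le:
  assumes "square_integrable cell u" "square_integrable cell v"
  shows "Hs_term s m (\<lambda>x. u x - v x) k \<le> 2 * Hs_term s m u k + 2 * Hs_term s m v k"
proof -
  have ui: "integrable cell u" "integrable cell v" using assms by (auto intro: integrable_square_integrable_cell)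
  have d: "(LINT x|cell. wave k d x * (u x - v x)) = (LINT x|cell. wave k d x * u x) - (LINT x|cell. wave k d x * v x)" for d
    using integrable_wave_mult[OF ui(1)] integrable_wave_mult[OF ui(2)] by (simp add: right_diff_distrib)
  have sq: "(x - y)\<^sup>2 \<le> 2 * x\<^sup>2 + 2 * y\<^sup>2" for x y :: real
    using zero_le_power2[of "x + y"] by (simp add: power2_eq_square algebra_simps)
  have comb: "((x - y)\<^sup>2 + (x' - y')\<^sup>2) / (2 * pi) ^ 3 \<le> 2 * ((x\<^sup>2 + x'\<^sup>2) / (2 * pi) ^ 3) + 2 * ((y\<^sup>2 + y'\<^sup>2) / (2 * pi) ^ 3)" for x y x' y' :: real
  proof -
    have "(x - y)\<^sup>2 + (x' - y')\<^sup>2 \<le> 2 * (x\<^sup>2 + x'\<^sup>2) + 2 * (y\<^sup>2 + y'\<^sup>2)" using add_mono[OF sq[of x y] sq[of x' y']] unfolding distrib_left by (simp only: ac_simps)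
    then have "((x - y)\<^sup>2 + (x' - y')\<^sup>2) / (2 * pi) ^ 3 \<le> (2 * (x\<^sup>2 + x'\<^sup>2) + 2 * (y\<^sup>2 + y'\<^sup>2)) / (2 * pi) ^ 3"
      by (rule divide_right_mono) simp
    then show ?thesis by (simp only: add_divide_distrib[of "2 * _"] times_divide_eq_right)
  qed
  have "(cmod (fourier_coeff (\<lambda>x. u x - v x) k))\<^sup>2 \<le> 2 * (cmod (fourier_coeff u k))\<^sup>2 + 2 * (cmod (fourier_coeff v k))\<^sup>2"
    unfolding Fourier_coeff_square[OF ui(1)] Fourier_coeff_square[OF ui(2)] Fourier_coeff_square[OF Bochner_Integration.integrable_diff[OF ui]] d
    by (rule comb)
  then have "rad k powr (2 * s) * (cmod (fourier_coeff (\<lambda>x. u x - v x) k))\<^sup>2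
    \<le> rad k powr (2 * s) * (2 * (cmod (fourier_coeff u k))\<^sup>2 + 2 * (cmod (fourier_coeff v k))\<^sup>2)"
    by (rule mult_left_mono) simp
  then show ?thesis by (simp add: Hs_term_eq algebra_simps)
qed

text \<open>Convergence in the norm of \<open>Hs_space\<close> implies convergence of each Fourier coefficient, so
  every trace pairs with the waves as the \<open>L\<^sup>2\<close> trace does.\<close>
lemma has_trace_pairing:
  assumes V: "V \<in> Xs_space s m" and tr: "has_trace s m V u"
  shows "Xs_inner s m (Theta k d) V = rad k powr (2 * s) * (LINT x|cell. wave k d x * u x)"
proof -
  obtain \<phi> where a: "approximates s m \<phi> V" and lim: "(\<lambda>n. Hs_norm s m (\<lambda>x. \<phi> n (x, 0) - u x)) \<longlonglongrightarrow> 0"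
    and uH: "u \<in> Hs_space s m" using tr by (auto simp: has_trace_def)
  have us: "square_integrable cell u" by (rule Hs_space_square_integrable[OF uH])
  have ps: "square_integrable cell (\<lambda>x. \<phi> n (x, 0))" for n
    by (intro smooth_trace_square_integrable approximates_smooth[OF a])
  let ?e = "\<lambda>n x. \<phi> n (x, 0) - u x"
  have es: "square_integrable cell (?e n)" for n by (intro square_integrable_diff ps us)
  \<comment> \<open>An infinite sum that does not converge has the value 0 by convention, so \<open>Hs_norm\<close> controls the
    single terms only after summability is known.\<close>
  have summ: "Hs_term s m (?e n) summable_on UNIV" for n
  proof (rule summable_on_comparison_test)
    have "Hs_term s m (\<lambda>x. \<phi> n (x, 0)) summable_on UNIV"
      by (rule Hs_term_summable[OF grad_jet_in_Xs(2) L2_trace_grad_jet]) (rule approximates_smooth[OF a])+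
    then show "(\<lambda>k. 2 * Hs_term s m (\<lambda>x. \<phi> n (x, 0)) k + 2 * Hs_term s m u k) summable_on UNIV"
      using uH by (intro summable_on_add summable_on_cmult_right) (auto simp: Hs_space_def)
  qed (auto simp: Hs_term_nonneg intro: Hs_term_diff_le ps us)
  have bound: "(LINT x|cell. wave k d x * ?e n x)\<^sup>2 \<le> (2 * pi) ^ 3 / rad k powr (2 * s) * (Hs_norm s m (?e n))\<^sup>2" for n
  proof -
    have "Hs_term s m (?e n) k \<le> infsum (Hs_term s m (?e n)) UNIV"
      using finite_sum_le_infsum[OF summ[of n], of "{k}"] by (simp add: Hs_term_nonneg)
    also have "\<dots> = (Hs_norm s m (?e n))\<^sup>2" unfolding Hs_norm_def by (simp add: infsum_nonneg Hs_term_nonneg)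
    finally have "(cmod (fourier_coeff (?e n) k))\<^sup>2 \<le> (Hs_norm s m (?e n))\<^sup>2 / rad k powr (2 * s)"
      using rad_pos[of k] by (simp add: Hs_term_eq field_simps)
    then have "(2 * pi) ^ 3 * (cmod (fourier_coeff (?e n) k))\<^sup>2 \<le> (2 * pi) ^ 3 * ((Hs_norm s m (?e n))\<^sup>2 / rad k powr (2 * s))"
      by (rule mult_left_mono) simp
    then show ?thesis using abs_integral_wave_le[OF es[of n], of k d] by simp
  qed
  have "(\<lambda>n. (2 * pi) ^ 3 / rad k powr (2 * s) * (Hs_norm s m (?e n))\<^sup>2) \<longlonglongrightarrow> (2 * pi) ^ 3 / rad k powr (2 * s) * 0\<^sup>2"
    by (intro tendsto_intros lim)
  then have l0: "(\<lambda>n. (2 * pi) ^ 3 / rad k powr (2 * s) * (Hs_norm s m (?e n))\<^sup>2) \<longlonglongrightarrow> 0" by simp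
  have "(\<lambda>n. (LINT x|cell. wave k d x * ?e n x)\<^sup>2) \<longlonglongrightarrow> 0"
    by (intro tendsto_sandwich[OF _ _ tendsto_const l0] always_eventually allI bound zero_le_power2)
  then have "(\<lambda>n. LINT x|cell. wave k d x * ?e n x) \<longlonglongrightarrow> 0" by simp
  then have "(\<lambda>n. (LINT x|cell. wave k d x * \<phi> n (x, 0)) - (LINT x|cell. wave k d x * u x)) \<longlonglongrightarrow> 0"
    using integrable_wave_mult[OF integrable_square_integrable_cell[OF ps]] integrable_wave_mult[OF integrable_square_integrable_cell[OF us]]
    by (simp add: right_diff_distrib)
  then have "(\<lambda>n. LINT x|cell. wave k d x * \<phi> n (x, 0)) \<longlonglongrightarrow> (LINT x|cell. wave k d x * u x)"
    by (simp add: LIM_zero_iff)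
  then have "(\<lambda>n. rad k powr (2 * s) * (LINT x|cell. wave k d x * \<phi> n (x, 0))) \<longlonglongrightarrow> rad k powr (2 * s) * (LINT x|cell. wave k d x * u x)"
    by (rule tendsto_mult_left)
  moreover have "(\<lambda>n. Xs_inner s m (Theta k d) (grad_jet (\<phi> n))) \<longlonglongrightarrow> Xs_inner s m (Theta k d) V"
    using a by (intro Xs_inner_tendsto approximates_L2[OF a] Xs_space_L2[OF V] Theta_L2) (simp add: approximates_iff)
  ultimately show ?thesis
    by (intro LIMSEQ_unique) (simp_all add: Theta_pairing_smooth approximates_smooth[OF a])
qed

lemma Tr_square_integrable: "V \<in> Xs_space s m \<Longrightarrow> square_integrable cell (Tr s m V)"
  using has_trace_Tr by (intro Hs_space_square_integrable) (auto simp: has_trace_def)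

text \<open>The value of \<open>Tr\<close> is some trace; the pairings with all waves are the same for every trace and
  determine it almost everywhere.\<close>
lemma Tr_unique:
  assumes V: "V \<in> Xs_space s m" and u: "square_integrable cell u"
    and pair: "\<And>k d. Xs_inner s m (Theta k d) V = rad k powr (2 * s) * (LINT x|cell. wave k d x * u x)"
  shows "AE x in cell. u x = Tr s m V x"
proof -
  note t = Tr_square_integrable[OF V]
  have i: "integrable cell u" "integrable cell (Tr s m V)" using u t by (auto intro: integrable_square_integrable_cell)
  have "AE x in cell. u x - Tr s m V x = 0"
  proof (rule fourier_uniqueness)
    show "(LINT x|cell. (u x - Tr s m V x) * wave k d x) = 0" for k d
    proof -
      have "rad k powr (2 * s) * (LINT x|cell. wave k d x * u x) = rad k powr (2 * s) * (LINT x|cell. wave k d x * Tr s m V x)"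
        using pair[of k d] has_trace_pairing[OF V has_trace_Tr[OF V], of k d] by (simp only:)
      then have "(LINT x|cell. wave k d x * u x) = (LINT x|cell. wave k d x * Tr s m V x)" using rad_pos[of k] by simp
      moreover have "(LINT x|cell. (u x - Tr s m V x) * wave k d x) = (LINT x|cell. wave k d x * u x - wave k d x * Tr s m V x)"
        by (simp add: algebra_simps)
      ultimately show ?thesis
        using Bochner_Integration.integral_diff[OF integrable_wave_mult[OF i(1)] integrable_wave_mult[OF i(2)], of k d k d] by simp
    qed
  qed (use i in simp)
  then show ?thesis by eventually_elim simp
qed

end

section \<open>Solutions of high frequency\<close>

lemma Hs_term_cong_AE:
  assumes "AE x in cell. u x = v x" "u \<in> borel_measurable cell" "v \<in> borel_measurable cell"
  shows "Hs_term s m u = Hs_term s m v"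
proof -
  have m: "(\<lambda>x. of_real (f x) * cis (- (freq k \<bullet> x))) \<in> borel_measurable cell"
    if "f \<in> borel_measurable cell" for f :: "real^3 \<Rightarrow> real" and k
  proof -
    have "(\<lambda>x. complex_of_real (f x)) \<in> borel_measurable cell" using that by measurable
    moreover have "(\<lambda>x :: real^3. cis (- (freq k \<bullet> x))) \<in> borel_measurable borel"
      by (intro borel_measurable_continuous_onI continuous_intros)
    ultimately show ?thesis by (rule borel_measurable_times[OF _ measurable_cell])
  qed
  have "(LINT x|cell. of_real (u x) * cis (- (freq k \<bullet> x))) = (LINT x|cell. of_real (v x) * cis (- (freq k \<bullet> x)))" for k
    by (rule integral_cong_AE[OF m m]) (use assms in auto)
  then have "fourier_coeff u k = fourier_coeff v k" for k by (simp add: fourier_coeff_def)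
  then show ?thesis by (simp add: Hs_term_def fun_eq_iff)
qed

definition axis_freq :: "nat \<Rightarrow> int^3" where
  "axis_freq l = axis 1 (int l)"

lemma freq_axis_freq: "freq (axis_freq l) = real l *\<^sub>R axis 1 1"
  by (auto simp: freq_def axis_freq_def vec_eq_iff axis_def)

text \<open>Sines of the first coordinate are waves, so that the extension of waves applies to them.\<close>
definition sine :: "nat \<Rightarrow> real^3 \<Rightarrow> real" where
  "sine l = wave (axis_freq l) (- (pi / 2))"

lemma sine_eq: "sine l x = sin (real l * x $ 1)"
  by (simp add: sine_def wave_def freq_axis_freq inner_axis' cos_diff)

lemma sine_inner:
  assumes "l > 0"
  shows "(LINT x|cell. sine l x * sine l' x) = (if l = l' then (2 * pi) ^ 3 / 2 else 0)"
proof -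
  have "axis_freq l \<noteq> - axis_freq l'"
  proof
    assume "axis_freq l = - axis_freq l'"
    then have "axis_freq l $ 1 = - (axis_freq l' $ 1)" by simp
    then show False using assms by (simp add: axis_freq_def)
  qed
  moreover have "axis_freq l = axis_freq l' \<longleftrightarrow> l = l'" by (auto simp: axis_freq_def axis_eq_axis)
  ultimately show ?thesis unfolding sine_def integral_wave_mult by simp
qed

lemma abs_sine_le: "\<bar>sine l x\<bar> \<le> 1"
  by (simp add: sine_def abs_wave_le)

lemma sine_measurable: "sine l \<in> borel_measurable cell"
  unfolding sine_def by (intro measurable_cell) simp

lemma periodic_sine: "sine l (x + (2 * pi) *\<^sub>R axis i 1) = sine l x"
  unfolding sine_def by (rule periodic_wave)

text \<open>Least squares: among the combinations of the first \<open>K\<close> sines the Fourier sum is closest.\<close>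
lemma sine_best_approximation:
  fixes mode :: "nat \<Rightarrow> nat"
  assumes mode: "inj mode" "\<And>j. mode j > 0" and h: "square_integrable cell h"
  defines "\<mu> \<equiv> (2 * pi) ^ 3 / 2"
  defines "\<beta> \<equiv> \<lambda>j. LINT x|cell. h x * sine (mode j) x"
  shows "sqdist cell h (\<lambda>x. \<Sum>j<K. \<beta> j / \<mu> * sine (mode j) x) \<le> sqdist cell h (\<lambda>x. \<Sum>j<K. c j * sine (mode j) x)"
proof -
  have mu: "\<mu> > 0" by (simp add: \<mu>_def)
  have ss: "square_integrable cell (sine l)" for l unfolding sine_def by (rule square_integrable_wave)
  have hs: "integrable cell (\<lambda>x. h x * sine l x)" and sl: "integrable cell (\<lambda>x. sine l x * sine l' x)" for l l'
    using integrable_inner_square_integrable[OF h ss] integrable_inner_square_integrable[OF ss ss] by auto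
  have hh: "integrable cell (\<lambda>x. (h x)\<^sup>2)" by (rule square_integrable_real[OF h])
  have eq: "sqdist cell h (\<lambda>x. \<Sum>j<K. c j * sine (mode j) x) = (LINT x|cell. (h x)\<^sup>2) + (\<Sum>j<K. \<mu> * (c j)\<^sup>2 - 2 * c j * \<beta> j)" for c
  proof -
    have "sqdist cell h (\<lambda>x. \<Sum>j<K. c j * sine (mode j) x)
      = (LINT x|cell. (h x)\<^sup>2 - (\<Sum>j<K. 2 * c j * (h x * sine (mode j) x)) + (\<Sum>i<K. \<Sum>j<K. c i * c j * (sine (mode i) x * sine (mode j) x)))"
      unfolding sqdist_def
    proof (rule Bochner_Integration.integral_cong[OF refl])
      fix x
      let ?S = "\<Sum>j<K. c j * sine (mode j) x"
      have "(norm (h x - ?S))\<^sup>2 = (h x)\<^sup>2 - 2 * h x * ?S + ?S * ?S" by (simp add: power2_eq_square algebra_simps)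
      also have "2 * h x * ?S = (\<Sum>j<K. 2 * c j * (h x * sine (mode j) x))"
        unfolding sum_distrib_left by (intro sum.cong refl) (simp add: mult_ac)
      also have "?S * ?S = (\<Sum>i<K. \<Sum>j<K. c i * c j * (sine (mode i) x * sine (mode j) x))"
        unfolding sum_product by (intro sum.cong refl) (simp add: mult_ac)
      finally show "(norm (h x - ?S))\<^sup>2 = (h x)\<^sup>2 - (\<Sum>j<K. 2 * c j * (h x * sine (mode j) x))
        + (\<Sum>i<K. \<Sum>j<K. c i * c j * (sine (mode i) x * sine (mode j) x))" .
    qed
    also have "\<dots> = (LINT x|cell. (h x)\<^sup>2) - (\<Sum>j<K. 2 * c j * \<beta> j) + (\<Sum>i<K. \<Sum>j<K. c i * c j * (LINT x|cell. sine (mode i) x * sine (mode j) x))"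
      using hh hs sl by (simp add: \<beta>_def)
    also have "(\<Sum>i<K. \<Sum>j<K. c i * c j * (LINT x|cell. sine (mode i) x * sine (mode j) x)) = (\<Sum>i<K. \<mu> * (c i)\<^sup>2)"
    proof (intro sum.cong refl)
      fix i assume i: "i \<in> {..<K}"
      have "(\<Sum>j<K. c i * c j * (LINT x|cell. sine (mode i) x * sine (mode j) x)) = (\<Sum>j<K. if j = i then \<mu> * (c i)\<^sup>2 else 0)"
        using mode by (intro sum.cong refl) (auto simp: sine_inner \<mu>_def power2_eq_square inj_eq)
      then show "(\<Sum>j<K. c i * c j * (LINT x|cell. sine (mode i) x * sine (mode j) x)) = \<mu> * (c i)\<^sup>2" using i by simp
    qed
    finally show ?thesis by (simp add: sum_subtractf)
  qed
  have "\<mu> * (\<beta> j / \<mu>)\<^sup>2 - 2 * (\<beta> j / \<mu>) * \<beta> j \<le> \<mu> * (c j)\<^sup>2 - 2 * c j * \<beta> j" for j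
  proof -
    have "0 \<le> \<mu> * (c j - \<beta> j / \<mu>)\<^sup>2" using mu by simp
    also have "\<dots> = \<mu> * (c j)\<^sup>2 - 2 * c j * \<beta> j + \<beta> j * \<beta> j / \<mu>" using mu by (simp add: power2_eq_square field_simps)
    finally show ?thesis using mu by (simp add: power2_eq_square field_simps)
  qed
  then show ?thesis unfolding eq by (intro add_left_mono sum_mono)
qed

text \<open>The data of one branch of solutions: sines in \<open>x\<^sub>1\<close> whose frequencies are the multiples
  of \<open>n\<close>.\<close>
locale sine_branch = extension s m for s m :: real +
  fixes a b lam q :: real and n :: nat
  assumes a: "a > 0" and b: "b > 0" and lam: "lam > 0" and q: "1 < q" "q < 2" and n: "n > 0"
    and weights_summable: "summable (\<lambda>j. 1 / rad (axis_freq (n * Suc j)) powr (2 * s))"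
    and weights_small: "(2 * pi) ^ 3 * (\<Sum>j. 1 / rad (axis_freq (n * Suc j)) powr (2 * s))\<^sup>2 \<le> b * ((2 * pi) ^ 3 / 2)\<^sup>2"
begin

text \<open>The squared \<open>L\<^sup>2\<close> norm of a sine on the cell.\<close>
definition "\<mu> = (2 * pi) ^ 3 / 2"

definition mode :: "nat \<Rightarrow> nat" where
  "mode j = n * Suc j"

abbreviation "ee j \<equiv> sine (mode j)"
abbreviation "ww j \<equiv> rad (axis_freq (mode j)) powr (2 * s)"
abbreviation "Th j \<equiv> Theta (axis_freq (mode j)) (- (pi / 2))"

lemma mode_pos: "mode j > 0" and inj_mode: "inj mode"
  using n by (auto simp: mode_def inj_def)

lemma mu_pos: "\<mu> > 0" by (simp add: \<mu>_def)

lemma ee_inner: "(LINT x|cell. ee i x * ee j x) = (if i = j then \<mu> else 0)"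
  using sine_inner[OF mode_pos, of i "mode j"] inj_mode by (auto simp: \<mu>_def inj_eq)

sublocale kirchhoff_energy cell ee "\<lambda>j. ww j" "a * \<mu>" "b * \<mu>\<^sup>2" lam q
proof (intro kirchhoff_energy.intro finite_measure_cell kirchhoff_energy_axioms.intro)
  show "ee j \<in> borel_measurable cell" for j by (rule sine_measurable)
  show "\<bar>ee j x\<bar> \<le> 1" for j x by (rule abs_sine_le)
  show "ww j > 0" for j using rad_pos[of "axis_freq (mode j)"] by simp
  show "summable (\<lambda>j. 1 / ww j)" unfolding mode_def by (rule weights_summable)
  show "a * \<mu> > 0" "b * \<mu>\<^sup>2 > 0" using a b mu_pos by auto
  show "lam > 0" "1 < q" "q < 2" using lam q by auto
  show "measure cell (space cell) * (\<Sum>j. 1 / ww j)\<^sup>2 \<le> b * \<mu>\<^sup>2" using weights_small unfolding measure_cell \<mu>_def mode_def .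
  \<comment> \<open>As \<open>|ee 0| \<le> 1\<close> and \<open>q < 2\<close>, the integral is at least that of the square.\<close>
  show "(LINT x|cell. \<bar>ee 0 x\<bar> powr q) > 0"
  proof -
    have "\<mu> = (LINT x|cell. ee 0 x * ee 0 x)" by (simp add: ee_inner)
    also have "\<dots> \<le> (LINT x|cell. \<bar>ee 0 x\<bar> powr q)"
    proof (rule integral_mono)
      have "square_integrable cell (ee 0)" unfolding sine_def by (rule square_integrable_wave)
      then show "integrable cell (\<lambda>x. ee 0 x * ee 0 x)" using integrable_inner_square_integrable by fastforce
      show "integrable cell (\<lambda>x. \<bar>ee 0 x\<bar> powr q)"
        using sine_measurable[of "mode 0"] abs_sine_le q
        by (intro cell_integrable_bounded[of _ 1]) (auto intro!: powr_le1)
      show "ee 0 x * ee 0 x \<le> \<bar>ee 0 x\<bar> powr q" for x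
      proof -
        have "\<bar>ee 0 x\<bar> powr 2 \<le> \<bar>ee 0 x\<bar> powr q"
          using abs_sine_le[of "mode 0" x] q by (intro powr_mono') auto
        moreover have "\<bar>ee 0 x\<bar> powr 2 = ee 0 x * ee 0 x" by (cases "ee 0 x = 0") (auto simp: powr_numeral power2_eq_square)
        ultimately show ?thesis by simp
      qed
    qed
    finally show ?thesis using mu_pos by linarith
  qed
qed

lemma Th_inner: "Xs_inner s m (Th i) (Th j) = (if i = j then ww i * \<mu> else 0)"
  using ee_inner[of i j] unfolding Theta_gram by (simp add: sine_def)

definition partial_jet :: "(nat \<Rightarrow> real) \<Rightarrow> nat \<Rightarrow> jet" where
  "partial_jet c K = jsum {..<K} c Th"

definition series_jet :: "(nat \<Rightarrow> real) \<Rightarrow> jet" where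
  "series_jet c = (\<lambda>z. \<Sum>j. c j * fst (Th j) z, \<lambda>z. \<Sum>j. c j *\<^sub>R snd (Th j) z)"

lemma partial_jet_Xs: "partial_jet c K \<in> Xs_space s m"
  unfolding partial_jet_def by (intro Xs_jsum Theta_in_Xs) simp

lemma jsum_norm:
  assumes "finite I"
  shows "Xs_inner s m (jsum I c Th) (jsum I c Th) = (\<Sum>i\<in>I. \<mu> * (ww i * (c i)\<^sup>2))"
proof -
  have L: "jsum I c Th \<in> L2_jets s" by (intro L2_jets_jsum Theta_L2)
  have inner: "Xs_inner s m (Th i) (jsum I c Th) = c i * (ww i * \<mu>)" if "i \<in> I" for i
  proof -
    have "Xs_inner s m (Th i) (jsum I c Th) = Xs_inner s m (jsum I c Th) (Th i)" by (rule Xs_inner_commute)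
    also have "\<dots> = (\<Sum>j\<in>I. c j * Xs_inner s m (Th j) (Th i))" by (rule Xs_inner_jsum_left[OF Theta_L2 Theta_L2])
    also have "\<dots> = (\<Sum>j\<in>I. if j = i then c i * (ww i * \<mu>) else 0)" by (rule sum.cong) (auto simp: Th_inner)
    also have "\<dots> = c i * (ww i * \<mu>)" using assms that by simp
    finally show ?thesis .
  qed
  have "Xs_inner s m (jsum I c Th) (jsum I c Th) = (\<Sum>i\<in>I. c i * Xs_inner s m (Th i) (jsum I c Th))"
    by (rule Xs_inner_jsum_left[OF Theta_L2 L])
  then show ?thesis by (simp add: inner power2_eq_square mult_ac)
qed

text \<open>For \<open>y > 0\<close> the exponential decay of the profile beats the factor \<open>rad k\<close> that a
  derivative costs.\<close>
lemma Th_bound: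
  obtains C where "C > 0" "\<And>j z. snd z > 0 \<Longrightarrow> norm (snd (Th j) z) \<le> C / snd z"
proof -
  obtain C where C: "C > 0" "\<And>y. y \<ge> 0 \<Longrightarrow> \<bar>theta s y\<bar> \<le> C * exp (- (y / 2))" using theta_exp_bound[OF s0] by blast
  obtain D where D: "D > 0" "\<And>y. y \<ge> 0 \<Longrightarrow> \<bar>flux s y\<bar> \<le> D * exp (- (y / 2))" using flux_exp_bound[OF s0 s(2)] by blast
  \<comment> \<open>The constant 9 is crude; the quadratic Taylor polynomial of \<open>exp (t / 2)\<close> times 9 exceeds both factors.\<close>
  have ex: "(1 + t\<^sup>2) * exp (- (t / 2)) \<le> 9" "t * exp (- (t / 2)) \<le> 9" if "t \<ge> 0" for t :: real
  proof -
    have e: "1 + t / 2 + t\<^sup>2 / 8 \<le> exp (t / 2)" using exp_lower_Taylor_quadratic[of "t / 2"] that by (simp add: power_divide)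
    have aux: "1 + v \<le> 9 * (1 + t / 2 + v / 8) \<and> t \<le> 9 * (1 + t / 2 + v / 8)" if "v \<ge> 0" for v :: real
      using that \<open>t \<ge> 0\<close> by (simp add: field_simps)
    have "1 + t\<^sup>2 \<le> 9 * (1 + t / 2 + t\<^sup>2 / 8)" using aux[of "t\<^sup>2"] by simp
    also have "\<dots> \<le> 9 * exp (t / 2)" using e by (rule mult_left_mono) simp
    finally show "(1 + t\<^sup>2) * exp (- (t / 2)) \<le> 9" by (simp add: exp_minus field_simps)
    have "t \<le> 9 * (1 + t / 2 + t\<^sup>2 / 8)" using aux[of "t\<^sup>2"] by simp
    also have "\<dots> \<le> 9 * exp (t / 2)" using e by (rule mult_left_mono) simp
    finally show "t * exp (- (t / 2)) \<le> 9" by (simp add: exp_minus field_simps)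
  qed
  show ?thesis
  proof (rule that[of "9 * C + 9 * D"])
    fix j and z :: "(real^3) \<times> real" assume y: "snd z > 0"
    let ?k = "axis_freq (mode j)"
    let ?y = "snd z" and ?r = "rad ?k"
    let ?t = "?r * ?y"
    have r: "?r > 0" by (rule rad_pos)
    have t: "?t > 0" using r y by simp
    have nf: "norm (freq ?k) \<le> ?r" unfolding rad_def by (rule real_le_rsqrt) simp
    have 1: "norm ((wave ?k (- (pi / 2) + pi / 2) (fst z) * prof s ?r ?y) *\<^sub>R freq ?k) \<le> 9 * C / ?y"
    proof -
      have "norm ((wave ?k (- (pi / 2) + pi / 2) (fst z) * prof s ?r ?y) *\<^sub>R freq ?k) = \<bar>wave ?k (- (pi / 2) + pi / 2) (fst z)\<bar> * \<bar>theta s ?t\<bar> * norm (freq ?k)"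
        by (simp add: abs_mult prof_def)
      also have "\<dots> \<le> 1 * (C * exp (- (?t / 2))) * ?r"
        using C(2)[of ?t] t nf C(1) by (intro mult_mono abs_wave_le) auto
      also have "\<dots> = C * (?t * exp (- (?t / 2))) / ?y" using y by simp
      also have "\<dots> \<le> C * 9 / ?y" using ex(2)[of ?t] t C(1) y by (intro divide_right_mono mult_left_mono) auto
      finally show ?thesis by (simp only: mult.commute[of C])
    qed
    have 2: "norm (wave ?k (- (pi / 2)) (fst z) * prof' s ?r ?y) \<le> 9 * D / ?y"
    proof -
      have "?t powr (2 * s - 1) * ?t = ?t powr (2 * s)" using t powr_add[of ?t "2 * s - 1" 1] by simp
      also have "\<dots> \<le> 1 + ?t\<^sup>2"
      proof (cases "?t \<le> 1")
        case True
        then have "?t powr (2 * s) \<le> 1" using t s by (intro powr_le1) auto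
        then show ?thesis by (smt (verit) zero_le_power2)
      next
        case False
        then have "?t powr (2 * s) \<le> ?t powr 2" using s by (intro powr_mono) auto
        then show ?thesis using t by (simp add: powr_numeral)
      qed
      finally have p: "?t powr (2 * s - 1) * ?t \<le> 1 + ?t\<^sup>2" .
      have "norm (wave ?k (- (pi / 2)) (fst z) * prof' s ?r ?y) = \<bar>wave ?k (- (pi / 2)) (fst z)\<bar> * (?t powr (2 * s - 1) * ?t * \<bar>flux s ?t\<bar> / ?y)"
        using r y by (simp add: prof'_def abs_mult)
      also have "\<dots> \<le> 1 * ((1 + ?t\<^sup>2) * (D * exp (- (?t / 2))) / ?y)"
        using p D(2)[of ?t] t y r by (intro mult_mono divide_right_mono abs_wave_le mult_nonneg_nonneg divide_nonneg_nonneg) auto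
      also have "\<dots> = D * ((1 + ?t\<^sup>2) * exp (- (?t / 2))) / ?y" by simp
      also have "\<dots> \<le> D * 9 / ?y" using ex(1)[of ?t] t D(1) y by (intro divide_right_mono mult_left_mono) auto
      finally show ?thesis by (simp only: mult.commute[of D])
    qed
    have "norm (snd (Th j) z) \<le> norm ((wave ?k (- (pi / 2) + pi / 2) (fst z) * prof s ?r ?y) *\<^sub>R freq ?k) + norm (wave ?k (- (pi / 2)) (fst z) * prof' s ?r ?y)"
      unfolding Theta_def wave_jet_def snd_conv by (rule norm_Pair_le)
    then show "norm (snd (Th j) z) \<le> (9 * C + 9 * D) / ?y" using 1 2 by (simp add: add_divide_distrib)
  qed (use C D in auto)
qed

context
  fixes c :: "nat \<Rightarrow> real"
  assumes adm: "admissible c"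
begin

text \<open>Coefficients of finite energy are absolutely summable, so the series of jets converges at every
  interior point.  This identifies the limit in the mean with the pointwise sum.\<close>
lemma partial_jet_pointwise:
  assumes "z \<in> space (weighted s)"
  shows "(\<lambda>K. join m (partial_jet c K) z) \<longlonglongrightarrow> join m (series_jet c) z"
proof -
  have y: "snd z > 0" using assms by (auto simp: space_weighted)
  note abs = admissible_abs_summable[OF adm]
  obtain C where C: "C > 0" "\<And>j z. snd z > 0 \<Longrightarrow> norm (snd (Th j) z) \<le> C / snd z" using Th_bound by blast
  have "summable (\<lambda>j. norm (c j *\<^sub>R snd (Th j) z))"
  proof (rule summable_comparison_test'[where N = 0])
    show "summable (\<lambda>j. \<bar>c j\<bar> * (C / snd z))" by (rule summable_mult2[OF abs])
    show "norm (norm (c j *\<^sub>R snd (Th j) z)) \<le> \<bar>c j\<bar> * (C / snd z)" for j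
      using mult_left_mono[OF C(2)[OF y, of j] abs_ge_zero[of "c j"]] by simp
  qed
  then have s2: "summable (\<lambda>j. c j *\<^sub>R snd (Th j) z)" by (rule summable_norm_cancel)
  have "summable (\<lambda>j. norm (c j * fst (Th j) z))"
  proof (rule summable_comparison_test'[OF abs, of 0])
    fix j
    have "\<bar>fst (Th j) z\<bar> \<le> 1 * 1"
      unfolding Theta_def wave_jet_def fst_conv abs_mult prof_def using y rad_pos[of "axis_freq (mode j)"]
      by (intro mult_mono abs_wave_le theta_le_1 s0) auto
    then show "norm (norm (c j * fst (Th j) z)) \<le> \<bar>c j\<bar>" by (simp add: abs_mult mult_left_le)
  qed
  then have s1: "summable (\<lambda>j. c j * fst (Th j) z)" by (rule summable_norm_cancel)
  have "(\<lambda>K. (m * (\<Sum>j<K. c j * fst (Th j) z), \<Sum>j<K. c j *\<^sub>R snd (Th j) z)) \<longlonglongrightarrow> (m * (\<Sum>j. c j * fst (Th j) z), \<Sum>j. c j *\<^sub>R snd (Th j) z)"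
    by (intro tendsto_intros summable_LIMSEQ s1 s2)
  then show ?thesis by (simp add: join_def partial_jet_def series_jet_def jsum_def)
qed

lemma series_jet_L2: "series_jet c \<in> L2_jets s"
  and series_jet_limit: "(\<lambda>K. sqdist (weighted s) (join m (series_jet c)) (join m (partial_jet c K))) \<longlonglongrightarrow> 0"
proof -
  let ?E = "\<lambda>K. kappa s * \<mu> * (size2 c - (\<Sum>j<K. ww j * (c j)\<^sup>2))"
  have meas: "fst (series_jet c) \<in> borel_measurable (weighted s)" "snd (series_jet c) \<in> borel_measurable (weighted s)"
  proof -
    have T: "fst (Th j) \<in> borel_measurable (weighted s)" "snd (Th j) \<in> borel_measurable (weighted s)" for j
      using Theta_L2 by (auto simp: L2_jets_def)
    show "fst (series_jet c) \<in> borel_measurable (weighted s)"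
      unfolding series_jet_def fst_conv by (intro borel_measurable_suminf borel_measurable_times borel_measurable_const T)
    show "snd (series_jet c) \<in> borel_measurable (weighted s)"
      unfolding series_jet_def snd_conv by (intro borel_measurable_suminf borel_measurable_scaleR borel_measurable_const T)
  qed
  have sq: "square_integrable (weighted s) (join m (partial_jet c K))" for K
    by (intro square_integrable_join Xs_space_L2 partial_jet_Xs)
  have cau: "sqdist (weighted s) (join m (partial_jet c K')) (join m (partial_jet c K)) \<le> ?E K" if "K \<le> K'" for K K'
  proof -
    have "join m (partial_jet c K') z - join m (partial_jet c K) z = join m (jsum {K..<K'} c Th) z" for z
    proof -
      have "{..<K'} = {..<K} \<union> {K..<K'}" using that by auto
      then have "(\<Sum>j<K'. c j *\<^sub>R join m (Th j) z) = (\<Sum>j<K. c j *\<^sub>R join m (Th j) z) + (\<Sum>j\<in>{K..<K'}. c j *\<^sub>R join m (Th j) z)"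
        by (simp add: sum.union_disjoint ivl_disj_int)
      then show ?thesis by (simp add: partial_jet_def join_jsum)
    qed
    then have "sqdist (weighted s) (join m (partial_jet c K')) (join m (partial_jet c K)) = kappa s * Xs_inner s m (jsum {K..<K'} c Th) (jsum {K..<K'} c Th)"
      unfolding Xs_inner_self sqdist_def using kap by simp
    also have "\<dots> = kappa s * \<mu> * (\<Sum>j\<in>{K..<K'}. ww j * (c j)\<^sup>2)"
      by (simp add: jsum_norm sum_distrib_left mult_ac)
    also have "(\<Sum>j\<in>{K..<K'}. ww j * (c j)\<^sup>2) = (\<Sum>j<K'. ww j * (c j)\<^sup>2) - (\<Sum>j<K. ww j * (c j)\<^sup>2)"
      using that by (simp add: sum_diff_nat_ivl lessThan_atLeast0)
    also have "kappa s * \<mu> * ((\<Sum>j<K'. ww j * (c j)\<^sup>2) - (\<Sum>j<K. ww j * (c j)\<^sup>2)) \<le> ?E K"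
    proof (intro mult_left_mono diff_right_mono)
      show "(\<Sum>j<K'. ww j * (c j)\<^sup>2) \<le> size2 c"
        unfolding size2_def using adm unfolding admissible_def by (intro sum_le_suminf) auto
      show "0 \<le> kappa s * \<mu>" using kap mu_pos by simp
    qed
    finally show ?thesis .
  qed
  have "(\<lambda>K. \<Sum>j<K. ww j * (c j)\<^sup>2) \<longlonglongrightarrow> size2 c"
    unfolding size2_def using adm by (intro summable_LIMSEQ) (simp add: admissible_def)
  then have "?E \<longlonglongrightarrow> kappa s * \<mu> * (size2 c - size2 c)" by (intro tendsto_intros)
  then have E0: "?E \<longlonglongrightarrow> 0" by simp
  have mj: "join m (series_jet c) \<in> borel_measurable (weighted s)"
    unfolding join_def[abs_def] using meas by (intro borel_measurable_Pair borel_measurable_times borel_measurable_const)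
  have ptw: "AE z in weighted s. (\<lambda>K. join m (partial_jet c K) z) \<longlonglongrightarrow> join m (series_jet c) z"
    by (rule AE_I2) (rule partial_jet_pointwise)
  note L = square_integrable_pointwise_limit[where f = "\<lambda>K. join m (partial_jet c K)", OF sq mj ptw cau E0]
  show "(\<lambda>K. sqdist (weighted s) (join m (series_jet c)) (join m (partial_jet c K))) \<longlonglongrightarrow> 0"
    using L(2) by (simp add: sqdist_commute[of _ "join m (series_jet c)"])
  have "square_integrable (weighted s) (\<lambda>z. (1 / m) *\<^sub>R fst (join m (series_jet c) z))"
  proof (rule square_integrable_dominated[OF L(1), where C = "1 / m"])
    show "(\<lambda>z. (1 / m) *\<^sub>R fst (join m (series_jet c) z)) \<in> borel_measurable (weighted s)"
      using meas by (simp add: join_def)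
    show "norm ((1 / m) *\<^sub>R fst (join m (series_jet c) z)) \<le> 1 / m * norm (join m (series_jet c) z)" for z
      using mult_left_mono[OF norm_fst_le_norm[of "join m (series_jet c) z"], of "1 / m"] m by simp
  qed
  moreover have "square_integrable (weighted s) (\<lambda>z. snd (join m (series_jet c) z))"
    by (rule square_integrable_snd[OF L(1)])
  ultimately show "series_jet c \<in> L2_jets s" using m by (simp add: L2_jets_iff join_def)
qed

lemma series_jet_Xs: "series_jet c \<in> Xs_space s m"
  by (rule Xs_closed[OF partial_jet_Xs series_jet_L2 series_jet_limit])

lemma series_jet_inner_limit:
  assumes "Z \<in> L2_jets s"
  shows "(\<lambda>K. \<Sum>j<K. c j * Xs_inner s m (Th j) Z) \<longlonglongrightarrow> Xs_inner s m (series_jet c) Z"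
proof -
  have "(\<lambda>K. Xs_inner s m Z (partial_jet c K)) \<longlonglongrightarrow> Xs_inner s m Z (series_jet c)"
    by (rule Xs_inner_tendsto(1)[OF Xs_space_L2[OF partial_jet_Xs] series_jet_L2 assms series_jet_limit])
  moreover have "Xs_inner s m Z (partial_jet c K) = (\<Sum>j<K. c j * Xs_inner s m (Th j) Z)" for K
    unfolding Xs_inner_commute[of s m Z "partial_jet c K"] unfolding partial_jet_def
    by (rule Xs_inner_jsum_left[OF Theta_L2 assms])
  ultimately show ?thesis unfolding Xs_inner_commute[of s m "series_jet c" Z] by simp
qed

lemma series_jet_norm: "(Xs_norm s m (series_jet c))\<^sup>2 = \<mu> * size2 c"
proof -
  have "(\<lambda>K. Xs_inner s m (partial_jet c K) (partial_jet c K)) \<longlonglongrightarrow> Xs_inner s m (series_jet c) (series_jet c)"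
    by (rule Xs_inner_tendsto(2)[OF Xs_space_L2[OF partial_jet_Xs] series_jet_L2 series_jet_L2 series_jet_limit])
  moreover have "Xs_inner s m (partial_jet c K) (partial_jet c K) = \<mu> * (\<Sum>j<K. ww j * (c j)\<^sup>2)" for K
    unfolding partial_jet_def by (subst jsum_norm) (simp_all add: sum_distrib_left)
  moreover have "(\<lambda>K. \<mu> * (\<Sum>j<K. ww j * (c j)\<^sup>2)) \<longlonglongrightarrow> \<mu> * size2 c"
    unfolding size2_def using adm by (intro tendsto_intros summable_LIMSEQ) (simp add: admissible_def)
  ultimately show ?thesis unfolding Xs_norm_power2 using LIMSEQ_unique by fastforce
qed

lemma series_square_integrable: "square_integrable cell (series c)"
  by (rule cell.square_integrable_bounded[OF series_measurable]) (use series_bound[OF adm] in simp)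

lemma partial_sum_tendsto_series:
  "(\<lambda>K. sqdist cell (\<lambda>x. \<Sum>j<K. c j * ee j x) (series c)) \<longlonglongrightarrow> 0"
proof -
  let ?T = "\<lambda>K. (\<Sum>j. 1 / ww (j + K)) * size2 c"
  have le: "sqdist cell (\<lambda>x. \<Sum>j<K. c j * ee j x) (series c) \<le> (2 * pi) ^ 3 * ?T K" for K
  proof -
    have T0: "0 \<le> ?T K"
      using w_sum size2_nonneg[OF adm] by (intro mult_nonneg_nonneg suminf_nonneg) (auto intro: summable_ignore_initial_segment[OF w_sum])
    have "sqdist cell (\<lambda>x. \<Sum>j<K. c j * ee j x) (series c) \<le> (LINT x|cell. ?T K)"
      unfolding sqdist_def
    proof (rule integral_mono)
      show "integrable cell (\<lambda>x. (norm ((\<Sum>j<K. c j * ee j x) - series c x))\<^sup>2)"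
      proof (intro square_integrable_norm square_integrable_diff series_square_integrable square_integrable_sum)
        show "square_integrable cell (\<lambda>x. c j * ee j x)" for j
          using square_integrable_scaleR[OF square_integrable_wave, of "c j"] by (simp add: sine_def)
      qed
      fix x
      have "norm ((\<Sum>j<K. c j * ee j x) - series c x) \<le> sqrt (?T K)"
        using series_tail[OF adm, of x K] by (simp add: abs_minus_commute)
      then have "(norm ((\<Sum>j<K. c j * ee j x) - series c x))\<^sup>2 \<le> (sqrt (?T K))\<^sup>2" by (rule power_mono) simp
      then show "(norm ((\<Sum>j<K. c j * ee j x) - series c x))\<^sup>2 \<le> ?T K" using T0 by simp
    qed simp
    then show ?thesis by (simp add: measure_cell)
  qed
  have "(\<lambda>K. (2 * pi) ^ 3 * ?T K) \<longlonglongrightarrow> (2 * pi) ^ 3 * (0 * size2 c)"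
    using suminf_exist_split2[OF w_sum] by (intro tendsto_intros)
  then have lim: "(\<lambda>K. (2 * pi) ^ 3 * ?T K) \<longlonglongrightarrow> 0" by simp
  show ?thesis
    by (rule tendsto_sandwich[OF _ _ tendsto_const lim]) (intro always_eventually allI sqdist_nonneg le)+
qed

lemma series_pairing:
  "(\<lambda>K. \<Sum>j<K. c j * (LINT x|cell. wave k d x * ee j x)) \<longlonglongrightarrow> (LINT x|cell. wave k d x * series c x)"
proof -
  have ps: "square_integrable cell (\<lambda>x. \<Sum>j<K. c j * ee j x)" for K
    using square_integrable_scaleR[OF square_integrable_wave] by (intro square_integrable_sum) (simp add: sine_def)
  have "(\<lambda>K. LINT x|cell. wave k d x \<bullet> (\<Sum>j<K. c j * ee j x)) \<longlonglongrightarrow> (LINT x|cell. wave k d x \<bullet> series c x)"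
    by (rule integral_inner_tendsto[OF ps series_square_integrable square_integrable_wave partial_sum_tendsto_series])
  moreover have "(LINT x|cell. wave k d x \<bullet> (\<Sum>j<K. c j * ee j x)) = (\<Sum>j<K. c j * (LINT x|cell. wave k d x * ee j x))" for K
  proof -
    have i: "integrable cell (\<lambda>x. wave k d x * ee j x)" for j
      using integrable_inner_square_integrable[OF square_integrable_wave[of k d] square_integrable_wave] by (simp add: sine_def)
    have "(LINT x|cell. wave k d x \<bullet> (\<Sum>j<K. c j * ee j x)) = (LINT x|cell. (\<Sum>j<K. c j * (wave k d x * ee j x)))"
      by (simp add: sum_distrib_left mult_ac)
    then show ?thesis using i by simp
  qed
  ultimately show ?thesis by simp
qed

text \<open>Both functions have the same pairings with all waves.\<close>
lemma Tr_series_jet: "AE x in cell. series c x = Tr s m (series_jet c) x"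
proof (rule Tr_unique[OF series_jet_Xs series_square_integrable])
  fix k d
  have "(\<lambda>K. \<Sum>j<K. c j * Xs_inner s m (Th j) (Theta k d)) \<longlonglongrightarrow> Xs_inner s m (series_jet c) (Theta k d)"
    by (rule series_jet_inner_limit[OF Theta_L2])
  moreover have "Xs_inner s m (Th j) (Theta k d) = rad k powr (2 * s) * (LINT x|cell. wave k d x * ee j x)" for j
    by (subst Xs_inner_commute) (simp add: Theta_gram sine_def)
  ultimately have "(\<lambda>K. rad k powr (2 * s) * (\<Sum>j<K. c j * (LINT x|cell. wave k d x * ee j x))) \<longlonglongrightarrow> Xs_inner s m (series_jet c) (Theta k d)"
    by (simp add: sum_distrib_left mult.left_commute)
  moreover have "(\<lambda>K. rad k powr (2 * s) * (\<Sum>j<K. c j * (LINT x|cell. wave k d x * ee j x))) \<longlonglongrightarrow> rad k powr (2 * s) * (LINT x|cell. wave k d x * series c x)"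
    by (intro tendsto_mult_left series_pairing)
  ultimately show "Xs_inner s m (Theta k d) (series_jet c) = rad k powr (2 * s) * (LINT x|cell. wave k d x * series c x)"
    unfolding Xs_inner_commute[of s m "Theta k d"] by (rule LIMSEQ_unique)
qed

lemma series_in_Hs: "series c \<in> Hs_space s m"
proof -
  have T: "Tr s m (series_jet c) \<in> Hs_space s m"
    using has_trace_Tr[OF series_jet_Xs] by (simp add: has_trace_def)
  have "Hs_term s m (series c) = Hs_term s m (Tr s m (series_jet c))"
    by (rule Hs_term_cong_AE[OF Tr_series_jet]) (use T series_measurable in \<open>auto simp: Hs_space_def\<close>)
  moreover have "periodic (series c)" by (simp add: periodic_def series_def periodic_sine)
  ultimately show ?thesis
    using T series_square_integrable series_measurable by (auto simp: Hs_space_def square_integrable_real)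
qed

text \<open>The nonlinearity is odd, so composing it with a sine series gives again an odd function,
  which sums of sines approximate uniformly.\<close>
lemma nonlin_fourier_tendsto:
  "(\<lambda>K. sqdist cell (\<lambda>x. \<Sum>j<K. (LINT x|cell. nonlin lam q (series c x) * ee j x) / \<mu> * ee j x) (\<lambda>x. nonlin lam q (series c x))) \<longlonglongrightarrow> 0"
proof -
  \<comment> \<open>The series is \<open>F\<close> at \<open>n * x\<^sub>1\<close>, and a sum of sines evaluated there only contains the frequencies
    \<open>mode j\<close>.\<close>
  define F where "F = (\<lambda>t. \<Sum>j. c j * sin (real (Suc j) * t))"
  define FK where "FK = (\<lambda>K t. \<Sum>j<K. c j * sin (real (Suc j) * t))"
  note abs = admissible_abs_summable[OF adm]
  have ser: "series c x = F (real n * x $ 1)" for x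
    by (subst series_def) (simp add: F_def sine_eq mode_def mult_ac del: mult_Suc_right of_nat_Suc)
  have bd: "\<bar>c j * sin (real (Suc j) * t)\<bar> \<le> \<bar>c j\<bar>" for j t
    using abs_sin_le_one[of "real (Suc j) * t"] by (simp add: abs_mult mult_left_le del: of_nat_Suc)
  have ul: "uniform_limit UNIV FK F sequentially"
    unfolding FK_def F_def by (rule Weierstrass_m_test[OF _ abs]) (use bd in simp)
  have FM: "\<bar>F t\<bar> \<le> (\<Sum>j. \<bar>c j\<bar>)" for t
  proof -
    have sm: "summable (\<lambda>j. \<bar>c j * sin (real (Suc j) * t)\<bar>)"
      by (rule summable_comparison_test'[OF abs, of 0]) (use bd in simp)
    have "\<bar>F t\<bar> \<le> (\<Sum>j. \<bar>c j * sin (real (Suc j) * t)\<bar>)" unfolding F_def by (rule summable_rabs[OF sm])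
    also have "\<dots> \<le> (\<Sum>j. \<bar>c j\<bar>)" by (intro suminf_le bd sm abs)
    finally show ?thesis .
  qed
  have FKs: "sin_poly (FK K)" for K
    unfolding FK_def by (intro sin_poly_sum sin_poly.scale sin_poly.sin)
  let ?h = "\<lambda>x. nonlin lam q (series c x)"
  have hs: "square_integrable cell ?h"
  proof -
    have "compact (nonlin lam q ` {- (\<Sum>j. \<bar>c j\<bar>)..(\<Sum>j. \<bar>c j\<bar>)})"
      using continuous_nonlin[OF q(1)] by (intro compact_continuous_image) (auto intro: continuous_on_subset)
    then obtain L where L: "\<And>z. z \<in> nonlin lam q ` {- (\<Sum>j. \<bar>c j\<bar>)..(\<Sum>j. \<bar>c j\<bar>)} \<Longrightarrow> \<bar>z\<bar> \<le> L"
      using compact_imp_bounded bounded_real by metis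
    show ?thesis
    proof (rule cell.square_integrable_bounded)
      show "?h \<in> borel_measurable cell" by (rule measurable_compose[OF series_measurable nonlin_measurable])
      show "norm (?h x) \<le> L" for x
        unfolding real_norm_def using FM[of "real n * x $ 1"] by (intro L imageI) (auto simp: ser abs_le_iff minus_le_iff)
    qed
  qed
  show ?thesis
  proof (rule LIMSEQ_I)
    fix \<epsilon> :: real assume eps: "\<epsilon> > 0"
    define \<delta> where "\<delta> = sqrt (\<epsilon> / (2 * (2 * pi) ^ 3))"
    have delta: "\<delta> > 0" "(2 * pi) ^ 3 * \<delta>\<^sup>2 < \<epsilon>" using eps by (auto simp: \<delta>_def)
    obtain p where p: "sin_poly p" "\<And>t. \<bar>nonlin lam q (F t) - p t\<bar> < \<delta>"
      using odd_continuous_approx[OF continuous_nonlin[OF q(1)] nonlin_minus FM FKs ul delta(1)] by blast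
    obtain J cc where J: "\<And>K t. K \<ge> J \<Longrightarrow> p t = (\<Sum>j<K. (if j < J then cc j else 0) * sin (real (Suc j) * t))"
      using sin_poly_coefficients[OF p(1)] by blast
    show "\<exists>K0. \<forall>K\<ge>K0. norm (sqdist cell (\<lambda>x. \<Sum>j<K. (LINT x|cell. ?h x * ee j x) / \<mu> * ee j x) ?h - 0) < \<epsilon>"
    proof (intro exI[of _ J] allI impI)
      fix K assume K: "K \<ge> J"
      let ?c = "\<lambda>j. if j < J then cc j else 0"
      have pe: "(\<Sum>j<K. ?c j * ee j x) = p (real n * x $ 1)" for x
        unfolding J[OF K] by (simp add: sine_eq mode_def mult_ac del: mult_Suc_right of_nat_Suc)
      have "sqdist cell (\<lambda>x. \<Sum>j<K. (LINT x|cell. ?h x * ee j x) / \<mu> * ee j x) ?h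
        = sqdist cell ?h (\<lambda>x. \<Sum>j<K. (LINT x|cell. ?h x * ee j x) / \<mu> * ee j x)" by (rule sqdist_commute)
      \<comment> \<open>Fourier sums are at least as close as the uniform approximation by the sum of sines \<open>p\<close>.\<close>
      also have "\<dots> \<le> sqdist cell ?h (\<lambda>x. \<Sum>j<K. ?c j * ee j x)"
        unfolding \<mu>_def by (rule sine_best_approximation[OF inj_mode mode_pos hs])
      also have "\<dots> \<le> (LINT x|cell. \<delta>\<^sup>2)"
        unfolding sqdist_def
      proof (rule integral_mono)
        show "integrable cell (\<lambda>x. (norm (?h x - (\<Sum>j<K. ?c j * ee j x)))\<^sup>2)"
        proof (intro square_integrable_norm square_integrable_diff hs square_integrable_sum)
          show "square_integrable cell (\<lambda>x. ?c j * ee j x)" for j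
            using square_integrable_scaleR[OF square_integrable_wave, of "?c j"] by (simp add: sine_def)
        qed
        fix x
        have "norm (?h x - (\<Sum>j<K. ?c j * ee j x)) \<le> \<delta>" using p(2)[of "real n * x $ 1"] by (simp only: pe ser real_norm_def less_imp_le)
        then show "(norm (?h x - (\<Sum>j<K. ?c j * ee j x)))\<^sup>2 \<le> \<delta>\<^sup>2" by (rule power_mono) simp
      qed simp
      also have "\<dots> < \<epsilon>" using delta(2) by (simp add: measure_cell)
      finally show "norm (sqdist cell (\<lambda>x. \<Sum>j<K. (LINT x|cell. ?h x * ee j x) / \<mu> * ee j x) ?h - 0) < \<epsilon>"
        by (simp only: diff_zero real_norm_def abs_of_nonneg[OF sqdist_nonneg])
    qed
  qed
qed

text \<open>The left-hand side of the weak equation is the limit of finite combinations of the pairings of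
  \<open>V\<close> with the extended sines.  By the assumed equations these are the integrals of \<open>Tr s m V\<close>
  against the Fourier sums of the nonlinear term, which converge to that term in \<open>L\<^sup>2\<close>.\<close>
lemma weak_solution_series:
  assumes EL: "\<And>j. (a * \<mu> + b * \<mu>\<^sup>2 * size2 c) * (ww j * c j) = (LINT x|cell. nonlin lam q (series c x) * ee j x)"
  shows "weak_solution s m a b lam q 4 (series c)"
  unfolding weak_solution_def
proof (intro conjI bexI[OF _ series_jet_Xs] ballI)
  show "series c \<in> Hs_space s m" by (rule series_in_Hs)
  show "(series c, Tr s m (series_jet c)) \<in> ae_eq" using Tr_series_jet by (simp add: ae_eq_def)
  fix V assume V: "V \<in> Xs_space s m"
  let ?t = "Tr s m V" and ?h = "\<lambda>x. nonlin lam q (series c x)"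
  let ?D = "a + b * (Xs_norm s m (series_jet c))\<^sup>2"
  define \<beta> where "\<beta> = (\<lambda>j. LINT x|cell. ?h x * ee j x)"
  have ts: "square_integrable cell ?t" by (rule Tr_square_integrable[OF V])
  have es: "square_integrable cell (ee j)" for j unfolding sine_def by (rule square_integrable_wave)
  have pair: "Xs_inner s m (Th j) V = ww j * (LINT x|cell. ?t x * ee j x)" for j
    using has_trace_pairing[OF V has_trace_Tr[OF V], of "axis_freq (mode j)" "- (pi / 2)"] by (simp add: sine_def mult.commute)
  have beta: "?D * (c j * ww j) = \<beta> j / \<mu>" for j
  proof -
    have "?D * (c j * ww j) * \<mu> = (a * \<mu> + b * \<mu>\<^sup>2 * size2 c) * (ww j * c j)"
      unfolding series_jet_norm by (simp add: power2_eq_square algebra_simps)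
    also have "\<dots> = \<beta> j" unfolding \<beta>_def by (rule EL)
    finally show ?thesis using mu_pos by (simp add: eq_divide_eq)
  qed
  have SK: "square_integrable cell (\<lambda>x. \<Sum>j<K. \<beta> j / \<mu> * ee j x)" for K
  proof (rule square_integrable_sum)
    show "square_integrable cell (\<lambda>x. \<beta> j / \<mu> * ee j x)" for j
      using square_integrable_scaleR[OF es[of j], of "\<beta> j / \<mu>"] by simp
  qed
  have hs: "square_integrable cell ?h"
  proof -
    have K: "compact (nonlin lam q ` {- sqrt (S0 * size2 c)..sqrt (S0 * size2 c)})"
      using continuous_nonlin[OF q(1)] by (intro compact_continuous_image) (auto intro: continuous_on_subset)
    then obtain L where L: "\<And>z. z \<in> nonlin lam q ` {- sqrt (S0 * size2 c)..sqrt (S0 * size2 c)} \<Longrightarrow> \<bar>z\<bar> \<le> L"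
      using compact_imp_bounded bounded_real by metis
    show ?thesis
    proof (rule cell.square_integrable_bounded)
      show "?h \<in> borel_measurable cell" by (rule measurable_compose[OF series_measurable nonlin_measurable])
      show "norm (?h x) \<le> L" for x
        unfolding real_norm_def using series_bound[OF adm, of x] by (intro L imageI) (auto simp: abs_le_iff minus_le_iff)
    qed
  qed
  have "(\<lambda>K. ?D * (\<Sum>j<K. c j * Xs_inner s m (Th j) V)) \<longlonglongrightarrow> ?D * Xs_inner s m (series_jet c) V"
    by (intro tendsto_mult_left series_jet_inner_limit Xs_space_L2[OF V])
  moreover have "?D * (\<Sum>j<K. c j * Xs_inner s m (Th j) V) = (LINT x|cell. ?t x \<bullet> (\<Sum>j<K. \<beta> j / \<mu> * ee j x))" for K
  proof -
    have i: "integrable cell (\<lambda>x. ?t x * ee j x)" for j using integrable_inner_square_integrable[OF ts es] by simp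
    have "?D * (\<Sum>j<K. c j * Xs_inner s m (Th j) V) = (\<Sum>j<K. ?D * (c j * ww j) * (LINT x|cell. ?t x * ee j x))"
      unfolding pair sum_distrib_left by (intro sum.cong refl) (simp only: mult.assoc)
    also have "\<dots> = (\<Sum>j<K. \<beta> j / \<mu> * (LINT x|cell. ?t x * ee j x))" unfolding beta ..
    also have "\<dots> = (LINT x|cell. (\<Sum>j<K. \<beta> j / \<mu> * (?t x * ee j x)))" using i by simp
    also have "\<dots> = (LINT x|cell. ?t x \<bullet> (\<Sum>j<K. \<beta> j / \<mu> * ee j x))"
      unfolding inner_real_def sum_distrib_left by (intro Bochner_Integration.integral_cong sum.cong refl) (simp add: mult_ac)
    finally show ?thesis .
  qed
  moreover have "(\<lambda>K. LINT x|cell. ?t x \<bullet> (\<Sum>j<K. \<beta> j / \<mu> * ee j x)) \<longlonglongrightarrow> (LINT x|cell. ?t x \<bullet> ?h x)"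
    by (rule integral_inner_tendsto[OF SK hs ts]) (unfold \<beta>_def, rule nonlin_fourier_tendsto)
  ultimately have "?D * Xs_inner s m (series_jet c) V = (LINT x|cell. ?t x \<bullet> ?h x)"
    using LIMSEQ_unique by (simp only:)
  then show "?D * Xs_inner s m (series_jet c) V =
    (LINT x|cell. (lam * \<bar>series c x\<bar> powr (q - 2) * series c x + \<bar>series c x\<bar> powr (4 - 2) * series c x) * ?t x)"
    by (simp add: nonlin_def mult.commute)
qed

lemma series_coefficient:
  assumes "l > 0"
  shows "(LINT x|cell. sine l x * series c x) = (\<Sum>j. c j * (if l = mode j then \<mu> else 0))"
    "(\<lambda>j. c j * (if l = mode j then \<mu> else 0)) sums (LINT x|cell. sine l x * series c x)"
proof -
  have "(\<lambda>K. \<Sum>j<K. c j * (LINT x|cell. sine l x * ee j x)) \<longlonglongrightarrow> (LINT x|cell. sine l x * series c x)"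
    using series_pairing[of "axis_freq l" "- (pi / 2)"] by (simp add: sine_def)
  then show s: "(\<lambda>j. c j * (if l = mode j then \<mu> else 0)) sums (LINT x|cell. sine l x * series c x)"
    unfolding sums_def sine_inner[OF assms] \<mu>_def .
  then show "(LINT x|cell. sine l x * series c x) = (\<Sum>j. c j * (if l = mode j then \<mu> else 0))"
    by (rule sums_unique)
qed

end

text \<open>The minimiser is not 0 because its energy is negative, and the Fourier coefficients of its series
  vanish at frequencies that are not multiples of \<open>n\<close>.\<close>
theorem branch_solution:
  "\<exists>u. weak_solution s m a b lam q 4 u \<and> (\<exists>l>0. (LINT x|cell. sine l x * u x) \<noteq> 0) \<and>
     (\<forall>l>0. (LINT x|cell. sine l x * u x) \<noteq> 0 \<longrightarrow> n dvd l)"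
proof -
  obtain c where c: "admissible c" "energy c < 0" "\<And>c'. admissible c' \<Longrightarrow> energy c \<le> energy c'"
    by (rule minimiser_exists) (rule that)
  have "weak_solution s m a b lam q 4 (series c)"
    by (rule weak_solution_series[OF c(1) euler_lagrange[OF c(1) c(3)]])
  moreover have "\<exists>l>0. (LINT x|cell. sine l x * series c x) \<noteq> 0"
  proof -
    have "\<exists>i. c i \<noteq> 0"
    proof (rule ccontr)
      assume "\<not> ?thesis"
      then have "c = (\<lambda>_. 0)" by auto
      then have "energy c = 0" by (simp add: energy_def size2_def series_def potential_def)
      then show False using c(2) by simp
    qed
    then obtain i where i: "c i \<noteq> 0" by blast
    have "(\<lambda>j. c j * (if mode i = mode j then \<mu> else 0)) = (\<lambda>j. if j = i then c i * \<mu> else 0)"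
      using inj_mode by (auto simp: inj_eq)
    then have "(LINT x|cell. ee i x * series c x) = c i * \<mu>"
      using series_coefficient(2)[OF c(1) mode_pos, of i] sums_single[of i "\<lambda>_. c i * \<mu>"] sums_unique2 by fastforce
    then show ?thesis using i mu_pos mode_pos by (intro exI[of _ "mode i"]) simp
  qed
  moreover have "n dvd l" if "l > 0" "(LINT x|cell. sine l x * series c x) \<noteq> 0" for l
  proof (rule ccontr)
    assume "\<not> n dvd l"
    then have "l \<noteq> mode j" for j by (auto simp: mode_def)
    then show False using series_coefficient(1)[OF c(1) that(1)] that(2) by simp
  qed
  ultimately show ?thesis by blast
qed

end

section \<open>Infinitely many solutions\<close>

text \<open>Each weight is at least \<open>(n * (j + 1)) powr (2 * s)\<close>; the reciprocals of these are summable because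
  \<open>2 * s > 1\<close>, and the factor \<open>n powr (- (2 * s))\<close> makes their sum small for large \<open>n\<close>.\<close>
lemma (in extension) weights_bound:
  assumes n: "n > 0"
  shows "summable (\<lambda>j. 1 / rad (axis_freq (n * Suc j)) powr (2 * s))"
    "(\<Sum>j. 1 / rad (axis_freq (n * Suc j)) powr (2 * s)) \<le> real n powr (- (2 * s)) * (\<Sum>j. real (Suc j) powr (- (2 * s)))"
    "0 \<le> (\<Sum>j. 1 / rad (axis_freq (n * Suc j)) powr (2 * s))"
proof -
  have le: "1 / rad (axis_freq (n * Suc j)) powr (2 * s) \<le> real n powr (- (2 * s)) * real (Suc j) powr (- (2 * s))" for j
  proof -
    let ?l = "real n * real (Suc j)"
    have l: "?l > 0" using n by simp
    have "norm (freq (axis_freq (n * Suc j))) = ?l" by (simp add: freq_axis_freq del: mult_Suc_right of_nat_Suc)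
    then have "?l\<^sup>2 \<le> (rad (axis_freq (n * Suc j)))\<^sup>2" by (simp add: rad_power2)
    then have "?l \<le> rad (axis_freq (n * Suc j))" by (rule power2_le_imp_le[OF _ less_imp_le[OF rad_pos]])
    then have "?l powr (2 * s) \<le> rad (axis_freq (n * Suc j)) powr (2 * s)"
      by (rule powr_mono2[OF _ less_imp_le[OF l], rotated]) (use s in simp)
    moreover have "0 < ?l powr (2 * s)" unfolding powr_gt_zero using n by simp
    ultimately have "1 / rad (axis_freq (n * Suc j)) powr (2 * s) \<le> 1 / ?l powr (2 * s)" by (rule frac_le[OF zero_le_one order_refl, rotated])
    also have "\<dots> = real n powr (- (2 * s)) * real (Suc j) powr (- (2 * s))"
      using n by (simp add: powr_mult powr_minus field_simps del: of_nat_Suc)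
    finally show ?thesis .
  qed
  have "summable (\<lambda>j. real j powr (- (2 * s)))" using s by (subst summable_real_powr_iff) simp
  then have "summable (\<lambda>j. real (Suc j) powr (- (2 * s)))" by (subst summable_Suc_iff)
  then have sm: "summable (\<lambda>j. real n powr (- (2 * s)) * real (Suc j) powr (- (2 * s)))" by (rule summable_mult)
  show S: "summable (\<lambda>j. 1 / rad (axis_freq (n * Suc j)) powr (2 * s))"
    by (rule summable_comparison_test'[OF sm, of 0]) (use le in simp)
  show "(\<Sum>j. 1 / rad (axis_freq (n * Suc j)) powr (2 * s)) \<le> real n powr (- (2 * s)) * (\<Sum>j. real (Suc j) powr (- (2 * s)))"
  proof -
    have "(\<Sum>j. 1 / rad (axis_freq (n * Suc j)) powr (2 * s)) \<le> (\<Sum>j. real n powr (- (2 * s)) * real (Suc j) powr (- (2 * s)))"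
      by (rule suminf_le[OF le S sm])
    also have "\<dots> = real n powr (- (2 * s)) * (\<Sum>j. real (Suc j) powr (- (2 * s)))"
      using \<open>summable (\<lambda>j. real (Suc j) powr (- (2 * s)))\<close> by (rule suminf_mult)
    finally show ?thesis .
  qed
  show "0 \<le> (\<Sum>j. 1 / rad (axis_freq (n * Suc j)) powr (2 * s))" by (intro suminf_nonneg S) simp
qed

theorem theorem3:
  fixes s a b m q p :: real
  assumes "3 / 4 < s" "s < 1"
    and "0 < a" "0 < b" "0 < m"
    and "1 < q" "q < 2"
    and "p = 4"
    and "b > 1 / (S4 s m)\<^sup>2"
  shows "\<forall>lam>0. infinite ({u. weak_solution s m a b lam q p u} // ae_eq)"
proof (intro allI impI notI)
  fix lam :: real
  assume lam: "lam > 0" and fin: "finite ({u. weak_solution s m a b lam q p u} // ae_eq)"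
  interpret extension s m using assms by unfold_locales auto
  let ?\<sigma> = "\<Sum>j. real (Suc j) powr (- (2 * s))"
  have "(\<lambda>n. real n powr (- (2 * s))) \<longlonglongrightarrow> 0"
    by (rule tendsto_neg_powr[OF _ filterlim_real_sequentially]) (use assms in simp)
  then have "(\<lambda>n. (2 * pi) ^ 3 * (real n powr (- (2 * s)) * ?\<sigma>)\<^sup>2) \<longlonglongrightarrow> (2 * pi) ^ 3 * (0 * ?\<sigma>)\<^sup>2"
    by (intro tendsto_mult_left tendsto_power tendsto_mult_right)
  moreover have "(2 * pi) ^ 3 * (0 * ?\<sigma>)\<^sup>2 < b * ((2 * pi) ^ 3 / 2)\<^sup>2" using assms by simp
  ultimately have "\<forall>\<^sub>F n in sequentially. (2 * pi) ^ 3 * (real n powr (- (2 * s)) * ?\<sigma>)\<^sup>2 < b * ((2 * pi) ^ 3 / 2)\<^sup>2"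
    by (rule order_tendstoD(2))
  \<comment> \<open>From \<open>n0\<close> on the smallness assumption of \<open>sine_branch\<close> holds.\<close>
  then obtain n0 where n0: "\<And>n. n \<ge> n0 \<Longrightarrow> (2 * pi) ^ 3 * (real n powr (- (2 * s)) * ?\<sigma>)\<^sup>2 < b * ((2 * pi) ^ 3 / 2)\<^sup>2"
    by (auto simp: eventually_sequentially)
  have "\<exists>u. weak_solution s m a b lam q p u \<and> (\<exists>l>0. (LINT x|cell. sine l x * u x) \<noteq> 0) \<and>
     (\<forall>l>0. (LINT x|cell. sine l x * u x) \<noteq> 0 \<longrightarrow> n dvd l)" if "n > n0" for n
  proof -
    have n: "n > 0" using that by simp
    note w = weights_bound[OF n]
    have "(2 * pi) ^ 3 * (\<Sum>j. 1 / rad (axis_freq (n * Suc j)) powr (2 * s))\<^sup>2 \<le> (2 * pi) ^ 3 * (real n powr (- (2 * s)) * ?\<sigma>)\<^sup>2"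
      by (intro mult_left_mono power_mono w) simp
    then have "(2 * pi) ^ 3 * (\<Sum>j. 1 / rad (axis_freq (n * Suc j)) powr (2 * s))\<^sup>2 \<le> b * ((2 * pi) ^ 3 / 2)\<^sup>2"
      using n0[of n] that by linarith
    then interpret sine_branch s m a b lam q n
      using assms lam n w(1) by unfold_locales auto
    show ?thesis using branch_solution assms(8) by simp
  qed
  then have "\<forall>n. \<exists>u. n > n0 \<longrightarrow> weak_solution s m a b lam q p u \<and> (\<exists>l>0. (LINT x|cell. sine l x * u x) \<noteq> 0) \<and>
     (\<forall>l>0. (LINT x|cell. sine l x * u x) \<noteq> 0 \<longrightarrow> n dvd l)" by blast
  from choice[OF this] obtain u where u: "\<And>n. n > n0 \<Longrightarrow> weak_solution s m a b lam q p (u n)"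
    "\<And>n. n > n0 \<Longrightarrow> \<exists>l>0. (LINT x|cell. sine l x * u n x) \<noteq> 0"
    "\<And>n l. n > n0 \<Longrightarrow> l > 0 \<Longrightarrow> (LINT x|cell. sine l x * u n x) \<noteq> 0 \<Longrightarrow> n dvd l" by blast
  have "(\<lambda>n. ae_eq `` {u n}) ` {n0<..} \<subseteq> {u. weak_solution s m a b lam q p u} // ae_eq"
    using u(1) by (auto intro: quotientI)
  then have "finite ((\<lambda>n. ae_eq `` {u n}) ` {n0<..})" using fin by (rule finite_subset)
  \<comment> \<open>With finitely many classes, one class would contain the solutions for infinitely many \<open>n\<close>.\<close>
  then obtain k where k: "k > n0" "infinite {n \<in> {n0<..}. ae_eq `` {u n} = ae_eq `` {u k}}"
    using pigeonhole_infinite[OF infinite_Ioi] by auto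
  obtain l where l: "l > 0" "(LINT x|cell. sine l x * u k x) \<noteq> 0" using u(2)[OF k(1)] by blast
  \<comment> \<open>Functions of the same class share their coefficients, hence each such \<open>n\<close> divides \<open>l\<close>.\<close>
  have "{n \<in> {n0<..}. ae_eq `` {u n} = ae_eq `` {u k}} \<subseteq> {..l}"
  proof
    fix n assume "n \<in> {n \<in> {n0<..}. ae_eq `` {u n} = ae_eq `` {u k}}"
    then have n: "n > n0" and cl: "ae_eq `` {u n} = ae_eq `` {u k}" by auto
    have "u k \<in> ae_eq `` {u n}" unfolding cl by (simp add: ae_eq_def)
    then have ae: "AE x in cell. u n x = u k x" by (simp add: ae_eq_def)
    have m: "(\<lambda>x. sine l x * u i x) \<in> borel_measurable cell" if "i > n0" for i
      using u(1)[OF that] by (intro borel_measurable_times sine_measurable) (simp add: weak_solution_def Hs_space_def)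
    have "(LINT x|cell. sine l x * u n x) = (LINT x|cell. sine l x * u k x)"
      by (rule integral_cong_AE[OF m[OF n] m[OF k(1)]]) (use ae in auto)
    then have "n dvd l" using u(3)[OF n l(1)] l(2) by simp
    then show "n \<in> {..l}" using l(1) by (auto intro: dvd_imp_le)
  qed
  then show False using k(2) finite_subset by blast
qed

end
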